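(* (1) For all $q_0\in(0,1)$ there exists $C>0$ such that, for every $N\ge 3$ whose parameter $q$ satisfies $q\le q_0$, we have $\|G_n(x)\|\le C$ for all $x\in W$ and all $n$. (2) There exist $q_1\in(0,1)$ and $D>0$ such that, for every $N\ge3$ whose parameter $q$ satisfies $q\le q_1$, the matrix $G_n(x)$ is invertible with $\|G_n(x)^{-1}\|\le D$ for all $x\in W$ and all $n$. (Here, for $x\in W_k$, $n$ ranges over the integers $n\ge k$, and norms are operator norms.)
   Context: For an integer $N\ge3$, $q\in(0,1)$ is defined by $q+q^{-1}=N$. Let $C^*_u(\mathbb{F}O_N)$ be the universal unital $C^*$-algebra generated by self-adjoint $u_{i,j}$, $1\le i,j\le N$, with $u=(u_{i,j})$ unitary, coproduct $\Delta(u_{i,j})=\sum_k u_{i,k}\otimes u_{k,j}$ and Haar state $h$ (a trace). $M=\mathcal{L}(\mathbb{F}O_N)$ is the von Neumann algebra generated in the GNS representation of $h$, on $H\supset M$, with $(x\mid y)=h(x^*y)$. Put $H_1=\mathbb{C}^N$ with canonical basis $(e_i)$, $t=\sum_i e_i\otimes e_i:\mathbb{C}\to H_1\otimes H_1$; $H_n\subset H_1^{\otimes n}$ is the subspace of vectors $\zeta$ with $(\mathrm{id}^{\otimes i}\otimes t^*\otimes\mathrm{id}^{\otimes(n-i-2)})\zeta=0$ for $0\le i\le n-2$, with orthogonal projection $P_n$, and $d_n=\dim H_n=(q^{n+1}-q^{-n-1})/(q-q^{-1})$. $X\in B(H_n)$ is identified with $P_nXP_n\in B(H_1^{\otimes n})$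 and $u_n(X)=\sum_{I,J}X_{J,I}\,u_{i_1,j_1}\cdots u_{i_n,j_n}\in M$; one has $(u_n(X)\mid u_n(Y))=d_n^{-1}\mathrm{Tr}(X^*Y)$ and $u_m(B(H_m))\perp u_n(B(H_n))$ for $m\ne n$. $B(H_n)^{\circ\circ}$ is the set of $X\in B(H_n)$ with $(\mathrm{Tr}_1\otimes\mathrm{id})(X)=0=(\mathrm{id}\otimes\mathrm{Tr}_1)(X)$ (trace of $B(H_1)$ on the first, resp. last, leg). The rotation $\rho(X)=(P_n\otimes t^* )(\mathrm{id}_1\otimes X\otimes\mathrm{id}_1)(t\otimes P_n)$ restricts to a finite order unitary on $B(H_n)^{\circ\circ}$. For $k\ge1$, $W_k$ is the image under $u_k$ of an orthogonal basis of $B(H_k)^{\circ\circ}$ consisting of eigenvectors of $\rho$, normalized so that $\|u_k(X)\|_2=1$; $W=\bigcup_{k\ge1}W_k$. For $x=u_k(X)\in W_k$, $i,j\in\mathbb{N}$, put $X_{i,j}=P_{i+k+j}(\mathrm{id}_i\otimes X\otimes\mathrm{id}_j)P_{i+k+j}$ and $x_{i,j}=u_{i+k+j}(X_{i,j})$. For $n\ge k$, $G_n(x)$ is the Gram matrix with entries $G_{n;i,p}=(x_{i,n-k-i}\mid x_{p,n-k-p})$, $0\le i,p\le n-k$. *)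

theory Defs
  imports
    Complex_Main
    "HOL-Library.Poly_Mapping"
    "HOL-Library.Product_Plus"
    "HOL-Library.Nonpos_Ints"
    "HOL-Analysis.L2_Norm"
    "Jordan_Normal_Form.Matrix"
begin

section \<open>Operators between tensor powers of \<open>H\<^sub>1\<close>\<close>

text \<open>
  The canonical basis of the \<open>n\<close>-th tensor power of \<open>H\<^sub>1\<close>, of dimension \<open>N ^ n\<close>, is indexed by the
  words of length \<open>n\<close> over \<open>{..<N}\<close>.  A vector is the function giving its coordinates, and an
  operator from the \<open>n\<close>-th to the \<open>m\<close>-th power is its matrix, row index first.  Both
  are extended by zero to all other words, so that equality of functions is equality of operators.
\<close>

type_synonym tvec = "nat list \<Rightarrow> complex"
type_synonym tmat = "nat list \<Rightarrow> nat list \<Rightarrow> complex"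

definition words :: "nat \<Rightarrow> nat \<Rightarrow> nat list set" where
  "words N n = {I. length I = n \<and> set I \<subseteq> {..<N}}"

definition tensor_space :: "nat \<Rightarrow> nat \<Rightarrow> tvec set" where
  "tensor_space N n = {\<zeta>. \<forall>I. \<zeta> I \<noteq> 0 \<longrightarrow> I \<in> words N n}"

definition ops :: "nat \<Rightarrow> nat \<Rightarrow> nat \<Rightarrow> tmat set" where
  "ops N m n = {A. \<forall>I J. A I J \<noteq> 0 \<longrightarrow> I \<in> words N m \<and> J \<in> words N n}"

definition tinner :: "nat \<Rightarrow> nat \<Rightarrow> tvec \<Rightarrow> tvec \<Rightarrow> complex" where
  "tinner N n \<zeta> \<eta> = (\<Sum>I\<in>words N n. cnj (\<zeta> I) * \<eta> I)"

definition op_app :: "nat \<Rightarrow> nat \<Rightarrow> tmat \<Rightarrow> tvec \<Rightarrow> tvec" where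
  "op_app N n A \<zeta> = (\<lambda>I. \<Sum>J\<in>words N n. A I J * \<zeta> J)"

text \<open>In \<^term>\<open>op_comp N m A B\<close>, \<open>m\<close> is the number of intermediate legs.\<close>

definition op_comp :: "nat \<Rightarrow> nat \<Rightarrow> tmat \<Rightarrow> tmat \<Rightarrow> tmat" where
  "op_comp N m A B = (\<lambda>I J. \<Sum>K\<in>words N m. A I K * B K J)"

text \<open>In \<^term>\<open>op_tensor m n A B\<close>, the first factor \<open>A\<close> has \<open>m\<close> output and \<open>n\<close> input legs.\<close>

definition op_tensor :: "nat \<Rightarrow> nat \<Rightarrow> tmat \<Rightarrow> tmat \<Rightarrow> tmat" where
  "op_tensor m n A B = (\<lambda>I J. A (take m I) (take n J) * B (drop m I) (drop n J))"

definition op_adj :: "tmat \<Rightarrow> tmat" where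
  "op_adj A = (\<lambda>I J. cnj (A J I))"

definition op_id :: "nat \<Rightarrow> nat \<Rightarrow> tmat" where
  "op_id N n = (\<lambda>I J. if I \<in> words N n \<and> I = J then 1 else 0)"

definition op_trace :: "nat \<Rightarrow> nat \<Rightarrow> tmat \<Rightarrow> complex" where
  "op_trace N n A = (\<Sum>I\<in>words N n. A I I)"

definition op_t :: "nat \<Rightarrow> tmat" where
  "op_t N = (\<lambda>I J. if J = [] \<and> (\<exists>i<N. I = [i, i]) then 1 else 0)"

definition sandwich :: "nat \<Rightarrow> nat \<Rightarrow> nat \<Rightarrow> nat \<Rightarrow> nat \<Rightarrow> tmat \<Rightarrow> tmat" where
  "sandwich N i m n j A = op_tensor (i + m) (i + n) (op_tensor i i (op_id N i) A) (op_id N j)"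

definition Hspace :: "nat \<Rightarrow> nat \<Rightarrow> tvec set" where
  "Hspace N n = {\<zeta> \<in> tensor_space N n.
     \<forall>i. i + 2 \<le> n \<longrightarrow> op_app N n (sandwich N i 0 2 (n - i - 2) (op_adj (op_t N))) \<zeta> = (\<lambda>_. 0)}"

definition Pproj :: "nat \<Rightarrow> nat \<Rightarrow> tmat" where
  "Pproj N n = (THE P. P \<in> ops N n n \<and>
     (\<forall>\<zeta>\<in>tensor_space N n. op_app N n P \<zeta> \<in> Hspace N n \<and>
        (\<forall>\<eta>\<in>Hspace N n. tinner N n \<eta> (\<lambda>I. \<zeta> I - op_app N n P \<zeta> I) = 0)))"

definition compress :: "nat \<Rightarrow> nat \<Rightarrow> tmat \<Rightarrow> tmat" where
  "compress N n X = op_comp N n (Pproj N n) (op_comp N n X (Pproj N n))"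

definition BH :: "nat \<Rightarrow> nat \<Rightarrow> tmat set" where
  "BH N n = {X \<in> ops N n n. compress N n X = X}"

text \<open>The partial traces over the first and over the last leg, for operators on \<open>n \<ge> 1\<close> legs.\<close>

definition ptrace_first :: "nat \<Rightarrow> tmat \<Rightarrow> tmat" where
  "ptrace_first N X = (\<lambda>I J. \<Sum>a<N. X (a # I) (a # J))"

definition ptrace_last :: "nat \<Rightarrow> tmat \<Rightarrow> tmat" where
  "ptrace_last N X = (\<lambda>I J. \<Sum>a<N. X (I @ [a]) (J @ [a]))"

definition BH00 :: "nat \<Rightarrow> nat \<Rightarrow> tmat set" where
  "BH00 N n = {X \<in> BH N n. ptrace_first N X = (\<lambda>_ _. 0) \<and> ptrace_last N X = (\<lambda>_ _. 0)}"

definition rotation :: "nat \<Rightarrow> nat \<Rightarrow> tmat \<Rightarrow> tmat" where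
  "rotation N n X =
     op_comp N (n + 2) (op_tensor n n (Pproj N n) (op_adj (op_t N)))
       (op_comp N (n + 2) (sandwich N 1 n n 1 X)
         (op_tensor 2 0 (op_t N) (Pproj N n)))"

definition shifted :: "nat \<Rightarrow> nat \<Rightarrow> tmat \<Rightarrow> nat \<Rightarrow> nat \<Rightarrow> tmat" where
  "shifted N k X i j = compress N (i + k + j) (sandwich N i k k j X)"


section \<open>The universal \<open>C\<^sup>*\<close>-algebra\<close>

text \<open>
  Lists form a monoid under concatenation, so finitely supported complex functions on lists of
  generators, with the convolution product of \<^type>\<open>poly_mapping\<close>, form the free
  unital algebra on these generators.  The letter \<open>(i, j)\<close> stands for the generator \<open>u\<^sub>i\<^sub>,\<^sub>j\<close>.
\<close>

instantiation list :: (type) monoid_add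
begin

definition zero_list :: "'a list" where "zero_list = []"

definition plus_list :: "'a list \<Rightarrow> 'a list \<Rightarrow> 'a list" where "plus_list = append"

instance
  by standard (simp_all add: zero_list_def plus_list_def)

end

type_synonym uword = "(nat \<times> nat) list"
type_synonym ncpoly = "uword \<Rightarrow>\<^sub>0 complex"

definition free_alg :: "nat \<Rightarrow> ncpoly set" where
  "free_alg N = {p. Poly_Mapping.keys p \<subseteq> lists ({..<N} \<times> {..<N})}"

definition gen :: "nat \<Rightarrow> nat \<Rightarrow> ncpoly" where
  "gen i j = Poly_Mapping.single [(i, j)] 1"

definition nc_scale :: "complex \<Rightarrow> ncpoly \<Rightarrow> ncpoly" where
  "nc_scale c p = Poly_Mapping.map ((*) c) p"

text \<open>The generators are self-adjoint, so the involution reverses words.\<close>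

definition nc_star :: "ncpoly \<Rightarrow> ncpoly" where
  "nc_star p = Poly_Mapping.map_key rev (Poly_Mapping.map cnj p)"

text \<open>
  A \<open>C\<^sup>*\<close>-seminorm on the free \<open>*\<close>-algebra vanishing on the defining relations
  \<open>u u\<^sup>* = 1 = u\<^sup>* u\<close>.  The universal seminorm is the largest one, and the universal
  \<open>C\<^sup>*\<close>-algebra is the separated completion for it: Cauchy sequences modulo null sequences.
\<close>

definition cstar_seminorm :: "nat \<Rightarrow> (ncpoly \<Rightarrow> real) \<Rightarrow> bool" where
  "cstar_seminorm N s \<longleftrightarrow>
     (\<forall>p\<in>free_alg N. 0 \<le> s p) \<and>
     (\<forall>p\<in>free_alg N. \<forall>r\<in>free_alg N. s (p + r) \<le> s p + s r) \<and>
     (\<forall>c. \<forall>p\<in>free_alg N. s (nc_scale c p) = cmod c * s p) \<and>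
     (\<forall>p\<in>free_alg N. \<forall>r\<in>free_alg N. s (p * r) \<le> s p * s r) \<and>
     (\<forall>p\<in>free_alg N. s (nc_star p * p) = (s p)\<^sup>2) \<and>
     (\<forall>i<N. \<forall>j<N.
        s ((\<Sum>k<N. gen i k * nc_star (gen j k)) - (if i = j then 1 else 0)) = 0 \<and>
        s ((\<Sum>k<N. nc_star (gen k i) * gen k j) - (if i = j then 1 else 0)) = 0)"

definition unorm :: "nat \<Rightarrow> ncpoly \<Rightarrow> real" where
  "unorm N p = (SUP s\<in>{s. cstar_seminorm N s}. s p)"

type_synonym cuelem = "(nat \<Rightarrow> ncpoly) set"

definition cu_seqs :: "nat \<Rightarrow> (nat \<Rightarrow> ncpoly) set" where
  "cu_seqs N = {f. (\<forall>n. f n \<in> free_alg N) \<and>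
     (\<forall>e>0. \<exists>M. \<forall>m\<ge>M. \<forall>n\<ge>M. unorm N (f m - f n) < e)}"

definition cu_class :: "nat \<Rightarrow> (nat \<Rightarrow> ncpoly) \<Rightarrow> cuelem" where
  "cu_class N f = {g \<in> cu_seqs N. (\<lambda>n. unorm N (f n - g n)) \<longlonglongrightarrow> 0}"

definition cu_carrier :: "nat \<Rightarrow> cuelem set" where
  "cu_carrier N = cu_class N ` cu_seqs N"

definition cu_emb :: "nat \<Rightarrow> ncpoly \<Rightarrow> cuelem" where
  "cu_emb N p = cu_class N (\<lambda>_. p)"

definition cu_add :: "nat \<Rightarrow> cuelem \<Rightarrow> cuelem \<Rightarrow> cuelem" where
  "cu_add N x y = (\<Union>f\<in>x. \<Union>g\<in>y. cu_class N (\<lambda>n. f n + g n))"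

definition cu_mult :: "nat \<Rightarrow> cuelem \<Rightarrow> cuelem \<Rightarrow> cuelem" where
  "cu_mult N x y = (\<Union>f\<in>x. \<Union>g\<in>y. cu_class N (\<lambda>n. f n * g n))"

definition cu_scale :: "nat \<Rightarrow> complex \<Rightarrow> cuelem \<Rightarrow> cuelem" where
  "cu_scale N c x = (\<Union>f\<in>x. cu_class N (\<lambda>n. nc_scale c (f n)))"

definition cu_star :: "nat \<Rightarrow> cuelem \<Rightarrow> cuelem" where
  "cu_star N x = (\<Union>f\<in>x. cu_class N (\<lambda>n. nc_star (f n)))"


section \<open>Coproduct and Haar state\<close>

text \<open>
  Pairs of words form the product monoid, whose monoid algebra is the algebraic tensor square of the
  free algebra; the pair \<open>(v, w)\<close> stands for \<open>v \<otimes> w\<close>.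
\<close>

type_synonym ncpoly2 = "(uword \<times> uword) \<Rightarrow>\<^sub>0 complex"

definition coprod_gen :: "nat \<Rightarrow> nat \<times> nat \<Rightarrow> ncpoly2" where
  "coprod_gen N = (\<lambda>(i, j). \<Sum>k<N. Poly_Mapping.single ([(i, k)], [(k, j)]) 1)"

definition coprod :: "nat \<Rightarrow> ncpoly \<Rightarrow> ncpoly2" where
  "coprod N p = (\<Sum>w\<in>Poly_Mapping.keys p.
     Poly_Mapping.single 0 (Poly_Mapping.lookup p w) * prod_list (map (coprod_gen N) w))"

definition slice_left :: "(uword \<Rightarrow> complex) \<Rightarrow> ncpoly2 \<Rightarrow> ncpoly" where
  "slice_left \<phi> T = (\<Sum>(v, w)\<in>Poly_Mapping.keys T.
     Poly_Mapping.single w (\<phi> v * Poly_Mapping.lookup T (v, w)))"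

definition slice_right :: "(uword \<Rightarrow> complex) \<Rightarrow> ncpoly2 \<Rightarrow> ncpoly" where
  "slice_right \<phi> T = (\<Sum>(v, w)\<in>Poly_Mapping.keys T.
     Poly_Mapping.single v (\<phi> w * Poly_Mapping.lookup T (v, w)))"

definition cu_state :: "nat \<Rightarrow> (cuelem \<Rightarrow> complex) \<Rightarrow> bool" where
  "cu_state N h \<longleftrightarrow>
     (\<forall>x\<in>cu_carrier N. \<forall>y\<in>cu_carrier N. h (cu_add N x y) = h x + h y) \<and>
     (\<forall>c. \<forall>x\<in>cu_carrier N. h (cu_scale N c x) = c * h x) \<and>
     (\<forall>x\<in>cu_carrier N. h (cu_mult N (cu_star N x) x) \<in> \<real>\<^sub>\<ge>\<^sub>0) \<and>
     h (cu_emb N 1) = 1"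

text \<open>
  Invariance \<open>(h \<otimes> id) \<Delta>(x) = h(x) 1 = (id \<otimes> h) \<Delta>(x)\<close> is imposed for \<open>x\<close> a polynomial in the
  generators, where the coproduct takes values in the algebraic tensor square.  These \<open>x\<close> are dense
  and both sides are continuous, so it then holds on the whole \<open>C\<^sup>*\<close>-algebra.
\<close>

definition haar_state :: "nat \<Rightarrow> (cuelem \<Rightarrow> complex) \<Rightarrow> bool" where
  "haar_state N h \<longleftrightarrow> cu_state N h \<and>
     (\<forall>p\<in>free_alg N.
        cu_emb N (slice_left (\<lambda>v. h (cu_emb N (Poly_Mapping.single v 1))) (coprod N p))
          = cu_scale N (h (cu_emb N p)) (cu_emb N 1) \<and>
        cu_emb N (slice_right (\<lambda>v. h (cu_emb N (Poly_Mapping.single v 1))) (coprod N p))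
          = cu_scale N (h (cu_emb N p)) (cu_emb N 1))"

text \<open>
  The scalar product \<open>(x | y) = h(x\<^sup>* y)\<close> of the GNS space of \<open>h\<close>, linear in \<open>y\<close>.  All vectors
  considered below are images of polynomials in the generators.
\<close>

definition haar_inner :: "nat \<Rightarrow> (cuelem \<Rightarrow> complex) \<Rightarrow> cuelem \<Rightarrow> cuelem \<Rightarrow> complex" where
  "haar_inner N h x y = h (cu_mult N (cu_star N x) y)"

definition haar_norm2 :: "nat \<Rightarrow> (cuelem \<Rightarrow> complex) \<Rightarrow> cuelem \<Rightarrow> real" where
  "haar_norm2 N h x = sqrt (Re (haar_inner N h x x))"

text \<open>The word \<^term>\<open>zip I J\<close> is the monomial \<open>u\<^sub>i\<^sub>1\<^sub>,\<^sub>j\<^sub>1 \<cdots> u\<^sub>i\<^sub>n\<^sub>,\<^sub>j\<^sub>n\<close>.\<close>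

definition ucoef :: "nat \<Rightarrow> nat \<Rightarrow> tmat \<Rightarrow> cuelem" where
  "ucoef N n X = cu_emb N (\<Sum>I\<in>words N n. \<Sum>J\<in>words N n. Poly_Mapping.single (zip I J) (X J I))"


section \<open>The families \<open>W\<^sub>k\<close> and the Gram matrices\<close>

text \<open>
  \<open>W\<^sub>k\<close> is the image under \<^term>\<open>ucoef N k\<close> of a set \<open>B\<close> satisfying \<open>W_basis N h k B\<close>.
  Since \<open>ucoef N k\<close> is injective on \<^term>\<open>BH N k\<close>, an element \<open>x\<close> of \<open>W\<^sub>k\<close> is given by its
  preimage \<open>X\<close> in \<open>B\<close>, from which the elements \<open>x\<^sub>i\<^sub>,\<^sub>j\<close> are built.
\<close>

definition W_basis :: "nat \<Rightarrow> (cuelem \<Rightarrow> complex) \<Rightarrow> nat \<Rightarrow> tmat set \<Rightarrow> bool" where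
  "W_basis N h k B \<longleftrightarrow>
     finite B \<and> B \<subseteq> BH00 N k \<and>
     (\<forall>X\<in>B. X \<noteq> (\<lambda>_ _. 0)) \<and>
     (\<forall>X\<in>B. \<forall>Y\<in>B. X \<noteq> Y \<longrightarrow> op_trace N k (op_comp N k (op_adj X) Y) = 0) \<and>
     (\<forall>Y\<in>BH00 N k. \<exists>c. Y = (\<lambda>I J. \<Sum>X\<in>B. c X * X I J)) \<and>
     (\<forall>X\<in>B. \<exists>\<mu>. rotation N k X = (\<lambda>I J. \<mu> * X I J)) \<and>
     (\<forall>X\<in>B. haar_norm2 N h (ucoef N k X) = 1)"

definition x_shift :: "nat \<Rightarrow> nat \<Rightarrow> tmat \<Rightarrow> nat \<Rightarrow> nat \<Rightarrow> cuelem" where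
  "x_shift N k X i j = ucoef N (i + k + j) (shifted N k X i j)"

definition gram_matrix ::
  "nat \<Rightarrow> (cuelem \<Rightarrow> complex) \<Rightarrow> nat \<Rightarrow> tmat \<Rightarrow> nat \<Rightarrow> complex mat" where
  "gram_matrix N h k X n = mat (n - k + 1) (n - k + 1)
     (\<lambda>(i, p). haar_inner N h (x_shift N k X i (n - k - i)) (x_shift N k X p (n - k - p)))"

definition vec_norm2 :: "complex vec \<Rightarrow> real" where
  "vec_norm2 v = L2_set (\<lambda>i. cmod (vec_index v i)) {..<dim_vec v}"

definition mat_op_norm :: "complex mat \<Rightarrow> real" where
  "mat_op_norm A = (SUP v\<in>{v \<in> carrier_vec (dim_col A). vec_norm2 v \<le> 1}. vec_norm2 (A *\<^sub>v v))"

end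

theory Submission
  imports Defs "Jordan_Normal_Form.Determinant"
begin

text \<open>
The entries of \<open>G\<^sub>n(x)\<close> are made explicit in two independent steps, and then estimated.

For \<open>X\<close>, \<open>Y\<close> in \<open>B(H\<^sub>n)\<close> one has \<open>(u\<^sub>n(X) | u\<^sub>n(Y)) = Tr(X\<^sup>* Y) / d\<^sub>n\<close>
(\<open>haar_inner_ucoef\<close>).  Invariance of \<open>h\<close> makes the matrix of numbers \<open>h(u\<^sub>I\<^sub>J\<^sup>* u\<^sub>K\<^sub>L)\<close>, for fixed \<open>J\<close>
and \<open>L\<close>, commute with the corepresentation, and Schur's lemma says that its compression to
\<open>H\<^sub>n\<close> is a scalar; its trace is known, because the projection onto \<open>H\<^sub>n\<close> is an intertwiner.  The
argument requires that the \<open>d\<^sub>n\<^sup>2\<close> coefficients of \<open>u\<close> on \<open>H\<^sub>n\<close> be linearly independent in the universal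
\<open>C\<^sup>*\<close>-algebra, hence a lower bound for the universal seminorm.  It comes from an explicit
representation on the sum of the spaces \<open>H\<^sub>n \<otimes> H\<^sub>n\<close>, where \<open>u\<^sub>i\<^sub>,\<^sub>j\<close> creates \<open>e\<^sub>i \<otimes> e\<^sub>j\<close> on
the left or annihilates it (\<open>U_selfadjoint\<close>, \<open>U_unitary\<close>): the coefficients of degree \<open>n\<close>, applied to
the vacuum, are independent in top degree.

Adding one leg on the left or on the right and compressing defines \<open>\<lambda>\<close> and \<open>\<kappa>\<close>, which
commute, and \<open>X\<^sub>i\<^sub>,\<^sub>j = \<lambda>\<^sup>i \<kappa>\<^sup>j X\<close>.  For the scalar products above their adjoints are multiples
of the partial traces, and with \<open>g = c\<^sub>n c\<^sub>n\<^sub>+\<^sub>1 \<le> q\<^sup>2\<close>, where \<open>c\<^sub>n = d\<^sub>n\<^sub>-\<^sub>1 / d\<^sub>n \<le> q\<close>, the Wenzl recursion gives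
\<open>\<lambda>\<^sup>* \<lambda> = (1 - g) + g \<lambda> \<lambda>\<^sup>*\<close>, and the same for \<open>\<kappa>\<close>.  In particular both are contractions.  The product
\<open>\<lambda>\<^sup>* \<kappa>\<close> is a multiple of \<open>\<kappa> \<lambda>\<^sup>*\<close> up to terms with the small factor \<open>1 / d\<^sub>n\<close>, which involve the rotation and its
inverse (\<open>tau_kap\<close>).  As \<open>X\<close> is killed by \<open>\<lambda>\<^sup>*\<close> and \<open>\<kappa>\<^sup>*\<close> and is an eigenvector of the rotation, the span of the
\<open>X\<^sub>i\<^sub>,\<^sub>j\<close> is stable under \<open>\<lambda>\<^sup>*\<close>.

Give the combination \<open>\<Sum>\<^sub>s f\<^sub>s X\<^sub>s\<^sub>,\<^sub>m\<^sub>-\<^sub>s\<close> the norm \<open>\<Sum>\<^sub>s |f\<^sub>s| (2 q)\<^sup>-\<^sup>s\<close>.  Then \<open>\<lambda>\<^sup>*\<close>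
multiplies norms by at most \<open>2 q\<close> (\<open>lamstar_wball\<close>), so that moving \<open>\<lambda>\<^sup>i\<close> to the other side of a scalar product bounds
the entry \<open>(i, p)\<close> by \<open>(2 q)\<^sup>i\<^sup>-\<^sup>p\<close> for \<open>p \<le> i\<close>.  On the diagonal, each further leg costs at most a factor \<open>q\<^sup>2\<close> of the
previous loss, which keeps the entries within \<open>2 q\<^sup>2 / (1 - q\<^sup>2)\<close> of 1.  Since \<open>N \<ge> 3\<close> forces
\<open>q \<le> 2 / 5\<close>, all row sums are bounded, and for small \<open>q\<close> the matrix is close to the identity; the Schur test turns
both facts into bounds of operator norms.
\<close>

section \<open>Words\<close>

lemma finite_words [simp]: "finite (words N n)"
  using finite_lists_length_eq[of "{..<N}" n]
  by (simp add: words_def conj_commute)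

lemma words_0 [simp]: "words N 0 = {[]}"
  by (auto simp: words_def)

lemma length_words: "I \<in> words N n \<Longrightarrow> length I = n"
  by (simp add: words_def)

lemma Nil_in_words [simp]: "[] \<in> words N n \<longleftrightarrow> n = 0"
  by (auto simp: words_def)

lemma Cons_in_words [simp]: "a # I \<in> words N n \<longleftrightarrow> (\<exists>m. n = Suc m \<and> a < N \<and> I \<in> words N m)"
  by (auto simp: words_def)

lemma snoc_in_words [simp]: "I @ [a] \<in> words N n \<longleftrightarrow> (\<exists>m. n = Suc m \<and> a < N \<and> I \<in> words N m)"
  by (auto simp: words_def)

lemma rev_in_words [simp]: "rev I \<in> words N n \<longleftrightarrow> I \<in> words N n"
  by (simp add: words_def)

lemma words_Suc: "words N (Suc n) = (\<lambda>(a, I). a # I) ` ({..<N} \<times> words N n)"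
  unfolding set_eq_iff
proof (intro allI iffI)
  fix I assume "I \<in> words N (Suc n)"
  then show "I \<in> (\<lambda>(a, I). a # I) ` ({..<N} \<times> words N n)"
    by (cases I) (auto simp: image_iff)
qed auto

lemma sum_words_Suc: "sum f (words N (Suc n)) = (\<Sum>a<N. \<Sum>I\<in>words N n. f (a # I))"
proof -
  have "inj_on (\<lambda>(a, I). a # I) ({..<N} \<times> words N n)"
    by (auto simp: inj_on_def)
  then have "sum f (words N (Suc n)) = (\<Sum>(a, I)\<in>{..<N} \<times> words N n. f (a # I))"
    unfolding words_Suc by (subst sum.reindex) (auto simp: comp_def case_prod_beta)
  then show ?thesis by (simp add: sum.cartesian_product)
qed

lemma sum_words_rev: "(\<Sum>I\<in>words N n. f (rev I)) = (\<Sum>I\<in>words N n. f I)"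
  by (rule sum.reindex_bij_witness[of _ rev rev]) auto

lemma sum_words_snoc: "sum f (words N (Suc n)) = (\<Sum>I\<in>words N n. \<Sum>a<N. f (I @ [a]))"
proof -
  have "sum f (words N (Suc n)) = (\<Sum>a<N. \<Sum>I\<in>words N n. f (rev I @ [a]))"
    by (subst sum_words_rev[symmetric]) (simp add: sum_words_Suc)
  also have "\<dots> = (\<Sum>a<N. \<Sum>I\<in>words N n. f (I @ [a]))"
    by (simp add: sum_words_rev[of "\<lambda>I. f (I @ [_])"])
  finally show ?thesis by (simp add: sum.swap[of _ "words N n"])
qed

lemma sum_words_add:
  "sum f (words N (m + n)) = (\<Sum>I\<in>words N m. \<Sum>J\<in>words N n. f (I @ J))"
  by (induction m arbitrary: f) (simp_all add: sum_words_Suc)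

section \<open>The Jones--Wenzl projections\<close>

text \<open>
The parameter \<open>q\<close> enters the estimates through the ratios \<open>c\<^sub>n\<close> of consecutive dimensions, all of which
are at most \<open>q\<close>.
\<close>

locale temperley_lieb =
  fixes N :: nat and q :: real
  assumes N3: "3 \<le> N" and q0: "0 < q" and q1: "q < 1" and qN: "q + inverse q = real N"
begin

lemma q_le: "q \<le> 2/5"
proof (rule ccontr)
  assume "\<not> q \<le> 2/5"
  then have h: "2/5 < q" by simp
  have "q * q + 1 = q * real N" using qN q0 by (simp add: field_simps)
  moreover have "q * 3 \<le> q * real N" using N3 q0 by (intro mult_left_mono) auto
  moreover have "(q - 2/5) * (q - 1) < 0" using h q1 by (intro mult_pos_neg) auto
  then have "q * q - 7/5 * q + 2/5 < 0" by (simp add: field_simps)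
  ultimately show False using h by linarith
qed

text \<open>
The ratios \<open>c\<^sub>n = d\<^sub>n\<^sub>-\<^sub>1 / d\<^sub>n\<close>.  The value \<open>c\<^sub>0 = 0\<close> lets the Wenzl recursion and the formulas derived from it
hold at level 0 without a case distinction.
\<close>

primrec c :: "nat \<Rightarrow> real" where
  "c 0 = 0"
| "c (Suc n) = 1 / (real N - c n)"

text \<open>
The dimension of \<open>H\<^sub>n\<close> (see \<open>Q_trace\<close>).
\<close>

primrec d :: "nat \<Rightarrow> real" where
  "d 0 = 1"
| "d (Suc n) = (real N - c n) * d n"

lemma c_bounds: "0 \<le> c n" "c n \<le> q"
proof (induction n)
  case (Suc n)
  have "inverse q = real N - q" using qN by simp
  then have 1: "inverse q \<le> real N - c n" using Suc by simp
  have "0 < inverse q" using q0 by simp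
  with 1 have pos: "0 < real N - c n" by linarith
  { case 1 show ?case using pos by simp
  next
    case 2 show ?case using le_imp_inverse_le[OF 1] q0 by (simp add: inverse_eq_divide) }
qed (use q0 in auto)

lemma Nc_pos: "0 < real N - c n"
  using c_bounds(2)[of n] q1 N3 by simp

lemma c_pos: "0 < c (Suc n)"
  using Nc_pos by simp

lemma d_pos [simp]: "0 < d n"
  by (induction n) (use Nc_pos in auto)

lemma d_nz [simp]: "d n \<noteq> 0"
  using d_pos[of n] by linarith

lemma c_Suc_d: "c (Suc n) = d n / d (Suc n)"
  using Nc_pos[of n] by (simp add: field_simps)

declare c.simps(2) [simp del] d.simps(2) [simp del]

lemma Nc: "real N - c n = 1 / c (Suc n)"
  by (simp add: c.simps)

text \<open>
The space \<open>H\<^sub>n\<close> in coordinates: vectors annihilated by all contractions of adjacent legs.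
\<close>

definition H :: "nat \<Rightarrow> tvec set" where
  "H n = {\<zeta>. (\<forall>I. \<zeta> I \<noteq> 0 \<longrightarrow> I \<in> words N n) \<and>
     (\<forall>A B. length A + length B + 2 = n \<longrightarrow> (\<Sum>x<N. \<zeta> (A @ x # x # B)) = 0)}"

lemma H_supp: "\<zeta> \<in> H n \<Longrightarrow> I \<notin> words N n \<Longrightarrow> \<zeta> I = 0"
  by (auto simp: H_def)

lemma H_cap: "\<zeta> \<in> H n \<Longrightarrow> length A + length B + 2 = n \<Longrightarrow> (\<Sum>x<N. \<zeta> (A @ x # x # B)) = 0"
  by (auto simp: H_def)

lemma H_cap_first: "\<zeta> \<in> H n \<Longrightarrow> length B + 2 = n \<Longrightarrow> (\<Sum>x<N. \<zeta> (x # x # B)) = 0"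
  using H_cap[of \<zeta> n "[]" B] by simp

lemma H_cap_last: "\<zeta> \<in> H n \<Longrightarrow> length A + 2 = n \<Longrightarrow> (\<Sum>x<N. \<zeta> (A @ [x, x])) = 0"
  using H_cap[of \<zeta> n A "[]"] by simp

lemma H_Cons: "\<zeta> \<in> H (Suc n) \<Longrightarrow> (\<lambda>I. \<zeta> (a # I)) \<in> H n"
  unfolding H_def
  apply (intro CollectI conjI allI impI)
   apply fastforce
  subgoal for A B by (elim CollectE conjE allE[of _ "a # A"] allE[of _ B]) simp
  done

lemma H_rev: "\<zeta> \<in> H n \<Longrightarrow> (\<lambda>I. \<zeta> (rev I)) \<in> H n"
  unfolding H_def
  apply (intro CollectI conjI allI impI)
   apply fastforce
  subgoal for A B by (elim CollectE conjE allE[of _ "rev B"] allE[of _ "rev A"]) simp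
  done

lemma H_snoc: "\<zeta> \<in> H (Suc n) \<Longrightarrow> (\<lambda>I. \<zeta> (I @ [a])) \<in> H n"
  unfolding H_def
  apply (intro CollectI conjI allI impI)
   apply fastforce
  subgoal for A B by (elim CollectE conjE allE[of _ "A"] allE[of _ "B @ [a]"]) simp
  done

lemma H_sum:
  assumes "\<And>x. x \<in> S \<Longrightarrow> f x \<in> H n"
  shows "(\<lambda>I. \<Sum>x\<in>S. g x * f x I) \<in> H n"
proof -
  have "(\<Sum>y<N. \<Sum>x\<in>S. g x * f x (A @ y # y # B)) = 0" if "length A + length B + 2 = n" for A B
    by (subst sum.swap) (simp add: sum_distrib_left[symmetric] H_cap[OF assms that])
  moreover have "I \<in> words N n" if "(\<Sum>x\<in>S. g x * f x I) \<noteq> 0" for I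
    using that assms H_supp by (metis (mono_tags, lifting) mult_zero_right sum.neutral)
  ultimately show ?thesis by (auto simp: H_def)
qed

lemma H_scale: "f \<in> H n \<Longrightarrow> (\<lambda>I. g * f I) \<in> H n"
  using H_sum[of "{()}" "\<lambda>_. f" n "\<lambda>_. g"] by simp

lemma H_add: "f \<in> H n \<Longrightarrow> f' \<in> H n \<Longrightarrow> (\<lambda>I. f I + f' I) \<in> H n"
  using H_sum[of "{True,False}" "\<lambda>b. if b then f else f'" n "\<lambda>_. 1"] by (simp split: if_splits)

lemma H_zero: "(\<lambda>_. 0) \<in> H n"
  by (simp add: H_def)

lemma H_cnj: "f \<in> H n \<Longrightarrow> (\<lambda>I. cnj (f I)) \<in> H n"
  by (simp add: H_def flip: cnj_sum)

text \<open>
The kernel of the orthogonal projection onto \<open>H\<^sub>n\<close>, by the left Wenzl recursion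
\<open>P\<^sub>n\<^sub>+\<^sub>1 = (1 \<otimes> P\<^sub>n) - c\<^sub>n (1 \<otimes> P\<^sub>n) (t t\<^sup>* \<otimes> 1) (1 \<otimes> P\<^sub>n)\<close>, written out on words.
\<close>

fun Q :: "nat \<Rightarrow> nat list \<Rightarrow> nat list \<Rightarrow> complex" where
  "Q 0 I J = (if I = [] \<and> J = [] then 1 else 0)"
| "Q (Suc n) (a # I) (b # J) = (if a < N \<and> b < N then
     (if a = b then Q n I J else 0) - of_real (c n) * (\<Sum>K\<in>words N (n - 1). Q n I (a # K) * Q n (b # K) J)
     else 0)"
| "Q (Suc n) _ _ = 0"

lemma Q_supp: "Q n I J \<noteq> 0 \<Longrightarrow> I \<in> words N n \<and> J \<in> words N n"
proof (induction n arbitrary: I J)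
  case (Suc n)
  obtain a I' b J' where IJ: "I = a # I'" "J = b # J'"
    using Suc.prems by (cases I; cases J) auto
  have "I' \<in> words N n \<and> J' \<in> words N n \<and> a < N \<and> b < N"
  proof (cases "a < N \<and> b < N \<and> (I' \<notin> words N n \<or> J' \<notin> words N n)")
    case True
    then have "Q n I' J' = 0" and "\<And>K. Q n I' (a # K) * Q n (b # K) J' = 0"
      using Suc.IH by (blast, metis mult_eq_0_iff Suc.IH)
    then have "Q n I' J' = 0" "(\<Sum>K\<in>words N (n - 1). Q n I' (a # K) * Q n (b # K) J') = 0"
      by (blast, meson sum.neutral)
    with Suc.prems IJ have False by (simp split: if_splits)
    then show ?thesis ..
  qed (use Suc.prems IJ in \<open>auto split: if_splits\<close>)
  then show ?case using IJ by simp
qed (simp split: if_splits)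

lemma Q_supp0: "I \<notin> words N n \<Longrightarrow> Q n I J = 0" "J \<notin> words N n \<Longrightarrow> Q n I J = 0"
  using Q_supp by blast+

lemma Q_sym: "Q n I J = Q n J I"
proof (induction n arbitrary: I J)
  case (Suc n)
  show ?case
  proof (cases I; cases J)
    fix a I' b J' assume "I = a # I'" "J = b # J'"
    moreover have "Q n I' (a # K) * Q n (b # K) J' = Q n J' (b # K) * Q n (a # K) I'" for K
      using Suc[of I' "a # K"] Suc[of J' "b # K"] by simp
    ultimately show ?thesis using Suc[of I' J'] by simp
  qed auto
qed auto

lemma Q_cnj [simp]: "cnj (Q n I J) = Q n I J"
proof (induction n arbitrary: I J)
  case (Suc n)
  then show ?case by (cases I; cases J) (simp_all add: Suc)
qed auto

text \<open>
The correction term of the recursion contracts the first two legs of \<open>\<zeta>\<close>, hence vanishes on \<open>H\<^sub>n\<^sub>+\<^sub>1\<close>.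
\<close>

lemma Q_fix: "\<zeta> \<in> H n \<Longrightarrow> (\<Sum>J\<in>words N n. Q n I J * \<zeta> J) = \<zeta> I"
proof (induction n arbitrary: I \<zeta>)
  case 0
  then show ?case using H_supp[of \<zeta> 0 I] by auto
next
  case (Suc n)
  show ?case
  proof (cases "I \<in> words N (Suc n)")
    case False
    then show ?thesis using H_supp[OF Suc.prems] by (simp add: Q_supp0)
  next
    case True
    then obtain a I' where I: "I = a # I'" "a < N" "I' \<in> words N n" by (cases I) auto
    have s: "(\<Sum>J\<in>words N n. Q n I J * \<zeta> (b # J)) = \<zeta> (b # I)" for b I
      using Suc.IH[OF H_Cons[OF Suc.prems]] .
    have if_sum: "(\<Sum>J\<in>words N n. (if a = b then Q n I' J * \<zeta> (b # J) else 0)) = (if a = b then \<zeta> (b # I') else 0)" for b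
      by (simp add: s)
    have "(\<Sum>J\<in>words N (Suc n). Q (Suc n) I J * \<zeta> J) =
       (\<Sum>b<N. \<Sum>J\<in>words N n. (if a = b then Q n I' J * \<zeta> (b # J) else 0) -
          of_real (c n) * (\<Sum>K\<in>words N (n - 1). Q n I' (a # K) * (Q n (b # K) J * \<zeta> (b # J))))"
      unfolding sum_words_Suc I
      by (intro sum.cong refl) (use I in \<open>auto simp: algebra_simps sum_distrib_left\<close>)
    also have "\<dots> = (\<Sum>b<N. (if a = b then \<zeta> (b # I') else 0)) -
       of_real (c n) * (\<Sum>b<N. \<Sum>J\<in>words N n. \<Sum>K\<in>words N (n - 1). Q n I' (a # K) * (Q n (b # K) J * \<zeta> (b # J)))"
      by (simp only: sum_subtractf sum_distrib_left s if_sum)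
    also have "(\<Sum>b<N. \<Sum>J\<in>words N n. \<Sum>K\<in>words N (n - 1). Q n I' (a # K) * (Q n (b # K) J * \<zeta> (b # J)))
       = (\<Sum>b<N. \<Sum>K\<in>words N (n - 1). \<Sum>J\<in>words N n. Q n I' (a # K) * (Q n (b # K) J * \<zeta> (b # J)))"
      by (intro sum.cong refl sum.swap)
    also have "\<dots> = (\<Sum>b<N. \<Sum>K\<in>words N (n - 1). Q n I' (a # K) * \<zeta> (b # b # K))"
      by (simp add: sum_distrib_left[symmetric] s)
    also have "\<dots> = (\<Sum>K\<in>words N (n - 1). Q n I' (a # K) * (\<Sum>b<N. \<zeta> (b # b # K)))"
      by (subst sum.swap) (simp add: sum_distrib_left)
    also have "of_real (c n) * \<dots> = 0"
    proof (cases n)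
      case (Suc m)
      have "(\<Sum>b<N. \<zeta> (b # b # K)) = 0" if "K \<in> words N (n - 1)" for K
        by (rule H_cap_first[OF Suc.prems]) (use that Suc in \<open>auto dest: length_words\<close>)
      then show ?thesis by simp
    qed simp
    finally show ?thesis using I by simp
  qed
qed

text \<open>
Both properties are carried by one induction: the first two legs of \<open>Q (n + 1)\<close> contract to zero because the
partial trace of \<open>Q n\<close> is \<open>Q (n - 1) / c\<^sub>n\<close>, and that trace is computed from idempotency of the previous
kernel, which follows from the first property and \<open>Q_fix\<close>.
\<close>

lemma Q_H_ptrace:
  "(\<forall>J. (\<lambda>I. Q n I J) \<in> H n) \<and>
   (\<forall>m I J. n = Suc m \<longrightarrow> (\<Sum>a<N. Q n (a # I) (a # J)) = Q m I J / of_real (c n))"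
proof (induction n)
  case 0
  then show ?case by (auto simp: H_def)
next
  case (Suc n)
  then have Hn: "(\<lambda>I. Q n I J) \<in> H n" for J by blast
  have tr: "(\<Sum>a<N. Q n (a # I) (a # J)) = Q (n - 1) I J / of_real (c n)" if "n \<noteq> 0" for I J
    using Suc that by (cases n) auto
  have idem: "(\<Sum>K\<in>words N n. Q n I K * Q n K J) = Q n I J" for I J
    using Q_fix[OF Hn] .
  have cap: "(\<Sum>x<N. Q (Suc n) (A @ x # x # B) J) = 0" if len: "length A + length B + 2 = Suc n" for A B J
  proof (cases "J \<in> words N (Suc n)")
    case True
    then obtain b J' where J: "J = b # J'" "b < N" "J' \<in> words N n" by (cases J) auto
    show ?thesis
    proof (cases A)
      case Nil
      then obtain m where n: "n = Suc m" "length B = m" using len by (cases n) auto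
      have "(\<Sum>x<N. Q (Suc n) (x # x # B) J) =
         (\<Sum>x<N. (if x = b then Q n (b # B) J' else 0)) -
          of_real (c n) * (\<Sum>x<N. \<Sum>K\<in>words N (n - 1). Q n (x # B) (x # K) * Q n (b # K) J')"
        using J by (simp add: sum_subtractf sum_distrib_left cong: if_cong)
      also have "(\<Sum>x<N. \<Sum>K\<in>words N (n - 1). Q n (x # B) (x # K) * Q n (b # K) J')
         = (\<Sum>K\<in>words N m. (\<Sum>x<N. Q n (x # B) (x # K)) * Q n (b # K) J')"
        unfolding n diff_Suc_1 by (subst sum.swap) (simp only: sum_distrib_right)
      also have "\<dots> = (\<Sum>K\<in>words N m. Q m B K * Q n (b # K) J') / of_real (c n)"
        by (subst tr) (simp_all add: n sum_divide_distrib)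
      also have "(\<Sum>K\<in>words N m. Q m B K * Q n (b # K) J') = Q n (b # B) J'"
        using Q_fix[OF H_Cons[of "\<lambda>I. Q n I J'" m b], of B] Hn[of J'] n by simp
      finally show ?thesis using J Nil n c_pos[of m] by simp
    next
      case (Cons a A')
      have z: "(\<Sum>x<N. Q n (A' @ x # x # B) K) = 0" for K
        using H_cap[OF Hn[of K], of A' B] len Cons by simp
      show ?thesis
      proof (cases "a < N")
        case True
        have "(\<Sum>x<N. Q (Suc n) (A @ x # x # B) J) =
           (if a = b then (\<Sum>x<N. Q n (A' @ x # x # B) J') else 0) -
            of_real (c n) * (\<Sum>x<N. \<Sum>K\<in>words N (n - 1). Q n (A' @ x # x # B) (a # K) * Q n (b # K) J')"
          using J True Cons by (simp add: sum_subtractf sum_distrib_left)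
        also have "(\<Sum>x<N. \<Sum>K\<in>words N (n - 1). Q n (A' @ x # x # B) (a # K) * Q n (b # K) J')
          = (\<Sum>K\<in>words N (n - 1). (\<Sum>x<N. Q n (A' @ x # x # B) (a # K)) * Q n (b # K) J')"
          by (subst sum.swap) (simp only: sum_distrib_right)
        finally show ?thesis by (simp add: z)
      qed (use Cons J in simp)
    qed
  qed (simp add: Q_supp0)
  have trS: "(\<Sum>a<N. Q (Suc n) (a # I) (a # J)) = Q n I J / of_real (c (Suc n))" for I J
  proof -
    have "(\<Sum>a<N. Q (Suc n) (a # I) (a # J)) = of_nat N * Q n I J -
      of_real (c n) * (\<Sum>a<N. \<Sum>K\<in>words N (n - 1). Q n I (a # K) * Q n (a # K) J)"
      by (simp add: sum_subtractf sum_distrib_left)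
    also have "of_real (c n) * (\<Sum>a<N. \<Sum>K\<in>words N (n - 1). Q n I (a # K) * Q n (a # K) J) = of_real (c n) * Q n I J"
    proof (cases n)
      case (Suc m)
      then show ?thesis using idem[of I J] by (simp add: sum_words_Suc del: Q.simps)
    qed simp
    also have "of_nat N * Q n I J - of_real (c n) * Q n I J = of_real (real N - c n) * Q n I J"
      by (simp add: algebra_simps)
    finally show ?thesis by (simp add: Nc)
  qed
  show ?case
    using cap trS Q_supp by (auto simp: H_def)
qed

lemma Q_in_H: "(\<lambda>I. Q n I J) \<in> H n"
  using Q_H_ptrace by blast

lemma Q_in_H': "(\<lambda>J. Q n I J) \<in> H n"
  using Q_in_H[of n I] by (simp add: Q_sym[of n I])

lemma Q_ptrace: "(\<Sum>a<N. Q (Suc n) (a # I) (a # J)) = Q n I J / of_real (c (Suc n))"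
  using Q_H_ptrace[of "Suc n"] by blast

lemma Q_idem: "(\<Sum>K\<in>words N n. Q n I K * Q n K J) = Q n I J"
  using Q_fix[OF Q_in_H] .

lemma Q_trace: "(\<Sum>I\<in>words N n. Q n I I) = of_real (d n)"
proof (induction n)
  case (Suc n)
  have "(\<Sum>I\<in>words N (Suc n). Q (Suc n) I I) = (\<Sum>I\<in>words N n. \<Sum>a<N. Q (Suc n) (a # I) (a # I))"
    unfolding sum_words_Suc by (rule sum.swap)
  also have "\<dots> = of_real (d n) / of_real (c (Suc n))"
    unfolding Q_ptrace by (simp add: sum_divide_distrib[symmetric] Suc)
  finally show ?case by (simp add: c_Suc_d)
qed simp

lemma Q_fix_right: "\<zeta> \<in> H n \<Longrightarrow> (\<Sum>J\<in>words N n. \<zeta> J * Q n J I) = \<zeta> I"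
  using Q_fix[of \<zeta> n I] by (simp add: mult.commute Q_sym[of n I])

lemma Q_apply_H: "(\<lambda>I. \<Sum>J\<in>words N n. Q n I J * \<zeta> J) \<in> H n"
  using H_sum[of "words N n" "\<lambda>J I. Q n I J" n \<zeta>] Q_in_H by (simp add: mult.commute)

text \<open>
Reversal of words preserves \<open>H\<^sub>n\<close>, so it commutes with the projection onto it.  This gives the right Wenzl
recursion from the left one.
\<close>

lemma Q_rev: "Q n (rev I) (rev J) = Q n I J"
proof -
  have 1: "(\<Sum>K\<in>words N n. Q n (rev I) (rev K) * Q n K J) = Q n I J" for I J
    using Q_fix[OF H_rev[OF Q_in_H[of n J]], of "rev I"]
    by (subst sum_words_rev[symmetric]) simp
  have "Q n (rev I) (rev J) = (\<Sum>K\<in>words N n. Q n I K * Q n (rev K) (rev J))"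
    using Q_fix[OF H_rev[OF Q_in_H[of n "rev J"]], of I] by simp
  also have "\<dots> = (\<Sum>K\<in>words N n. Q n (rev J) (rev K) * Q n K I)"
    by (intro sum.cong refl) (simp add: Q_sym[of n I] Q_sym[of n "rev J"])
  also have "\<dots> = Q n I J" by (simp only: 1 Q_sym[of n I J])
  finally show ?thesis .
qed

lemma Q_snoc:
  assumes "a < N" "b < N"
  shows "Q (Suc n) (I @ [a]) (J @ [b]) = (if a = b then Q n I J else 0) -
    of_real (c n) * (\<Sum>K\<in>words N (n - 1). Q n I (K @ [a]) * Q n (K @ [b]) J)"
proof -
  have "Q (Suc n) (I @ [a]) (J @ [b]) = Q (Suc n) (a # rev I) (b # rev J)"
    using Q_rev[of "Suc n" "I @ [a]" "J @ [b]"] by (simp del: Q.simps)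
  also have "\<dots> = (if a = b then Q n I J else 0) -
    of_real (c n) * (\<Sum>K\<in>words N (n - 1). Q n (rev I) (a # rev K) * Q n (b # rev K) (rev J))"
    by (subst sum_words_rev[of "\<lambda>K. Q n (rev I) (a # K) * Q n (b # K) (rev J)"])
      (simp add: assms Q_rev)
  also have "(\<lambda>K. Q n (rev I) (a # rev K) * Q n (b # rev K) (rev J)) = (\<lambda>K. Q n I (K @ [a]) * Q n (K @ [b]) J)"
    using Q_rev[of n I "_ @ [a]"] Q_rev[of n "_ @ [b]" J] by simp
  finally show ?thesis .
qed

end

context temperley_lieb begin

section \<open>Bending the Jones--Wenzl projections\<close>

text \<open>
The coefficient \<open>c\<^sub>n (-1)\<^sup>n\<^sup>-\<^sup>1 / d\<^sub>n\<^sub>-\<^sub>1\<close> with which \<open>Q_bend\<close> enters the next step of the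
recursion.
\<close>

definition e :: "nat \<Rightarrow> complex" where
  "e n = of_real ((- 1) ^ (n - 1) / d n)"

text \<open>
Bending the first input leg and the last output leg of the projection around produces a scalar on \<open>H\<^sub>n\<close>.  In the
Wenzl recursion the leading term contracts the last two legs of \<open>\<zeta>\<close> and vanishes, and what remains is the same expression one
level below, multiplied by \<open>-c\<^sub>n\<close>; the product of these factors is \<open>\<plusminus>1 / d\<^sub>n\<close>.
\<close>

lemma Q_bend:
  assumes "\<zeta> \<in> H (Suc m)" "a < N" "I \<in> words N m"
  shows "(\<Sum>J\<in>words N m. \<Sum>b<N. Q (Suc m) (I @ [b]) (a # J) * \<zeta> (J @ [b])) = of_real ((-1) ^ m / d m) * \<zeta> (a # I)"
  using assms
proof (induction m arbitrary: \<zeta> a I)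
  case 0
  have "(\<Sum>b<N. (if b = a then 1 else 0) * \<zeta> [b]) = \<zeta> [a]"
    using 0 by (simp add: if_distrib[where f="\<lambda>x. x * _"] cong: if_cong)
  then show ?case using 0 by (simp cong: if_cong)
next
  case (Suc m)
  let ?n = "Suc m"
  obtain i I' where I: "I = i # I'" "i < N" "I' \<in> words N m"
    using Suc.prems(3) by (cases I) auto
  have fix_snoc: "(\<Sum>J\<in>words N ?n. Q ?n L J * \<zeta> (J @ [b])) = \<zeta> (L @ [b])" for L b
    using Q_fix[OF H_snoc[OF Suc.prems(1)]] .
  have "(\<Sum>J\<in>words N ?n. \<Sum>b<N. Q (Suc ?n) (I @ [b]) (a # J) * \<zeta> (J @ [b]))
     = (\<Sum>b<N. \<Sum>J\<in>words N ?n. (if i = a then 1 else 0) * (Q ?n (I' @ [b]) J * \<zeta> (J @ [b])) -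
         of_real (c ?n) * (\<Sum>K\<in>words N m. Q ?n (I' @ [b]) (i # K) * (Q ?n (a # K) J * \<zeta> (J @ [b]))))"
    unfolding sum.swap[of _ "{..<N}"]
    by (intro sum.cong refl) (use I Suc.prems(2) in \<open>simp add: algebra_simps sum_distrib_left del: Q.simps(2) add: Q.simps(2)[of ?n]\<close>)
  also have "\<dots> = (if i = a then 1 else 0) * (\<Sum>b<N. \<Sum>J\<in>words N ?n. Q ?n (I' @ [b]) J * \<zeta> (J @ [b])) -
      of_real (c ?n) * (\<Sum>b<N. \<Sum>J\<in>words N ?n. \<Sum>K\<in>words N m. Q ?n (I' @ [b]) (i # K) * (Q ?n (a # K) J * \<zeta> (J @ [b])))"
    by (simp only: sum_subtractf sum_distrib_left)
  also have "(\<Sum>b<N. \<Sum>J\<in>words N ?n. Q ?n (I' @ [b]) J * \<zeta> (J @ [b])) = 0"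
    using H_cap_last[OF Suc.prems(1), of I'] length_words[OF I(3)] by (simp add: fix_snoc)
  also have "(\<Sum>b<N. \<Sum>J\<in>words N ?n. \<Sum>K\<in>words N m. Q ?n (I' @ [b]) (i # K) * (Q ?n (a # K) J * \<zeta> (J @ [b])))
     = (\<Sum>b<N. \<Sum>K\<in>words N m. \<Sum>J\<in>words N ?n. Q ?n (I' @ [b]) (i # K) * (Q ?n (a # K) J * \<zeta> (J @ [b])))"
    by (intro sum.cong refl sum.swap)
  also have "\<dots> = (\<Sum>b<N. \<Sum>K\<in>words N m. Q ?n (I' @ [b]) (i # K) * \<zeta> (a # K @ [b]))"
    by (simp only: sum_distrib_left[symmetric] fix_snoc append_Cons)
  also have "\<dots> = (\<Sum>K\<in>words N m. \<Sum>b<N. Q ?n (I' @ [b]) (i # K) * \<zeta> (a # K @ [b]))"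
    by (rule sum.swap)
  also have "\<dots> = of_real ((-1) ^ m / d m) * \<zeta> (a # i # I')"
    using Suc.IH[OF H_Cons[OF Suc.prems(1)] I(2) I(3), of a] .
  finally show ?case
    using d_nz[of m] by (simp add: I c_Suc_d)
qed

text \<open>
The vector \<open>e\<^sub>a \<otimes> f\<close>.
\<close>

definition ltens :: "nat \<Rightarrow> tvec \<Rightarrow> tvec" where
  "ltens a f = (\<lambda>I. case I of [] \<Rightarrow> 0 | x # I' \<Rightarrow> if x = a then f I' else 0)"

text \<open>
The vector \<open>f \<otimes> e\<^sub>a\<close>.
\<close>

definition rtens :: "tvec \<Rightarrow> nat \<Rightarrow> tvec" where
  "rtens f a = (\<lambda>I. if I \<noteq> [] \<and> last I = a then f (butlast I) else 0)"

lemma ltens_Cons [simp]: "ltens a f (x # I) = (if x = a then f I else 0)"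
  by (simp add: ltens_def)

lemma rtens_snoc [simp]: "rtens f a (I @ [x]) = (if x = a then f I else 0)"
  by (simp add: rtens_def)

lemma sum_ltens: "a < N \<Longrightarrow> (\<Sum>I\<in>words N (Suc n). ltens a f I * F I) = (\<Sum>I\<in>words N n. f I * F (a # I))"
  "a < N \<Longrightarrow> (\<Sum>I\<in>words N (Suc n). F I * ltens a f I) = (\<Sum>I\<in>words N n. F (a # I) * f I)"
proof -
  have "(\<Sum>I\<in>words N n. ltens a f (b # I) * F (b # I)) = (if b = a then \<Sum>I\<in>words N n. f I * F (a # I) else 0)"
    "(\<Sum>I\<in>words N n. F (b # I) * ltens a f (b # I)) = (if b = a then \<Sum>I\<in>words N n. F (a # I) * f I else 0)" for b
    by simp_all
  then show "a < N \<Longrightarrow> (\<Sum>I\<in>words N (Suc n). ltens a f I * F I) = (\<Sum>I\<in>words N n. f I * F (a # I))"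
    "a < N \<Longrightarrow> (\<Sum>I\<in>words N (Suc n). F I * ltens a f I) = (\<Sum>I\<in>words N n. F (a # I) * f I)"
    unfolding sum_words_Suc by simp_all
qed

lemma sum_rtens: "a < N \<Longrightarrow> (\<Sum>I\<in>words N (Suc n). rtens f a I * F I) = (\<Sum>I\<in>words N n. f I * F (I @ [a]))"
  "a < N \<Longrightarrow> (\<Sum>I\<in>words N (Suc n). F I * rtens f a I) = (\<Sum>I\<in>words N n. F (I @ [a]) * f I)"
  unfolding sum_words_snoc
  by (simp_all add: if_distrib[where f="\<lambda>x. x * _"] if_distrib[where f="\<lambda>x. _ * x"] cong: if_cong)

definition Qproj :: "nat \<Rightarrow> tvec \<Rightarrow> tvec" where
  "Qproj n f = (\<lambda>I. \<Sum>J\<in>words N n. Q n I J * f J)"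

lemma Qproj_H: "Qproj n f \<in> H n"
  unfolding Qproj_def by (rule Q_apply_H)

lemma Qproj_fix: "f \<in> H n \<Longrightarrow> Qproj n f = f"
  unfolding Qproj_def by (rule ext) (rule Q_fix)

text \<open>
Slices of \<open>P\<^sub>n\<^sub>+\<^sub>1 (e\<^sub>a \<otimes> f)\<close>.  A slice at the side of the new leg is read off from the recursion on that side; a
slice at the opposite side (\<open>Qproj_ltens_snoc\<close>) uses the recursion of the opposite side and then \<open>Q_bend\<close>, which
is why the small number \<open>e\<close> appears there.
\<close>

lemma Qproj_ltens_Cons:
  assumes "f \<in> H (Suc m)" "a < N" "x < N"
  shows "(\<lambda>I. Qproj (Suc (Suc m)) (ltens a f) (x # I)) =
    Qproj (Suc m) (\<lambda>I. (if x = a then f I else 0) - of_real (c (Suc m)) * ltens x (\<lambda>I. f (a # I)) I)"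
proof
  fix I
  let ?n = "Suc m"
  have "Qproj (Suc ?n) (ltens a f) (x # I) = (\<Sum>J\<in>words N ?n. Q (Suc ?n) (x # I) (a # J) * f J)"
    using assms by (simp only: Qproj_def sum_ltens)
  also have "\<dots> = (\<Sum>J\<in>words N ?n. Q ?n I J * (if x = a then f J else 0)) -
     of_real (c ?n) * (\<Sum>J\<in>words N ?n. \<Sum>K\<in>words N m. Q ?n I (x # K) * (Q ?n (a # K) J * f J))"
    unfolding sum_distrib_left sum_subtractf[symmetric]
    by (intro sum.cong refl) (use assms in \<open>simp add: algebra_simps sum_distrib_left del: Q.simps(2) add: Q.simps(2)[of ?n]\<close>)
  also have "(\<Sum>J\<in>words N ?n. \<Sum>K\<in>words N m. Q ?n I (x # K) * (Q ?n (a # K) J * f J))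
    = (\<Sum>K\<in>words N m. Q ?n I (x # K) * f (a # K))"
    by (subst sum.swap) (simp only: sum_distrib_left[symmetric] Q_fix[OF assms(1)])
  also have "\<dots> = (\<Sum>J\<in>words N ?n. Q ?n I J * ltens x (\<lambda>I. f (a # I)) J)"
    using assms by (simp only: sum_ltens)
  finally show "Qproj (Suc ?n) (ltens a f) (x # I) = Qproj ?n (\<lambda>I. (if x = a then f I else 0) - of_real (c ?n) * ltens x (\<lambda>I. f (a # I)) I) I"
    by (simp only: Qproj_def right_diff_distrib sum_subtractf sum_distrib_left mult.left_commute)
qed

lemma Qproj_rtens_snoc:
  assumes "f \<in> H (Suc m)" "a < N" "x < N"
  shows "(\<lambda>I. Qproj (Suc (Suc m)) (rtens f a) (I @ [x])) =
    Qproj (Suc m) (\<lambda>I. (if x = a then f I else 0) - of_real (c (Suc m)) * rtens (\<lambda>I. f (I @ [a])) x I)"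
proof
  fix I
  let ?n = "Suc m"
  have "Qproj (Suc ?n) (rtens f a) (I @ [x]) = (\<Sum>J\<in>words N ?n. Q (Suc ?n) (I @ [x]) (J @ [a]) * f J)"
    using assms by (simp only: Qproj_def sum_rtens)
  also have "\<dots> = (\<Sum>J\<in>words N ?n. Q ?n I J * (if x = a then f J else 0)) -
     of_real (c ?n) * (\<Sum>J\<in>words N ?n. \<Sum>K\<in>words N m. Q ?n I (K @ [x]) * (Q ?n (K @ [a]) J * f J))"
    unfolding sum_distrib_left sum_subtractf[symmetric]
    by (intro sum.cong refl) (simp add: Q_snoc[OF assms(3,2)] algebra_simps sum_distrib_left del: Q.simps(2))
  also have "(\<Sum>J\<in>words N ?n. \<Sum>K\<in>words N m. Q ?n I (K @ [x]) * (Q ?n (K @ [a]) J * f J))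
    = (\<Sum>K\<in>words N m. Q ?n I (K @ [x]) * f (K @ [a]))"
    by (subst sum.swap) (simp only: sum_distrib_left[symmetric] Q_fix[OF assms(1)])
  also have "\<dots> = (\<Sum>J\<in>words N ?n. Q ?n I J * rtens (\<lambda>I. f (I @ [a])) x J)"
    using assms by (simp only: sum_rtens)
  finally show "Qproj (Suc ?n) (rtens f a) (I @ [x]) = Qproj ?n (\<lambda>I. (if x = a then f I else 0) - of_real (c ?n) * rtens (\<lambda>I. f (I @ [a])) x I) I"
    by (simp only: Qproj_def right_diff_distrib sum_subtractf sum_distrib_left mult.left_commute)
qed

lemma Qproj_ltens_snoc:
  assumes "f \<in> H (Suc m)" "a < N" "x < N"
  shows "(\<lambda>I. Qproj (Suc (Suc m)) (ltens a f) (I @ [x])) =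
    Qproj (Suc m) (\<lambda>I. ltens a (\<lambda>I. f (I @ [x])) I - e (Suc m) * rtens (\<lambda>I. f (a # I)) x I)"
proof
  fix I
  let ?n = "Suc m"
  have "Qproj (Suc ?n) (ltens a f) (I @ [x]) = (\<Sum>J\<in>words N ?n. Q (Suc ?n) (I @ [x]) (a # J) * f J)"
    using assms by (simp only: Qproj_def sum_ltens)
  also have "\<dots> = (\<Sum>J\<in>words N m. \<Sum>b<N. Q (Suc ?n) (I @ [x]) ((a # J) @ [b]) * f (J @ [b]))"
    by (simp only: sum_words_snoc append_Cons)
  also have "\<dots> = (\<Sum>J\<in>words N m. \<Sum>b<N. (if x = b then Q ?n I (a # J) else 0) * f (J @ [b])) -
     of_real (c ?n) * (\<Sum>J\<in>words N m. \<Sum>b<N. \<Sum>K\<in>words N m. Q ?n I (K @ [x]) * (Q ?n (K @ [b]) (a # J) * f (J @ [b])))"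
    unfolding sum_distrib_left sum_subtractf[symmetric]
    by (intro sum.cong refl, subst Q_snoc) (use assms in \<open>simp_all add: algebra_simps sum_distrib_left del: Q.simps(2)\<close>)
  also have "(\<Sum>J\<in>words N m. \<Sum>b<N. (if x = b then Q ?n I (a # J) else 0) * f (J @ [b])) = (\<Sum>J\<in>words N m. Q ?n I (a # J) * f (J @ [x]))"
    using assms(3) by (simp add: if_distrib[where f="\<lambda>x. x * _"] del: Q.simps(2) cong: if_cong)
  also have "\<dots> = (\<Sum>J\<in>words N ?n. Q ?n I J * ltens a (\<lambda>I. f (I @ [x])) J)"
    using assms by (simp only: sum_ltens)
  also have "(\<Sum>J\<in>words N m. \<Sum>b<N. \<Sum>K\<in>words N m. Q ?n I (K @ [x]) * (Q ?n (K @ [b]) (a # J) * f (J @ [b])))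
     = (\<Sum>K\<in>words N m. Q ?n I (K @ [x]) * (\<Sum>J\<in>words N m. \<Sum>b<N. Q ?n (K @ [b]) (a # J) * f (J @ [b])))"
    unfolding sum_distrib_left
    by (subst sum.swap[of _ "words N m" "words N m"], rule sum.cong[OF refl], rule sum.swap)
  also have "\<dots> = (\<Sum>K\<in>words N m. of_real ((-1) ^ m / d m) * (Q ?n I (K @ [x]) * f (a # K)))"
    by (intro sum.cong refl, subst Q_bend) (use assms in auto)
  also have "\<dots> = of_real ((-1) ^ m / d m) * (\<Sum>J\<in>words N ?n. Q ?n I J * rtens (\<lambda>I. f (a # I)) x J)"
    using assms by (simp only: sum_rtens sum_distrib_left)
  also have "of_real (c ?n) * \<dots> = e ?n * (\<Sum>J\<in>words N ?n. Q ?n I J * rtens (\<lambda>I. f (a # I)) x J)"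
    by (simp add: e_def c_Suc_d)
  finally show "Qproj (Suc ?n) (ltens a f) (I @ [x]) = Qproj ?n (\<lambda>I. ltens a (\<lambda>I. f (I @ [x])) I - e ?n * rtens (\<lambda>I. f (a # I)) x I) I"
    by (simp only: Qproj_def right_diff_distrib sum_subtractf sum_distrib_left mult.left_commute)
qed

section \<open>Operators on \<open>H\<^sub>n\<close> and their bilinear forms\<close>

text \<open>
The matrices of the operators \<open>X\<close> on the tensor power with \<open>P\<^sub>n X P\<^sub>n = X\<close>: all rows and columns lie in \<open>H\<^sub>n\<close>,
which is its own complex conjugate.
\<close>

definition MH :: "nat \<Rightarrow> tmat set" where
  "MH n = {Y. (\<forall>J. (\<lambda>I. Y I J) \<in> H n) \<and> (\<forall>I. (\<lambda>J. Y I J) \<in> H n)}"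

text \<open>
The bilinear rather than sesquilinear form, because the identities proved with it then contain no conjugates.
\<close>

definition bform :: "nat \<Rightarrow> tmat \<Rightarrow> tvec \<Rightarrow> tvec \<Rightarrow> complex" where
  "bform n Z u v = (\<Sum>I\<in>words N n. \<Sum>J\<in>words N n. u I * Z I J * v J)"

definition compr :: "nat \<Rightarrow> tmat \<Rightarrow> tmat" where
  "compr n Z = (\<lambda>I J. bform n Z (\<lambda>K. Q n K I) (\<lambda>L. Q n L J))"

lemma MH_fst: "Y \<in> MH n \<Longrightarrow> (\<lambda>I. Y I J) \<in> H n" and MH_snd: "Y \<in> MH n \<Longrightarrow> (\<lambda>J. Y I J) \<in> H n"
  by (simp_all add: MH_def)

lemma bform_swap: "bform n Z u v = (\<Sum>J\<in>words N n. \<Sum>I\<in>words N n. u I * Z I J * v J)"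
  unfolding bform_def by (rule sum.swap)

lemma bform_cong: "(\<And>I. I \<in> words N n \<Longrightarrow> u I = u' I) \<Longrightarrow> (\<And>I. I \<in> words N n \<Longrightarrow> v I = v' I) \<Longrightarrow> bform n Z u v = bform n Z u' v'"
  by (simp add: bform_def)

lemma bform_expand:
  "bform n Z (\<lambda>I. p I - s * r I) (\<lambda>I. p' I - s' * r' I) =
     bform n Z p p' - s' * bform n Z p r' - s * bform n Z r p' + s * s' * bform n Z r r'"
  by (simp add: bform_def sum_distrib_left sum_subtractf[symmetric] sum.distrib[symmetric] algebra_simps)

lemma bform_Q: "Y \<in> MH n \<Longrightarrow> bform n Y (\<lambda>K. Q n K I) (\<lambda>L. Q n L J) = Y I J"
proof -
  assume Y: "Y \<in> MH n"
  have "bform n Y (\<lambda>K. Q n K I) (\<lambda>L. Q n L J) = (\<Sum>K\<in>words N n. Q n K I * (\<Sum>L\<in>words N n. Y K L * Q n L J))"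
    by (simp add: bform_def sum_distrib_left mult.assoc)
  also have "\<dots> = (\<Sum>K\<in>words N n. Q n I K * Y K J)"
    by (simp only: Q_fix_right[OF MH_snd[OF Y]] Q_sym[of n I])
  also have "\<dots> = Y I J" using Q_fix[OF MH_fst[OF Y]] .
  finally show ?thesis .
qed

lemma compr_MH: "compr n Z \<in> MH n"
  unfolding MH_def compr_def
proof (intro CollectI conjI allI)
  fix J
  have "(\<lambda>I. \<Sum>K\<in>words N n. (\<Sum>L\<in>words N n. Z K L * Q n L J) * Q n K I) \<in> H n"
    by (rule H_sum) (rule Q_in_H')
  then show "(\<lambda>I. bform n Z (\<lambda>K. Q n K I) (\<lambda>L. Q n L J)) \<in> H n"
    by (simp add: bform_def sum_distrib_left sum_distrib_right mult_ac)
next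
  fix I
  have "(\<lambda>J. \<Sum>L\<in>words N n. (\<Sum>K\<in>words N n. Z K L * Q n K I) * Q n L J) \<in> H n"
    by (rule H_sum) (rule Q_in_H')
  then show "(\<lambda>J. bform n Z (\<lambda>K. Q n K I) (\<lambda>L. Q n L J)) \<in> H n"
    by (simp add: bform_swap sum_distrib_left sum_distrib_right mult_ac)
qed

lemma bform_compr: "bform n (compr n Z) u v = bform n Z (Qproj n u) (Qproj n v)"
proof -
  have "bform n (compr n Z) u v = (\<Sum>I\<in>words N n. \<Sum>J\<in>words N n. \<Sum>K\<in>words N n. \<Sum>L\<in>words N n. (Q n K I * u I) * Z K L * (Q n L J * v J))"
    by (simp add: bform_def compr_def sum_distrib_left sum_distrib_right mult_ac)
  also have "\<dots> = (\<Sum>I\<in>words N n. \<Sum>K\<in>words N n. \<Sum>J\<in>words N n. \<Sum>L\<in>words N n. (Q n K I * u I) * Z K L * (Q n L J * v J))"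
    by (rule sum.cong[OF refl], rule sum.swap)
  also have "\<dots> = (\<Sum>I\<in>words N n. \<Sum>K\<in>words N n. \<Sum>L\<in>words N n. \<Sum>J\<in>words N n. (Q n K I * u I) * Z K L * (Q n L J * v J))"
    by (rule sum.cong[OF refl], rule sum.cong[OF refl], rule sum.swap)
  also have "\<dots> = (\<Sum>K\<in>words N n. \<Sum>I\<in>words N n. \<Sum>L\<in>words N n. \<Sum>J\<in>words N n. (Q n K I * u I) * Z K L * (Q n L J * v J))"
    by (rule sum.swap)
  also have "\<dots> = (\<Sum>K\<in>words N n. \<Sum>L\<in>words N n. \<Sum>I\<in>words N n. \<Sum>J\<in>words N n. (Q n K I * u I) * Z K L * (Q n L J * v J))"
    by (rule sum.cong[OF refl], rule sum.swap)
  also have "\<dots> = bform n Z (Qproj n u) (Qproj n v)"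
    unfolding bform_def Qproj_def
    by (rule sum.cong[OF refl], rule sum.cong[OF refl], simp only: sum_distrib_right, simp only: sum_distrib_left)
  finally show ?thesis .
qed

lemma bform_compr_H: "u \<in> H n \<Longrightarrow> v \<in> H n \<Longrightarrow> bform n (compr n Z) u v = bform n Z u v"
  by (simp add: bform_compr Qproj_fix)

lemma compr_fix: "Y \<in> MH n \<Longrightarrow> compr n Y = Y"
  by (rule ext, rule ext) (simp add: compr_def bform_Q)

lemma bform_Qproj: "Y \<in> MH n \<Longrightarrow> bform n Y (Qproj n u) (Qproj n v) = bform n Y u v"
  by (metis bform_compr compr_fix)

text \<open>
The identities between compressed operators are checked on bilinear forms: on vectors of \<open>H\<^sub>n\<close> the outer
compressions disappear (\<open>bform_compr_H\<close>).
\<close>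

lemma MH_eqI:
  assumes "Y \<in> MH n" "Z \<in> MH n" "\<And>u v. u \<in> H n \<Longrightarrow> v \<in> H n \<Longrightarrow> bform n Y u v = bform n Z u v"
  shows "Y = Z"
proof (rule ext, rule ext)
  fix I J
  show "Y I J = Z I J"
    using assms(3)[OF Q_in_H[of n I] Q_in_H[of n J]] by (simp add: bform_Q assms)
qed

end

context temperley_lieb begin

section \<open>Creation operators, partial traces and rotations\<close>

text \<open>
The operator \<open>1 \<otimes> Y\<close>; correspondingly \<open>rid Y\<close> is \<open>Y \<otimes> 1\<close>.
\<close>

definition lid :: "tmat \<Rightarrow> tmat" where
  "lid Y = (\<lambda>I J. if I \<noteq> [] \<and> J \<noteq> [] \<and> hd I = hd J \<and> hd I < N then Y (tl I) (tl J) else 0)"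

definition rid :: "tmat \<Rightarrow> tmat" where
  "rid Y = (\<lambda>I J. if I \<noteq> [] \<and> J \<noteq> [] \<and> last I = last J \<and> last I < N then Y (butlast I) (butlast J) else 0)"

text \<open>
The operators \<open>\<lambda>\<close> and \<open>\<kappa>\<close> (\<open>kap\<close>), which add a leg on the left and on the right; here \<open>n\<close> is the number of legs of
\<open>Y\<close>.
\<close>

definition lam :: "nat \<Rightarrow> tmat \<Rightarrow> tmat" where
  "lam n Y = compr (Suc n) (lid Y)"

definition kap :: "nat \<Rightarrow> tmat \<Rightarrow> tmat" where
  "kap n Y = compr (Suc n) (rid Y)"

abbreviation "tau \<equiv> ptrace_first N"
abbreviation "tau' \<equiv> ptrace_last N"

text \<open>
The first output leg of \<open>rot0 Y\<close> is the first input leg of \<open>Y\<close>, and its last input leg is the last output leg of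
\<open>Y\<close>.  This is the rotation before compression, and \<open>rot1\<close> is its inverse.
\<close>

definition rot0 :: "tmat \<Rightarrow> tmat" where
  "rot0 Y = (\<lambda>I J. if I \<noteq> [] \<and> J \<noteq> [] then Y (tl I @ [last J]) (hd I # butlast J) else 0)"

definition rot1 :: "tmat \<Rightarrow> tmat" where
  "rot1 Y = (\<lambda>I J. if I \<noteq> [] \<and> J \<noteq> [] then Y (hd J # butlast I) (tl J @ [last I]) else 0)"

definition R0 :: "nat \<Rightarrow> tmat \<Rightarrow> tmat" where "R0 n Y = compr n (rot0 Y)"
definition R1 :: "nat \<Rightarrow> tmat \<Rightarrow> tmat" where "R1 n Y = compr n (rot1 Y)"

abbreviation (input) lc :: "complex \<Rightarrow> tmat \<Rightarrow> complex \<Rightarrow> tmat \<Rightarrow> tmat" where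
  "lc s Y t Z \<equiv> (\<lambda>I J. s * Y I J + t * Z I J)"

lemma lam_MH: "lam n Y \<in> MH (Suc n)" and kap_MH: "kap n Y \<in> MH (Suc n)"
  and R0_MH: "R0 n Y \<in> MH n" and R1_MH: "R1 n Y \<in> MH n"
  by (simp_all add: lam_def kap_def R0_def R1_def compr_MH)

lemma MH_lc: "Y \<in> MH n \<Longrightarrow> Z \<in> MH n \<Longrightarrow> lc s Y t Z \<in> MH n"
  by (simp add: MH_def H_add H_scale)

lemma bform_lc: "bform n (lc s Y t Z) u v = s * bform n Y u v + t * bform n Z u v"
  by (simp add: bform_def sum_distrib_left sum.distrib[symmetric] algebra_simps)

lemma compr_lc: "compr n (lc s Y t Z) = lc s (compr n Y) t (compr n Z)"
  by (simp add: compr_def bform_lc)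

lemma lid_lc: "lid (lc s Y t Z) = lc s (lid Y) t (lid Z)"
  and rid_lc: "rid (lc s Y t Z) = lc s (rid Y) t (rid Z)"
  and tau_lc: "tau (lc s Y t Z) = lc s (tau Y) t (tau Z)"
  by (auto simp: lid_def rid_def fun_eq_iff ptrace_first_def sum.distrib sum_distrib_left)

lemma lam_lc: "lam n (lc s Y t Z) = lc s (lam n Y) t (lam n Z)"
  and kap_lc: "kap n (lc s Y t Z) = lc s (kap n Y) t (kap n Z)"
  unfolding lam_def kap_def lid_lc rid_lc compr_lc by simp_all

lemma sum_if_const: "(\<Sum>x\<in>S. if P then f x else 0) = (if P then sum f S else 0)"
  by simp

lemma bform_if: "bform n Y (\<lambda>I. if P then u I else 0) v = (if P then bform n Y u v else 0)"
  "bform n Y u (\<lambda>I. if P then v I else 0) = (if P then bform n Y u v else 0)"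
  by (simp_all add: bform_def)

lemma bform_sum_right: "bform n Y u (\<lambda>I. \<Sum>x\<in>S. f x I) = (\<Sum>x\<in>S. bform n Y u (f x))"
proof (induction S rule: infinite_finite_induct)
  case (insert x S)
  have "bform n Y u (\<lambda>I. f x I + g I) = bform n Y u (f x) + bform n Y u g" for g
    by (simp add: bform_def sum.distrib algebra_simps)
  then show ?case using insert by simp
qed (simp_all add: bform_def)

text \<open>
Transposition exchanges the two rotations and commutes with adding legs and with partial traces; it derives \<open>R1_kap\<close> from
\<open>R0_kap\<close>.
\<close>

definition transp :: "tmat \<Rightarrow> tmat" where "transp Y = (\<lambda>I J. Y J I)"

lemma transp_apply: "transp Y I J = Y J I"
  by (simp add: transp_def)

lemma transp_transp [simp]: "transp (transp Y) = Y"
  by (simp add: transp_def)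

lemma bform_transp: "bform n (transp Y) u v = bform n Y v u"
  unfolding transp_def by (subst bform_swap) (simp add: bform_def mult_ac)

lemma bform_sum_left: "bform n Y (\<lambda>I. \<Sum>x\<in>S. f x I) u = (\<Sum>x\<in>S. bform n Y (f x) u)"
  using bform_sum_right[of n "transp Y" u f S] by (simp add: bform_transp)

lemma bform_lid: "bform (Suc n) (lid Y) u v = (\<Sum>a<N. bform n Y (\<lambda>I. u (a # I)) (\<lambda>J. v (a # J)))"
proof -
  have "(\<Sum>J\<in>words N (Suc n). u (a # I) * lid Y (a # I) J * v J) = (\<Sum>J\<in>words N n. u (a # I) * Y I J * v (a # J))"
    if "a < N" for a I
  proof -
    have "(\<Sum>J\<in>words N n. u (a # I) * lid Y (a # I) (b # J) * v (b # J)) = (if b = a then \<Sum>J\<in>words N n. u (a # I) * Y I J * v (a # J) else 0)" for b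
      using that by (simp add: lid_def)
    then show ?thesis using that by (simp add: sum_words_Suc)
  qed
  then show ?thesis unfolding bform_def
    by (subst sum_words_Suc[where f="\<lambda>I. \<Sum>J\<in>words N (Suc n). u I * lid Y I J * v J"]) simp
qed

lemma bform_rid: "bform (Suc n) (rid Y) u v = (\<Sum>a<N. bform n Y (\<lambda>I. u (I @ [a])) (\<lambda>J. v (J @ [a])))"
proof -
  have "(\<Sum>J\<in>words N (Suc n). u (I @ [a]) * rid Y (I @ [a]) J * v J) = (\<Sum>J\<in>words N n. u (I @ [a]) * Y I J * v (J @ [a]))"
    if "a < N" for a I
  proof -
    have "(\<Sum>b<N. u (I @ [a]) * rid Y (I @ [a]) (J @ [b]) * v (J @ [b])) = (\<Sum>b<N. if b = a then u (I @ [a]) * Y I J * v (J @ [a]) else 0)" for J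
      using that by (intro sum.cong) (auto simp: rid_def)
    then show ?thesis using that by (simp add: sum_words_snoc)
  qed
  then have "bform (Suc n) (rid Y) u v = (\<Sum>I\<in>words N n. \<Sum>a<N. \<Sum>J\<in>words N n. u (I @ [a]) * Y I J * v (J @ [a]))"
    unfolding bform_def
    by (subst sum_words_snoc[where f="\<lambda>I. \<Sum>J\<in>words N (Suc n). u I * rid Y I J * v J"]) simp
  also have "\<dots> = (\<Sum>a<N. bform n Y (\<lambda>I. u (I @ [a])) (\<lambda>J. v (J @ [a])))"
    unfolding bform_def by (rule sum.swap)
  finally show ?thesis .
qed

lemma bform_ll: "a < N \<Longrightarrow> b < N \<Longrightarrow> bform (Suc n) Y (ltens a f) (ltens b g) = (\<Sum>I\<in>words N n. \<Sum>J\<in>words N n. f I * Y (a # I) (b # J) * g J)"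
  and bform_rl: "a < N \<Longrightarrow> b < N \<Longrightarrow> bform (Suc n) Y (rtens f a) (ltens b g) = (\<Sum>I\<in>words N n. \<Sum>J\<in>words N n. f I * Y (I @ [a]) (b # J) * g J)"
  and bform_rr: "a < N \<Longrightarrow> b < N \<Longrightarrow> bform (Suc n) Y (rtens f a) (rtens g b) = (\<Sum>I\<in>words N n. \<Sum>J\<in>words N n. f I * Y (I @ [a]) (J @ [b]) * g J)"
  unfolding bform_def mult.assoc sum_distrib_left[symmetric]
  by (simp_all only: sum_ltens sum_rtens)

lemma bform_tau: "(\<Sum>a<N. bform (Suc n) Y (ltens a u) (ltens a v)) = bform n (tau Y) u v"
proof -
  have "(\<Sum>a<N. bform (Suc n) Y (ltens a u) (ltens a v)) = (\<Sum>a<N. \<Sum>I\<in>words N n. \<Sum>J\<in>words N n. u I * Y (a # I) (a # J) * v J)"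
    by (simp add: bform_ll)
  also have "\<dots> = bform n (tau Y) u v"
    by (simp add: bform_def ptrace_first_def sum_distrib_left sum_distrib_right sum.swap[of _ "{..<N}"])
  finally show ?thesis .
qed

lemma bform_tau': "(\<Sum>a<N. bform (Suc n) Y (rtens u a) (rtens v a)) = bform n (tau' Y) u v"
proof -
  have "(\<Sum>a<N. bform (Suc n) Y (rtens u a) (rtens v a)) = (\<Sum>a<N. \<Sum>I\<in>words N n. \<Sum>J\<in>words N n. u I * Y (I @ [a]) (J @ [a]) * v J)"
    by (simp add: bform_rr)
  also have "\<dots> = bform n (tau' Y) u v"
    by (simp add: bform_def ptrace_last_def sum_distrib_left sum_distrib_right sum.swap[of _ "{..<N}"])
  finally show ?thesis .
qed

lemma tau_MH: "Y \<in> MH (Suc n) \<Longrightarrow> tau Y \<in> MH n"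
  unfolding MH_def ptrace_first_def
  using H_sum[of "{..<N}" "\<lambda>a I. Y (a # I) (a # _)" n "\<lambda>_. 1"] H_sum[of "{..<N}" "\<lambda>a J. Y (a # _) (a # J)" n "\<lambda>_. 1"]
  by (auto simp: H_Cons[of "\<lambda>I. Y I _"] H_Cons[of "Y _"])

lemma tau'_MH: "Y \<in> MH (Suc n) \<Longrightarrow> tau' Y \<in> MH n"
  unfolding MH_def ptrace_last_def
  using H_sum[of "{..<N}" "\<lambda>a I. Y (I @ [a]) (_ @ [a])" n "\<lambda>_. 1"] H_sum[of "{..<N}" "\<lambda>a J. Y (_ @ [a]) (J @ [a])" n "\<lambda>_. 1"]
  by (auto simp: H_snoc[of "\<lambda>I. Y I _"] H_snoc[of "Y _"])

lemma bform_lam: "bform (Suc n) (lam n Y) u v = (\<Sum>a<N. bform n Y (\<lambda>I. Qproj (Suc n) u (a # I)) (\<lambda>J. Qproj (Suc n) v (a # J)))"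
  by (simp add: lam_def bform_compr bform_lid)

lemma bform_kap: "bform (Suc n) (kap n Y) u v = (\<Sum>a<N. bform n Y (\<lambda>I. Qproj (Suc n) u (I @ [a])) (\<lambda>J. Qproj (Suc n) v (J @ [a])))"
  by (simp add: kap_def bform_compr bform_rid)

lemma bform_lam_H: "u \<in> H (Suc n) \<Longrightarrow> v \<in> H (Suc n) \<Longrightarrow>
    bform (Suc n) (lam n Y) u v = (\<Sum>a<N. bform n Y (\<lambda>I. u (a # I)) (\<lambda>J. v (a # J)))"
  by (simp add: bform_lam Qproj_fix)

lemma bform_kap_H: "u \<in> H (Suc n) \<Longrightarrow> v \<in> H (Suc n) \<Longrightarrow>
    bform (Suc n) (kap n Y) u v = (\<Sum>a<N. bform n Y (\<lambda>I. u (I @ [a])) (\<lambda>J. v (J @ [a])))"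
  by (simp add: bform_kap Qproj_fix)

lemma bform_rot0: "bform (Suc n) (rot0 Y) u v =
  (\<Sum>a<N. \<Sum>x<N. bform (Suc n) Y (rtens (\<lambda>I. u (a # I)) x) (ltens a (\<lambda>J. v (J @ [x]))))"
proof -
  have "bform (Suc n) (rot0 Y) u v = (\<Sum>a<N. \<Sum>I\<in>words N n. \<Sum>J\<in>words N n. \<Sum>x<N. u (a # I) * Y (I @ [x]) (a # J) * v (J @ [x]))"
    unfolding bform_def
    by (subst sum_words_Suc[where f="\<lambda>I. \<Sum>J\<in>words N (Suc n). u I * rot0 Y I J * v J"])
      (simp add: rot0_def sum_words_snoc)
  also have "\<dots> = (\<Sum>a<N. \<Sum>x<N. \<Sum>I\<in>words N n. \<Sum>J\<in>words N n. u (a # I) * Y (I @ [x]) (a # J) * v (J @ [x]))"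
    by (simp only: sum.swap[of _ "{..<N}" "words N n"])
  finally show ?thesis by (simp add: bform_rl)
qed

lemma bform_rot1: "bform (Suc n) (rot1 Y) u v =
  (\<Sum>a<N. \<Sum>x<N. bform (Suc n) Y (ltens a (\<lambda>J. u (J @ [x]))) (rtens (\<lambda>I. v (a # I)) x))"
proof -
  have "rot1 Y = transp (rot0 (transp Y))"
    by (auto simp: rot0_def rot1_def fun_eq_iff transp_def)
  then show ?thesis by (simp add: bform_rot0 bform_transp)
qed

lemma sum_ltens_slices: "(\<Sum>a<N. bform (Suc n) Y u (ltens a (\<lambda>I. v (a # I)))) = bform (Suc n) Y u v"
    "(\<Sum>a<N. bform (Suc n) Y (ltens a (\<lambda>I. v (a # I))) u) = bform (Suc n) Y v u"
proof -
  have *: "(\<Sum>a<N. ltens a (\<lambda>I. v (a # I)) I) = v I" if "I \<in> words N (Suc n)" for I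
    using that by (cases I) auto
  show "(\<Sum>a<N. bform (Suc n) Y u (ltens a (\<lambda>I. v (a # I)))) = bform (Suc n) Y u v"
    unfolding bform_sum_right[symmetric] by (rule bform_cong) (auto simp: *)
  show "(\<Sum>a<N. bform (Suc n) Y (ltens a (\<lambda>I. v (a # I))) u) = bform (Suc n) Y v u"
    unfolding bform_sum_left[symmetric] by (rule bform_cong) (auto simp: *)
qed

lemma sum_rtens_slices: "(\<Sum>a<N. bform (Suc n) Y u (rtens (\<lambda>I. v (I @ [a])) a)) = bform (Suc n) Y u v"
    "(\<Sum>a<N. bform (Suc n) Y (rtens (\<lambda>I. v (I @ [a])) a) u) = bform (Suc n) Y v u"
proof -
  have *: "(\<Sum>a<N. rtens (\<lambda>I. v (I @ [a])) a I) = v I" if "I \<in> words N (Suc n)" for I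
    using that by (cases I rule: rev_cases) auto
  show "(\<Sum>a<N. bform (Suc n) Y u (rtens (\<lambda>I. v (I @ [a])) a)) = bform (Suc n) Y u v"
    unfolding bform_sum_right[symmetric] by (rule bform_cong) (auto simp: *)
  show "(\<Sum>a<N. bform (Suc n) Y (rtens (\<lambda>I. v (I @ [a])) a) u) = bform (Suc n) Y v u"
    unfolding bform_sum_left[symmetric] by (rule bform_cong) (auto simp: *)
qed

text \<open>
Tracing the left leg of \<open>\<lambda> Y\<close> closes the leg just added.  The two Wenzl corrections produce the loss
\<open>2 c\<^sub>n\<close> of the loop value \<open>N\<close>, and their product re-creates a left leg on the partial trace of \<open>Y\<close>.
\<close>

lemma tau_lam:
  assumes Y: "Y \<in> MH (Suc m)"
  shows "tau (lam (Suc m) Y) = lc (of_real (real N - 2 * c (Suc m))) Y (of_real ((c (Suc m))\<^sup>2)) (lam m (tau Y))"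
proof (rule MH_eqI[of _ "Suc m"])
  let ?n = "Suc m" and ?c = "complex_of_real (c (Suc m))"
  show "tau (lam (Suc m) Y) \<in> MH ?n" by (intro tau_MH lam_MH)
  show "lc (of_real (real N - 2 * c (Suc m))) Y (of_real ((c (Suc m))\<^sup>2)) (lam m (tau Y)) \<in> MH ?n"
    by (intro MH_lc Y lam_MH)
  fix u v assume u: "u \<in> H ?n" and v: "v \<in> H ?n"
  have "bform ?n (tau (lam ?n Y)) u v = (\<Sum>a<N. \<Sum>x<N. bform ?n Y
      (\<lambda>I. Qproj (Suc ?n) (ltens a u) (x # I)) (\<lambda>I. Qproj (Suc ?n) (ltens a v) (x # I)))"
    by (simp add: bform_tau[symmetric] bform_lam)
  also have "\<dots> = (\<Sum>a<N. \<Sum>x<N. bform ?n Y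
      (\<lambda>I. (if x = a then u I else 0) - ?c * ltens x (\<lambda>I. u (a # I)) I)
      (\<lambda>I. (if x = a then v I else 0) - ?c * ltens x (\<lambda>I. v (a # I)) I))"
    by (intro sum.cong refl) (simp add: Qproj_ltens_Cons u v bform_Qproj Y)
  also have "\<dots> = (\<Sum>a<N. \<Sum>x<N. if x = a then bform ?n Y u v else 0)
      - ?c * (\<Sum>a<N. \<Sum>x<N. if x = a then bform ?n Y u (ltens x (\<lambda>I. v (a # I))) else 0)
      - ?c * (\<Sum>a<N. \<Sum>x<N. if x = a then bform ?n Y (ltens x (\<lambda>I. u (a # I))) v else 0)
      + ?c * ?c * (\<Sum>a<N. \<Sum>x<N. bform ?n Y (ltens x (\<lambda>I. u (a # I))) (ltens x (\<lambda>I. v (a # I))))"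
    unfolding bform_expand sum_subtractf sum.distrib sum_distrib_left
    by (simp add: bform_if cong: if_cong)
  also have "\<dots> = of_real (real N - 2 * c (Suc m)) * bform ?n Y u v + of_real ((c (Suc m))\<^sup>2) * bform ?n (lam m (tau Y)) u v"
    by (simp add: sum_ltens_slices bform_tau bform_lam_H u v power2_eq_square algebra_simps)
  finally show "bform ?n (tau (lam ?n Y)) u v = bform ?n (lc (of_real (real N - 2 * c (Suc m))) Y (of_real ((c (Suc m))\<^sup>2)) (lam m (tau Y))) u v"
    by (simp only: bform_lc)
qed

lemma tau'_kap:
  assumes Y: "Y \<in> MH (Suc m)"
  shows "tau' (kap (Suc m) Y) = lc (of_real (real N - 2 * c (Suc m))) Y (of_real ((c (Suc m))\<^sup>2)) (kap m (tau' Y))"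
proof (rule MH_eqI[of _ "Suc m"])
  let ?n = "Suc m" and ?c = "complex_of_real (c (Suc m))"
  show "tau' (kap (Suc m) Y) \<in> MH ?n" by (intro tau'_MH kap_MH)
  show "lc (of_real (real N - 2 * c (Suc m))) Y (of_real ((c (Suc m))\<^sup>2)) (kap m (tau' Y)) \<in> MH ?n"
    by (intro MH_lc Y kap_MH)
  fix u v assume u: "u \<in> H ?n" and v: "v \<in> H ?n"
  have "bform ?n (tau' (kap ?n Y)) u v = (\<Sum>a<N. \<Sum>x<N. bform ?n Y
      (\<lambda>I. Qproj (Suc ?n) (rtens u a) (I @ [x])) (\<lambda>I. Qproj (Suc ?n) (rtens v a) (I @ [x])))"
    by (simp add: bform_tau'[symmetric] bform_kap)
  also have "\<dots> = (\<Sum>a<N. \<Sum>x<N. bform ?n Y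
      (\<lambda>I. (if x = a then u I else 0) - ?c * rtens (\<lambda>I. u (I @ [a])) x I)
      (\<lambda>I. (if x = a then v I else 0) - ?c * rtens (\<lambda>I. v (I @ [a])) x I))"
    by (intro sum.cong refl) (simp add: Qproj_rtens_snoc u v bform_Qproj Y)
  also have "\<dots> = (\<Sum>a<N. \<Sum>x<N. if x = a then bform ?n Y u v else 0)
      - ?c * (\<Sum>a<N. \<Sum>x<N. if x = a then bform ?n Y u (rtens (\<lambda>I. v (I @ [a])) x) else 0)
      - ?c * (\<Sum>a<N. \<Sum>x<N. if x = a then bform ?n Y (rtens (\<lambda>I. u (I @ [a])) x) v else 0)
      + ?c * ?c * (\<Sum>a<N. \<Sum>x<N. bform ?n Y (rtens (\<lambda>I. u (I @ [a])) x) (rtens (\<lambda>I. v (I @ [a])) x))"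
    unfolding bform_expand sum_subtractf sum.distrib sum_distrib_left
    by (simp add: bform_if cong: if_cong)
  also have "\<dots> = of_real (real N - 2 * c (Suc m)) * bform ?n Y u v + of_real ((c (Suc m))\<^sup>2) * bform ?n (kap m (tau' Y)) u v"
    by (simp add: sum_rtens_slices bform_tau' bform_kap_H u v power2_eq_square algebra_simps)
  finally show "bform ?n (tau' (kap ?n Y)) u v = bform ?n (lc (of_real (real N - 2 * c (Suc m))) Y (of_real ((c (Suc m))\<^sup>2)) (kap m (tau' Y))) u v"
    by (simp only: bform_lc)
qed

text \<open>
A leg added on the right, then a trace on the left.  Expanding both compressions at the opposite side gives four
terms: the traces pass each other, or one end of the closed line is bent around, which is a rotation in one of the two
directions, or both are bent.
\<close>

lemma tau_kap:
  assumes Y: "Y \<in> MH (Suc m)"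
  shows "tau (kap (Suc m) Y) = lc 1 (lc 1 (kap m (tau Y)) (- e (Suc m)) (lc 1 (R0 (Suc m) Y) 1 (R1 (Suc m) Y)))
     ((e (Suc m))\<^sup>2) (lam m (tau' Y))"
proof (rule MH_eqI[of _ "Suc m"])
  let ?n = "Suc m" and ?e = "e (Suc m)"
  show "tau (kap (Suc m) Y) \<in> MH ?n" by (intro tau_MH kap_MH)
  show "lc 1 (lc 1 (kap m (tau Y)) (- ?e) (lc 1 (R0 ?n Y) 1 (R1 ?n Y))) (?e\<^sup>2) (lam m (tau' Y)) \<in> MH ?n"
    by (intro MH_lc lam_MH kap_MH R0_MH R1_MH)
  fix u v assume u: "u \<in> H ?n" and v: "v \<in> H ?n"
  have "bform ?n (tau (kap ?n Y)) u v = (\<Sum>a<N. \<Sum>x<N. bform ?n Y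
      (\<lambda>I. Qproj (Suc ?n) (ltens a u) (I @ [x])) (\<lambda>I. Qproj (Suc ?n) (ltens a v) (I @ [x])))"
    by (simp add: bform_tau[symmetric] bform_kap)
  also have "\<dots> = (\<Sum>a<N. \<Sum>x<N. bform ?n Y
      (\<lambda>I. ltens a (\<lambda>I. u (I @ [x])) I - ?e * rtens (\<lambda>I. u (a # I)) x I)
      (\<lambda>I. ltens a (\<lambda>I. v (I @ [x])) I - ?e * rtens (\<lambda>I. v (a # I)) x I))"
    by (intro sum.cong refl) (simp add: Qproj_ltens_snoc u v bform_Qproj Y)
  also have "\<dots> = (\<Sum>a<N. \<Sum>x<N. bform ?n Y (ltens a (\<lambda>I. u (I @ [x]))) (ltens a (\<lambda>I. v (I @ [x]))))
      - ?e * bform ?n (rot1 Y) u v - ?e * bform ?n (rot0 Y) u v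
      + ?e * ?e * (\<Sum>a<N. \<Sum>x<N. bform ?n Y (rtens (\<lambda>I. u (a # I)) x) (rtens (\<lambda>I. v (a # I)) x))"
    unfolding bform_expand sum_subtractf sum.distrib bform_rot0 bform_rot1 sum_distrib_left ..
  also have "(\<Sum>a<N. \<Sum>x<N. bform ?n Y (ltens a (\<lambda>I. u (I @ [x]))) (ltens a (\<lambda>I. v (I @ [x])))) = bform ?n (kap m (tau Y)) u v"
    by (subst sum.swap) (simp add: bform_tau bform_kap_H u v)
  also have "(\<Sum>a<N. \<Sum>x<N. bform ?n Y (rtens (\<lambda>I. u (a # I)) x) (rtens (\<lambda>I. v (a # I)) x)) = bform ?n (lam m (tau' Y)) u v"
    by (simp add: bform_tau' bform_lam_H u v)
  also have "bform ?n (rot1 Y) u v = bform ?n (R1 ?n Y) u v" by (simp add: R1_def bform_compr_H u v)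
  also have "bform ?n (rot0 Y) u v = bform ?n (R0 ?n Y) u v" by (simp add: R0_def bform_compr_H u v)
  finally show "bform ?n (tau (kap ?n Y)) u v = bform ?n (lc 1 (lc 1 (kap m (tau Y)) (- ?e) (lc 1 (R0 ?n Y) 1 (R1 ?n Y))) (?e\<^sup>2) (lam m (tau' Y))) u v"
    unfolding bform_lc by (simp add: power2_eq_square algebra_simps)
qed

text \<open>
How the rotation passes a leg added on the right.  Of the four terms in the expansion, the one without any
correction contracts the last two legs of a vector of \<open>H\<close> and vanishes, so that every remaining term is small.
\<close>

lemma R0_kap:
  assumes Y: "Y \<in> MH (Suc m)"
  shows "R0 (Suc (Suc m)) (kap (Suc m) Y) = lc (- of_real (c (Suc m))) (kap (Suc m) (R0 (Suc m) Y))
     (- e (Suc m)) (lc 1 (lam (Suc m) Y) (- of_real (c (Suc m))) (lam (Suc m) (kap m (tau' Y))))"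
proof (rule MH_eqI[of _ "Suc (Suc m)"])
  let ?n = "Suc m" and ?e = "e (Suc m)" and ?c = "complex_of_real (c (Suc m))"
  show "R0 (Suc ?n) (kap ?n Y) \<in> MH (Suc ?n)" by (intro R0_MH)
  show "lc (- ?c) (kap ?n (R0 ?n Y)) (- ?e) (lc 1 (lam ?n Y) (- ?c) (lam ?n (kap m (tau' Y)))) \<in> MH (Suc ?n)"
    by (intro MH_lc lam_MH kap_MH)
  fix u v assume u: "u \<in> H (Suc ?n)" and v: "v \<in> H (Suc ?n)"
  have "bform (Suc ?n) (R0 (Suc ?n) (kap ?n Y)) u v = (\<Sum>a<N. \<Sum>x<N. \<Sum>b<N. bform ?n Y
      (\<lambda>I. Qproj (Suc ?n) (rtens (\<lambda>I. u (a # I)) x) (I @ [b])) (\<lambda>I. Qproj (Suc ?n) (ltens a (\<lambda>J. v (J @ [x]))) (I @ [b])))"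
    by (simp add: R0_def bform_compr_H u v bform_rot0 bform_kap)
  also have "\<dots> = (\<Sum>a<N. \<Sum>x<N. \<Sum>b<N. bform ?n Y
      (\<lambda>I. (if b = x then u (a # I) else 0) - ?c * rtens (\<lambda>I. u (a # I @ [x])) b I)
      (\<lambda>I. ltens a (\<lambda>I. v (I @ [b, x])) I - ?e * rtens (\<lambda>I. v (a # I @ [x])) b I))"
    by (intro sum.cong refl) (simp add: Qproj_ltens_snoc Qproj_rtens_snoc H_Cons[OF u] H_snoc[OF v] bform_Qproj Y)
  also have "\<dots> = (\<Sum>a<N. \<Sum>x<N. bform ?n Y (\<lambda>I. u (a # I)) (ltens a (\<lambda>I. v (I @ [x, x]))))
      - ?e * (\<Sum>a<N. \<Sum>x<N. bform ?n Y (\<lambda>I. u (a # I)) (rtens (\<lambda>I. v (a # I @ [x])) x))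
      - ?c * (\<Sum>a<N. \<Sum>x<N. \<Sum>b<N. bform ?n Y (rtens (\<lambda>I. u (a # I @ [x])) b) (ltens a (\<lambda>I. v (I @ [b, x]))))
      + ?c * ?e * (\<Sum>a<N. \<Sum>x<N. \<Sum>b<N. bform ?n Y (rtens (\<lambda>I. u (a # I @ [x])) b) (rtens (\<lambda>I. v (a # I @ [x])) b))"
    unfolding bform_expand sum_subtractf sum.distrib sum_distrib_left
    by (simp add: bform_if if_distrib[where f="\<lambda>x. _ * x"] cong: if_cong)
  also have "(\<Sum>a<N. \<Sum>x<N. bform ?n Y (\<lambda>I. u (a # I)) (ltens a (\<lambda>I. v (I @ [x, x])))) = 0"
  proof -
    have "(\<Sum>x<N. ltens a (\<lambda>I. v (I @ [x, x])) I) = 0" if "I \<in> words N ?n" for a I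
      using that H_cap_last[OF v, of "tl I"] length_words[OF that] by (cases I) (auto simp: sum_if_const)
    then have "(\<Sum>x<N. bform ?n Y (\<lambda>I. u (a # I)) (ltens a (\<lambda>I. v (I @ [x, x])))) = bform ?n Y (\<lambda>I. u (a # I)) (\<lambda>_. 0)" for a
      unfolding bform_sum_right[symmetric] by (intro bform_cong) auto
    then show ?thesis by (simp add: bform_def)
  qed
  also have "(\<Sum>a<N. \<Sum>x<N. bform ?n Y (\<lambda>I. u (a # I)) (rtens (\<lambda>I. v (a # I @ [x])) x)) = bform (Suc ?n) (lam ?n Y) u v"
    using sum_rtens_slices(1)[where v="\<lambda>I. v (_ # I)"] by (simp add: bform_lam_H u v)
  also have "(\<Sum>a<N. \<Sum>x<N. \<Sum>b<N. bform ?n Y (rtens (\<lambda>I. u (a # I @ [x])) b) (ltens a (\<lambda>I. v (I @ [b, x])))) =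
      (\<Sum>x<N. bform ?n (rot0 Y) (\<lambda>I. u (I @ [x])) (\<lambda>I. v (I @ [x])))"
    by (subst sum.swap) (simp add: bform_rot0)
  also have "\<dots> = bform (Suc ?n) (kap ?n (R0 ?n Y)) u v"
    by (simp add: bform_kap_H u v R0_def bform_compr_H H_snoc[OF u] H_snoc[OF v])
  also have "(\<Sum>a<N. \<Sum>x<N. \<Sum>b<N. bform ?n Y (rtens (\<lambda>I. u (a # I @ [x])) b) (rtens (\<lambda>I. v (a # I @ [x])) b))
      = bform (Suc ?n) (lam ?n (kap m (tau' Y))) u v"
    by (simp add: bform_tau' bform_lam_H bform_kap_H H_Cons[OF u] H_Cons[OF v] u v)
  finally show "bform (Suc ?n) (R0 (Suc ?n) (kap ?n Y)) u v = bform (Suc ?n) (lc (- ?c) (kap ?n (R0 ?n Y)) (- ?e) (lc 1 (lam ?n Y) (- ?c) (lam ?n (kap m (tau' Y))))) u v"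
    unfolding bform_lc by (simp add: algebra_simps)
qed

lemma MH_transp: "transp Y \<in> MH n \<longleftrightarrow> Y \<in> MH n"
  by (auto simp: MH_def transp_def)

lemma compr_transp: "compr n (transp Y) = transp (compr n Y)"
  by (simp add: compr_def bform_transp transp_def[of "\<lambda>I J. bform n Y (_ I) (_ J)"])

lemma lam_transp: "lam n (transp Y) = transp (lam n Y)"
proof -
  have "lid (transp Y) = transp (lid Y)" by (auto simp: lid_def fun_eq_iff transp_def)
  then show ?thesis by (simp add: lam_def compr_transp)
qed

lemma kap_transp: "kap n (transp Y) = transp (kap n Y)"
proof -
  have "rid (transp Y) = transp (rid Y)" by (auto simp: rid_def fun_eq_iff transp_def)
  then show ?thesis by (simp add: kap_def compr_transp)
qed

lemma R0_transp: "R0 n (transp Y) = transp (R1 n Y)"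
proof -
  have "rot0 (transp Y) = transp (rot1 Y)" by (auto simp: transp_def rot0_def rot1_def fun_eq_iff)
  then show ?thesis by (simp add: R0_def R1_def compr_transp)
qed

lemma tau'_transp: "tau' (transp Y) = transp (tau' Y)"
  by (simp add: ptrace_last_def transp_def)

lemma R1_kap:
  assumes Y: "Y \<in> MH (Suc m)"
  shows "R1 (Suc (Suc m)) (kap (Suc m) Y) = lc (- of_real (c (Suc m))) (kap (Suc m) (R1 (Suc m) Y))
     (- e (Suc m)) (lc 1 (lam (Suc m) Y) (- of_real (c (Suc m))) (lam (Suc m) (kap m (tau' Y))))"
proof -
  have "transp (R1 (Suc (Suc m)) (kap (Suc m) Y)) = R0 (Suc (Suc m)) (kap (Suc m) (transp Y))"
    by (simp only: R0_transp kap_transp)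
  also have "\<dots> = transp (lc (- of_real (c (Suc m))) (kap (Suc m) (R1 (Suc m) Y))
     (- e (Suc m)) (lc 1 (lam (Suc m) Y) (- of_real (c (Suc m))) (lam (Suc m) (kap m (tau' Y)))))"
    by (subst R0_kap, simp_all only: MH_transp Y R0_transp kap_transp lam_transp tau'_transp) (simp add: fun_eq_iff transp_apply)
  finally have "transp (transp (R1 (Suc (Suc m)) (kap (Suc m) Y))) = transp (transp (lc (- of_real (c (Suc m))) (kap (Suc m) (R1 (Suc m) Y))
     (- e (Suc m)) (lc 1 (lam (Suc m) Y) (- of_real (c (Suc m))) (lam (Suc m) (kap m (tau' Y))))))"
    by (rule arg_cong)
  then show ?thesis by (simp only: transp_transp)
qed

lemma lam_kap: "lam (Suc n) (kap n Y) = kap (Suc n) (lam n Y)"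
proof (rule MH_eqI[OF lam_MH kap_MH])
  fix u v assume u: "u \<in> H (Suc (Suc n))" and v: "v \<in> H (Suc (Suc n))"
  show "bform (Suc (Suc n)) (lam (Suc n) (kap n Y)) u v = bform (Suc (Suc n)) (kap (Suc n) (lam n Y)) u v"
    by (simp add: bform_lam_H bform_kap_H u v H_Cons[OF u] H_Cons[OF v] H_snoc[OF u] H_snoc[OF v])
      (rule sum.swap)
qed

end

context temperley_lieb begin

section \<open>Tensor operators in coordinates\<close>

lemma cap_app:
  assumes n: "n = i + (2 + j)"
  shows "op_app N n (sandwich N i 0 2 j (op_adj (op_t N))) \<zeta> I =
    (if take i I \<in> words N i \<and> drop i I \<in> words N j then \<Sum>x<N. \<zeta> (take i I @ x # x # drop i I) else 0)"
proof -
  let ?P = "take i I \<in> words N i" and ?R = "drop i I \<in> words N j"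
  have entry: "sandwich N i 0 2 j (op_adj (op_t N)) I (A @ x # y # B) =
     (if ?P \<and> take i I = A then 1 else 0) * (if x = y then 1 else 0) * (if ?R \<and> drop i I = B then 1 else 0)"
    if "A \<in> words N i" "x < N" "y < N" for A B x y
    using that length_words[OF that(1)]
    by (auto simp: sandwich_def op_tensor_def op_id_def op_adj_def op_t_def numeral_2_eq_2)
  have app: "op_app N n (sandwich N i 0 2 j (op_adj (op_t N))) \<zeta> I = (\<Sum>A\<in>words N i. \<Sum>x<N. \<Sum>y<N. \<Sum>B\<in>words N j.
      sandwich N i 0 2 j (op_adj (op_t N)) I (A @ x # y # B) * \<zeta> (A @ x # y # B))"
    unfolding op_app_def n sum_words_add[of _ N i "2 + j"] by (simp add: sum_words_Suc)
  show ?thesis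
  proof (cases "?P \<and> ?R")
    case True
    have "op_app N n (sandwich N i 0 2 j (op_adj (op_t N))) \<zeta> I = (\<Sum>A\<in>words N i. \<Sum>x<N. \<Sum>y<N. \<Sum>B\<in>words N j.
      if B = drop i I then (if y = x then (if A = take i I then \<zeta> (A @ x # y # B) else 0) else 0) else 0)"
      unfolding app by (intro sum.cong refl) (use True in \<open>auto simp: entry\<close>)
    also have "\<dots> = (\<Sum>A\<in>words N i. if A = take i I then \<Sum>x<N. \<zeta> (A @ x # x # drop i I) else 0)"
      by (rule sum.cong[OF refl]) (use True in auto)
    also have "\<dots> = (\<Sum>x<N. \<zeta> (take i I @ x # x # drop i I))"
      using True by simp
    finally show ?thesis using True by simp
  next
    case False
    then show ?thesis unfolding app by (auto simp: entry intro!: sum.neutral)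
  qed
qed

lemma Hspace_eq: "Hspace N n = H n"
proof -
  have "\<zeta> \<in> Hspace N n \<longleftrightarrow> \<zeta> \<in> H n" if supp: "\<forall>I. \<zeta> I \<noteq> 0 \<longrightarrow> I \<in> words N n" for \<zeta> :: tvec
  proof -
    have "(\<forall>i. i + 2 \<le> n \<longrightarrow> op_app N n (sandwich N i 0 2 (n - i - 2) (op_adj (op_t N))) \<zeta> = (\<lambda>_. 0))
       \<longleftrightarrow> (\<forall>A B. length A + length B + 2 = n \<longrightarrow> (\<Sum>x<N. \<zeta> (A @ x # x # B)) = 0)" (is "?L \<longleftrightarrow> ?R")
    proof
      assume L: ?L
      show ?R
      proof (intro allI impI)
        fix A B :: "nat list" assume len: "length A + length B + 2 = n"
        show "(\<Sum>x<N. \<zeta> (A @ x # x # B)) = 0"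
        proof (cases "A \<in> words N (length A) \<and> B \<in> words N (length B)")
          case True
          have "op_app N n (sandwich N (length A) 0 2 (length B) (op_adj (op_t N))) \<zeta> (A @ B) = 0"
            using L[rule_format, of "length A"] len by (auto simp: fun_eq_iff)
          then show ?thesis using True len by (subst (asm) cap_app) auto
        next
          case False
          then have "A @ x # x # B \<notin> words N n" for x
            using len by (auto simp: words_def)
          then show ?thesis using supp by (metis (no_types, lifting) sum.neutral)
        qed
      qed
    next
      assume R: ?R
      show ?L
      proof (intro allI impI ext)
        fix i I assume "i + 2 \<le> n"
        then show "op_app N n (sandwich N i 0 2 (n - i - 2) (op_adj (op_t N))) \<zeta> I = 0"
          using R[rule_format, of "take i I" "drop i I"]
          by (subst cap_app) (auto dest!: length_words)
      qed
    qed
    then show ?thesis using supp by (auto simp: Hspace_def H_def tensor_space_def)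
  qed
  then show ?thesis by (auto simp: Hspace_def H_def tensor_space_def)
qed

text \<open>
The two defining properties of the orthogonal projection determine its matrix: a second candidate differs from
\<open>Q\<close> by vectors which lie in \<open>H\<^sub>n\<close> and are orthogonal to it.
\<close>

lemma Pproj_eq: "Pproj N n = Q n"
  unfolding Pproj_def Hspace_eq
proof (rule the_equality)
  have app: "op_app N n (Q n) \<zeta> = Qproj n \<zeta>" for \<zeta>
    by (simp add: op_app_def Qproj_def)
  have orth: "tinner N n \<eta> (\<lambda>I. \<zeta> I - Qproj n \<zeta> I) = 0" if "\<eta> \<in> H n" for \<eta> \<zeta>
  proof -
    have "(\<Sum>I\<in>words N n. cnj (\<eta> I) * Qproj n \<zeta> I) = (\<Sum>J\<in>words N n. (\<Sum>I\<in>words N n. cnj (\<eta> I) * Q n I J) * \<zeta> J)"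
      unfolding Qproj_def sum_distrib_left sum_distrib_right mult.assoc by (rule sum.swap)
    also have "\<dots> = (\<Sum>J\<in>words N n. cnj (\<eta> J) * \<zeta> J)"
      using Q_fix_right[OF H_cnj[OF that]] by simp
    finally show ?thesis by (simp add: tinner_def right_diff_distrib sum_subtractf)
  qed
  show Q: "Q n \<in> ops N n n \<and> (\<forall>\<zeta>\<in>tensor_space N n. op_app N n (Q n) \<zeta> \<in> H n \<and>
        (\<forall>\<eta>\<in>H n. tinner N n \<eta> (\<lambda>I. \<zeta> I - op_app N n (Q n) \<zeta> I) = 0))"
    using Q_supp by (auto simp: ops_def app Qproj_H orth)
  fix P assume P: "P \<in> ops N n n \<and> (\<forall>\<zeta>\<in>tensor_space N n. op_app N n P \<zeta> \<in> H n \<and>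
        (\<forall>\<eta>\<in>H n. tinner N n \<eta> (\<lambda>I. \<zeta> I - op_app N n P \<zeta> I) = 0))"
  show "P = Q n"
  proof (rule ext, rule ext)
    fix I J
    show "P I J = Q n I J"
    proof (cases "J \<in> words N n")
      case False
      then show ?thesis using P Q unfolding ops_def by (metis (mono_tags, lifting) mem_Collect_eq)
    next
      case True
      define \<delta> :: tvec where "\<delta> = (\<lambda>K. if K = J then 1 else 0)"
      have \<delta>: "\<delta> \<in> tensor_space N n" using True by (simp add: tensor_space_def \<delta>_def)
      have PJ: "op_app N n P \<delta> = (\<lambda>I. P I J)" and QJ: "Qproj n \<delta> = (\<lambda>I. Q n I J)"
        using True by (simp_all add: op_app_def Qproj_def \<delta>_def if_distrib[where f="\<lambda>x. _ * x"] cong: if_cong)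
      define w where "w = (\<lambda>I. P I J - Q n I J)"
      have PH: "(\<lambda>I. P I J) \<in> H n" using P \<delta> PJ by metis
      have wH: "w \<in> H n"
        using H_add[OF PH H_scale[OF Q_in_H[of n J], of "-1"]] by (simp add: w_def)
      have "tinner N n w (\<lambda>I. \<delta> I - P I J) = 0"
        using P \<delta> PJ wH by metis
      moreover have "tinner N n w (\<lambda>I. \<delta> I - Q n I J) = 0"
        using orth[OF wH, of \<delta>] by (simp add: QJ)
      ultimately have "tinner N n w (\<lambda>I. \<delta> I - Q n I J) - tinner N n w (\<lambda>I. \<delta> I - P I J) = 0"
        by simp
      then have "(\<Sum>I\<in>words N n. cnj (w I) * w I) = 0"
        by (simp add: tinner_def sum_subtractf[symmetric] w_def algebra_simps)
      then have "complex_of_real (\<Sum>I\<in>words N n. (cmod (w I))\<^sup>2) = 0"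
        by (simp only: of_real_sum complex_norm_square mult.commute)
      then have "(\<Sum>I\<in>words N n. (cmod (w I))\<^sup>2) = 0" by (simp only: of_real_eq_0_iff)
      then have "w I = 0 \<or> I \<notin> words N n"
        by (subst (asm) sum_nonneg_eq_0_iff) auto
      then show ?thesis using H_supp[OF wH] by (auto simp: w_def)
    qed
  qed
qed

lemma compress_eq: "compress N n X = compr n X"
proof (rule ext, rule ext)
  fix I J
  show "compress N n X I J = compr n X I J"
    by (simp add: compress_def Pproj_eq op_comp_def compr_def bform_def sum_distrib_left Q_sym[of n I] mult.assoc)
qed

lemma BH_eq: "BH N n = MH n"
proof (intro equalityI subsetI)
  fix X assume "X \<in> BH N n"
  then show "X \<in> MH n" using compr_MH[of n X] by (simp add: BH_def compress_eq)
next
  fix X assume X: "X \<in> MH n"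
  then have "X \<in> ops N n n"
    unfolding ops_def using H_supp[OF MH_fst[OF X]] H_supp[OF MH_snd[OF X]] by blast
  then show "X \<in> BH N n" using X by (simp add: BH_def compress_eq compr_fix)
qed

lemma BH00_eq: "BH00 N n = {X \<in> MH n. tau X = (\<lambda>_ _. 0) \<and> tau' X = (\<lambda>_ _. 0)}"
  by (simp add: BH00_def BH_eq)

primrec kapn :: "nat \<Rightarrow> tmat \<Rightarrow> nat \<Rightarrow> tmat" where
  "kapn k X 0 = X"
| "kapn k X (Suc j) = kap (k + j) (kapn k X j)"

text \<open>
The operator \<open>\<lambda>\<^sup>i \<kappa>\<^sup>j X\<close>, which is \<open>X\<^sub>i\<^sub>,\<^sub>j\<close> by \<open>shifted_eq\<close>.
\<close>

primrec xshift :: "nat \<Rightarrow> tmat \<Rightarrow> nat \<Rightarrow> nat \<Rightarrow> tmat" where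
  "xshift k X 0 j = kapn k X j"
| "xshift k X (Suc i) j = lam (k + i + j) (xshift k X i j)"

lemma kapn_MH: "X \<in> MH k \<Longrightarrow> kapn k X j \<in> MH (k + j)"
  by (cases j) (simp_all add: kap_MH)

lemma xshift_MH: "X \<in> MH k \<Longrightarrow> xshift k X i j \<in> MH (k + i + j)"
  by (cases i) (simp_all add: kapn_MH lam_MH)

lemma bform_kapn:
  assumes "u \<in> H (k + j)" "v \<in> H (k + j)"
  shows "bform (k + j) (kapn k X j) u v = (\<Sum>B\<in>words N j. bform k X (\<lambda>K. u (K @ B)) (\<lambda>K. v (K @ B)))"
  using assms
proof (induction j arbitrary: u v)
  case (Suc j)
  then have u: "u \<in> H (Suc (k + j))" and v: "v \<in> H (Suc (k + j))" by simp_all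
  have "bform (k + Suc j) (kapn k X (Suc j)) u v = (\<Sum>a<N. bform (k + j) (kapn k X j) (\<lambda>K. u (K @ [a])) (\<lambda>K. v (K @ [a])))"
    using u v by (simp add: bform_kap_H)
  also have "\<dots> = (\<Sum>a<N. \<Sum>B\<in>words N j. bform k X (\<lambda>K. u (K @ B @ [a])) (\<lambda>K. v (K @ B @ [a])))"
    by (simp add: Suc.IH H_snoc[OF u] H_snoc[OF v])
  also have "\<dots> = (\<Sum>B\<in>words N (Suc j). bform k X (\<lambda>K. u (K @ B)) (\<lambda>K. v (K @ B)))"
    by (subst sum.swap) (simp add: sum_words_snoc)
  finally show ?case .
qed simp

text \<open>
Compressing after each added leg has the same effect as compressing once at the end, since slices of vectors
of \<open>H\<close> are in \<open>H\<close>.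
\<close>

lemma bform_xshift:
  assumes "u \<in> H (k + i + j)" "v \<in> H (k + i + j)"
  shows "bform (k + i + j) (xshift k X i j) u v = (\<Sum>A\<in>words N i. \<Sum>B\<in>words N j. bform k X (\<lambda>K. u (A @ K @ B)) (\<lambda>K. v (A @ K @ B)))"
  using assms
proof (induction i arbitrary: u v)
  case 0
  then show ?case by (simp add: bform_kapn)
next
  case (Suc i)
  then have u: "u \<in> H (Suc (k + i + j))" and v: "v \<in> H (Suc (k + i + j))" by simp_all
  then show ?case
    by (simp add: bform_lam_H Suc.IH H_Cons[OF u] H_Cons[OF v] sum_words_Suc)
qed

lemma bform_sandwich:
  "bform (i + k + j) (sandwich N i k k j X) u v = (\<Sum>A\<in>words N i. \<Sum>B\<in>words N j. bform k X (\<lambda>K. u (A @ K @ B)) (\<lambda>K. v (A @ K @ B)))"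
proof -
  have entry: "sandwich N i k k j X (A @ K @ B) (A' @ L @ B') =
      (if A = A' then 1 else 0) * X K L * (if B = B' then 1 else 0)"
    if "A \<in> words N i" "A' \<in> words N i" "K \<in> words N k" "L \<in> words N k" "B \<in> words N j" for A A' K L B B'
    using that length_words[OF that(1)] length_words[OF that(2)] length_words[OF that(3)] length_words[OF that(4)]
    by (simp add: sandwich_def op_tensor_def op_id_def)
  have "bform (i + k + j) (sandwich N i k k j X) u v = (\<Sum>A\<in>words N i. \<Sum>K\<in>words N k. \<Sum>B\<in>words N j. \<Sum>A'\<in>words N i. \<Sum>L\<in>words N k. \<Sum>B'\<in>words N j.
     u (A @ K @ B) * sandwich N i k k j X (A @ K @ B) (A' @ L @ B') * v (A' @ L @ B'))"
    unfolding bform_def add.assoc sum_words_add ..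
  also have "\<dots> = (\<Sum>A\<in>words N i. \<Sum>K\<in>words N k. \<Sum>B\<in>words N j. \<Sum>A'\<in>words N i. \<Sum>L\<in>words N k. \<Sum>B'\<in>words N j.
     if B = B' then (if A = A' then u (A @ K @ B) * X K L * v (A' @ L @ B') else 0) else 0)"
    by (intro sum.cong refl) (auto simp: entry)
  also have "\<dots> = (\<Sum>A\<in>words N i. \<Sum>K\<in>words N k. \<Sum>B\<in>words N j. \<Sum>A'\<in>words N i.
     if A = A' then \<Sum>L\<in>words N k. u (A @ K @ B) * X K L * v (A' @ L @ B) else 0)"
    by (intro sum.cong refl) auto
  also have "\<dots> = (\<Sum>A\<in>words N i. \<Sum>K\<in>words N k. \<Sum>B\<in>words N j. \<Sum>L\<in>words N k. u (A @ K @ B) * X K L * v (A @ L @ B))"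
    by (rule sum.cong[OF refl], rule sum.cong[OF refl], rule sum.cong[OF refl]) simp
  also have "\<dots> = (\<Sum>A\<in>words N i. \<Sum>B\<in>words N j. bform k X (\<lambda>K. u (A @ K @ B)) (\<lambda>K. v (A @ K @ B)))"
    unfolding bform_def by (rule sum.cong[OF refl], rule sum.swap)
  finally show ?thesis .
qed

lemma shifted_eq:
  assumes "X \<in> MH k"
  shows "shifted N k X i j = xshift k X i j"
proof -
  have eq: "i + k + j = k + i + j" by simp
  have "shifted N k X i j = compr (k + i + j) (sandwich N i k k j X)"
    unfolding shifted_def compress_eq eq ..
  moreover have "\<dots> = xshift k X i j"
  proof (rule MH_eqI[OF compr_MH xshift_MH[OF assms]])
    fix u v assume "u \<in> H (k + i + j)" "v \<in> H (k + i + j)"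
    then show "bform (k + i + j) (compr (k + i + j) (sandwich N i k k j X)) u v = bform (k + i + j) (xshift k X i j) u v"
      using bform_sandwich[of i k j X u v] by (simp add: bform_compr_H bform_xshift eq)
  qed
  ultimately show ?thesis by simp
qed

lemma rotation_eq:
  assumes X: "X \<in> MH (Suc m)"
  shows "rotation N (Suc m) X = R0 (Suc m) X"
proof (rule ext, rule ext)
  fix P0 J0
  let ?n = "Suc m"
  let ?A = "op_tensor ?n ?n (Q ?n) (op_adj (op_t N))"
  let ?B = "sandwich N 1 ?n ?n 1 X"
  let ?C = "op_tensor 2 0 (op_t N) (Q ?n)"
  have rot: "rotation N ?n X P0 J0 = (\<Sum>K\<in>words N (?n + 2). ?A P0 K * (\<Sum>L\<in>words N (?n + 2). ?B K L * ?C L J0))"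
    by (simp only: rotation_def Pproj_eq op_comp_def)
  have C: "(\<Sum>L\<in>words N (?n + 2). ?B K L * ?C L J0) = (\<Sum>z<N. \<Sum>L\<in>words N m. \<Sum>l<N. ?B K (z # z # L @ [l]) * Q ?n (L @ [l]) J0)" for K
  proof -
    have "(\<Sum>L\<in>words N (?n + 2). ?B K L * ?C L J0) = (\<Sum>z<N. \<Sum>y<N. \<Sum>L\<in>words N ?n. ?B K (z # y # L) * ?C (z # y # L) J0)"
      by (simp add: sum_words_Suc[of _ N "Suc ?n"] sum_words_Suc[of _ N "?n"] del: Q.simps)
    also have "\<dots> = (\<Sum>z<N. \<Sum>y<N. if y = z then \<Sum>L\<in>words N ?n. ?B K (z # y # L) * Q ?n L J0 else 0)"
      by (intro sum.cong refl) (auto simp: op_tensor_def op_t_def numeral_2_eq_2 simp del: Q.simps)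
    finally show ?thesis by (simp add: sum_words_snoc del: Q.simps)
  qed
  have B: "?B (a # I @ [i, i]) (z # z # L @ [l]) = (if a = z then 1 else 0) * X (I @ [i]) (z # L) * (if i = l then 1 else 0)"
    if "a < N" "I \<in> words N m" "i < N" "L \<in> words N m" for a I i z L l
    using that length_words[OF that(2)] length_words[OF that(4)]
    by (simp add: sandwich_def op_tensor_def op_id_def)
  show "rotation N ?n X P0 J0 = R0 ?n X P0 J0"
  proof (cases "P0 \<in> words N ?n")
    case True
    have "rotation N ?n X P0 J0 = (\<Sum>a<N. \<Sum>I\<in>words N m. \<Sum>i<N. \<Sum>y<N. ?A P0 (a # I @ [i, y]) * (\<Sum>L\<in>words N (?n + 2). ?B (a # I @ [i, y]) L * ?C L J0))"
      unfolding rot by (simp add: sum_words_Suc[of _ N "Suc ?n"] sum_words_snoc[of _ N m] sum_words_snoc[of _ N ?n] del: Q.simps)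
    also have "\<dots> = (\<Sum>a<N. \<Sum>I\<in>words N m. \<Sum>i<N. \<Sum>y<N. if y = i then Q ?n P0 (a # I) * (\<Sum>L\<in>words N (?n + 2). ?B (a # I @ [i, i]) L * ?C L J0) else 0)"
      by (intro sum.cong refl) (use length_words[OF True] in \<open>auto simp: op_tensor_def op_t_def op_adj_def dest!: length_words simp del: Q.simps\<close>)
    also have "\<dots> = (\<Sum>a<N. \<Sum>I\<in>words N m. \<Sum>i<N. Q ?n P0 (a # I) * (\<Sum>z<N. \<Sum>L\<in>words N m. \<Sum>l<N. ?B (a # I @ [i, i]) (z # z # L @ [l]) * Q ?n (L @ [l]) J0))"
      unfolding C[symmetric] by (simp del: Q.simps)
    also have "\<dots> = (\<Sum>a<N. \<Sum>I\<in>words N m. \<Sum>i<N. Q ?n P0 (a # I) * (\<Sum>z<N. if z = a then \<Sum>L\<in>words N m. \<Sum>l<N. (if l = i then X (I @ [i]) (a # L) * Q ?n (L @ [i]) J0 else 0) else 0))"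
      by (intro sum.cong refl arg_cong2[where f="(*)"]) (auto simp: B[unfolded One_nat_def] sum_if_const if_distrib[where f="\<lambda>x. _ * x"] if_distrib[where f="\<lambda>x. x * _"] simp del: Q.simps cong: if_cong intro!: sum.cong)
    also have "\<dots> = (\<Sum>a<N. \<Sum>I\<in>words N m. \<Sum>i<N. \<Sum>L\<in>words N m. Q ?n (a # I) P0 * X (I @ [i]) (a # L) * Q ?n (L @ [i]) J0)"
      by (simp add: sum_distrib_left Q_sym[of ?n P0] mult.assoc del: Q.simps)
    also have "\<dots> = (\<Sum>a<N. \<Sum>i<N. \<Sum>I\<in>words N m. \<Sum>L\<in>words N m. Q ?n (a # I) P0 * X (I @ [i]) (a # L) * Q ?n (L @ [i]) J0)"
      by (rule sum.cong[OF refl], rule sum.swap)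
    also have "\<dots> = R0 ?n X P0 J0"
      by (simp add: R0_def compr_def bform_rot0 bform_rl del: Q.simps)
    finally show ?thesis .
  next
    case False
    have "?A P0 K = 0" for K
      using False by (auto simp: op_tensor_def op_adj_def op_t_def Q_supp0 simp del: Q.simps)
    then have "rotation N ?n X P0 J0 = 0" by (simp add: rot del: Q.simps)
    moreover have "R0 ?n X P0 J0 = 0" using H_supp[OF MH_fst[OF R0_MH] False] .
    ultimately show ?thesis by simp
  qed
qed

text \<open>
Each contraction of adjacent legs of the rotated operator is a contraction of adjacent legs of \<open>X\<close> or, at the
corner around which a leg was bent, one of the two partial traces.  So on \<open>B(H\<^sub>n)\<^sup>\<circ>\<^sup>\<circ>\<close> the rotation
requires no compression.
\<close>

lemma rot0_BH00_MH:
  assumes X: "X \<in> BH00 N (Suc m)"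
  shows "rot0 X \<in> MH (Suc m)"
proof -
  have MH: "X \<in> MH (Suc m)" and t1: "\<And>I J. tau X I J = 0" and t2: "\<And>I J. tau' X I J = 0"
    using X by (auto simp: BH00_eq)
  have supp: "X I J = 0" if "I \<notin> words N (Suc m) \<or> J \<notin> words N (Suc m)" for I J
    using that H_supp[OF MH_fst[OF MH]] H_supp[OF MH_snd[OF MH]] by blast
  have supp': "I \<in> words N (Suc m) \<and> J \<in> words N (Suc m)" if nz: "rot0 X I J \<noteq> 0" for I J
  proof -
    obtain a I' J' b where IJ: "I = a # I'" "J = J' @ [b]"
      using nz by (cases I; cases J rule: rev_cases) (auto simp: rot0_def)
    with nz supp[of "I' @ [b]" "a # J'"] show ?thesis by (auto simp: rot0_def)
  qed
  have cap1: "(\<Sum>x<N. rot0 X (A @ x # x # B) J) = 0" if len: "length A + length B + 2 = Suc m" for A B J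
  proof (cases J rule: rev_cases)
    case (snoc J' b)
    show ?thesis
    proof (cases A)
      case Nil
      then show ?thesis using snoc t1[of "B @ [b]" J'] by (simp add: rot0_def ptrace_first_def)
    next
      case (Cons a A')
      then show ?thesis using snoc H_cap[OF MH_fst[OF MH], of A' "B @ [b]" "a # J'"] len by (simp add: rot0_def)
    qed
  qed (simp add: rot0_def)
  have cap2: "(\<Sum>x<N. rot0 X I (A @ x # x # B)) = 0" if len: "length A + length B + 2 = Suc m" for A B I
  proof (cases I)
    case (Cons a I')
    show ?thesis
    proof (cases B rule: rev_cases)
      case Nil
      then show ?thesis using Cons t2[of I' "a # A"] by (simp add: rot0_def ptrace_last_def butlast_append)
    next
      case (snoc B' b)
      then show ?thesis using Cons H_cap[OF MH_snd[OF MH], of "a # A" B' "I' @ [b]"] len by (simp add: rot0_def butlast_append)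
    qed
  qed (simp add: rot0_def)
  show ?thesis using supp' cap1 cap2 by (auto simp: MH_def H_def)
qed

text \<open>
Without compression the rotation only permutes the matrix entries.  It is therefore isometric, whence
\<open>|\<mu>| = 1\<close>, and the inverse permutation has the eigenvalue \<open>\<mu>\<^sup>-\<^sup>1\<close>.
\<close>

lemma eigenvector_rotations:
  assumes X: "X \<in> BH00 N (Suc m)" and nz: "X \<noteq> (\<lambda>_ _. 0)"
    and eig: "rotation N (Suc m) X = (\<lambda>I J. \<mu> * X I J)"
  shows "cmod \<mu> = 1" "R0 (Suc m) X = (\<lambda>I J. \<mu> * X I J)" "R1 (Suc m) X = (\<lambda>I J. cnj \<mu> * X I J)"
proof -
  let ?n = "Suc m"
  have MH: "X \<in> MH ?n" using X by (simp add: BH00_eq)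
  show R0: "R0 ?n X = (\<lambda>I J. \<mu> * X I J)" using eig rotation_eq[OF MH] by simp
  have rot: "rot0 X = (\<lambda>I J. \<mu> * X I J)"
    using R0 compr_fix[OF rot0_BH00_MH[OF X]] by (simp add: R0_def)
  define S where "S = (\<Sum>I\<in>words N ?n. \<Sum>J\<in>words N ?n. (cmod (X I J))\<^sup>2)"
  have "S \<noteq> 0"
  proof
    assume "S = 0"
    then have "\<forall>I\<in>words N ?n. (\<Sum>J\<in>words N ?n. (cmod (X I J))\<^sup>2) = 0"
      unfolding S_def by (subst (asm) sum_nonneg_eq_0_iff) (auto intro: sum_nonneg)
    then have "X I J = 0" if "I \<in> words N ?n" "J \<in> words N ?n" for I J
      using that by (subst (asm) sum_nonneg_eq_0_iff) auto
    then have "X I J = 0" for I J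
      using H_supp[OF MH_fst[OF MH]] H_supp[OF MH_snd[OF MH]] by blast
    then show False using nz by blast
  qed
  have "(\<Sum>I\<in>words N ?n. \<Sum>J\<in>words N ?n. (cmod (rot0 X I J))\<^sup>2)
    = (\<Sum>a<N. \<Sum>I\<in>words N m. \<Sum>J\<in>words N m. \<Sum>x<N. (cmod (X (I @ [x]) (a # J)))\<^sup>2)"
    by (subst sum_words_Suc[where f="\<lambda>I. \<Sum>J\<in>words N ?n. (cmod (rot0 X I J))\<^sup>2"])
      (simp add: rot0_def sum_words_snoc)
  also have "\<dots> = (\<Sum>I\<in>words N m. \<Sum>a<N. \<Sum>J\<in>words N m. \<Sum>x<N. (cmod (X (I @ [x]) (a # J)))\<^sup>2)"
    by (rule sum.swap)
  also have "\<dots> = (\<Sum>I\<in>words N m. \<Sum>a<N. \<Sum>x<N. \<Sum>J\<in>words N m. (cmod (X (I @ [x]) (a # J)))\<^sup>2)"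
    by (rule sum.cong[OF refl], rule sum.cong[OF refl], rule sum.swap)
  also have "\<dots> = (\<Sum>I\<in>words N m. \<Sum>x<N. \<Sum>a<N. \<Sum>J\<in>words N m. (cmod (X (I @ [x]) (a # J)))\<^sup>2)"
    by (rule sum.cong[OF refl], rule sum.swap)
  also have "\<dots> = S"
    unfolding S_def
    by (subst sum_words_snoc[where f="\<lambda>I. \<Sum>J\<in>words N ?n. (cmod (X I J))\<^sup>2"]) (simp add: sum_words_Suc)
  finally have "(cmod \<mu>)\<^sup>2 * S = S"
    by (simp add: rot S_def norm_mult power_mult_distrib sum_distrib_left)
  then have "(cmod \<mu>)\<^sup>2 = 1" using \<open>S \<noteq> 0\<close> by simp
  then show mu: "cmod \<mu> = 1" by (simp add: power2_eq_1_iff) (smt (verit) norm_ge_zero)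
  have inv: "rot1 (rot0 X) I J = X I J" for I J
  proof (cases "I = [] \<or> J = []")
    case True
    then show ?thesis using H_supp[OF MH_fst[OF MH], of I J] H_supp[OF MH_snd[OF MH], of J I]
      by (auto simp: rot1_def)
  qed (auto simp: rot0_def rot1_def)
  have "\<mu> * rot1 X I J = X I J" for I J
    using inv[of I J] by (auto simp: rot rot1_def split: if_splits)
  then have "cnj \<mu> * (\<mu> * rot1 X I J) = cnj \<mu> * X I J" for I J by simp
  moreover have "cnj \<mu> * \<mu> = 1" using mu by (metis complex_norm_square mult.commute of_real_1 one_power2)
  ultimately have "rot1 X = (\<lambda>I J. cnj \<mu> * X I J)" by (simp add: mult.assoc[symmetric] fun_eq_iff)
  then have "R1 ?n X = compr ?n (\<lambda>I J. cnj \<mu> * X I J)" by (simp add: R1_def)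
  also have "\<dots> = (\<lambda>I J. cnj \<mu> * X I J)"
    using MH_lc[OF MH MH, of "cnj \<mu>" 0] by (intro compr_fix) simp
  finally show "R1 ?n X = (\<lambda>I J. cnj \<mu> * X I J)" .
qed

end

section \<open>Inner products and contractivity\<close>

context temperley_lieb begin

text \<open>
The scalar product \<open>Tr(Y\<^sup>* Z) / d\<^sub>n\<close>, with \<open>sq n Y\<close> the corresponding square of the norm of \<open>Y\<close>.
\<close>

definition ip :: "nat \<Rightarrow> tmat \<Rightarrow> tmat \<Rightarrow> complex" where
  "ip n Y Z = (\<Sum>I\<in>words N n. \<Sum>J\<in>words N n. cnj (Y I J) * Z I J) / of_real (d n)"

definition sq :: "nat \<Rightarrow> tmat \<Rightarrow> real" where
  "sq n Y = (\<Sum>I\<in>words N n. \<Sum>J\<in>words N n. (cmod (Y I J))\<^sup>2) / d n"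

lemma sq_nonneg: "0 \<le> sq n Y"
  by (simp add: sq_def sum_nonneg less_imp_le)

lemma ip_self: "ip n Y Y = of_real (sq n Y)"
  by (simp add: ip_def sq_def complex_norm_square mult.commute flip: of_real_power)

lemma ip_cnj: "cnj (ip n Y Z) = ip n Z Y"
  by (simp add: ip_def mult.commute)

lemma ip_lc: "ip n Y (lc s Z t W) = s * ip n Y Z + t * ip n Y W"
  by (simp add: ip_def sum_distrib_left sum.distrib[symmetric] add_divide_distrib[symmetric] algebra_simps)

lemma ip_lc_left: "ip n (lc s Z t W) Y = cnj s * ip n Z Y + cnj t * ip n W Y"
  by (subst ip_cnj[symmetric], subst ip_lc) (simp add: ip_cnj)

lemma ip_scale: "ip n Y (\<lambda>I J. s * Z I J) = s * ip n Y Z"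
  using ip_lc[of n Y s Z 0 Z] by simp

lemma ip_zero: "ip n Y (\<lambda>_ _. 0) = 0"
  by (simp add: ip_def)

lemma ip_sum: "ip n Y (\<lambda>I J. \<Sum>s\<in>S. f s * Z s I J) = (\<Sum>s\<in>S. f s * ip n Y (Z s))"
proof (induction S rule: infinite_finite_induct)
  case (insert x F)
  then show ?case using ip_lc[of n Y "f x" "Z x" 1 "\<lambda>I J. \<Sum>s\<in>F. f s * Z s I J"] by simp
qed (simp_all add: ip_zero)

lemma cauchy_schwarz: "cmod (ip n Y Z) \<le> sqrt (sq n Y) * sqrt (sq n Z)"
proof -
  let ?S = "words N n \<times> words N n"
  have L: "sqrt (sq n Y) = L2_set (\<lambda>p. cmod (Y (fst p) (snd p))) ?S / sqrt (d n)" for Y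
    by (simp add: sq_def L2_set_def real_sqrt_divide sum.cartesian_product case_prod_beta)
  have "cmod (ip n Y Z) = cmod (\<Sum>p\<in>?S. cnj (Y (fst p) (snd p)) * Z (fst p) (snd p)) / d n"
    by (simp add: ip_def norm_divide sum.cartesian_product case_prod_beta less_imp_le)
  also have "\<dots> \<le> (\<Sum>p\<in>?S. \<bar>cmod (Y (fst p) (snd p))\<bar> * \<bar>cmod (Z (fst p) (snd p))\<bar>) / d n"
    by (intro divide_right_mono order.trans[OF norm_sum]) (simp_all add: norm_mult less_imp_le)
  also have "\<dots> \<le> (L2_set (\<lambda>p. cmod (Y (fst p) (snd p))) ?S * L2_set (\<lambda>p. cmod (Z (fst p) (snd p))) ?S) / d n"
    by (intro divide_right_mono L2_set_mult_ineq) (simp add: less_imp_le)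
  also have "\<dots> = sqrt (sq n Y) * sqrt (sq n Z)"
    using real_sqrt_mult_self[of "d n"] by (simp add: L less_imp_le)
  finally show ?thesis .
qed

text \<open>
What \<open>\<lambda>\<close> and \<open>\<kappa>\<close> have in common: an adjoint \<open>A\<close> for the scalar products \<open>ip\<close> and the relation
\<open>L\<^sup>* L = (1 - g) + g L L\<^sup>*\<close> with \<open>g = c\<^sub>n c\<^sub>n\<^sub>+\<^sub>1\<close>.  Everything about norms is derived from this.
\<close>

definition creation :: "(nat \<Rightarrow> tmat \<Rightarrow> tmat) \<Rightarrow> (nat \<Rightarrow> tmat \<Rightarrow> tmat) \<Rightarrow> bool" where
  "creation L A \<longleftrightarrow>
     (\<forall>n Y. L n Y \<in> MH (Suc n)) \<and>
     (\<forall>n Z. Z \<in> MH (Suc n) \<longrightarrow> A n Z \<in> MH n) \<and>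
     (\<forall>n Y Z. Z \<in> MH (Suc n) \<longrightarrow> ip (Suc n) (L n Y) Z = ip n Y (A n Z)) \<and>
     (\<forall>Y\<in>MH 0. A 0 (L 0 Y) = Y) \<and>
     (\<forall>m. \<forall>Y\<in>MH (Suc m). A (Suc m) (L (Suc m) Y) =
        lc (of_real (1 - c (Suc m) * c (Suc (Suc m)))) Y (of_real (c (Suc m) * c (Suc (Suc m)))) (L m (A m Y)))"

context
  fixes L A assumes cr: "creation L A"
begin

lemma cr_L: "L n Y \<in> MH (Suc n)"
  and cr_A: "Z \<in> MH (Suc n) \<Longrightarrow> A n Z \<in> MH n"
  and cr_adj: "Z \<in> MH (Suc n) \<Longrightarrow> ip (Suc n) (L n Y) Z = ip n Y (A n Z)"
  and cr_0: "Y \<in> MH 0 \<Longrightarrow> A 0 (L 0 Y) = Y"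
  and cr_Suc: "Y \<in> MH (Suc m) \<Longrightarrow> A (Suc m) (L (Suc m) Y) =
        lc (of_real (1 - c (Suc m) * c (Suc (Suc m)))) Y (of_real (c (Suc m) * c (Suc (Suc m)))) (L m (A m Y))"
  using cr unfolding creation_def by blast+

lemma sq_L: "of_real (sq (Suc n) (L n Y)) = ip n Y (A n (L n Y))"
  using cr_adj[OF cr_L[of n Y], of Y] by (simp add: ip_self)

lemma sq_A: "Y \<in> MH (Suc m) \<Longrightarrow> ip (Suc m) Y (L m (A m Y)) = of_real (sq m (A m Y))"
  using cr_adj[of Y m "A m Y"] by (metis ip_cnj ip_self complex_cnj_complex_of_real)

lemma sq_L_Suc:
  assumes "Y \<in> MH (Suc m)"
  shows "sq (Suc (Suc m)) (L (Suc m) Y) = (1 - c (Suc m) * c (Suc (Suc m))) * sq (Suc m) Y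
     + c (Suc m) * c (Suc (Suc m)) * sq m (A m Y)"
proof -
  have "complex_of_real (sq (Suc (Suc m)) (L (Suc m) Y)) = complex_of_real ((1 - c (Suc m) * c (Suc (Suc m))) * sq (Suc m) Y
     + c (Suc m) * c (Suc (Suc m)) * sq m (A m Y))"
    unfolding sq_L cr_Suc[OF assms] ip_lc sq_A[OF assms] ip_self by simp
  then show ?thesis by (simp only: of_real_eq_iff)
qed

lemma gg_bounds: "0 \<le> c n * c m" "c n * c m \<le> q\<^sup>2" "c n * c m < 1"
proof -
  show "0 \<le> c n * c m" using c_bounds by simp
  show "c n * c m \<le> q\<^sup>2" unfolding power2_eq_square using c_bounds q0 by (intro mult_mono) auto
  also have "q\<^sup>2 < 1" using power_strict_mono[of q 1 2] q0 q1 by simp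
  finally show "c n * c m < 1" .
qed

text \<open>
If \<open>L\<^sup>*\<close> is contractive at the previous level, then \<open>L\<^sup>* L\<close> is bounded by
\<open>(1 - g) + g = 1\<close>, so the two statements are carried by one induction.
\<close>

lemma L_contract: "Y \<in> MH n \<Longrightarrow> sq (Suc n) (L n Y) \<le> sq n Y"
  and A_contract: "Z \<in> MH (Suc n) \<Longrightarrow> sq n (A n Z) \<le> sq (Suc n) Z"
proof -
  have A_of_L: "sq n (A n Z) \<le> sq (Suc n) Z" if L: "\<And>Y. Y \<in> MH n \<Longrightarrow> sq (Suc n) (L n Y) \<le> sq n Y" and Z: "Z \<in> MH (Suc n)" for n Z
  proof -
    have "sq n (A n Z) = cmod (ip (Suc n) (L n (A n Z)) Z)"
      using cr_adj[OF Z, of "A n Z"] by (simp add: ip_self sq_nonneg)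
    also have "\<dots> \<le> sqrt (sq (Suc n) (L n (A n Z))) * sqrt (sq (Suc n) Z)"
      by (rule cauchy_schwarz)
    also have "\<dots> \<le> sqrt (sq n (A n Z)) * sqrt (sq (Suc n) Z)"
      by (intro mult_right_mono real_sqrt_le_mono L cr_A Z) (simp add: sq_nonneg)
    finally have *: "sqrt (sq n (A n Z)) * sqrt (sq n (A n Z)) \<le> sqrt (sq n (A n Z)) * sqrt (sq (Suc n) Z)"
      using sq_nonneg[of n "A n Z"] by simp
    show ?thesis
    proof (cases "sq n (A n Z) = 0")
      case False
      then have "0 < sqrt (sq n (A n Z))" using sq_nonneg[of n "A n Z"] by simp
      with * have "sqrt (sq n (A n Z)) \<le> sqrt (sq (Suc n) Z)" by (simp only: mult_le_cancel_left_pos)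
      then show ?thesis by simp
    qed (simp add: sq_nonneg)
  qed
  have L: "Y \<in> MH n \<Longrightarrow> sq (Suc n) (L n Y) \<le> sq n Y" for n Y
  proof (induction n arbitrary: Y)
    case 0
    have "complex_of_real (sq (Suc 0) (L 0 Y)) = of_real (sq 0 Y)"
      unfolding sq_L cr_0[OF 0] ip_self ..
    then show ?case by simp
  next
    case (Suc m)
    have "sq m (A m Y) \<le> sq (Suc m) Y" using A_of_L[OF Suc.IH Suc.prems] .
    then have "c (Suc m) * c (Suc (Suc m)) * sq m (A m Y) \<le> c (Suc m) * c (Suc (Suc m)) * sq (Suc m) Y"
      by (intro mult_left_mono gg_bounds)
    then show ?case using sq_L_Suc[OF Suc.prems] by (simp add: algebra_simps)
  qed
  show "Y \<in> MH n \<Longrightarrow> sq (Suc n) (L n Y) \<le> sq n Y" by (rule L)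
  show "Z \<in> MH (Suc n) \<Longrightarrow> sq n (A n Z) \<le> sq (Suc n) Z" using A_of_L L by blast
qed

text \<open>
This is the inequality \<open>0 \<le> \<parallel>Y - L\<^sup>* L Y\<parallel>\<^sup>2\<close>.
\<close>

lemma sq_L_A_L:
  assumes "Y \<in> MH n"
  shows "sq (Suc n) (L n Y) - sq n (A n (L n Y)) \<le> sq n Y - sq (Suc n) (L n Y)"
proof -
  let ?W = "A n (L n Y)"
  have "complex_of_real (sq n (lc 1 Y (- 1) ?W)) = ip n Y Y - ip n Y ?W - cnj (ip n Y ?W) + ip n ?W ?W"
    unfolding ip_self[symmetric] ip_lc ip_lc_left ip_cnj by simp
  also have "\<dots> = of_real (sq n Y - 2 * sq (Suc n) (L n Y) + sq n ?W)"
    unfolding sq_L[symmetric] ip_self by simp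
  finally have "sq n (lc 1 Y (- 1) ?W) = sq n Y - 2 * sq (Suc n) (L n Y) + sq n ?W"
    by (simp only: of_real_eq_iff)
  then show ?thesis using sq_nonneg[of n "lc 1 Y (- 1) ?W"] by simp
qed

text \<open>
By \<open>sq_L_Suc\<close> the loss in one step is \<open>g\<close> times the loss of \<open>L\<^sup>*\<close> on the same vector, which
\<open>sq_L_A_L\<close> bounds by the loss in the preceding step.  Hence the losses decay like \<open>q\<^sup>2\<^sup>i\<close>, and their sum is
a geometric series.
\<close>

lemma iterate_lower:
  assumes Y0: "Y 0 \<in> MH (Suc m)" and YS: "\<And>i. Y (Suc i) = L (Suc m + i) (Y i)"
  shows "(1 - q\<^sup>2 / (1 - q\<^sup>2)) * sq (Suc m) (Y 0) \<le> sq (Suc m + i) (Y i)"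
proof -
  let ?s = "\<lambda>i. sq (Suc m + i) (Y i)"
  have MHY: "Y i \<in> MH (Suc m + i)" for i
    by (cases i) (simp_all add: Y0 YS cr_L)
  have q2: "0 \<le> q\<^sup>2" "q\<^sup>2 < 1" using power_strict_mono[of q 1 2] q0 q1 by simp_all
  have dec: "?s i - ?s (Suc i) \<le> (q\<^sup>2) ^ Suc i * ?s 0" for i
  proof (induction i)
    case 0
    have "?s 0 - ?s (Suc 0) = c (Suc m) * c (Suc (Suc m)) * (?s 0 - sq m (A m (Y 0)))"
      using sq_L_Suc[OF Y0] by (simp add: YS algebra_simps)
    also have "\<dots> \<le> q\<^sup>2 * ?s 0"
      using sq_nonneg[of m "A m (Y 0)"] A_contract[OF Y0] by (intro mult_mono gg_bounds) auto
    finally show ?case by simp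
  next
    case (Suc i)
    let ?n = "Suc m + i"
    have "?s (Suc i) - ?s (Suc (Suc i)) = c (Suc ?n) * c (Suc (Suc ?n)) * (?s (Suc i) - sq ?n (A ?n (Y (Suc i))))"
      using sq_L_Suc[of "Y (Suc i)" ?n] MHY[of "Suc i"] by (simp add: YS algebra_simps)
    also have "\<dots> \<le> q\<^sup>2 * (?s i - ?s (Suc i))"
      using sq_L_A_L[OF MHY[of i]] A_contract[of "Y (Suc i)" ?n] MHY[of "Suc i"]
      by (intro mult_mono gg_bounds) (auto simp: YS)
    also have "\<dots> \<le> q\<^sup>2 * ((q\<^sup>2) ^ Suc i * ?s 0)"
      by (intro mult_left_mono Suc.IH q2)
    also have "\<dots> = (q\<^sup>2) ^ Suc (Suc i) * ?s 0" by (simp only: power_Suc mult.assoc)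
    finally show ?case .
  qed
  have "?s 0 - ?s i \<le> (\<Sum>j<i. (q\<^sup>2) ^ Suc j) * ?s 0"
  proof (induction i)
    case (Suc i)
    then show ?case using dec[of i] by (simp add: algebra_simps)
  qed simp
  also have "\<dots> \<le> q\<^sup>2 / (1 - q\<^sup>2) * ?s 0"
  proof (rule mult_right_mono)
    have "(\<Sum>j<i. (q\<^sup>2) ^ Suc j) = q\<^sup>2 * (\<Sum>j<i. (q\<^sup>2) ^ j)"
      by (simp add: sum_distrib_left)
    also have "\<dots> = q\<^sup>2 * ((1 - (q\<^sup>2) ^ i) / (1 - q\<^sup>2))"
      using q2 by (simp add: sum_gp_strict)
    also have "\<dots> \<le> q\<^sup>2 * (1 / (1 - q\<^sup>2))"
      using q2 by (intro mult_left_mono divide_right_mono) auto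
    finally show "(\<Sum>j<i. (q\<^sup>2) ^ Suc j) \<le> q\<^sup>2 / (1 - q\<^sup>2)" by simp
  qed (simp add: sq_nonneg)
  finally show ?thesis by (simp add: algebra_simps)
qed

end

text \<open>
The adjoints of \<open>\<lambda>\<close> and \<open>\<kappa>\<close>; the factor is the quotient of the normalizations \<open>1 / d\<^sub>n\<close> at the two levels.
\<close>

definition lamstar :: "nat \<Rightarrow> tmat \<Rightarrow> tmat" where
  "lamstar n Z = (\<lambda>I J. of_real (c (Suc n)) * tau Z I J)"

definition kapstar :: "nat \<Rightarrow> tmat \<Rightarrow> tmat" where
  "kapstar n Z = (\<lambda>I J. of_real (c (Suc n)) * tau' Z I J)"

lemma MH_scale: "Y \<in> MH n \<Longrightarrow> (\<lambda>I J. s * Y I J) \<in> MH n"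
  by (simp add: MH_def H_scale)

text \<open>
The projection is self-adjoint, so a compression on one side of a scalar product can be dropped.
\<close>

lemma ip_compr:
  assumes Z: "Z \<in> MH n"
  shows "ip n (compr n B) Z = ip n B Z"
proof -
  have "(\<Sum>I\<in>words N n. \<Sum>J\<in>words N n. cnj (compr n B I J) * Z I J)
    = (\<Sum>I\<in>words N n. \<Sum>J\<in>words N n. \<Sum>K\<in>words N n. \<Sum>M\<in>words N n. cnj (B K M) * (Q n M J * (Q n K I * Z I J)))"
    by (simp add: compr_def bform_def sum_distrib_left sum_distrib_right mult_ac del: Q.simps)
  also have "\<dots> = (\<Sum>I\<in>words N n. \<Sum>K\<in>words N n. \<Sum>J\<in>words N n. \<Sum>M\<in>words N n. cnj (B K M) * (Q n M J * (Q n K I * Z I J)))"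
    by (rule sum.cong[OF refl], rule sum.swap)
  also have "\<dots> = (\<Sum>K\<in>words N n. \<Sum>I\<in>words N n. \<Sum>J\<in>words N n. \<Sum>M\<in>words N n. cnj (B K M) * (Q n M J * (Q n K I * Z I J)))"
    by (rule sum.swap)
  also have "\<dots> = (\<Sum>K\<in>words N n. \<Sum>J\<in>words N n. \<Sum>I\<in>words N n. \<Sum>M\<in>words N n. cnj (B K M) * (Q n M J * (Q n K I * Z I J)))"
    by (rule sum.cong[OF refl], rule sum.swap)
  also have "\<dots> = (\<Sum>K\<in>words N n. \<Sum>J\<in>words N n. \<Sum>M\<in>words N n. \<Sum>I\<in>words N n. cnj (B K M) * (Q n M J * (Q n K I * Z I J)))"
    by (rule sum.cong[OF refl], rule sum.cong[OF refl], rule sum.swap)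
  also have "\<dots> = (\<Sum>K\<in>words N n. \<Sum>M\<in>words N n. \<Sum>J\<in>words N n. \<Sum>I\<in>words N n. cnj (B K M) * (Q n M J * (Q n K I * Z I J)))"
    by (rule sum.cong[OF refl], rule sum.swap)
  also have "\<dots> = (\<Sum>K\<in>words N n. \<Sum>M\<in>words N n. cnj (B K M) * Z K M)"
    by (simp only: sum_distrib_left[symmetric] Q_fix[OF MH_fst[OF Z]] Q_fix[OF MH_snd[OF Z]])
  finally show ?thesis by (simp add: ip_def)
qed

lemma lam_adj:
  assumes "Z \<in> MH (Suc n)"
  shows "ip (Suc n) (lam n Y) Z = ip n Y (lamstar n Z)"
proof -
  have "(\<Sum>I\<in>words N (Suc n). \<Sum>J\<in>words N (Suc n). cnj (lid Y I J) * Z I J) =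
     (\<Sum>a<N. \<Sum>I\<in>words N n. \<Sum>b<N. \<Sum>J\<in>words N n. cnj (lid Y (a # I) (b # J)) * Z (a # I) (b # J))"
    by (simp add: sum_words_Suc)
  also have "\<dots> = (\<Sum>a<N. \<Sum>I\<in>words N n. \<Sum>b<N. if b = a then (\<Sum>J\<in>words N n. cnj (Y I J) * Z (a # I) (a # J)) else 0)"
    by (intro sum.cong refl) (auto simp: lid_def)
  also have "\<dots> = (\<Sum>a<N. \<Sum>I\<in>words N n. \<Sum>J\<in>words N n. cnj (Y I J) * Z (a # I) (a # J))"
    by simp
  also have "\<dots> = (\<Sum>I\<in>words N n. \<Sum>J\<in>words N n. cnj (Y I J) * tau Z I J)"
    by (simp add: ptrace_first_def sum_distrib_left sum.swap[of _ "{..<N}"])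
  finally have "ip (Suc n) (lam n Y) Z = (\<Sum>I\<in>words N n. \<Sum>J\<in>words N n. cnj (Y I J) * tau Z I J) / of_real (d (Suc n))"
    unfolding lam_def ip_compr[OF assms] by (simp add: ip_def)
  also have "\<dots> = ip n Y (lamstar n Z)"
    unfolding lamstar_def ip_scale by (simp add: ip_def c_Suc_d)
  finally show ?thesis .
qed

lemma kap_adj:
  assumes "Z \<in> MH (Suc n)"
  shows "ip (Suc n) (kap n Y) Z = ip n Y (kapstar n Z)"
proof -
  have "(\<Sum>I\<in>words N (Suc n). \<Sum>J\<in>words N (Suc n). cnj (rid Y I J) * Z I J) =
     (\<Sum>I\<in>words N n. \<Sum>a<N. \<Sum>J\<in>words N n. \<Sum>b<N. cnj (rid Y (I @ [a]) (J @ [b])) * Z (I @ [a]) (J @ [b]))"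
    by (simp add: sum_words_snoc)
  also have "\<dots> = (\<Sum>I\<in>words N n. \<Sum>a<N. \<Sum>J\<in>words N n. \<Sum>b<N. if b = a then cnj (Y I J) * Z (I @ [a]) (J @ [a]) else 0)"
    by (intro sum.cong refl) (auto simp: rid_def)
  also have "\<dots> = (\<Sum>I\<in>words N n. \<Sum>a<N. \<Sum>J\<in>words N n. cnj (Y I J) * Z (I @ [a]) (J @ [a]))"
    by simp
  also have "\<dots> = (\<Sum>I\<in>words N n. \<Sum>J\<in>words N n. cnj (Y I J) * tau' Z I J)"
    by (simp add: ptrace_last_def sum_distrib_left sum.swap[of _ "{..<N}"])
  finally have "ip (Suc n) (kap n Y) Z = (\<Sum>I\<in>words N n. \<Sum>J\<in>words N n. cnj (Y I J) * tau' Z I J) / of_real (d (Suc n))"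
    unfolding kap_def ip_compr[OF assms] by (simp add: ip_def)
  also have "\<dots> = ip n Y (kapstar n Z)"
    unfolding kapstar_def ip_scale by (simp add: ip_def c_Suc_d)
  finally show ?thesis .
qed

lemma lamstar_MH: "Z \<in> MH (Suc n) \<Longrightarrow> lamstar n Z \<in> MH n"
  unfolding lamstar_def by (intro MH_scale tau_MH)

lemma kapstar_MH: "Z \<in> MH (Suc n) \<Longrightarrow> kapstar n Z \<in> MH n"
  unfolding kapstar_def by (intro MH_scale tau'_MH)

lemma lam_scale: "lam n (\<lambda>I J. s * Y I J) = (\<lambda>I J. s * lam n Y I J)"
  using lam_lc[of n s Y 0 Y] by simp

lemma kap_scale: "kap n (\<lambda>I J. s * Y I J) = (\<lambda>I J. s * kap n Y I J)"
  using kap_lc[of n s Y 0 Y] by simp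

lemma Nc2: "c (Suc (Suc m)) * (real N - 2 * c (Suc m)) = 1 - c (Suc m) * c (Suc (Suc m))"
  using Nc[of "Suc m"] c_pos[of "Suc m"] by (simp add: field_simps)

lemma lamstar_lam:
  assumes "Y \<in> MH (Suc m)"
  shows "lamstar (Suc m) (lam (Suc m) Y) =
    lc (of_real (1 - c (Suc m) * c (Suc (Suc m)))) Y (of_real (c (Suc m) * c (Suc (Suc m)))) (lam m (lamstar m Y))"
  unfolding lamstar_def tau_lam[OF assms] lam_scale Nc2[symmetric]
  by (simp add: algebra_simps power2_eq_square)

lemma kapstar_kap:
  assumes "Y \<in> MH (Suc m)"
  shows "kapstar (Suc m) (kap (Suc m) Y) =
    lc (of_real (1 - c (Suc m) * c (Suc (Suc m)))) Y (of_real (c (Suc m) * c (Suc (Suc m)))) (kap m (kapstar m Y))"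
  unfolding kapstar_def tau'_kap[OF assms] kap_scale Nc2[symmetric]
  by (simp add: algebra_simps power2_eq_square)

lemma Q1: "Q (Suc 0) [a] [b] = (if a = b \<and> a < N then 1 else 0)"
  by simp

lemma MH_0: "Y \<in> MH 0 \<Longrightarrow> I \<noteq> [] \<or> J \<noteq> [] \<Longrightarrow> Y I J = 0"
  using H_supp[OF MH_fst, of Y 0 I J] H_supp[OF MH_snd, of Y 0 J I] by auto

lemma lam_0: "Y \<in> MH 0 \<Longrightarrow> lam 0 Y [a] [b] = (if a = b \<and> a < N then Y [] [] else 0)"
  by (simp add: lam_def compr_def bform_def sum_words_Suc Q1 lid_def
      if_distrib[where f="\<lambda>x. x * _"] if_distrib[where f="\<lambda>x. _ * x"] del: Q.simps cong: if_cong)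

lemma kap_0: "Y \<in> MH 0 \<Longrightarrow> kap 0 Y [a] [b] = (if a = b \<and> a < N then Y [] [] else 0)"
  by (simp add: kap_def compr_def bform_def sum_words_Suc Q1 rid_def
      if_distrib[where f="\<lambda>x. x * _"] if_distrib[where f="\<lambda>x. _ * x"] del: Q.simps cong: if_cong)

lemma lamstar_lam_0:
  assumes "Y \<in> MH 0" shows "lamstar 0 (lam 0 Y) = Y"
proof (rule ext, rule ext)
  fix I J
  have N: "c (Suc 0) * real N = 1" using N3 by (simp add: c.simps)
  show "lamstar 0 (lam 0 Y) I J = Y I J"
  proof (cases "I = [] \<and> J = []")
    case True
    have "lamstar 0 (lam 0 Y) I J = of_real (c (Suc 0) * real N) * Y [] []"
      using True assms by (simp add: lamstar_def ptrace_first_def lam_0)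
    then show ?thesis using True by (simp add: N)
  next
    case False
    then show ?thesis using MH_0[OF assms] MH_0[OF lamstar_MH[OF lam_MH]] by metis
  qed
qed

lemma kapstar_kap_0:
  assumes "Y \<in> MH 0" shows "kapstar 0 (kap 0 Y) = Y"
proof (rule ext, rule ext)
  fix I J
  have N: "c (Suc 0) * real N = 1" using N3 by (simp add: c.simps)
  show "kapstar 0 (kap 0 Y) I J = Y I J"
  proof (cases "I = [] \<and> J = []")
    case True
    have "kapstar 0 (kap 0 Y) I J = of_real (c (Suc 0) * real N) * Y [] []"
      using True assms by (simp add: kapstar_def ptrace_last_def kap_0)
    then show ?thesis using True by (simp add: N)
  next
    case False
    then show ?thesis using MH_0[OF assms] MH_0[OF kapstar_MH[OF kap_MH]] by metis
  qed
qed

lemma creation_lam: "creation lam lamstar"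
  unfolding creation_def using lam_MH lamstar_MH lam_adj lamstar_lam_0 lamstar_lam by blast

lemma creation_kap: "creation kap kapstar"
  unfolding creation_def using kap_MH kapstar_MH kap_adj kapstar_kap_0 kapstar_kap by blast

text \<open>
Legs added on different sides do not interact; this moves a new right leg past the left ones.
\<close>

lemma kap_xshift: "X \<in> MH k \<Longrightarrow> kap (k + i + j) (xshift k X i j) = xshift k X i (Suc j)"
proof (induction i)
  case (Suc i)
  then show ?case using lam_kap[of "k + i + j" "xshift k X i j"] by simp
qed simp

end

section \<open>The free *-algebra\<close>

definition sc :: "complex \<Rightarrow> ncpoly" where "sc c = Poly_Mapping.single 0 c"

lemma poly_expand:
  fixes p :: "'a \<Rightarrow>\<^sub>0 'b::comm_monoid_add"
  shows "p = (\<Sum>w\<in>Poly_Mapping.keys p. Poly_Mapping.single w (Poly_Mapping.lookup p w))"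
proof (rule poly_mapping_eqI)
  fix k
  show "Poly_Mapping.lookup p k = Poly_Mapping.lookup (\<Sum>w\<in>Poly_Mapping.keys p. Poly_Mapping.single w (Poly_Mapping.lookup p w)) k"
    by (cases "k \<in> Poly_Mapping.keys p")
      (auto simp: lookup_sum lookup_single when_def in_keys_iff sum.delta' if_distrib cong: if_cong)
qed

lemma nc_induct [case_names zero single add]:
  fixes p :: "'a \<Rightarrow>\<^sub>0 'b::comm_monoid_add"
  assumes "P 0" "\<And>w c. w \<in> A \<Longrightarrow> P (Poly_Mapping.single w c)" "\<And>p r. P p \<Longrightarrow> P r \<Longrightarrow> P (p + r)"
    and "Poly_Mapping.keys p \<subseteq> A"
  shows "P p"
proof -
  have "P (\<Sum>w\<in>F. Poly_Mapping.single w (Poly_Mapping.lookup p w))" if "finite F" "F \<subseteq> A" for F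
    using that by (induction F rule: finite_induct) (auto intro: assms)
  then show ?thesis using assms(4) by (subst poly_expand) auto
qed

lemma nc_scale_eq: "nc_scale c p = sc c * p"
  by (simp add: nc_scale_def sc_def mult_map_scale_conv_mult)

lemma sc_central: "sc c * p = p * sc c"
proof (induction p rule: nc_induct[where A=UNIV])
  case (single w a)
  then show ?case by (simp add: sc_def mult_single mult.commute)
qed (simp_all add: algebra_simps)

lemma sc_simps: "sc 0 = 0" "sc 1 = 1" "sc (a + b) = sc a + sc b" "sc (a * b) = sc a * sc b" "sc (- a) = - sc a" "sc (a - b) = sc a - sc b"
  by (simp_all add: sc_def single_add mult_single single_uminus single_diff)

lemma inj_rev: "inj rev" by (simp add: inj_def)

lemma lookup_star: "Poly_Mapping.lookup (nc_star p) w = cnj (Poly_Mapping.lookup p (rev w))"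
  unfolding nc_star_def by (simp add: map_key.rep_eq inj_rev Poly_Mapping.map.rep_eq when_def)

lemma star_add: "nc_star (p + r) = nc_star p + nc_star r"
  by (rule poly_mapping_eqI) (simp add: lookup_star lookup_add)

lemma star_diff: "nc_star (p - r) = nc_star p - nc_star r"
  by (rule poly_mapping_eqI) (simp add: lookup_star lookup_minus)

lemma star_single: "nc_star (Poly_Mapping.single w c) = Poly_Mapping.single (rev w) (cnj c)"
  by (rule poly_mapping_eqI) (auto simp: lookup_star lookup_single when_def)

lemma star_zero: "nc_star 0 = 0"
  by (rule poly_mapping_eqI) (simp add: lookup_star)

lemma star_sum: "nc_star (sum f A) = (\<Sum>x\<in>A. nc_star (f x))"
  by (induction A rule: infinite_finite_induct) (simp_all add: star_zero star_add)

lemma star_star [simp]: "nc_star (nc_star p) = p"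
  by (rule poly_mapping_eqI) (simp add: lookup_star)

lemma star_sc: "nc_star (sc c) = sc (cnj c)"
  by (simp add: sc_def star_single zero_list_def)

lemma star_one: "nc_star 1 = 1"
  using star_sc[of 1] by (simp add: sc_simps)

lemma star_mult: "nc_star (p * r) = nc_star r * nc_star p"
proof (induction p rule: nc_induct[where A=UNIV])
  case (single w a)
  show ?case
  proof (induction r rule: nc_induct[where A=UNIV])
    case (single v b)
    then show ?case by (simp add: mult_single star_single plus_list_def mult.commute)
  qed (simp_all add: algebra_simps star_add star_zero)
qed (simp_all add: algebra_simps star_add star_zero)

lemma star_gen: "nc_star (gen i j) = gen i j"
  by (simp add: gen_def star_single)

abbreviation "letters N \<equiv> lists ({..<N} \<times> {..<N})"

lemma free_single: "w \<in> letters N \<Longrightarrow> Poly_Mapping.single w c \<in> free_alg N"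
  by (simp add: free_alg_def)

lemma free_zero: "0 \<in> free_alg N"
  by (simp add: free_alg_def)

lemma free_add: "p \<in> free_alg N \<Longrightarrow> r \<in> free_alg N \<Longrightarrow> p + r \<in> free_alg N"
  unfolding free_alg_def using keys_add[of p r] by blast

lemma free_mult: "p \<in> free_alg N \<Longrightarrow> r \<in> free_alg N \<Longrightarrow> p * r \<in> free_alg N"
  unfolding free_alg_def using keys_mult[of p r] by (force simp: plus_list_def)

lemma free_sc: "sc c \<in> free_alg N"
  unfolding sc_def by (rule free_single) (simp add: zero_list_def)

lemma free_one: "1 \<in> free_alg N"
  using free_sc[of 1] by (simp add: sc_simps)

lemma free_minus: "p \<in> free_alg N \<Longrightarrow> - p \<in> free_alg N"
  by (simp add: free_alg_def)

lemma free_diff: "p \<in> free_alg N \<Longrightarrow> r \<in> free_alg N \<Longrightarrow> p - r \<in> free_alg N"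
  using free_add[of p N "- r"] free_minus by simp

lemma free_sum: "(\<And>x. x \<in> A \<Longrightarrow> f x \<in> free_alg N) \<Longrightarrow> sum f A \<in> free_alg N"
  by (induction A rule: infinite_finite_induct) (auto intro: free_add free_zero)

lemma free_star:
  assumes "p \<in> free_alg N" shows "nc_star p \<in> free_alg N"
  unfolding free_alg_def
proof (intro CollectI subsetI)
  fix w assume "w \<in> Poly_Mapping.keys (nc_star p)"
  then have "rev w \<in> Poly_Mapping.keys p" by (simp add: in_keys_iff lookup_star)
  then have "rev w \<in> letters N" using assms by (auto simp: free_alg_def)
  then show "w \<in> letters N" by (simp add: in_lists_conv_set)
qed

lemma free_gen: "i < N \<Longrightarrow> j < N \<Longrightarrow> gen i j \<in> free_alg N"
  unfolding gen_def by (rule free_single) simp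

lemmas free_intros = free_zero free_one free_sc free_add free_diff free_minus free_mult free_star free_sum free_gen

section \<open>C*-seminorms\<close>

context
  fixes N s assumes cs: "cstar_seminorm N s"
begin

lemma s_nonneg: "p \<in> free_alg N \<Longrightarrow> 0 \<le> s p"
  and s_add: "p \<in> free_alg N \<Longrightarrow> r \<in> free_alg N \<Longrightarrow> s (p + r) \<le> s p + s r"
  and s_sc: "p \<in> free_alg N \<Longrightarrow> s (sc c * p) = cmod c * s p"
  and s_mult: "p \<in> free_alg N \<Longrightarrow> r \<in> free_alg N \<Longrightarrow> s (p * r) \<le> s p * s r"
  and s_cstar: "p \<in> free_alg N \<Longrightarrow> s (nc_star p * p) = (s p)\<^sup>2"
  and s_rel1: "i < N \<Longrightarrow> j < N \<Longrightarrow> s ((\<Sum>k<N. gen i k * gen j k) - (if i = j then 1 else 0)) = 0"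
  and s_rel2: "i < N \<Longrightarrow> j < N \<Longrightarrow> s ((\<Sum>k<N. gen k i * gen k j) - (if i = j then 1 else 0)) = 0"
  using cs unfolding cstar_seminorm_def nc_scale_eq star_gen by blast+

lemma s_zero: "s 0 = 0"
  using s_sc[OF free_zero, of 0] by simp

lemma s_minus: "p \<in> free_alg N \<Longrightarrow> s (- p) = s p"
  using s_sc[of p "-1"] by (simp add: sc_simps)

lemma s_one: "s 1 \<le> 1"
proof -
  have "s 1 = (s 1)\<^sup>2" using s_cstar[OF free_one] by (simp add: star_one)
  then show ?thesis by (cases "s 1 = 0") (simp_all add: power2_eq_square)
qed

lemma s_const: "s (sc c) \<le> cmod c"
  using s_sc[OF free_one, of c] mult_left_mono[OF s_one, of "cmod c"] by simp

lemma s_star_le: "p \<in> free_alg N \<Longrightarrow> s p \<le> s (nc_star p)"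
proof -
  assume p: "p \<in> free_alg N"
  have "s p * s p \<le> s (nc_star p) * s p"
    using s_cstar[OF p] s_mult[OF free_star[OF p] p] by (simp add: power2_eq_square)
  then show ?thesis
    using s_nonneg[OF p] s_nonneg[OF free_star[OF p]] by (cases "s p = 0") auto
qed

lemma s_star: "p \<in> free_alg N \<Longrightarrow> s (nc_star p) = s p"
  using s_star_le[of p] s_star_le[of "nc_star p"] free_star[of p] by simp

lemma s_sum: "(\<And>x. x \<in> A \<Longrightarrow> f x \<in> free_alg N) \<Longrightarrow> s (sum f A) \<le> (\<Sum>x\<in>A. s (f x))"
proof (induction A rule: infinite_finite_induct)
  case (insert x F)
  have "s (f x + sum f F) \<le> s (f x) + s (sum f F)"
    using insert.prems by (intro s_add free_sum) auto
  moreover have "s (sum f F) \<le> (\<Sum>x\<in>F. s (f x))"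
    using insert by auto
  ultimately show ?case using insert.hyps by simp
qed (simp_all add: s_zero)

lemma s_sq: "a \<in> free_alg N \<Longrightarrow> nc_star a = a \<Longrightarrow> s (a * a) = (s a)\<^sup>2"
  using s_cstar[of a] by simp

text \<open>
For a self-adjoint \<open>a\<close> of norm less than 1, the element \<open>2 a\<^sup>2 - 1\<close> is the real part of the square of a unitary
\<open>a + \<i> (1 - a\<^sup>2)\<^sup>1\<^sup>/\<^sup>2\<close>.  A root is not available in the free algebra, so \<open>1 - z\<^sub>n\<close> replaces it, with
\<open>z\<^sub>n\<^sub>+\<^sub>1 = (a\<^sup>2 + z\<^sub>n\<^sup>2) / 2\<close>, and the error is controlled by the contraction rate of this iteration.
\<close>

lemma s_double_square:
  assumes a: "a \<in> free_alg N" "nc_star a = a" and lt: "s a < 1"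
  shows "s (a * a + a * a - 1) \<le> 1"
proof -
  define \<theta> where "\<theta> = (s a)\<^sup>2"
  have \<theta>: "0 \<le> \<theta>" "\<theta> < 1"
    using power_strict_mono[of "s a" 1 2] lt s_nonneg[OF a(1)] by (simp_all add: \<theta>_def)
  \<comment> \<open>the fixed point of \<open>\<zeta> \<mapsto> (\<theta> + \<zeta>\<^sup>2) / 2\<close>, hence a bound for all \<open>s (z n)\<close>\<close>
  define \<zeta> where "\<zeta> = 1 - sqrt (1 - \<theta>)"
  have \<zeta>: "0 \<le> \<zeta>" "\<zeta> < 1" using \<theta> by (simp_all add: \<zeta>_def)
  have \<zeta>_eq: "(\<theta> + \<zeta>\<^sup>2) / 2 = \<zeta>"
  proof -
    have "(sqrt (1 - \<theta>))\<^sup>2 = 1 - \<theta>" using \<theta> by simp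
    then show ?thesis by (simp add: \<zeta>_def power2_eq_square field_simps)
  qed
  define z where "z = rec_nat 0 (\<lambda>_ p. sc (1/2) * (a * a + p * p))"
  have z0: "z 0 = 0" and zS: "\<And>n. z (Suc n) = sc (1/2) * (a * a + z n * z n)"
    by (simp_all add: z_def)
  have z_free: "z n \<in> free_alg N" for n
    by (induction n) (auto simp: z0 zS intro!: free_intros a)
  have z_star: "nc_star (z n) = z n" for n
    by (induction n) (simp_all add: z0 zS star_zero star_mult star_add star_sc a sc_central)
  have z_comm: "b * z n = z n * b" if "b * a = a * b" for b n
  proof (induction n)
    case (Suc n)
    have "b * (a * a) = a * a * b" by (metis that mult.assoc)
    moreover have "b * (z n * z n) = z n * z n * b" by (metis Suc mult.assoc)
    ultimately have "b * (a * a + z n * z n) = (a * a + z n * z n) * b"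
      by (simp only: distrib_left distrib_right)
    then show ?case unfolding zS by (metis sc_central mult.assoc)
  qed (simp add: z0)
  have a_z: "a * z n = z n * a" for n by (rule z_comm) simp
  have z_z: "z m * z n = z n * z m" for m n by (rule z_comm) (simp add: a_z)
  have sz: "s (z n) \<le> \<zeta>" for n
  proof (induction n)
    case 0
    then show ?case by (simp add: z0 s_zero \<zeta>)
  next
    case (Suc n)
    have "s (z n * z n) \<le> \<zeta>\<^sup>2"
      using s_sq[OF z_free z_star, of n] power_mono[OF Suc s_nonneg[OF z_free], of 2] by simp
    moreover have "s (a * a) = \<theta>" using s_sq[OF a] by (simp add: \<theta>_def)
    ultimately have "s (a * a + z n * z n) \<le> \<theta> + \<zeta>\<^sup>2"
      using s_add[of "a * a" "z n * z n"] by (simp add: free_mult a z_free)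
    then have "s (z (Suc n)) \<le> (\<theta> + \<zeta>\<^sup>2) / 2"
      unfolding zS by (subst s_sc) (auto intro!: free_intros a z_free)
    then show ?case by (simp only: \<zeta>_eq)
  qed
  define D where "D n = s (z (Suc n) - z n)" for n
  have D: "D n \<le> \<zeta> ^ n" for n
  proof (induction n)
    case 0
    have "D 0 \<le> \<zeta>" using sz[of 1] by (simp add: D_def z0)
    then show ?case using \<zeta> by simp
  next
    case (Suc n)
    have "z (Suc (Suc n)) - z (Suc n) = sc (1/2) * (z (Suc n) * z (Suc n) - z n * z n)"
      unfolding zS[of "Suc n"] unfolding zS[of n] by (simp add: algebra_simps)
    also have "z (Suc n) * z (Suc n) - z n * z n = (z (Suc n) - z n) * (z (Suc n) + z n)"
      using z_z[of n "Suc n"] by (simp add: algebra_simps)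
    finally have "D (Suc n) = 1/2 * s ((z (Suc n) - z n) * (z (Suc n) + z n))"
      unfolding D_def by (simp add: s_sc free_intros z_free)
    also have "\<dots> \<le> 1/2 * (D n * (\<zeta> + \<zeta>))"
    proof (intro mult_left_mono)
      have "s ((z (Suc n) - z n) * (z (Suc n) + z n)) \<le> D n * s (z (Suc n) + z n)"
        unfolding D_def by (intro s_mult free_intros z_free)
      also have "\<dots> \<le> D n * (\<zeta> + \<zeta>)"
        using order.trans[OF s_add[OF z_free z_free] add_mono[OF sz sz]]
        by (intro mult_left_mono) (auto simp: D_def intro!: s_nonneg free_intros z_free)
      finally show "s ((z (Suc n) - z n) * (z (Suc n) + z n)) \<le> D n * (\<zeta> + \<zeta>)" .
    qed simp
    also have "\<dots> \<le> \<zeta> ^ Suc n"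
      using mult_left_mono[OF Suc \<zeta>(1)] by (simp add: mult.commute)
    finally show ?case .
  qed
  have bound: "s (a * a + a * a - 1) \<le> 1 + 4 * D n" for n
  proof -
    define J where "J = sc \<i>"
    define r where "r = 1 - z n"
    define E where "E = (z (Suc n) - z n) + (z (Suc n) - z n)"
    have J: "J * J = -1" "nc_star J = - J" "J \<in> free_alg N"
      using sc_simps(4)[of \<i> \<i>] by (simp_all add: J_def sc_simps star_sc free_sc)
    have r: "r \<in> free_alg N" "nc_star r = r" "a * r = r * a"
      by (simp_all add: r_def free_intros z_free star_diff star_one z_star a_z algebra_simps)
    have E: "E \<in> free_alg N" "s E \<le> 2 * D n"
      unfolding E_def D_def using s_add[of "z (Suc n) - z n" "z (Suc n) - z n"]
      by (auto intro!: free_intros z_free)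
    have two: "z (Suc n) + z (Suc n) = a * a + z n * z n"
      using sc_simps(3)[of "1/2" "1/2"] unfolding zS distrib_right[symmetric] by (simp add: sc_simps)
    then have E_eq: "a * a + r * r = 1 + E"
      by (simp add: E_def r_def algebra_simps)
    \<comment> \<open>the approximate unitary; \<open>u\<^sup>* u = 1 + E\<close>, and \<open>a\<^sup>2 - r\<^sup>2\<close> is the real part of \<open>u\<^sup>2\<close>\<close>
    define u where "u = a + J * r"
    have u: "u \<in> free_alg N" unfolding u_def by (intro free_intros a J r)
    have us: "nc_star u = a - J * r"
      by (simp add: u_def star_add star_mult a r J) (simp add: J_def sc_central)
    have aJr: "a * (J * r) = J * (a * r)" "J * r * a = J * (a * r)"
      using r(3) by (metis J_def sc_central mult.assoc, metis mult.assoc)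
    have JrJr: "J * r * (J * r) = - (r * r)"
    proof -
      have rJ: "r * J = J * r" by (simp add: J_def sc_central)
      have "J * r * (J * r) = J * (r * J) * r" by (simp only: mult.assoc)
      also have "\<dots> = (J * J) * (r * r)" by (simp only: rJ mult.assoc)
      finally show ?thesis by (simp add: J)
    qed
    have "nc_star u * u = a * a + r * r"
      unfolding us unfolding u_def by (simp add: left_diff_distrib distrib_left aJr JrJr)
    then have su: "(s u)\<^sup>2 \<le> 1 + 2 * D n"
      using s_cstar[OF u] s_add[OF free_one E(1)] s_one E(2) unfolding E_eq by simp
    have "u * u + nc_star u * nc_star u = (a * a - r * r) + (a * a - r * r)"
      unfolding us unfolding u_def by (simp add: distrib_left distrib_right left_diff_distrib right_diff_distrib aJr JrJr)
    then have half: "a * a - r * r = sc (1/2) * (u * u + nc_star u * nc_star u)"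
      using sc_simps(3)[of "1/2" "1/2"] by (simp add: distrib_left sc_simps flip: distrib_right)
    have "s (a * a - r * r) \<le> 1/2 * ((s u)\<^sup>2 + (s u)\<^sup>2)"
    proof -
      have "s (u * u) \<le> (s u)\<^sup>2" using s_mult[OF u u] by (simp add: power2_eq_square)
      moreover have "s (nc_star u * nc_star u) \<le> (s u)\<^sup>2"
        using s_mult[OF free_star[OF u] free_star[OF u]] by (simp add: power2_eq_square s_star u)
      ultimately have "s (u * u + nc_star u * nc_star u) \<le> (s u)\<^sup>2 + (s u)\<^sup>2"
        using s_add[of "u * u" "nc_star u * nc_star u"] by (simp add: free_intros u)
      then show ?thesis unfolding half by (subst s_sc) (simp_all add: free_intros u)
    qed
    moreover have eq: "a * a + a * a - 1 = (a * a - r * r) + E"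
      using E_eq by (simp add: algebra_simps)
    have "s (a * a + a * a - 1) \<le> s (a * a - r * r) + s E"
      unfolding eq by (intro s_add E(1) free_intros a r)
    ultimately show ?thesis using su E(2) by simp
  qed
  have "(\<lambda>n. 1 + 4 * \<zeta> ^ n) \<longlonglongrightarrow> 1 + 4 * 0"
    using \<zeta> by (intro tendsto_intros LIMSEQ_power_zero) simp
  moreover have "s (a * a + a * a - 1) \<le> 1 + 4 * \<zeta> ^ n" for n
    using bound[of n] D[of n] by simp
  ultimately show ?thesis by (intro LIMSEQ_le_const[of _ 1]) auto
qed

text \<open>
Positivity of squares in the only form in which it is needed: rescaling \<open>a\<close> in \<open>s_double_square\<close>.
\<close>

lemma s_pos:
  assumes a: "a \<in> free_alg N" "nc_star a = a" and t: "0 < t" "(s a)\<^sup>2 < 2 * t"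
  shows "s (sc (of_real t) - a * a) \<le> t"
proof -
  define b where "b = sc (of_real (1 / sqrt (2 * t))) * a"
  have b: "b \<in> free_alg N" "nc_star b = b"
    unfolding b_def using a by (simp_all add: free_intros star_mult star_sc sc_central)
  have "s b = s a / sqrt (2 * t)" unfolding b_def s_sc[OF a(1)] norm_of_real using t by simp
  moreover have "s a < sqrt (2 * t)" using t(2) by (rule real_less_rsqrt)
  ultimately have "s b < 1" using t by simp
  then have 1: "s (b * b + b * b - 1) \<le> 1" by (rule s_double_square[OF b])
  have bb: "b * b = sc (of_real (1 / (2 * t))) * (a * a)"
  proof -
    let ?C = "sc (of_real (1 / sqrt (2 * t)))"
    have "b * b = ?C * (a * ?C) * a" unfolding b_def by (simp only: mult.assoc)
    also have "a * ?C = ?C * a" by (rule sc_central[symmetric])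
    also have "?C * (?C * a) * a = (?C * ?C) * (a * a)" by (simp only: mult.assoc)
    finally have "b * b = (?C * ?C) * (a * a)" .
    moreover have "?C * ?C = sc (of_real (1 / (2 * t)))"
      unfolding sc_simps(4)[symmetric] of_real_mult[symmetric] using t by simp
    ultimately show ?thesis by simp
  qed
  have "sc (of_real (- t)) * (b * b + b * b - 1) = sc (of_real t) - a * a"
  proof -
    have "sc (of_real (- t)) * (b * b) + sc (of_real (- t)) * (b * b) = - (a * a)"
    proof -
      have X: "sc (of_real (- t)) * (b * b) = sc (- (1/2)) * (a * a)"
        unfolding bb mult.assoc[symmetric] sc_simps(4)[symmetric] of_real_mult[symmetric] using t by simp
      have h: "sc (- (1/2)) + sc (- (1/2)) = - 1"
        using sc_simps(3)[of "- (1/2)" "- (1/2)"] by (simp add: sc_simps(2,5))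
      show ?thesis unfolding X distrib_right[symmetric] h by simp
    qed
    then show ?thesis by (simp add: right_diff_distrib distrib_left sc_simps)
  qed
  then have "s (sc (of_real t) - a * a) = t * s (b * b + b * b - 1)"
    using s_sc[of "b * b + b * b - 1" "of_real (- t)"] t by (simp add: free_intros b)
  then show ?thesis using 1 t by simp
qed

text \<open>
The squares \<open>y\<^sub>k\<close> of the generators of one column add up to 1.  With \<open>s(t\<^sub>k - y\<^sub>k) \<le> t\<^sub>k\<close> from \<open>s_pos\<close> for all
\<open>k \<noteq> i\<close>, the element \<open>y\<^sub>i + (T - 1)\<close> has seminorm at most \<open>T = 1 + \<Sum>\<^sub>k t\<^sub>k\<close>.  If \<open>y\<^sub>i\<close> has seminorm \<open>\<tau>\<close>, then also
\<open>s(y\<^sub>i - t) \<le> t\<close> for \<open>t > \<tau> / 2\<close>, and the identity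
\<open>(T - 1 + t) y\<^sub>i = t (T - 1 + y\<^sub>i) + (T - 1) (y\<^sub>i - t)\<close> yields \<open>\<tau>\<^sup>2 \<le> \<tau>\<close> as \<open>t\<close> tends to \<open>\<tau> / 2\<close>.
\<close>

lemma s_gen:
  assumes ij: "i < N" "j < N"
  shows "s (gen i j) \<le> 1"
proof -
  define y where "y = gen i j * gen i j"
  define \<tau> where "\<tau> = (s (gen i j))\<^sup>2"
  define tk where "tk k = (s (gen k j))\<^sup>2 / 2 + 1" for k
  define T where "T = 1 + (\<Sum>k\<in>{..<N} - {i}. tk k)"
  have tk: "0 < tk k" "s (sc (of_real (tk k)) - gen k j * gen k j) \<le> tk k" if "k < N" for k
  proof -
    show "0 < tk k" by (simp add: tk_def add_nonneg_pos)
    then show "s (sc (of_real (tk k)) - gen k j * gen k j) \<le> tk k"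
      using that ij by (intro s_pos free_gen star_gen) (simp_all add: tk_def)
  qed
  have T: "1 \<le> T" unfolding T_def using tk by (force intro!: sum_nonneg simp: less_imp_le)
  have y: "y \<in> free_alg N" "s y = \<tau>"
    unfolding y_def \<tau>_def using ij by (simp_all add: free_intros s_sq star_gen)
  have sum_sc: "sc (of_real (sum f A)) = (\<Sum>k\<in>A. sc (of_real (f k)))" for f :: "nat \<Rightarrow> real" and A
    by (induction A rule: infinite_finite_induct) (simp_all add: sc_simps)
  define x where "x = (\<Sum>k<N. gen k j * gen k j) - 1"
  have x: "x \<in> free_alg N" "s x = 0"
    unfolding x_def using ij s_rel2[of j j] by (auto intro!: free_intros)
  have "sc (of_real (T - 1)) + y = (\<Sum>k\<in>{..<N} - {i}. sc (of_real (tk k)) - gen k j * gen k j) + (1 + x)"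
  proof -
    have "(\<Sum>k<N. gen k j * gen k j) = y + (\<Sum>k\<in>{..<N} - {i}. gen k j * gen k j)"
      unfolding y_def using ij by (intro sum.remove) auto
    then show ?thesis by (simp add: x_def T_def sum_sc sum_subtractf del: of_real_sum)
  qed
  also have "s \<dots> \<le> (\<Sum>k\<in>{..<N} - {i}. tk k) + (1 + 0)"
  proof -
    let ?f = "\<lambda>k. sc (of_real (tk k)) - gen k j * gen k j"
    have F: "?f k \<in> free_alg N" if "k \<in> {..<N} - {i}" for k using that ij by (auto intro!: free_intros)
    have "s (sum ?f ({..<N} - {i}) + (1 + x)) \<le> s (sum ?f ({..<N} - {i})) + s (1 + x)"
      by (intro s_add free_sum free_add free_one F x(1))
    moreover have "s (sum ?f ({..<N} - {i})) \<le> (\<Sum>k\<in>{..<N} - {i}. tk k)"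
      using F tk by (intro order.trans[OF s_sum] sum_mono) auto
    moreover have "s (1 + x) \<le> 1 + 0"
      using s_add[OF free_one x(1)] s_one x(2) by simp
    ultimately show ?thesis by simp
  qed
  finally have 1: "s (sc (of_real (T - 1)) + y) \<le> T" by (simp add: T_def)
  have "\<tau> * (T - 1 + \<tau> / 2) \<le> \<tau> / 2 * (2 * T - 1)"
  proof (rule field_le_epsilon)
    fix e :: real assume e: "0 < e"
    define t where "t = \<tau> / 2 + e / (2 * T - 1)"
    have "0 \<le> \<tau>" by (simp add: \<tau>_def)
    then have t: "0 < t" "\<tau> < 2 * t" "\<tau> / 2 \<le> t" using e T by (auto simp: t_def intro!: add_nonneg_pos divide_pos_pos)
    have 2: "s (y - sc (of_real t)) \<le> t"
      using s_pos[of "gen i j" t] s_minus[of "y - sc (of_real t)"] t ij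
      by (simp add: y_def \<tau>_def free_intros star_gen)
    have "sc (of_real (T - 1 + t)) * y = sc (of_real t) * (sc (of_real (T - 1)) + y) + sc (of_real (T - 1)) * (y - sc (of_real t))"
      using sc_simps(4)[of "of_real t" "of_real (T - 1)"] sc_simps(4)[of "of_real (T - 1)" "of_real t"]
      by (simp add: distrib_left distrib_right right_diff_distrib sc_simps(3) mult.commute[of "complex_of_real t"]
          flip: sc_simps(4)) (simp add: algebra_simps sc_simps(3,6))
    then have "s (sc (of_real (T - 1 + t)) * y) \<le> s (sc (of_real t) * (sc (of_real (T - 1)) + y)) + s (sc (of_real (T - 1)) * (y - sc (of_real t)))"
      using y by (simp only:) (intro s_add free_intros)
    then have "(T - 1 + t) * \<tau> \<le> t * s (sc (of_real (T - 1)) + y) + (T - 1) * s (y - sc (of_real t))"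
      using y t T by (simp add: s_sc free_intros del: of_real_add of_real_diff)
    also have "\<dots> \<le> t * T + (T - 1) * t"
      using 1 2 t T by (intro add_mono mult_left_mono) auto
    also have "\<dots> = t * (2 * T - 1)" by (simp add: algebra_simps)
    also have "\<dots> = \<tau> / 2 * (2 * T - 1) + e"
      unfolding t_def distrib_right using T by simp
    finally have "(T - 1 + t) * \<tau> \<le> \<tau> / 2 * (2 * T - 1) + e" .
    moreover have "\<tau> * (T - 1 + \<tau> / 2) \<le> (T - 1 + t) * \<tau>"
      using mult_left_mono[OF t(3) \<open>0 \<le> \<tau>\<close>] by (simp add: algebra_simps)
    ultimately show "\<tau> * (T - 1 + \<tau> / 2) \<le> \<tau> / 2 * (2 * T - 1) + e" by linarith
  qed
  then have "\<tau> * (\<tau> - 1) \<le> 0" by (simp add: field_simps)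
  then have "\<tau> \<le> 1" by (auto simp: mult_le_0_iff \<tau>_def)
  then show ?thesis
    unfolding \<tau>_def by (metis abs_le_square_iff abs_of_nonneg abs_one free_gen ij one_power2 s_nonneg)
qed

lemma s_word: "w \<in> letters N \<Longrightarrow> s (Poly_Mapping.single w c) \<le> cmod c"
proof (induction w)
  case Nil
  then show ?case using s_const[of c] by (simp add: sc_def zero_list_def)
next
  case (Cons l w)
  obtain i j where l: "l = (i, j)" by (cases l)
  have eq: "Poly_Mapping.single (l # w) c = gen i j * Poly_Mapping.single w c"
    by (simp add: gen_def mult_single plus_list_def l)
  have "s (gen i j * Poly_Mapping.single w c) \<le> s (gen i j) * s (Poly_Mapping.single w c)"
    using Cons l by (intro s_mult free_gen free_single) auto
  also have "\<dots> \<le> 1 * cmod c"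
    using Cons l by (intro mult_mono s_gen) (auto intro!: s_nonneg free_single)
  finally show ?case by (simp add: eq)
qed

lemma s_le_l1: "p \<in> free_alg N \<Longrightarrow> s p \<le> (\<Sum>w\<in>Poly_Mapping.keys p. cmod (Poly_Mapping.lookup p w))"
proof -
  assume p: "p \<in> free_alg N"
  then have k: "w \<in> letters N" if "w \<in> Poly_Mapping.keys p" for w using that by (auto simp: free_alg_def)
  have "s p = s (\<Sum>w\<in>Poly_Mapping.keys p. Poly_Mapping.single w (Poly_Mapping.lookup p w))"
    by (subst poly_expand) simp
  also have "\<dots> \<le> (\<Sum>w\<in>Poly_Mapping.keys p. s (Poly_Mapping.single w (Poly_Mapping.lookup p w)))"
    by (intro s_sum free_single k)
  also have "\<dots> \<le> (\<Sum>w\<in>Poly_Mapping.keys p. cmod (Poly_Mapping.lookup p w))"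
    by (intro sum_mono s_word k)
  finally show ?thesis .
qed

end

section \<open>The universal seminorm\<close>

lemma zero_cstar_seminorm: "cstar_seminorm N (\<lambda>_. 0)"
  by (simp add: cstar_seminorm_def)

text \<open>
The universal seminorm is a supremum of reals, so it majorizes a given seminorm only if the supremum is taken over
a bounded set; this is what the bound on generators provides.
\<close>

lemma seminorms_bdd: "p \<in> free_alg N \<Longrightarrow> bdd_above ((\<lambda>s. s p) ` {s. cstar_seminorm N s})"
  using s_le_l1 by (intro bdd_aboveI[of _ "\<Sum>w\<in>Poly_Mapping.keys p. cmod (Poly_Mapping.lookup p w)"]) auto

lemma le_unorm: "cstar_seminorm N s \<Longrightarrow> p \<in> free_alg N \<Longrightarrow> s p \<le> unorm N p"
  unfolding unorm_def by (rule cSUP_upper) (auto intro: seminorms_bdd)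

lemma unorm_le: "(\<And>s. cstar_seminorm N s \<Longrightarrow> s p \<le> B) \<Longrightarrow> unorm N p \<le> B"
  unfolding unorm_def using zero_cstar_seminorm by (intro cSUP_least) auto

lemma un_nonneg: "p \<in> free_alg N \<Longrightarrow> 0 \<le> unorm N p"
  using le_unorm[OF zero_cstar_seminorm] by simp

lemma un_add: "p \<in> free_alg N \<Longrightarrow> r \<in> free_alg N \<Longrightarrow> unorm N (p + r) \<le> unorm N p + unorm N r"
proof (rule unorm_le)
  fix s assume "p \<in> free_alg N" "r \<in> free_alg N" "cstar_seminorm N s"
  then show "s (p + r) \<le> unorm N p + unorm N r"
    using s_add[of N s p r] le_unorm[of N s p] le_unorm[of N s r] by linarith
qed

lemma un_mult: "p \<in> free_alg N \<Longrightarrow> r \<in> free_alg N \<Longrightarrow> unorm N (p * r) \<le> unorm N p * unorm N r"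
proof (rule unorm_le)
  fix s assume "p \<in> free_alg N" "r \<in> free_alg N" "cstar_seminorm N s"
  then show "s (p * r) \<le> unorm N p * unorm N r"
    using s_mult[of N s p r] mult_mono[OF le_unorm[of N s p] le_unorm[of N s r]] un_nonneg[of p N] s_nonneg[of N s r]
    by linarith
qed

lemma un_sc_le: "p \<in> free_alg N \<Longrightarrow> unorm N (sc c * p) \<le> cmod c * unorm N p"
  by (rule unorm_le, subst s_sc) (auto intro: mult_left_mono le_unorm)

lemma un_zero: "unorm N 0 = 0"
  by (rule antisym[OF unorm_le un_nonneg[OF free_zero]]) (simp add: s_zero)

lemma un_minus: "p \<in> free_alg N \<Longrightarrow> unorm N (- p) = unorm N p"
  using un_sc_le[of p N "-1"] un_sc_le[of "- p" N "-1"] by (simp add: sc_simps free_minus)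

lemma un_diff_commute: "p \<in> free_alg N \<Longrightarrow> r \<in> free_alg N \<Longrightarrow> unorm N (p - r) = unorm N (r - p)"
  using un_minus[of "p - r" N] by (simp add: free_diff)

lemma un_star_le: "p \<in> free_alg N \<Longrightarrow> unorm N (nc_star p) \<le> unorm N p"
  by (rule unorm_le, subst s_star) (auto intro: le_unorm)

lemma un_triangle: "p \<in> free_alg N \<Longrightarrow> r \<in> free_alg N \<Longrightarrow> v \<in> free_alg N \<Longrightarrow> unorm N (p - v) \<le> unorm N (p - r) + unorm N (r - v)"
  using un_add[of "p - r" N "r - v"] by (simp add: free_diff)

lemma un_rel1: "i < N \<Longrightarrow> j < N \<Longrightarrow> unorm N ((\<Sum>k<N. gen i k * gen j k) - (if i = j then 1 else 0)) = 0"
  by (rule antisym[OF unorm_le un_nonneg], simp only: s_rel1) (auto intro!: free_intros)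

lemma un_rel2: "i < N \<Longrightarrow> j < N \<Longrightarrow> unorm N ((\<Sum>k<N. gen k i * gen k j) - (if i = j then 1 else 0)) = 0"
  by (rule antisym[OF unorm_le un_nonneg], simp only: s_rel2) (auto intro!: free_intros)

section \<open>The separated completion\<close>

text \<open>
Equality in the universal \<open>C\<^sup>*\<close>-algebra of the images of two polynomials (see \<open>emb_eq\<close>).
\<close>

definition eqv :: "nat \<Rightarrow> ncpoly \<Rightarrow> ncpoly \<Rightarrow> bool" where
  "eqv N p r \<longleftrightarrow> p \<in> free_alg N \<and> r \<in> free_alg N \<and> unorm N (p - r) = 0"

lemma eqv_refl: "p \<in> free_alg N \<Longrightarrow> eqv N p p"
  by (simp add: eqv_def un_zero)

lemma eqv_sym: "eqv N p r \<Longrightarrow> eqv N r p"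
  using un_diff_commute[of p N r] by (simp add: eqv_def)

lemma eqv_trans: "eqv N p r \<Longrightarrow> eqv N r v \<Longrightarrow> eqv N p v"
  using un_triangle[of p N r v] un_nonneg[of "p - v" N] free_diff[of p N v] by (auto simp: eqv_def)

lemma eqvI: "p \<in> free_alg N \<Longrightarrow> r \<in> free_alg N \<Longrightarrow> unorm N (p - r) \<le> 0 \<Longrightarrow> eqv N p r"
  using un_nonneg[of "p - r" N] by (simp add: eqv_def free_diff)

lemma eqv_add:
  assumes "eqv N p r" "eqv N p' r'" shows "eqv N (p + p') (r + r')"
proof (rule eqvI)
  have "unorm N ((p - r) + (p' - r')) \<le> unorm N (p - r) + unorm N (p' - r')"
    using assms by (intro un_add free_diff) (auto simp: eqv_def)
  then show "unorm N (p + p' - (r + r')) \<le> 0" using assms by (simp add: eqv_def algebra_simps)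
qed (use assms in \<open>auto simp: eqv_def intro: free_add\<close>)

lemma eqv_sum: "(\<And>x. x \<in> A \<Longrightarrow> eqv N (f x) (g x)) \<Longrightarrow> eqv N (sum f A) (sum g A)"
  by (induction A rule: infinite_finite_induct) (auto intro: eqv_add eqv_refl free_zero)

lemma eqv_mult_left:
  assumes "eqv N p r" "v \<in> free_alg N" shows "eqv N (v * p) (v * r)"
proof (rule eqvI)
  have "unorm N (v * (p - r)) \<le> unorm N v * unorm N (p - r)"
    using assms by (intro un_mult free_diff) (auto simp: eqv_def)
  then show "unorm N (v * p - v * r) \<le> 0" using assms by (simp add: eqv_def right_diff_distrib)
qed (use assms in \<open>auto simp: eqv_def intro: free_mult\<close>)

lemma eqv_mult_right:
  assumes "eqv N p r" "v \<in> free_alg N" shows "eqv N (p * v) (r * v)"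
proof (rule eqvI)
  have "unorm N ((p - r) * v) \<le> unorm N (p - r) * unorm N v"
    using assms by (intro un_mult free_diff) (auto simp: eqv_def)
  then show "unorm N (p * v - r * v) \<le> 0" using assms by (simp add: eqv_def left_diff_distrib)
qed (use assms in \<open>auto simp: eqv_def intro: free_mult\<close>)

lemma eqv_rel1: "i < N \<Longrightarrow> j < N \<Longrightarrow> eqv N (\<Sum>k<N. gen i k * gen j k) (if i = j then 1 else 0)"
  unfolding eqv_def using un_rel1[of i N j] by (auto intro!: free_intros)

lemma eqv_rel2: "i < N \<Longrightarrow> j < N \<Longrightarrow> eqv N (\<Sum>k<N. gen k i * gen k j) (if i = j then 1 else 0)"
  unfolding eqv_def using un_rel2[of i N j] by (auto intro!: free_intros)

lemma const_seq: "p \<in> free_alg N \<Longrightarrow> (\<lambda>_. p) \<in> cu_seqs N"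
  by (simp add: cu_seqs_def un_zero)

lemma null_le:
  fixes a b :: "nat \<Rightarrow> real"
  assumes "b \<longlonglongrightarrow> 0" "\<And>n. a n \<le> b n" "\<And>n. 0 \<le> a n"
  shows "a \<longlonglongrightarrow> 0"
  using assms by (intro tendsto_sandwich[OF _ _ tendsto_const assms(1)]) auto

lemma cu_class_eq:
  assumes F: "\<And>n. f n \<in> free_alg N" "\<And>n. g n \<in> free_alg N"
    and lim: "(\<lambda>n. unorm N (f n - g n)) \<longlonglongrightarrow> 0"
  shows "cu_class N f = cu_class N g"
proof -
  have half: "v \<in> cu_class N g" if "v \<in> cu_class N f" and F: "\<And>n. f n \<in> free_alg N" "\<And>n. g n \<in> free_alg N"
    and lim: "(\<lambda>n. unorm N (f n - g n)) \<longlonglongrightarrow> 0" for f g v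
  proof -
    have v: "v \<in> cu_seqs N" "(\<lambda>n. unorm N (f n - v n)) \<longlonglongrightarrow> 0" "\<And>n. v n \<in> free_alg N"
      using that(1) by (auto simp: cu_class_def cu_seqs_def)
    have "(\<lambda>n. unorm N (g n - v n)) \<longlonglongrightarrow> 0"
    proof (rule null_le)
      show "(\<lambda>n. unorm N (f n - g n) + unorm N (f n - v n)) \<longlonglongrightarrow> 0"
        using tendsto_add[OF lim v(2)] by simp
      show "unorm N (g n - v n) \<le> unorm N (f n - g n) + unorm N (f n - v n)" for n
        using un_triangle[OF F(2) F(1) v(3)] un_diff_commute[OF F(2) F(1)] by simp
    qed (use F v in \<open>auto intro!: un_nonneg free_diff\<close>)
    then show ?thesis using v by (simp add: cu_class_def)
  qed
  have "(\<lambda>n. unorm N (g n - f n)) \<longlonglongrightarrow> 0" using lim un_diff_commute[OF F(1) F(2)] by simp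
  then show ?thesis using half[of _ f g] half[of _ g f] F lim by blast
qed

lemma emb_memD: "f \<in> cu_emb N p \<Longrightarrow> f n \<in> free_alg N"
  and emb_mem_lim: "f \<in> cu_emb N p \<Longrightarrow> (\<lambda>n. unorm N (p - f n)) \<longlonglongrightarrow> 0"
  by (auto simp: cu_emb_def cu_class_def cu_seqs_def)

lemma emb_self: "p \<in> free_alg N \<Longrightarrow> (\<lambda>_. p) \<in> cu_emb N p"
  by (simp add: cu_emb_def cu_class_def const_seq un_zero)

lemma emb_eq: "p \<in> free_alg N \<Longrightarrow> r \<in> free_alg N \<Longrightarrow> cu_emb N p = cu_emb N r \<longleftrightarrow> eqv N p r"
proof
  assume pr: "p \<in> free_alg N" "r \<in> free_alg N" and "cu_emb N p = cu_emb N r"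
  then have "(\<lambda>_. r) \<in> cu_emb N p" using emb_self by simp
  from emb_mem_lim[OF this] show "eqv N p r" using pr by (simp add: eqv_def LIMSEQ_const_iff)
next
  assume pr: "p \<in> free_alg N" "r \<in> free_alg N" and "eqv N p r"
  then show "cu_emb N p = cu_emb N r"
    unfolding cu_emb_def by (intro cu_class_eq) (auto simp: eqv_def)
qed

lemma emb_carrier: "p \<in> free_alg N \<Longrightarrow> cu_emb N p \<in> cu_carrier N"
  by (simp add: cu_carrier_def cu_emb_def const_seq)

text \<open>
The operations on classes are unions over representatives; they are well defined as soon as all members of the union
agree.
\<close>

lemma union_const:
  assumes "x \<noteq> {}" "\<And>f. f \<in> x \<Longrightarrow> C f = D"
  shows "(\<Union>f\<in>x. C f) = D"
  using assms by auto

lemma cu_add_emb: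
  assumes p: "p \<in> free_alg N" and r: "r \<in> free_alg N"
  shows "cu_add N (cu_emb N p) (cu_emb N r) = cu_emb N (p + r)"
  unfolding cu_add_def
proof (intro union_const)
  fix f g assume f: "f \<in> cu_emb N p" and g: "g \<in> cu_emb N r"
  show "cu_class N (\<lambda>n. f n + g n) = cu_emb N (p + r)"
    unfolding cu_emb_def
  proof (rule cu_class_eq[symmetric])
    show "(\<lambda>n. unorm N (p + r - (f n + g n))) \<longlonglongrightarrow> 0"
    proof (rule null_le)
      show "(\<lambda>n. unorm N (p - f n) + unorm N (r - g n)) \<longlonglongrightarrow> 0"
        using tendsto_add[OF emb_mem_lim[OF f] emb_mem_lim[OF g]] by simp
      have "unorm N (p + r - (f n + g n)) \<le> unorm N (p - f n) + unorm N (r - g n)" for n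
        using un_add[of "p - f n" N "r - g n"] p r emb_memD[OF f, of n] emb_memD[OF g, of n]
        by (simp add: free_diff algebra_simps)
      then show "unorm N (p + r - (f n + g n)) \<le> unorm N (p - f n) + unorm N (r - g n)" for n
        by simp
    qed (use p r emb_memD[OF f] emb_memD[OF g] in \<open>auto intro!: un_nonneg free_diff free_add\<close>)
  qed (use p r emb_memD[OF f] emb_memD[OF g] in \<open>auto intro!: free_add\<close>)
qed (use p r emb_self in blast)+

lemma cu_mult_emb:
  assumes p: "p \<in> free_alg N" and r: "r \<in> free_alg N"
  shows "cu_mult N (cu_emb N p) (cu_emb N r) = cu_emb N (p * r)"
  unfolding cu_mult_def
proof (intro union_const)
  fix f g assume f: "f \<in> cu_emb N p" and g: "g \<in> cu_emb N r"
  show "cu_class N (\<lambda>n. f n * g n) = cu_emb N (p * r)"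
    unfolding cu_emb_def
  proof (rule cu_class_eq[symmetric])
    let ?a = "\<lambda>n. unorm N (p - f n)" and ?b = "\<lambda>n. unorm N (r - g n)"
    show "(\<lambda>n. unorm N (p * r - f n * g n)) \<longlonglongrightarrow> 0"
    proof (rule null_le)
      have "(\<lambda>n. ?a n * unorm N r + unorm N p * ?b n + ?a n * ?b n) \<longlonglongrightarrow> 0 * unorm N r + unorm N p * 0 + 0 * 0"
        by (intro tendsto_intros emb_mem_lim[OF f] emb_mem_lim[OF g])
      then show "(\<lambda>n. ?a n * unorm N r + unorm N p * ?b n + ?a n * ?b n) \<longlonglongrightarrow> 0" by simp
      have "unorm N (p * r - f n * g n) \<le> ?a n * unorm N r + unorm N p * ?b n + ?a n * ?b n" for n
      proof -
        have F: "p - f n \<in> free_alg N" "r - g n \<in> free_alg N"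
          using p r emb_memD[OF f, of n] emb_memD[OF g, of n] by (auto intro: free_diff)
        have eq: "p * r - f n * g n = (p - f n) * r + p * (r - g n) + (- (p - f n)) * (r - g n)"
          by (simp add: algebra_simps)
        have "unorm N (p * r - f n * g n) \<le> unorm N ((p - f n) * r + p * (r - g n)) + unorm N ((- (p - f n)) * (r - g n))"
          unfolding eq by (intro un_add free_add free_mult free_minus F p r)
        also have "\<dots> \<le> (unorm N ((p - f n) * r) + unorm N (p * (r - g n))) + unorm N ((- (p - f n)) * (r - g n))"
          by (intro add_right_mono un_add free_mult F p r)
        also have "\<dots> \<le> (?a n * unorm N r + unorm N p * ?b n) + unorm N (- (p - f n)) * ?b n"
          by (intro add_mono un_mult free_minus F p r)
        finally show ?thesis by (simp only: un_minus[OF F(1)])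
      qed
      then show "unorm N (p * r - f n * g n) \<le> ?a n * unorm N r + unorm N p * ?b n + ?a n * ?b n" for n
        by simp
    qed (use p r emb_memD[OF f] emb_memD[OF g] in \<open>auto intro!: un_nonneg free_diff free_mult\<close>)
  qed (use p r emb_memD[OF f] emb_memD[OF g] in \<open>auto intro!: free_mult\<close>)
qed (use p r emb_self in blast)+

lemma cu_scale_emb:
  assumes p: "p \<in> free_alg N"
  shows "cu_scale N c (cu_emb N p) = cu_emb N (sc c * p)"
  unfolding cu_scale_def nc_scale_eq
proof (intro union_const)
  fix f assume f: "f \<in> cu_emb N p"
  show "cu_class N (\<lambda>n. sc c * f n) = cu_emb N (sc c * p)"
    unfolding cu_emb_def
  proof (rule cu_class_eq[symmetric])
    show "(\<lambda>n. unorm N (sc c * p - sc c * f n)) \<longlonglongrightarrow> 0"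
    proof (rule null_le)
      show "(\<lambda>n. cmod c * unorm N (p - f n)) \<longlonglongrightarrow> 0"
        using tendsto_mult_left[OF emb_mem_lim[OF f], of "cmod c"] by simp
      show "unorm N (sc c * p - sc c * f n) \<le> cmod c * unorm N (p - f n)" for n
        using p emb_memD[OF f] by (auto simp: right_diff_distrib[symmetric] intro!: un_sc_le free_diff)
    qed (use p emb_memD[OF f] in \<open>auto intro!: un_nonneg free_diff free_mult free_sc\<close>)
  qed (use p emb_memD[OF f] in \<open>auto intro!: free_mult free_sc\<close>)
qed (use p emb_self in blast)

lemma cu_star_emb:
  assumes p: "p \<in> free_alg N"
  shows "cu_star N (cu_emb N p) = cu_emb N (nc_star p)"
  unfolding cu_star_def
proof (intro union_const)
  fix f assume f: "f \<in> cu_emb N p"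
  show "cu_class N (\<lambda>n. nc_star (f n)) = cu_emb N (nc_star p)"
    unfolding cu_emb_def
  proof (rule cu_class_eq[symmetric])
    show "(\<lambda>n. unorm N (nc_star p - nc_star (f n))) \<longlonglongrightarrow> 0"
    proof (rule null_le)
      show "(\<lambda>n. unorm N (p - f n)) \<longlonglongrightarrow> 0" by (rule emb_mem_lim[OF f])
      show "unorm N (nc_star p - nc_star (f n)) \<le> unorm N (p - f n)" for n
        using p emb_memD[OF f] by (auto simp: star_diff[symmetric] intro!: un_star_le free_diff)
    qed (use p emb_memD[OF f] in \<open>auto intro!: un_nonneg free_diff free_star\<close>)
  qed (use p emb_memD[OF f] in \<open>auto intro!: free_star\<close>)
qed (use p emb_self in blast)

section \<open>Matrix coefficients and the invariance of the Haar state\<close>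

text \<open>
The monomial \<open>u\<^sub>i\<^sub>1\<^sub>,\<^sub>j\<^sub>1 \<cdots> u\<^sub>i\<^sub>n\<^sub>,\<^sub>j\<^sub>n\<close>, a coefficient of the \<open>n\<close>-th tensor power of the
fundamental corepresentation.
\<close>

definition um :: "nat list \<Rightarrow> nat list \<Rightarrow> ncpoly" where
  "um I J = Poly_Mapping.single (zip I J) 1"

lemma um_free: "I \<in> words N n \<Longrightarrow> J \<in> words N n \<Longrightarrow> um I J \<in> free_alg N"
  unfolding um_def by (rule free_single) (auto simp: words_def in_lists_conv_set dest: set_zip_leftD set_zip_rightD)

lemma um_Nil: "um [] [] = 1"
  by (simp add: um_def) (metis single_one zero_list_def)

lemma um_append: "length I = length J \<Longrightarrow> um (I @ K) (J @ L) = um I J * um K L"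
  by (simp add: um_def mult_single plus_list_def)

lemma um_Cons: "um (i # I) (j # J) = gen i j * um I J"
  by (simp add: um_def gen_def mult_single plus_list_def)

lemma um_snoc: "length I = length J \<Longrightarrow> um (I @ [i]) (J @ [j]) = um I J * gen i j"
  by (simp add: um_append) (simp add: um_def gen_def)

lemma um_star: "length I = length J \<Longrightarrow> nc_star (um I J) = um (rev I) (rev J)"
  by (simp add: um_def star_single zip_rev)

lemma slice_right_superset:
  assumes "finite A" "Poly_Mapping.keys T \<subseteq> A"
  shows "slice_right \<phi> T = (\<Sum>p\<in>A. Poly_Mapping.single (fst p) (\<phi> (snd p) * Poly_Mapping.lookup T p))"
  unfolding slice_right_def case_prod_beta prod.collapse
  using assms by (intro sum.mono_neutral_left) (auto simp: in_keys_iff)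

lemma slice_right_add: "slice_right \<phi> (T + U) = slice_right \<phi> T + slice_right \<phi> U"
proof -
  let ?A = "Poly_Mapping.keys T \<union> Poly_Mapping.keys U"
  have "slice_right \<phi> (T + U) = (\<Sum>p\<in>?A. Poly_Mapping.single (fst p) (\<phi> (snd p) * Poly_Mapping.lookup (T + U) p))"
    by (rule slice_right_superset) (auto simp: keys_add)
  also have "\<dots> = slice_right \<phi> T + slice_right \<phi> U"
    by (subst (1 2) slice_right_superset[of ?A]) (simp_all add: lookup_add algebra_simps single_add sum.distrib)
  finally show ?thesis .
qed

lemma slice_right_sum_single:
  "slice_right \<phi> (\<Sum>x\<in>A. Poly_Mapping.single (f x, g x) 1) = (\<Sum>x\<in>A. sc (\<phi> (g x)) * Poly_Mapping.single (f x) 1)"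
proof (induction A rule: infinite_finite_induct)
  case (insert x F)
  have "slice_right \<phi> (Poly_Mapping.single (f x, g x) 1) = sc (\<phi> (g x)) * Poly_Mapping.single (f x) 1"
    by (simp add: slice_right_def sc_def mult_single)
  then show ?case using insert by (simp add: slice_right_add)
qed (simp_all add: slice_right_def)

lemma coprod_um:
  assumes "I \<in> words N n" "J \<in> words N n"
  shows "coprod N (um I J) = (\<Sum>M\<in>words N n. Poly_Mapping.single (zip I M, zip M J) 1)"
proof -
  have "coprod N (um I J) = prod_list (map (coprod_gen N) (zip I J))"
    by (simp add: coprod_def um_def)
  also have "\<dots> = (\<Sum>M\<in>words N n. Poly_Mapping.single (zip I M, zip M J) 1)"
    using assms
  proof (induction n arbitrary: I J)
    case 0
    then show ?case by simp (metis single_one zero_list_def zero_prod_def)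
  next
    case (Suc n)
    obtain i I' j J' where IJ: "I = i # I'" "J = j # J'" "I' \<in> words N n" "J' \<in> words N n"
      using Suc.prems by (cases I; cases J) auto
    have "prod_list (map (coprod_gen N) (zip I J)) = (\<Sum>k<N. Poly_Mapping.single ([(i, k)], [(k, j)]) 1) *
       (\<Sum>M\<in>words N n. Poly_Mapping.single (zip I' M, zip M J') 1)"
      using Suc.IH[OF IJ(3,4)] by (simp add: IJ coprod_gen_def)
    also have "\<dots> = (\<Sum>k<N. \<Sum>M\<in>words N n. Poly_Mapping.single (zip I (k # M), zip (k # M) J) 1)"
      by (simp add: sum_product mult_single IJ plus_list_def)
    finally show ?case by (simp add: sum_words_Suc)
  qed
  finally show ?thesis .
qed

definition haarpoly :: "nat \<Rightarrow> (cuelem \<Rightarrow> complex) \<Rightarrow> ncpoly \<Rightarrow> complex" where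
  "haarpoly N h p = h (cu_emb N p)"

context
  fixes N h assumes haar: "haar_state N h"
begin

lemma haarpoly_add: "p \<in> free_alg N \<Longrightarrow> r \<in> free_alg N \<Longrightarrow> haarpoly N h (p + r) = haarpoly N h p + haarpoly N h r"
  using haar unfolding haar_state_def cu_state_def haarpoly_def
  by (simp add: emb_carrier cu_add_emb[symmetric])

lemma haarpoly_sc: "p \<in> free_alg N \<Longrightarrow> haarpoly N h (sc c * p) = c * haarpoly N h p"
  using haar unfolding haar_state_def cu_state_def haarpoly_def
  by (simp add: emb_carrier cu_scale_emb[symmetric])

lemma haarpoly_one: "haarpoly N h 1 = 1"
  using haar unfolding haar_state_def cu_state_def haarpoly_def by simp

lemma haarpoly_const: "haarpoly N h (sc c) = c"
  using haarpoly_sc[OF free_one, of c] by (simp add: haarpoly_one)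

lemma haarpoly_sum: "(\<And>x. x \<in> A \<Longrightarrow> f x \<in> free_alg N) \<Longrightarrow> haarpoly N h (sum f A) = (\<Sum>x\<in>A. haarpoly N h (f x))"
proof (induction A rule: infinite_finite_induct)
  case (insert x F)
  then show ?case by (simp add: haarpoly_add free_sum)
qed (use haarpoly_const[of 0] in \<open>simp_all add: sc_simps\<close>)

lemma haarpoly_eqv: "eqv N p r \<Longrightarrow> haarpoly N h p = haarpoly N h r"
  unfolding haarpoly_def using emb_eq[of p N r] by (simp add: eqv_def)

lemma haar_inner_emb: "p \<in> free_alg N \<Longrightarrow> r \<in> free_alg N \<Longrightarrow> haar_inner N h (cu_emb N p) (cu_emb N r) = haarpoly N h (nc_star p * r)"
  by (simp add: haar_inner_def cu_star_emb cu_mult_emb free_star haarpoly_def)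

lemma haar_invariance:
  assumes I: "I \<in> words N n" and J: "J \<in> words N n"
  shows "eqv N (\<Sum>M\<in>words N n. sc (haarpoly N h (um M J)) * um I M) (sc (haarpoly N h (um I J)))"
proof -
  let ?L = "\<Sum>M\<in>words N n. sc (haarpoly N h (um M J)) * um I M"
  have "cu_emb N (slice_right (\<lambda>v. h (cu_emb N (Poly_Mapping.single v 1))) (coprod N (um I J)))
          = cu_scale N (h (cu_emb N (um I J))) (cu_emb N 1)"
    using haar um_free[OF I J] by (simp add: haar_state_def)
  also have "slice_right (\<lambda>v. h (cu_emb N (Poly_Mapping.single v 1))) (coprod N (um I J)) = ?L"
    unfolding coprod_um[OF I J] slice_right_sum_single by (simp add: haarpoly_def um_def)
  also have "cu_scale N (h (cu_emb N (um I J))) (cu_emb N 1) = cu_emb N (sc (haarpoly N h (um I J)))"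
    by (simp add: cu_scale_emb free_one haarpoly_def)
  finally have "cu_emb N ?L = cu_emb N (sc (haarpoly N h (um I J)))" .
  moreover have "?L \<in> free_alg N" using I by (auto intro!: free_intros um_free)
  ultimately show ?thesis using emb_eq free_sc by blast
qed

end

section \<open>A representation on the sum of the spaces \<open>H\<^sub>n \<otimes> H\<^sub>n\<close>\<close>

context temperley_lieb begin

text \<open>
Finitely supported elements of the sum of the spaces \<open>H\<^sub>n \<otimes> H\<^sub>n\<close>, as matrices indexed by pairs of words of the same
length.
\<close>

definition V :: "tmat set" where
  "V = {v. (\<exists>M. \<forall>I J. v I J \<noteq> 0 \<longrightarrow> length I \<le> M) \<and>
     (\<forall>J. (\<lambda>I. v I J) \<in> H (length J)) \<and> (\<forall>I. (\<lambda>J. v I J) \<in> H (length I))}"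

lemma V_fst: "v \<in> V \<Longrightarrow> (\<lambda>I. v I J) \<in> H (length J)" and V_snd: "v \<in> V \<Longrightarrow> (\<lambda>J. v I J) \<in> H (length I)"
  and V_bound: "v \<in> V \<Longrightarrow> \<exists>M. \<forall>I J. v I J \<noteq> 0 \<longrightarrow> length I \<le> M"
  by (simp_all add: V_def)

lemma V_length: "v \<in> V \<Longrightarrow> length I \<noteq> length J \<Longrightarrow> v I J = 0"
  using H_supp[OF V_fst[of v J], of I] length_words[of I N "length J"] by blast

lemma V_zero: "(\<lambda>_ _. 0) \<in> V"
  by (simp add: V_def H_zero)

lemma V_lc: "v \<in> V \<Longrightarrow> w \<in> V \<Longrightarrow> lc a v b w \<in> V"
proof -
  assume v: "v \<in> V" and w: "w \<in> V"
  obtain M where M: "\<And>I J. v I J \<noteq> 0 \<Longrightarrow> length I \<le> M" using V_bound[OF v] by blast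
  obtain M' where M': "\<And>I J. w I J \<noteq> 0 \<Longrightarrow> length I \<le> M'" using V_bound[OF w] by blast
  have "length I \<le> max M M'" if "a * v I J + b * w I J \<noteq> 0" for I J
  proof -
    have "v I J \<noteq> 0 \<or> w I J \<noteq> 0" using that by auto
    then show ?thesis using M M' by (meson max.coboundedI1 max.coboundedI2)
  qed
  then show ?thesis using V_fst[OF v] V_fst[OF w] V_snd[OF v] V_snd[OF w]
    by (auto simp: V_def intro!: H_add H_scale)
qed

lemma V_scale: "v \<in> V \<Longrightarrow> (\<lambda>I J. a * v I J) \<in> V"
  using V_lc[of v v a 0] by simp

lemma V_sum: "(\<And>x. x \<in> A \<Longrightarrow> v x \<in> V) \<Longrightarrow> (\<lambda>I J. \<Sum>x\<in>A. f x * v x I J) \<in> V"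
proof (induction A rule: infinite_finite_induct)
  case (insert x F)
  then show ?case using V_lc[of "v x" "\<lambda>I J. \<Sum>x\<in>F. f x * v x I J" "f x" 1] by simp
qed (simp_all add: V_zero)

definition sqrtc :: "nat \<Rightarrow> complex" where "sqrtc n = of_real (sqrt (c n))"

lemma sqrtc_sq: "sqrtc n * sqrtc n = of_real (c n)"
  unfolding sqrtc_def of_real_mult[symmetric] using c_bounds[of n] by simp

lemma sqrtc_cnj [simp]: "cnj (sqrtc n) = sqrtc n"
  by (simp add: sqrtc_def)

text \<open>
The factors \<open>\<surd>c\<^sub>n\<close> make creation and annihilation mutually adjoint and balance the two terms in \<open>U_unitary\<close>.
\<close>

definition create :: "nat \<Rightarrow> nat \<Rightarrow> tmat \<Rightarrow> tmat" where
  "create i j v = (\<lambda>I J. sqrtc (length I) * (\<Sum>K\<in>words N (length I - 1). \<Sum>L\<in>words N (length I - 1).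
      Q (length I) I (i # K) * Q (length I) J (j # L) * v K L))"

definition annih :: "nat \<Rightarrow> nat \<Rightarrow> tmat \<Rightarrow> tmat" where
  "annih i j v = (\<lambda>I J. sqrtc (Suc (length I)) * v (i # I) (j # J))"

text \<open>
The operator representing the generator \<open>u\<^sub>i\<^sub>,\<^sub>j\<close>.
\<close>

definition U :: "nat \<Rightarrow> nat \<Rightarrow> tmat \<Rightarrow> tmat" where
  "U i j v = (\<lambda>I J. create i j v I J + annih i j v I J)"

lemma create_V: "v \<in> V \<Longrightarrow> create i j v \<in> V"
proof -
  assume v: "v \<in> V"
  obtain M where M: "\<And>I J. v I J \<noteq> 0 \<Longrightarrow> length I \<le> M" using V_bound[OF v] by blast
  have "length I \<le> Suc M" if "create i j v I J \<noteq> 0" for I J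
  proof (rule ccontr)
    assume "\<not> length I \<le> Suc M"
    then have gt: "Suc M < length I" by simp
    have "v K L = 0" if "K \<in> words N (length I - 1)" for K L
    proof (rule ccontr)
      assume "v K L \<noteq> 0"
      then have "length K \<le> M" by (rule M)
      then show False using gt length_words[OF that] by simp
    qed
    then have "create i j v I J = 0" by (simp add: create_def)
    with that show False by simp
  qed
  moreover have "(\<lambda>I. create i j v I J) \<in> H (length J)" for J
  proof -
    let ?n = "length J"
    have "(\<lambda>I. create i j v I J) = (\<lambda>I. \<Sum>K\<in>words N (?n - 1). (sqrtc ?n * (\<Sum>L\<in>words N (?n - 1). Q ?n J (j # L) * v K L)) * Q ?n I (i # K))"
    proof
      fix I
      show "create i j v I J = (\<Sum>K\<in>words N (?n - 1). (sqrtc ?n * (\<Sum>L\<in>words N (?n - 1). Q ?n J (j # L) * v K L)) * Q ?n I (i # K))"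
      proof (cases "length I = ?n")
        case True
        then show ?thesis by (simp add: create_def sum_distrib_left sum_distrib_right mult_ac del: Q.simps)
      next
        case False
        then have "J \<notin> words N (length I)" "I \<notin> words N ?n" by (auto simp: words_def)
        then show ?thesis by (simp add: create_def Q_supp0 del: Q.simps)
      qed
    qed
    also have "\<dots> \<in> H ?n" by (intro H_sum Q_in_H)
    finally show ?thesis .
  qed
  moreover have "(\<lambda>J. create i j v I J) \<in> H (length I)" for I
  proof -
    let ?n = "length I"
    have "(\<lambda>J. create i j v I J) = (\<lambda>J. \<Sum>L\<in>words N (?n - 1). (sqrtc ?n * (\<Sum>K\<in>words N (?n - 1). Q ?n I (i # K) * v K L)) * Q ?n J (j # L))"
      unfolding create_def by (subst sum.swap) (simp add: sum_distrib_left sum_distrib_right mult_ac del: Q.simps)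
    also have "\<dots> \<in> H ?n" by (intro H_sum Q_in_H)
    finally show ?thesis .
  qed
  ultimately show ?thesis by (auto simp: V_def)
qed

lemma annih_V: "v \<in> V \<Longrightarrow> annih i j v \<in> V"
proof -
  assume v: "v \<in> V"
  obtain M where M: "\<And>I J. v I J \<noteq> 0 \<Longrightarrow> length I \<le> M" using V_bound[OF v] by blast
  have "length I \<le> M" if "annih i j v I J \<noteq> 0" for I J
    using M[of "i # I" "j # J"] that by (auto simp: annih_def)
  moreover have "(\<lambda>I. annih i j v I J) \<in> H (length J)" for J
  proof -
    have "(\<lambda>I. annih i j v I J) = (\<lambda>I. sqrtc (Suc (length J)) * v (i # I) (j # J))"
    proof
      fix I
      show "annih i j v I J = sqrtc (Suc (length J)) * v (i # I) (j # J)"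
        by (cases "length I = length J") (simp_all add: annih_def V_length[OF v])
    qed
    then show ?thesis using V_fst[OF v, of "j # J"] by (auto intro!: H_scale H_Cons)
  qed
  moreover have "(\<lambda>J. annih i j v I J) \<in> H (length I)" for I
    using V_snd[OF v, of "i # I"] by (auto simp: annih_def intro!: H_scale H_Cons)
  ultimately show ?thesis by (auto simp: V_def)
qed

lemma U_V: "v \<in> V \<Longrightarrow> U i j v \<in> V"
  using V_lc[OF create_V annih_V, of v v 1 i j 1 i j] by (simp add: U_def)

lemma U_lc: "U i j (lc a v b w) = lc a (U i j v) b (U i j w)"
  by (simp add: U_def create_def annih_def fun_eq_iff sum_distrib_left sum.distrib algebra_simps del: Q.simps)

subsection \<open>The inner product\<close>

definition level_inner :: "nat \<Rightarrow> tmat \<Rightarrow> tmat \<Rightarrow> complex" where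
  "level_inner n v w = (\<Sum>I\<in>words N n. \<Sum>J\<in>words N n. cnj (v I J) * w I J)"

text \<open>
The series is a finite sum on \<open>V\<close>.
\<close>

definition vinner :: "tmat \<Rightarrow> tmat \<Rightarrow> complex" where
  "vinner v w = suminf (\<lambda>n. level_inner n v w)"

lemma vinner_eq:
  assumes "\<forall>I J. v I J \<noteq> 0 \<longrightarrow> length I \<le> M"
  shows "vinner v w = (\<Sum>n\<le>M. level_inner n v w)"
  unfolding vinner_def
proof (rule suminf_finite)
  fix n assume "n \<notin> {..M}"
  then have "v I J = 0" if "I \<in> words N n" for I J using assms length_words[OF that] by auto
  then show "level_inner n v w = 0" by (simp add: level_inner_def)
qed simp

lemma vinner_lc: "v \<in> V \<Longrightarrow> vinner v (lc a w b u) = a * vinner v w + b * vinner v u"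
proof -
  assume "v \<in> V"
  then obtain M where M: "\<forall>I J. v I J \<noteq> 0 \<longrightarrow> length I \<le> M" using V_bound by blast
  show ?thesis unfolding vinner_eq[OF M]
    by (simp add: level_inner_def sum_distrib_left sum.distrib algebra_simps)
qed

lemma common_bound:
  assumes "v \<in> V" "w \<in> V"
  obtains M where "\<forall>I J. v I J \<noteq> 0 \<longrightarrow> length I \<le> M" "\<forall>I J. w I J \<noteq> 0 \<longrightarrow> length I \<le> M"
proof -
  obtain M where M: "\<And>I J. v I J \<noteq> 0 \<Longrightarrow> length I \<le> M" using V_bound[OF assms(1)] by blast
  obtain M' where M': "\<And>I J. w I J \<noteq> 0 \<Longrightarrow> length I \<le> M'" using V_bound[OF assms(2)] by blast
  have "length I \<le> max M M'" if "v I J \<noteq> 0" for I J using M[OF that] by simp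
  moreover have "length I \<le> max M M'" if "w I J \<noteq> 0" for I J using M'[OF that] by simp
  ultimately show thesis using that by blast
qed

lemma vinner_cnj: "v \<in> V \<Longrightarrow> w \<in> V \<Longrightarrow> cnj (vinner v w) = vinner w v"
proof -
  assume "v \<in> V" "w \<in> V"
  then obtain M where M: "\<forall>I J. v I J \<noteq> 0 \<longrightarrow> length I \<le> M" "\<forall>I J. w I J \<noteq> 0 \<longrightarrow> length I \<le> M"
    by (rule common_bound)
  show ?thesis unfolding vinner_eq[OF M(1)] vinner_eq[OF M(2)]
    by (simp add: level_inner_def mult.commute)
qed

lemma vinner_scale: "v \<in> V \<Longrightarrow> vinner v (\<lambda>I J. a * w I J) = a * vinner v w"
  using vinner_lc[of v a w 0 w] by simp

lemma vinner_scale_left: "v \<in> V \<Longrightarrow> w \<in> V \<Longrightarrow> vinner (\<lambda>I J. a * w I J) v = cnj a * vinner w v"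
  using vinner_scale[of v a w] vinner_cnj[of v w] vinner_cnj[of v "\<lambda>I J. a * w I J"] V_scale[of w a] by (metis complex_cnj_mult)

definition vnorm :: "tmat \<Rightarrow> real" where "vnorm v = sqrt (Re (vinner v v))"

lemma vinner_self: "v \<in> V \<Longrightarrow> vinner v v = of_real ((vnorm v)\<^sup>2)"
proof -
  assume "v \<in> V"
  then obtain M where M: "\<forall>I J. v I J \<noteq> 0 \<longrightarrow> length I \<le> M" using V_bound by blast
  have "vinner v v = of_real (\<Sum>n\<le>M. \<Sum>I\<in>words N n. \<Sum>J\<in>words N n. (cmod (v I J))\<^sup>2)"
    unfolding vinner_eq[OF M] level_inner_def by (simp only: of_real_sum complex_norm_square mult.commute)
  moreover have "0 \<le> (\<Sum>n\<le>M. \<Sum>I\<in>words N n. \<Sum>J\<in>words N n. (cmod (v I J))\<^sup>2)"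
    by (intro sum_nonneg) auto
  ultimately show ?thesis by (simp add: vnorm_def)
qed

lemma vnorm_nonneg: "v \<in> V \<Longrightarrow> 0 \<le> vnorm v"
proof -
  assume "v \<in> V"
  then have "Re (vinner v v) = (vnorm v)\<^sup>2" using vinner_self by simp
  then have "0 \<le> Re (vinner v v)" by (simp only: zero_le_power2)
  then show ?thesis unfolding vnorm_def by simp
qed

lemma vinner_CS: "v \<in> V \<Longrightarrow> w \<in> V \<Longrightarrow> cmod (vinner v w) \<le> vnorm v * vnorm w"
proof (cases "vnorm w = 0")
  assume v: "v \<in> V" and w: "w \<in> V"
  have expand: "vinner (lc 1 v t w) (lc 1 v t w) = vinner v v + t * vinner v w + cnj t * vinner w v + cnj t * t * vinner w w" for t
  proof -
    have l: "lc 1 v t w \<in> V" by (rule V_lc[OF v w])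
    have "vinner (lc 1 v t w) v = cnj (vinner v (lc 1 v t w))" using vinner_cnj[OF v l] by simp
    also have "\<dots> = vinner v v + cnj t * vinner w v" unfolding vinner_lc[OF v] by (simp add: vinner_cnj v w)
    finally have 1: "vinner (lc 1 v t w) v = vinner v v + cnj t * vinner w v" .
    have "vinner (lc 1 v t w) w = cnj (vinner w (lc 1 v t w))" using vinner_cnj[OF w l] by simp
    also have "\<dots> = vinner v w + cnj t * vinner w w" unfolding vinner_lc[OF w] by (simp add: vinner_cnj v w)
    finally have 2: "vinner (lc 1 v t w) w = vinner v w + cnj t * vinner w w" .
    show ?thesis unfolding vinner_lc[OF l] 1 2 by (simp add: algebra_simps)
  qed
  have pos: "0 \<le> Re (vinner v v + t * vinner v w + cnj t * vinner w v + cnj t * t * vinner w w)" for t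
    unfolding expand[symmetric] vinner_self[OF V_lc[OF v w]] by simp
  {
    assume z: "vnorm w = 0"
    have ww: "vinner w w = 0" by (simp add: vinner_self w z)
    have "vinner v w = 0"
    proof (rule ccontr)
      assume ne: "vinner v w \<noteq> 0"
      let ?y = "(cmod (vinner v w))\<^sup>2"
      have y: "0 < ?y" using ne by simp
      define r where "r = ((vnorm v)\<^sup>2 + 1) / (2 * ?y)"
      have "vinner w v = cnj (vinner v w)" using vinner_cnj[OF v w] by simp
      then have "vinner v v + (- of_real r * cnj (vinner v w)) * vinner v w + cnj (- of_real r * cnj (vinner v w)) * vinner w v
          = of_real ((vnorm v)\<^sup>2 - 2 * r * ?y)"
        by (simp add: vinner_self v complex_norm_square algebra_simps del: of_real_power)
      then have "0 \<le> (vnorm v)\<^sup>2 - 2 * r * ?y"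
        using pos[of "- of_real r * cnj (vinner v w)"] by (simp add: ww del: of_real_diff of_real_power of_real_mult)
      moreover have "2 * r * ?y = (vnorm v)\<^sup>2 + 1" using y by (simp add: r_def field_simps)
      ultimately show False by simp
    qed
    then show "cmod (vinner v w) \<le> vnorm v * vnorm w" by (simp add: z)
  }
  {
    assume nz: "vnorm w \<noteq> 0"
    let ?y = "(cmod (vinner v w))\<^sup>2" and ?b = "(vnorm w)\<^sup>2"
    have b: "0 < ?b" using nz by simp
    define t where "t = - cnj (vinner v w) / of_real ?b"
    have wv: "vinner w v = cnj (vinner v w)" using vinner_cnj[OF v w] by simp
    have bne: "complex_of_real ?b \<noteq> 0" using b by simp
    have "t * vinner v w = - of_real (?y / ?b)" "cnj t * vinner w v = - of_real (?y / ?b)" "cnj t * t * vinner w w = of_real (?y / ?b)"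
      unfolding t_def wv vinner_self[OF w] of_real_divide complex_norm_square[of "vinner v w"]
      using bne by (simp_all add: field_simps del: of_real_power)
    then have "vinner v v + t * vinner v w + cnj t * vinner w v + cnj t * t * vinner w w = of_real ((vnorm v)\<^sup>2 - ?y / ?b)"
      by (simp add: vinner_self v del: of_real_power of_real_divide)
    then have "0 \<le> (vnorm v)\<^sup>2 - ?y / ?b" using pos[of t] by (simp only: Re_complex_of_real)
    then have "?y \<le> (vnorm v * vnorm w)\<^sup>2" using b by (simp add: field_simps power_mult_distrib)
    then show "cmod (vinner v w) \<le> vnorm v * vnorm w"
      using vnorm_nonneg[OF v] vnorm_nonneg[OF w] by (simp add: power2_le_iff_abs_le)
  }
qed

lemma vnorm_scale: "v \<in> V \<Longrightarrow> vnorm (\<lambda>I J. a * v I J) = cmod a * vnorm v"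
proof -
  assume v: "v \<in> V"
  have "complex_of_real ((vnorm (\<lambda>I J. a * v I J))\<^sup>2) = of_real ((cmod a * vnorm v)\<^sup>2)"
    unfolding vinner_self[OF V_scale[OF v], symmetric] vinner_scale[OF V_scale[OF v]] vinner_scale_left[OF v v] vinner_self[OF v]
    by (simp add: power_mult_distrib complex_norm_square mult.assoc[symmetric] flip: of_real_power)
  then have "(vnorm (\<lambda>I J. a * v I J))\<^sup>2 = (cmod a * vnorm v)\<^sup>2" by (simp only: of_real_eq_iff)
  then show ?thesis using vnorm_nonneg[OF v] vnorm_nonneg[OF V_scale[OF v, of a]] by (simp add: power2_eq_iff_nonneg)
qed

lemma vnorm_add: "v \<in> V \<Longrightarrow> w \<in> V \<Longrightarrow> vnorm (\<lambda>I J. v I J + w I J) \<le> vnorm v + vnorm w"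
proof -
  assume v: "v \<in> V" and w: "w \<in> V"
  let ?u = "\<lambda>I J. v I J + w I J"
  have u: "?u \<in> V" using V_lc[OF v w, of 1 1] by simp
  have "(vnorm ?u)\<^sup>2 = cmod (vinner ?u ?u)" by (simp add: vinner_self u del: of_real_power)
  also have "vinner ?u ?u = vinner ?u v + vinner ?u w" using vinner_lc[OF u, of 1 v 1 w] by simp
  also have "cmod \<dots> \<le> vnorm ?u * vnorm v + vnorm ?u * vnorm w"
    by (intro order.trans[OF norm_triangle_ineq] add_mono vinner_CS u v w)
  finally have "vnorm ?u * vnorm ?u \<le> vnorm ?u * (vnorm v + vnorm w)" by (simp add: power2_eq_square distrib_left)
  then show ?thesis using vnorm_nonneg[OF u] vnorm_nonneg[OF v] vnorm_nonneg[OF w] by (cases "vnorm ?u = 0") auto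
qed

lemma vnorm_zero: "vnorm (\<lambda>_ _. 0) = 0"
  using vnorm_scale[OF V_zero, of 0] by simp

lemma vnorm_zeroD:
  assumes v: "v \<in> V" and z: "vnorm v = 0"
  shows "v I J = 0"
proof (rule ccontr)
  assume nz: "v I J \<noteq> 0"
  obtain M where M: "\<forall>I J. v I J \<noteq> 0 \<longrightarrow> length I \<le> M" using V_bound[OF v] by blast
  let ?f = "\<lambda>n. \<Sum>I\<in>words N n. \<Sum>J\<in>words N n. (cmod (v I J))\<^sup>2"
  have "complex_of_real (sum ?f {..M}) = vinner v v"
    unfolding vinner_eq[OF M] level_inner_def by (simp only: of_real_sum complex_norm_square mult.commute)
  also have "\<dots> = 0" by (simp add: vinner_self v z)
  finally have s: "sum ?f {..M} = 0" by (simp only: of_real_eq_0_iff)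
  have IJ: "J \<in> words N (length I)" "I \<in> words N (length I)"
    using H_supp[OF V_snd[OF v, of I], of J] H_supp[OF V_fst[OF v, of J], of I] V_length[OF v, of I J] nz by (auto, metis)
  have "?f (length I) = 0"
    using s M nz by (subst (asm) sum_nonneg_eq_0_iff) (auto intro!: sum_nonneg)
  then have "(\<Sum>J\<in>words N (length I). (cmod (v I J))\<^sup>2) = 0"
    using IJ by (subst (asm) sum_nonneg_eq_0_iff) (auto intro!: sum_nonneg)
  then have "(cmod (v I J))\<^sup>2 = 0"
    using IJ by (subst (asm) sum_nonneg_eq_0_iff) auto
  then show False using nz by simp
qed

subsection \<open>Self-adjointness and unitarity\<close>

lemma sum_swap4:
  "(\<Sum>i\<in>A. \<Sum>j\<in>B. \<Sum>k\<in>C. \<Sum>l\<in>D. f i j k l) = (\<Sum>k\<in>C. \<Sum>l\<in>D. \<Sum>i\<in>A. \<Sum>j\<in>B. f i j k l)"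
proof -
  have "(\<Sum>i\<in>A. \<Sum>j\<in>B. \<Sum>k\<in>C. \<Sum>l\<in>D. f i j k l) = (\<Sum>i\<in>A. \<Sum>k\<in>C. \<Sum>j\<in>B. \<Sum>l\<in>D. f i j k l)"
    by (rule sum.cong[OF refl], rule sum.swap)
  also have "\<dots> = (\<Sum>k\<in>C. \<Sum>i\<in>A. \<Sum>j\<in>B. \<Sum>l\<in>D. f i j k l)" by (rule sum.swap)
  also have "\<dots> = (\<Sum>k\<in>C. \<Sum>i\<in>A. \<Sum>l\<in>D. \<Sum>j\<in>B. f i j k l)"
    by (rule sum.cong[OF refl], rule sum.cong[OF refl], rule sum.swap)
  also have "\<dots> = (\<Sum>k\<in>C. \<Sum>l\<in>D. \<Sum>i\<in>A. \<Sum>j\<in>B. f i j k l)"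
    by (rule sum.cong[OF refl], rule sum.swap)
  finally show ?thesis .
qed

lemma level_inner_create: "w \<in> V \<Longrightarrow> level_inner (Suc m) w (create i j v) = level_inner m (annih i j w) v"
proof -
  assume w: "w \<in> V"
  let ?n = "Suc m"
  have one: "(\<Sum>I\<in>words N ?n. Q ?n (i # K) I * (\<Sum>J\<in>words N ?n. Q ?n (j # L) J * cnj (w I J))) = cnj (w (i # K) (j # L))"
    if L: "L \<in> words N m" for K L
  proof -
    have "(\<Sum>J\<in>words N ?n. Q ?n (j # L) J * cnj (w I J)) = cnj (w I (j # L))" if "I \<in> words N ?n" for I
      using Q_fix[OF H_cnj[OF V_snd[OF w, of I]], of "j # L"] length_words[OF that] by (simp del: Q.simps)
    then have "(\<Sum>I\<in>words N ?n. Q ?n (i # K) I * (\<Sum>J\<in>words N ?n. Q ?n (j # L) J * cnj (w I J))) = (\<Sum>I\<in>words N ?n. Q ?n (i # K) I * cnj (w I (j # L)))"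
      by (simp del: Q.simps)
    also have "\<dots> = cnj (w (i # K) (j # L))"
      using Q_fix[OF H_cnj[OF V_fst[OF w, of "j # L"]], of "i # K"] length_words[OF L] by (simp del: Q.simps)
    finally show ?thesis .
  qed
  have "level_inner ?n w (create i j v) = (\<Sum>I\<in>words N ?n. \<Sum>J\<in>words N ?n. \<Sum>K\<in>words N m. \<Sum>L\<in>words N m.
      sqrtc ?n * (Q ?n (i # K) I * (Q ?n (j # L) J * cnj (w I J))) * v K L)"
    unfolding level_inner_def
  proof (intro sum.cong refl)
    fix I J assume "I \<in> words N ?n"
    then have "length I = ?n" by (rule length_words)
    then show "cnj (w I J) * create i j v I J = (\<Sum>K\<in>words N m. \<Sum>L\<in>words N m. sqrtc ?n * (Q ?n (i # K) I * (Q ?n (j # L) J * cnj (w I J))) * v K L)"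
      by (simp add: create_def sum_distrib_left mult_ac Q_sym[of ?n I] Q_sym[of ?n J] del: Q.simps)
  qed
  also have "\<dots> = (\<Sum>K\<in>words N m. \<Sum>L\<in>words N m. \<Sum>I\<in>words N ?n. \<Sum>J\<in>words N ?n.
      sqrtc ?n * (Q ?n (i # K) I * (Q ?n (j # L) J * cnj (w I J))) * v K L)"
    by (rule sum_swap4)
  also have "\<dots> = (\<Sum>K\<in>words N m. \<Sum>L\<in>words N m. sqrtc ?n * cnj (w (i # K) (j # L)) * v K L)"
    unfolding sum_distrib_left[symmetric] sum_distrib_right[symmetric]
    by (intro sum.cong refl) (simp only: one)
  also have "\<dots> = level_inner m (annih i j w) v"
    unfolding level_inner_def by (intro sum.cong refl) (simp add: annih_def length_words)
  finally show ?thesis .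
qed

lemma level_inner_create_0: "level_inner 0 w (create i j v) = 0"
  by (simp add: level_inner_def create_def sqrtc_def)

lemma vinner_create:
  assumes v: "v \<in> V" and w: "w \<in> V"
  shows "vinner w (create i j v) = vinner (annih i j w) v"
proof -
  obtain M where M: "\<And>I J. w I J \<noteq> 0 \<Longrightarrow> length I \<le> M" using V_bound[OF w] by blast
  have "vinner w (create i j v) = (\<Sum>n\<le>Suc M. level_inner n w (create i j v))"
    using M by (intro vinner_eq) (auto intro: le_SucI)
  also have "\<dots> = (\<Sum>m\<le>M. level_inner m (annih i j w) v)"
    unfolding sum.atMost_Suc_shift level_inner_create[OF w] level_inner_create_0 by simp
  also have "\<dots> = vinner (annih i j w) v"
  proof (rule vinner_eq[symmetric], intro allI impI)
    fix I J assume "annih i j w I J \<noteq> 0"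
    then show "length I \<le> M" using M[of "i # I" "j # J"] by (auto simp: annih_def)
  qed
  finally show ?thesis .
qed

lemma U_selfadjoint:
  assumes v: "v \<in> V" and w: "w \<in> V"
  shows "vinner w (U i j v) = vinner (U i j w) v"
proof -
  have split: "vinner w' (U i j v') = vinner w' (create i j v') + vinner w' (annih i j v')" if "w' \<in> V" for w' v'
    using vinner_lc[OF that, of 1 "create i j v'" 1 "annih i j v'"] by (simp add: U_def)
  have annih: "vinner w' (annih i j v') = vinner (create i j w') v'" if "v' \<in> V" "w' \<in> V" for v' w'
    using vinner_create[OF that(2,1), of i j] vinner_cnj[OF annih_V[OF that(1)] that(2)] vinner_cnj[OF that(1) create_V[OF that(2)]] by metis
  have "vinner w (U i j v) = vinner (annih i j w) v + vinner (create i j w) v"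
    by (simp add: split w vinner_create v annih)
  also have "\<dots> = cnj (vinner v (annih i j w) + vinner v (create i j w))"
    using v w by (simp add: vinner_cnj annih_V create_V)
  also have "\<dots> = cnj (vinner v (U i j w))" by (simp add: split v add.commute)
  also have "\<dots> = vinner (U i j w) v" by (rule vinner_cnj[OF v U_V[OF w]])
  finally show ?thesis .
qed

text \<open>
\<open>P\<^sub>n\<^sub>+\<^sub>1 (1 \<otimes> P\<^sub>n) = P\<^sub>n\<^sub>+\<^sub>1\<close>.
\<close>

lemma Q_absorb: "(\<Sum>K\<in>words N n. Q (Suc n) I (a # K) * Q n K J) = Q (Suc n) I (a # J)"
  using Q_fix_right[OF H_Cons[OF Q_in_H'[of "Suc n" I]], of a J] by (simp del: Q.simps)

lemma U_level:
  assumes "I \<in> words N n" "J \<in> words N n"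
  shows "U i j v I J = sqrtc n * (\<Sum>K\<in>words N (n - 1). \<Sum>L\<in>words N (n - 1). Q n I (i # K) * Q n J (j # L) * v K L)
     + sqrtc (Suc n) * v (i # I) (j # J)"
  using assms by (simp add: U_def create_def annih_def length_words del: Q.simps)

text \<open>
Two creations and two annihilations contract adjacent legs and vanish after summation over \<open>k\<close>.  Annihilating after
creating closes a leg, which by \<open>Q_ptrace\<close> and the recursion is \<open>\<delta>\<^sub>i\<^sub>j\<close> minus a Wenzl correction with factor \<open>c\<^sub>n\<close>; creating
after annihilating contributes exactly this correction.
\<close>

lemma U_unitary:
  assumes v: "v \<in> V" and i: "i < N" and j: "j < N"
  shows "(\<Sum>k<N. U i k (U j k v) I J) = (if i = j then v I J else 0)"
proof (cases "I \<in> words N (length I) \<and> J \<in> words N (length I)")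
  case False
  have z: "w I J = 0" if "w \<in> V" for w
    using False H_supp[OF V_fst[OF that, of J], of I] H_supp[OF V_snd[OF that, of I], of J] V_length[OF that, of I J] by metis
  show ?thesis using z[OF v] z[OF U_V[OF U_V[OF v]]] by simp
next
  case True
  define n where "n = length I"
  have I: "I \<in> words N n" and J: "J \<in> words N n" using True by (simp_all add: n_def)
  let ?W = "\<lambda>k. U j k v"
  have slice1: "v X \<in> H (length X)" and slice2: "(\<lambda>X. v X Y) \<in> H (length Y)" for X Y
    using V_snd[OF v] V_fst[OF v] by simp_all
  \<comment> \<open>the parts of the outer operator: \<open>up\<close> annihilates after a creation, \<open>down\<close> creates after an annihilation\<close>
  have up: "(\<Sum>k<N. sqrtc (Suc n) * ?W k (i # I) (k # J)) = (if i = j then v I J else 0)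
      - of_real (c n) * (\<Sum>K\<in>words N (n - 1). Q n I (i # K) * v (j # K) J)"
  proof -
    have W: "?W k (i # I) (k # J) = sqrtc (Suc n) * (\<Sum>K\<in>words N n. \<Sum>L\<in>words N n. Q (Suc n) (i # I) (j # K) * Q (Suc n) (k # J) (k # L) * v K L)
       + sqrtc (Suc (Suc n)) * v (j # i # I) (k # k # J)" if "k < N" for k
      using U_level[of "i # I" "Suc n" "k # J" j k v] I J i that by (simp del: Q.simps)
    have "(\<Sum>k<N. v (j # i # I) (k # k # J)) = 0"
      using H_cap_first[OF slice1[of "j # i # I"], of J] length_words[OF I] length_words[OF J] by simp
    then have "(\<Sum>k<N. sqrtc (Suc n) * ?W k (i # I) (k # J)) = (\<Sum>k<N. sqrtc (Suc n) * sqrtc (Suc n) *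
        (\<Sum>K\<in>words N n. \<Sum>L\<in>words N n. Q (Suc n) (i # I) (j # K) * Q (Suc n) (k # J) (k # L) * v K L))"
      by (simp add: W distrib_left sum.distrib sum_distrib_left[symmetric] mult.assoc del: Q.simps)
    also have "\<dots> = of_real (c (Suc n)) * (\<Sum>K\<in>words N n. \<Sum>L\<in>words N n. Q (Suc n) (i # I) (j # K) * (\<Sum>k<N. Q (Suc n) (k # J) (k # L)) * v K L)"
      unfolding sqrtc_sq sum_distrib_left sum_distrib_right
      by (simp only: sum.swap[of _ "{..<N}"])
    also have "\<dots> = (\<Sum>K\<in>words N n. Q (Suc n) (i # I) (j # K) * (\<Sum>L\<in>words N n. Q n J L * v K L))"
      unfolding Q_ptrace sum_distrib_left using c_pos[of n] by (intro sum.cong refl) (simp add: field_simps del: Q.simps)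
    also have "\<dots> = (\<Sum>K\<in>words N n. Q (Suc n) (i # I) (j # K) * v K J)"
      by (intro sum.cong refl) (use Q_fix[OF slice1] length_words in metis)
    also have "\<dots> = (\<Sum>K\<in>words N n. (if i = j then Q n I K else 0) * v K J)
       - of_real (c n) * (\<Sum>K\<in>words N n. \<Sum>A\<in>words N (n - 1). Q n I (i # A) * (Q n (j # A) K * v K J))"
      unfolding sum_distrib_left sum_subtractf[symmetric]
      by (intro sum.cong refl) (use i j in \<open>simp add: algebra_simps sum_distrib_left\<close>)
    also have "(\<Sum>K\<in>words N n. \<Sum>A\<in>words N (n - 1). Q n I (i # A) * (Q n (j # A) K * v K J))
       = (\<Sum>A\<in>words N (n - 1). Q n I (i # A) * (\<Sum>K\<in>words N n. Q n (j # A) K * v K J))"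
      unfolding sum_distrib_left by (rule sum.swap)
    also have "\<dots> = (\<Sum>A\<in>words N (n - 1). Q n I (i # A) * v (j # A) J)"
      using Q_fix[OF slice2[of J]] length_words[OF J] by simp
    also have "(\<Sum>K\<in>words N n. (if i = j then Q n I K else 0) * v K J) = (if i = j then v I J else 0)"
      using Q_fix[OF slice2[of J]] length_words[OF J] by simp
    finally show ?thesis .
  qed
  have down: "(\<Sum>k<N. sqrtc n * (\<Sum>K\<in>words N (n - 1). \<Sum>L\<in>words N (n - 1). Q n I (i # K) * Q n J (k # L) * ?W k K L))
     = of_real (c n) * (\<Sum>K\<in>words N (n - 1). Q n I (i # K) * v (j # K) J)"
  proof (cases n)
    case 0
    then show ?thesis by (simp add: sqrtc_def)
  next
    case (Suc m)
    have W: "?W k K L = sqrtc m * (\<Sum>A\<in>words N (m - 1). \<Sum>B\<in>words N (m - 1). Q m K (j # A) * Q m L (k # B) * v A B)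
       + sqrtc n * v (j # K) (k # L)" if "K \<in> words N m" "L \<in> words N m" for k K L
      using U_level[OF that, of j k v] Suc by simp
    have z: "(\<Sum>k<N. \<Sum>L\<in>words N m. Q n J (k # L) * Q m L (k # B)) = 0" if "B \<in> words N (m - 1)" "m \<noteq> 0" for B
    proof -
      have "(\<Sum>k<N. \<Sum>L\<in>words N m. Q n J (k # L) * Q m L (k # B)) = (\<Sum>k<N. Q n J (k # k # B))"
        unfolding Suc Q_absorb ..
      also have "\<dots> = 0"
        using H_cap_first[OF Q_in_H'[of n J], of B] length_words[OF that(1)] that(2) Suc by simp
      finally show ?thesis .
    qed
    have first: "(\<Sum>k<N. \<Sum>K\<in>words N m. \<Sum>L\<in>words N m. Q n I (i # K) * Q n J (k # L) * (sqrtc m * (\<Sum>A\<in>words N (m - 1). \<Sum>B\<in>words N (m - 1). Q m K (j # A) * Q m L (k # B) * v A B))) = 0"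
    proof (cases "m = 0")
      case True
      then show ?thesis by (simp add: sqrtc_def)
    next
      case False
      have "(\<Sum>k<N. \<Sum>K\<in>words N m. \<Sum>L\<in>words N m. Q n I (i # K) * Q n J (k # L) * (sqrtc m * (\<Sum>A\<in>words N (m - 1). \<Sum>B\<in>words N (m - 1). Q m K (j # A) * Q m L (k # B) * v A B)))
        = (\<Sum>K\<in>words N m. \<Sum>k<N. \<Sum>L\<in>words N m. \<Sum>A\<in>words N (m - 1). \<Sum>B\<in>words N (m - 1). (Q n I (i # K) * sqrtc m * Q m K (j # A) * v A B) * (Q n J (k # L) * Q m L (k # B)))"
        by (subst sum.swap) (simp add: sum_distrib_left mult_ac del: Q.simps)
      also have "\<dots> = (\<Sum>K\<in>words N m. \<Sum>A\<in>words N (m - 1). \<Sum>B\<in>words N (m - 1). \<Sum>k<N. \<Sum>L\<in>words N m. (Q n I (i # K) * sqrtc m * Q m K (j # A) * v A B) * (Q n J (k # L) * Q m L (k # B)))"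
        by (rule sum.cong[OF refl], rule sum_swap4)
      also have "\<dots> = 0"
        unfolding sum_distrib_left[symmetric] using z False by (intro sum.neutral ballI) simp
      finally show ?thesis .
    qed
    have "(\<Sum>k<N. sqrtc n * (\<Sum>K\<in>words N m. \<Sum>L\<in>words N m. Q n I (i # K) * Q n J (k # L) * ?W k K L))
      = sqrtc n * ((\<Sum>k<N. \<Sum>K\<in>words N m. \<Sum>L\<in>words N m. Q n I (i # K) * Q n J (k # L) * (sqrtc m * (\<Sum>A\<in>words N (m - 1). \<Sum>B\<in>words N (m - 1). Q m K (j # A) * Q m L (k # B) * v A B)))
       + (\<Sum>k<N. \<Sum>K\<in>words N m. \<Sum>L\<in>words N m. Q n I (i # K) * Q n J (k # L) * (sqrtc n * v (j # K) (k # L))))"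
      unfolding sum_distrib_left[of "sqrtc n", symmetric] sum.distrib[symmetric] distrib_left[symmetric]
      by (intro arg_cong2[where f="(*)"] sum.cong refl) (simp only: W)
    also have "\<dots> = sqrtc n * sqrtc n * (\<Sum>K\<in>words N m. Q n I (i # K) * (\<Sum>k<N. \<Sum>L\<in>words N m. Q n J (k # L) * v (j # K) (k # L)))"
      unfolding first by (subst sum.swap) (simp add: sum_distrib_left mult_ac del: Q.simps)
    also have "\<dots> = of_real (c n) * (\<Sum>K\<in>words N m. Q n I (i # K) * v (j # K) J)"
    proof -
      have "(\<Sum>k<N. \<Sum>L\<in>words N m. Q n J (k # L) * v (j # K) (k # L)) = v (j # K) J" if "K \<in> words N m" for K
        using Q_fix[OF slice1[of "j # K"], of J] length_words[OF that] Suc by (simp add: sum_words_Suc del: Q.simps)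
      then show ?thesis unfolding sqrtc_sq by simp
    qed
    finally show ?thesis using Suc by simp
  qed
  have "(\<Sum>k<N. U i k (?W k) I J) = (\<Sum>k<N. sqrtc n * (\<Sum>K\<in>words N (n - 1). \<Sum>L\<in>words N (n - 1). Q n I (i # K) * Q n J (k # L) * ?W k K L))
     + (\<Sum>k<N. sqrtc (Suc n) * ?W k (i # I) (k # J))"
    unfolding sum.distrib[symmetric] by (intro sum.cong refl U_level I J)
  then show ?thesis unfolding up down by simp
qed

lemma transp_V:
  assumes v: "v \<in> V" shows "transp v \<in> V"
proof -
  obtain M where M: "\<And>I J. v I J \<noteq> 0 \<Longrightarrow> length I \<le> M" using V_bound[OF v] by blast
  have "length I \<le> M" if "v J I \<noteq> 0" for I J
    using M[OF that] V_length[OF v, of J I] that by force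
  then show ?thesis using V_fst[OF v] V_snd[OF v] by (auto simp: V_def transp_def)
qed

text \<open>
Exchanging the two factors of \<open>H\<^sub>n \<otimes> H\<^sub>n\<close> exchanges rows and columns of the matrix \<open>u\<close>, so that one of
the two unitarity relations implies the other.
\<close>

lemma U_transp: "v \<in> V \<Longrightarrow> U i j (transp v) = transp (U j i v)"
proof (rule ext, rule ext)
  fix I J assume v: "v \<in> V"
  show "U i j (transp v) I J = transp (U j i v) I J"
  proof (cases "length I = length J")
    case True
    then show ?thesis unfolding U_def create_def annih_def transp_apply
      by (subst sum.swap) (simp add: mult_ac del: Q.simps)
  next
    case False
    then show ?thesis using V_length[OF U_V[OF transp_V[OF v]], of I J] V_length[OF U_V[OF v], of J I] by (simp add: transp_apply)
  qed
qed

lemma U_unitary':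
  assumes v: "v \<in> V" and i: "i < N" and j: "j < N"
  shows "(\<Sum>k<N. U k i (U k j v) I J) = (if i = j then v I J else 0)"
proof -
  have "U k i (U k j v) I J = U i k (U j k (transp v)) J I" for k
    using v by (simp add: U_transp U_V transp_apply)
  then show ?thesis using U_unitary[OF transp_V[OF v] i j, of J I] by (simp add: transp_apply)
qed

end

context temperley_lieb begin

subsection \<open>The resulting C*-seminorm\<close>

primrec wordop :: "uword \<Rightarrow> tmat \<Rightarrow> tmat" where
  "wordop [] v = v"
| "wordop (l # w) v = U (fst l) (snd l) (wordop w v)"

definition rep :: "ncpoly \<Rightarrow> tmat \<Rightarrow> tmat" where
  "rep p v = (\<lambda>I J. \<Sum>w\<in>Poly_Mapping.keys p. Poly_Mapping.lookup p w * wordop w v I J)"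

lemma rep_superset:
  "finite A \<Longrightarrow> Poly_Mapping.keys p \<subseteq> A \<Longrightarrow> rep p v = (\<lambda>I J. \<Sum>w\<in>A. Poly_Mapping.lookup p w * wordop w v I J)"
  unfolding rep_def by (intro ext sum.mono_neutral_left) (auto simp: in_keys_iff)

lemma rep_add: "rep (p + r) v = (\<lambda>I J. rep p v I J + rep r v I J)"
proof -
  let ?A = "Poly_Mapping.keys p \<union> Poly_Mapping.keys r"
  have "rep (p + r) v = (\<lambda>I J. \<Sum>w\<in>?A. Poly_Mapping.lookup (p + r) w * wordop w v I J)"
    by (rule rep_superset) (auto simp: keys_add)
  moreover have "rep p v = (\<lambda>I J. \<Sum>w\<in>?A. Poly_Mapping.lookup p w * wordop w v I J)"
    "rep r v = (\<lambda>I J. \<Sum>w\<in>?A. Poly_Mapping.lookup r w * wordop w v I J)"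
    by (rule rep_superset; auto)+
  ultimately show ?thesis by (simp add: lookup_add distrib_right sum.distrib)
qed

lemma rep_single: "rep (Poly_Mapping.single w a) v = (\<lambda>I J. a * wordop w v I J)"
  by (simp add: rep_def)

lemma rep_zero: "rep 0 v = (\<lambda>_ _. 0)"
  by (simp add: rep_def)

lemma wordop_lc: "wordop w (lc a v b u) = lc a (wordop w v) b (wordop w u)"
  by (induction w) (simp_all add: U_lc)

lemma wordop_append: "wordop (w @ x') v = wordop w (wordop x' v)"
  by (induction w) simp_all

lemma wordop_V: "v \<in> V \<Longrightarrow> wordop w v \<in> V"
  by (induction w) (simp_all add: U_V)

lemma rep_V: "v \<in> V \<Longrightarrow> rep p v \<in> V"
  unfolding rep_def by (intro V_sum wordop_V)

lemma rep_lc: "rep p (lc a v b u) = lc a (rep p v) b (rep p u)"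
  by (simp add: rep_def wordop_lc sum_distrib_left sum.distrib algebra_simps)

lemma rep_scale: "rep p (\<lambda>I J. a * v I J) = (\<lambda>I J. a * rep p v I J)"
  using rep_lc[of p a v 0 v] by simp

lemma rep_mult: "rep (p * r) v = rep p (rep r v)"
proof (induction p rule: nc_induct[where A=UNIV])
  case (single w a)
  show ?case
  proof (induction r rule: nc_induct[where A=UNIV])
    case zero
    show ?case using rep_scale[of "Poly_Mapping.single w a" 0 v] by (simp add: rep_zero)
  next
    case (single x' b)
    have "wordop w (\<lambda>I J. b * wordop x' v I J) = (\<lambda>I J. b * wordop w (wordop x' v) I J)"
      using wordop_lc[of w b "wordop x' v" 0 "wordop x' v"] by simp
    then show ?case by (simp add: mult_single rep_single plus_list_def wordop_append mult.assoc)
  next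
    case (add r r')
    then show ?case using rep_lc[of "Poly_Mapping.single w a" 1 "rep r v" 1 "rep r' v"] by (simp add: distrib_left rep_add)
  qed simp
qed (simp_all add: rep_zero rep_add distrib_right)

lemma rep_one: "rep 1 v = v"
proof -
  have one: "(1 :: ncpoly) = Poly_Mapping.single [] 1" by (metis single_one zero_list_def)
  show ?thesis unfolding one rep_single by simp
qed

lemma rep_gen: "rep (gen i j) v = U i j v"
  by (simp add: gen_def rep_single)

lemma rep_sc: "rep (sc a * p) v = (\<lambda>I J. a * rep p v I J)"
  unfolding rep_mult by (simp add: sc_def rep_single zero_list_def)

lemma rep_sum: "rep (sum f A) v = (\<lambda>I J. \<Sum>x\<in>A. rep (f x) v I J)"
  by (induction A rule: infinite_finite_induct) (simp_all add: rep_zero rep_add)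

lemma rep_star:
  assumes v: "v \<in> V" and u: "u \<in> V"
  shows "vinner u (rep p v) = vinner (rep (nc_star p) u) v"
proof (induction p rule: nc_induct[where A=UNIV])
  case zero
  have "vinner u (\<lambda>_ _. 0) = 0" "vinner (\<lambda>_ _. 0) v = 0" by (simp_all add: vinner_def level_inner_def)
  then show ?case by (simp add: rep_zero star_zero)
next
  case (single w a)
  have w: "vinner u (wordop w v) = vinner (wordop (rev w) u) v" if "u \<in> V" for u
    using that
  proof (induction w arbitrary: u)
    case (Cons l w)
    then show ?case by (simp add: U_selfadjoint wordop_V v U_V wordop_append)
  qed simp
  show ?case
    by (simp add: star_single rep_single vinner_scale u vinner_scale_left[OF v wordop_V[OF u]] w)
next
  case (add p r)
  have "vinner (rep (nc_star p) u) v + vinner (rep (nc_star r) u) v = cnj (vinner v (rep (nc_star p) u) + vinner v (rep (nc_star r) u))"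
    using v u by (simp add: vinner_cnj rep_V)
  also have "\<dots> = cnj (vinner v (rep (nc_star p + nc_star r) u))"
    using vinner_lc[OF v, of 1 "rep (nc_star p) u" 1 "rep (nc_star r) u"] by (simp add: rep_add)
  also have "\<dots> = vinner (rep (nc_star (p + r)) u) v"
    using v u by (simp add: vinner_cnj rep_V star_add)
  finally show ?case using add vinner_lc[OF u, of 1 "rep p v" 1 "rep r v"] by (simp add: rep_add)
qed (rule subset_UNIV)

lemma vinner_sum: "v \<in> V \<Longrightarrow> vinner v (\<lambda>I J. \<Sum>x\<in>A. f x I J) = (\<Sum>x\<in>A. vinner v (f x))"
proof (induction A rule: infinite_finite_induct)
  case (insert x F)
  then show ?case using vinner_lc[of v 1 "f x" 1 "\<lambda>I J. \<Sum>x\<in>F. f x I J"] by simp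
qed (simp_all add: vinner_def level_inner_def)

text \<open>
The rows of a unitary matrix of self-adjoint operators consist of contractions.
\<close>

lemma vnorm_U:
  assumes v: "v \<in> V" and ij: "i < N" "j < N"
  shows "vnorm (U i j v) \<le> vnorm v"
proof -
  have "complex_of_real (\<Sum>k<N. (vnorm (U k j v))\<^sup>2) = (\<Sum>k<N. vinner v (U k j (U k j v)))"
    using v by (simp add: vinner_self[symmetric] U_V U_selfadjoint flip: of_real_power)
  also have "\<dots> = vinner v (\<lambda>I J. \<Sum>k<N. U k j (U k j v) I J)" by (rule vinner_sum[OF v, symmetric])
  also have "\<dots> = vinner v v" using U_unitary'[OF v ij(2) ij(2)] by simp
  also have "\<dots> = of_real ((vnorm v)\<^sup>2)" by (rule vinner_self[OF v])
  finally have "(\<Sum>k<N. (vnorm (U k j v))\<^sup>2) = (vnorm v)\<^sup>2" by (simp only: of_real_eq_iff)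
  moreover have "(vnorm (U i j v))\<^sup>2 \<le> (\<Sum>k<N. (vnorm (U k j v))\<^sup>2)"
    using ij by (intro member_le_sum) auto
  ultimately have "(vnorm (U i j v))\<^sup>2 \<le> (vnorm v)\<^sup>2" by simp
  then show ?thesis by (rule power2_le_imp_le) (rule vnorm_nonneg[OF v])
qed

lemma vnorm_wordop: "v \<in> V \<Longrightarrow> w \<in> letters N \<Longrightarrow> vnorm (wordop w v) \<le> vnorm v"
proof (induction w)
  case (Cons l w)
  then have "vnorm (U (fst l) (snd l) (wordop w v)) \<le> vnorm (wordop w v)"
    by (intro vnorm_U wordop_V) auto
  then show ?case using Cons by auto
qed simp

lemma vnorm_sum: "(\<And>x. x \<in> A \<Longrightarrow> f x \<in> V) \<Longrightarrow> vnorm (\<lambda>I J. \<Sum>x\<in>A. f x I J) \<le> (\<Sum>x\<in>A. vnorm (f x))"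
proof (induction A rule: infinite_finite_induct)
  case (insert x F)
  have F: "(\<lambda>I J. \<Sum>x\<in>F. f x I J) \<in> V" using V_sum[of F f "\<lambda>_. 1"] insert by simp
  have "vnorm (\<lambda>I J. f x I J + (\<Sum>x\<in>F. f x I J)) \<le> vnorm (f x) + vnorm (\<lambda>I J. \<Sum>x\<in>F. f x I J)"
    using insert F by (intro vnorm_add) auto
  moreover have "vnorm (\<lambda>I J. \<Sum>x\<in>F. f x I J) \<le> (\<Sum>x\<in>F. vnorm (f x))" using insert by auto
  ultimately show ?case using insert.hyps by simp
qed (simp_all add: vnorm_zero)

lemma rep_bounded:
  assumes "p \<in> free_alg N"
  shows "\<exists>B\<ge>0. \<forall>v\<in>V. vnorm (rep p v) \<le> B * vnorm v"
proof (intro exI conjI ballI)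
  let ?B = "\<Sum>w\<in>Poly_Mapping.keys p. cmod (Poly_Mapping.lookup p w)"
  show "0 \<le> ?B" by (simp add: sum_nonneg)
  fix v assume v: "v \<in> V"
  have "vnorm (rep p v) \<le> (\<Sum>w\<in>Poly_Mapping.keys p. vnorm (\<lambda>I J. Poly_Mapping.lookup p w * wordop w v I J))"
    unfolding rep_def by (intro vnorm_sum V_scale wordop_V v)
  also have "\<dots> \<le> (\<Sum>w\<in>Poly_Mapping.keys p. cmod (Poly_Mapping.lookup p w) * vnorm v)"
    using assms v by (intro sum_mono) (auto simp: vnorm_scale wordop_V free_alg_def intro!: mult_left_mono vnorm_wordop)
  finally show "vnorm (rep p v) \<le> ?B * vnorm v" by (simp add: sum_distrib_right)
qed

definition repnorm :: "ncpoly \<Rightarrow> real" where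
  "repnorm p = (SUP v\<in>{v \<in> V. vnorm v \<le> 1}. vnorm (rep p v))"

lemma repnorm_bound:
  assumes p: "p \<in> free_alg N" and v: "v \<in> V"
  shows "vnorm (rep p v) \<le> repnorm p * vnorm v"
proof -
  obtain B where B: "0 \<le> B" "\<And>v. v \<in> V \<Longrightarrow> vnorm (rep p v) \<le> B * vnorm v" using rep_bounded[OF p] by blast
  have bdd: "bdd_above ((\<lambda>v. vnorm (rep p v)) ` {v \<in> V. vnorm v \<le> 1})"
    using B by (intro bdd_aboveI[of _ B]) (force intro: order.trans[OF B(2)] mult_left_le)
  show ?thesis
  proof (cases "vnorm v = 0")
    case True
    then show ?thesis using B(2)[OF v] by simp
  next
    case False
    then have pos: "0 < vnorm v" using vnorm_nonneg[OF v] by simp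
    let ?a = "complex_of_real (1 / vnorm v)"
    have n1: "vnorm (\<lambda>I J. ?a * v I J) = 1" unfolding vnorm_scale[OF v] norm_of_real using pos by simp
    have "vnorm (rep p (\<lambda>I J. ?a * v I J)) \<le> repnorm p"
      unfolding repnorm_def by (intro cSUP_upper[OF _ bdd] CollectI conjI V_scale[OF v]) (simp only: n1 order_refl)
    then have "1 / vnorm v * vnorm (rep p v) \<le> repnorm p"
      unfolding rep_scale vnorm_scale[OF rep_V[OF v]] norm_of_real using pos by simp
    then show ?thesis using pos by (simp add: field_simps)
  qed
qed

lemma repnorm_le:
  assumes "\<And>v. v \<in> V \<Longrightarrow> vnorm (rep p v) \<le> B * vnorm v" "0 \<le> B"
  shows "repnorm p \<le> B"
  unfolding repnorm_def
proof (rule cSUP_least)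
  have "(\<lambda>_ _. 0) \<in> {v \<in> V. vnorm v \<le> 1}" by (simp add: V_zero vnorm_zero)
  then show "{v \<in> V. vnorm v \<le> 1} \<noteq> {}" by blast
  fix v assume "v \<in> {v \<in> V. vnorm v \<le> 1}"
  then show "vnorm (rep p v) \<le> B" using assms(1)[of v] mult_left_mono[of "vnorm v" 1 B] assms(2) by simp
qed

lemma repnorm_nonneg: "p \<in> free_alg N \<Longrightarrow> 0 \<le> repnorm p"
proof -
  assume p: "p \<in> free_alg N"
  define \<Omega> :: tmat where "\<Omega> = (\<lambda>I J. if I = [] \<and> J = [] then 1 else 0)"
  have \<Omega>: "\<Omega> \<in> V" by (auto simp: V_def H_def \<Omega>_def)
  have "vnorm \<Omega> \<noteq> 0" using vnorm_zeroD[OF \<Omega>, of "[]" "[]"] by (auto simp: \<Omega>_def)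
  then have "0 < vnorm \<Omega>" using vnorm_nonneg[OF \<Omega>] by simp
  moreover have "0 \<le> repnorm p * vnorm \<Omega>" using repnorm_bound[OF p \<Omega>] vnorm_nonneg[OF rep_V[OF \<Omega>, of p]] by simp
  ultimately show ?thesis by (simp add: zero_le_mult_iff)
qed

text \<open>
The operator norm of a \<open>*\<close>-representation, here on a space which is not complete: the \<open>C\<^sup>*\<close>-identity needs only the
Cauchy--Schwarz inequality.
\<close>

lemma repnorm_cstar: "cstar_seminorm N repnorm"
  unfolding cstar_seminorm_def nc_scale_eq star_gen
proof (intro conjI ballI allI impI)
  show "0 \<le> repnorm p" if "p \<in> free_alg N" for p using repnorm_nonneg that .
next
  fix p r assume p: "p \<in> free_alg N" and r: "r \<in> free_alg N"
  show "repnorm (p + r) \<le> repnorm p + repnorm r"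
  proof (rule repnorm_le)
    fix v assume v: "v \<in> V"
    show "vnorm (rep (p + r) v) \<le> (repnorm p + repnorm r) * vnorm v"
      unfolding rep_add using vnorm_add[OF rep_V[OF v] rep_V[OF v], of p r] repnorm_bound[OF p v] repnorm_bound[OF r v]
      by (simp add: distrib_right)
  qed (simp add: repnorm_nonneg p r)
  show "repnorm (p * r) \<le> repnorm p * repnorm r"
  proof (rule repnorm_le)
    fix v assume v: "v \<in> V"
    show "vnorm (rep (p * r) v) \<le> repnorm p * repnorm r * vnorm v"
      unfolding rep_mult
      using repnorm_bound[OF p rep_V[OF v], of r] mult_left_mono[OF repnorm_bound[OF r v] repnorm_nonneg[OF p]] by simp
  qed (simp add: repnorm_nonneg p r)
next
  fix a p assume p: "p \<in> free_alg N"
  have le: "repnorm (sc b * r) \<le> cmod b * repnorm r" if r: "r \<in> free_alg N" for b r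
  proof (rule repnorm_le)
    fix v assume v: "v \<in> V"
    show "vnorm (rep (sc b * r) v) \<le> cmod b * repnorm r * vnorm v"
      unfolding rep_sc vnorm_scale[OF rep_V[OF v]] using mult_left_mono[OF repnorm_bound[OF r v], of "cmod b"] by simp
  qed (simp add: repnorm_nonneg r)
  show "repnorm (sc a * p) = cmod a * repnorm p"
  proof (cases "a = 0")
    case True
    then show ?thesis using le[OF p, of a] repnorm_nonneg[of "sc a * p"] p by (simp add: free_intros)
  next
    case False
    have "p = sc (1 / a) * (sc a * p)"
      using False by (simp add: mult.assoc[symmetric] sc_simps flip: sc_simps(4))
    then have "repnorm p \<le> cmod (1 / a) * repnorm (sc a * p)"
      using le[of "sc a * p" "1 / a"] p by (metis free_mult free_sc)
    then have "cmod a * repnorm p \<le> repnorm (sc a * p)" using False by (simp add: norm_divide field_simps)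
    then show ?thesis using le[OF p, of a] by simp
  qed
next
  have sq: "(repnorm p)\<^sup>2 \<le> repnorm (nc_star p * p)" if p: "p \<in> free_alg N" for p
  proof -
    have pp: "nc_star p * p \<in> free_alg N" using p by (simp add: free_intros)
    have "repnorm p \<le> sqrt (repnorm (nc_star p * p))"
    proof (rule repnorm_le)
      fix v assume v: "v \<in> V"
      have "complex_of_real ((vnorm (rep p v))\<^sup>2) = vinner v (rep (nc_star p * p) v)"
        unfolding vinner_self[OF rep_V[OF v], symmetric] rep_mult
        using rep_star[OF rep_V[OF v] v, of "nc_star p"] by simp
      then have "(vnorm (rep p v))\<^sup>2 = cmod (vinner v (rep (nc_star p * p) v))"
        by (metis norm_of_real abs_of_nonneg zero_le_power2)
      also have "\<dots> \<le> vnorm v * vnorm (rep (nc_star p * p) v)" by (intro vinner_CS v rep_V)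
      also have "\<dots> \<le> vnorm v * (repnorm (nc_star p * p) * vnorm v)"
        by (intro mult_left_mono repnorm_bound pp v vnorm_nonneg)
      also have "\<dots> = (sqrt (repnorm (nc_star p * p)) * vnorm v)\<^sup>2"
        using repnorm_nonneg[OF pp] by (simp add: power_mult_distrib) (simp add: power2_eq_square)
      finally show "vnorm (rep p v) \<le> sqrt (repnorm (nc_star p * p)) * vnorm v"
        by (rule power2_le_imp_le) (simp add: repnorm_nonneg pp vnorm_nonneg v)
    qed (simp add: repnorm_nonneg pp)
    then have "(repnorm p)\<^sup>2 \<le> (sqrt (repnorm (nc_star p * p)))\<^sup>2"
      by (intro power_mono repnorm_nonneg p)
    then show ?thesis using repnorm_nonneg[OF pp] by simp
  qed
  have mult: "repnorm (p * r) \<le> repnorm p * repnorm r" if p: "p \<in> free_alg N" and r: "r \<in> free_alg N" for p r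
  proof (rule repnorm_le)
    fix v assume v: "v \<in> V"
    show "vnorm (rep (p * r) v) \<le> repnorm p * repnorm r * vnorm v"
      unfolding rep_mult
      using repnorm_bound[OF p rep_V[OF v], of r] mult_left_mono[OF repnorm_bound[OF r v] repnorm_nonneg[OF p]] by simp
  qed (simp add: repnorm_nonneg p r)
  have le: "repnorm p \<le> repnorm (nc_star p)" if p: "p \<in> free_alg N" for p
  proof (cases "repnorm p = 0")
    case False
    have "repnorm p * repnorm p \<le> repnorm (nc_star p) * repnorm p"
      using sq[OF p] mult[OF free_star[OF p] p] by (simp add: power2_eq_square)
    then show ?thesis using False repnorm_nonneg[OF p] by simp
  qed (simp add: repnorm_nonneg free_star p)
  fix p assume p: "p \<in> free_alg N"
  have "repnorm (nc_star p * p) \<le> repnorm p * repnorm p"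
    using mult[OF free_star[OF p] p] le[OF free_star[OF p]] mult_right_mono[OF _ repnorm_nonneg[OF p], of "repnorm (nc_star p)" "repnorm p"] by simp
  then show "repnorm (nc_star p * p) = (repnorm p)\<^sup>2" using sq[OF p] by (simp add: power2_eq_square)
next
  have zero: "repnorm p = 0" if "p \<in> free_alg N" "\<And>v I J. v \<in> V \<Longrightarrow> rep p v I J = 0" for p
  proof -
    have "rep p v = (\<lambda>_ _. 0)" if "v \<in> V" for v using that \<open>\<And>v I J. v \<in> V \<Longrightarrow> rep p v I J = 0\<close> by blast
    then have "repnorm p \<le> 0" by (intro repnorm_le) (simp_all add: vnorm_zero)
    then show ?thesis using repnorm_nonneg[OF that(1)] by simp
  qed
  have diff: "rep (p - r) v I J = rep p v I J - rep r v I J" for p r v I J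
    using rep_add[of "p - r" r v] by simp
  fix i j assume ij: "i < N" "j < N"
  show "repnorm ((\<Sum>k<N. gen i k * gen j k) - (if i = j then 1 else 0)) = 0"
    using ij by (intro zero) (auto simp: diff rep_sum rep_mult rep_gen rep_one rep_zero U_unitary intro!: free_intros)
  show "repnorm ((\<Sum>k<N. gen k i * gen k j) - (if i = j then 1 else 0)) = 0"
    using ij by (intro zero) (auto simp: diff rep_sum rep_mult rep_gen rep_one rep_zero U_unitary' intro!: free_intros)
qed

subsection \<open>Injectivity of \<open>u\<^sub>n\<close>\<close>

definition vacuum :: tmat where "vacuum = (\<lambda>I J. if I = [] \<and> J = [] then 1 else 0)"

lemma vacuum_V: "vacuum \<in> V"
  by (auto simp: V_def H_def vacuum_def)

text \<open>
A monomial of degree \<open>n\<close> applied to the vacuum has its component of degree \<open>n\<close> from creations alone, which build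
\<open>P\<^sub>n e\<^sub>I \<otimes> P\<^sub>n e\<^sub>J\<close>.
\<close>

lemma wordop_vacuum_top:
  assumes "I \<in> words N n" "J \<in> words N n"
  shows "n < length K \<Longrightarrow> wordop (zip I J) vacuum K L = 0"
    "K \<in> words N n \<Longrightarrow> L \<in> words N n \<Longrightarrow> wordop (zip I J) vacuum K L = (\<Prod>m<n. sqrtc (Suc m)) * Q n K I * Q n L J"
  using assms
proof (induction n arbitrary: I J K L)
  case 0
  { case 1 then show ?case by (simp add: vacuum_def) next case 2 then show ?case by (simp add: vacuum_def) }
next
  case (Suc n)
  {
    case 1
    then obtain i I' j J' where IJ: "I = i # I'" "J = j # J'" "I' \<in> words N n" "J' \<in> words N n" "i < N" "j < N"
      by (cases I; cases J) auto
    have "wordop (zip I' J') vacuum A B = 0" if "A \<in> words N (length K - 1)" for A B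
      using Suc.IH(1)[of A I' J' B] 1 IJ length_words[OF that] by simp
    moreover have "wordop (zip I' J') vacuum (i # K) (j # L) = 0"
      using Suc.IH(1)[of "i # K" I' J' "j # L"] 1 IJ by simp
    ultimately show ?case by (simp add: IJ U_def create_def annih_def)
  next
    case 2
    then obtain i I' j J' where IJ: "I = i # I'" "J = j # J'" "I' \<in> words N n" "J' \<in> words N n" "i < N" "j < N"
      by (cases I; cases J) auto
    have z: "wordop (zip I' J') vacuum (i # K) (j # L) = 0"
      using Suc.IH(1)[of "i # K" I' J' "j # L"] 2 IJ length_words[of K N "Suc n"] by simp
    have "wordop (zip I J) vacuum K L = sqrtc (Suc n) * (\<Sum>A\<in>words N n. \<Sum>B\<in>words N n. Q (Suc n) K (i # A) * Q (Suc n) L (j # B) * wordop (zip I' J') vacuum A B)"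
      using U_level[of K "Suc n" L i j "wordop (zip I' J') vacuum"] 2 by (simp add: IJ z del: Q.simps)
    also have "\<dots> = sqrtc (Suc n) * (\<Sum>A\<in>words N n. \<Sum>B\<in>words N n. (\<Prod>m<n. sqrtc (Suc m)) * ((Q (Suc n) K (i # A) * Q n A I') * (Q (Suc n) L (j # B) * Q n B J')))"
      using Suc.IH(2) IJ by (simp add: mult_ac del: Q.simps)
    also have "\<dots> = (\<Prod>m<Suc n. sqrtc (Suc m)) * Q (Suc n) K (i # I') * Q (Suc n) L (j # J')"
      unfolding sum_distrib_left[symmetric] sum_distrib_right[symmetric] Q_absorb
      by (simp only: prod.lessThan_Suc mult_ac)
    finally show ?case by (simp add: IJ del: Q.simps)
  }
qed

text \<open>
A relation in the universal \<open>C\<^sup>*\<close>-algebra holds in the representation; its top component at the vacuum is the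
compression of the coefficient matrix to \<open>H\<^sub>n \<otimes> H\<^sub>n\<close>.
\<close>

lemma coefficients_independent:
  assumes eq: "eqv N (\<Sum>I\<in>words N n. \<Sum>J\<in>words N n. sc (A I J) * um I J) 0"
    and K: "K \<in> words N n" and L: "L \<in> words N n"
  shows "(\<Sum>I\<in>words N n. \<Sum>J\<in>words N n. A I J * (Q n K I * Q n L J)) = 0"
proof -
  let ?p = "\<Sum>I\<in>words N n. \<Sum>J\<in>words N n. sc (A I J) * um I J"
  have p: "?p \<in> free_alg N" by (intro free_intros um_free)
  have "repnorm ?p \<le> 0" using le_unorm[OF repnorm_cstar p] eq by (simp add: eqv_def)
  then have "vnorm (rep ?p vacuum) \<le> 0 * vnorm vacuum"
    using repnorm_bound[OF p vacuum_V] mult_right_mono[of "repnorm ?p" 0 "vnorm vacuum"] vnorm_nonneg[OF vacuum_V] by simp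
  then have "vnorm (rep ?p vacuum) = 0" using vnorm_nonneg[OF rep_V[OF vacuum_V, of ?p]] by simp
  then have "rep ?p vacuum K L = 0" by (rule vnorm_zeroD[OF rep_V[OF vacuum_V]])
  moreover have "rep ?p vacuum K L = (\<Sum>I\<in>words N n. \<Sum>J\<in>words N n. A I J * ((\<Prod>m<n. sqrtc (Suc m)) * Q n K I * Q n L J))"
    unfolding rep_sum rep_sc um_def rep_single
    by (intro sum.cong refl) (simp add: wordop_vacuum_top(2) K L)
  moreover have "\<dots> = (\<Prod>m<n. sqrtc (Suc m)) * (\<Sum>I\<in>words N n. \<Sum>J\<in>words N n. A I J * (Q n K I * Q n L J))"
    by (simp add: sum_distrib_left mult_ac)
  moreover have "(\<Prod>m<n. sqrtc (Suc m)) \<noteq> 0"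
    using c_pos by (auto simp: sqrtc_def less_imp_neq[symmetric])
  ultimately show ?thesis by simp
qed

end

section \<open>Orthogonality relations\<close>

lemma sc_left: "v * (sc a * p) = sc a * (v * p)"
  by (metis mult.assoc sc_central)

lemma sc_comm: "sc a * (sc b * p) = sc b * (sc a * p)"
  by (rule sc_left)

lemma sc_pull:
  "gen i j * (sc a * p) = sc a * (gen i j * p)"
  "um I J * (sc a * p) = sc a * (um I J * p)"
  "nc_star r * (sc a * p) = sc a * (nc_star r * p)"
  by (rule sc_left)+

lemma star_um_free: "I \<in> words N n \<Longrightarrow> J \<in> words N n \<Longrightarrow> nc_star (um I J) \<in> free_alg N"
  by (intro free_star um_free)

lemma eqv_sc: "eqv N p r \<Longrightarrow> eqv N (sc a * p) (sc a * r)"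
  by (intro eqv_mult_left free_sc)

text \<open>
Tensor powers of a unitary corepresentation are unitary.
\<close>

lemma um_unitary_left:
  assumes "J \<in> words N n" "K \<in> words N n"
  shows "eqv N (\<Sum>I\<in>words N n. nc_star (um I J) * um I K) (if J = K then 1 else 0)"
  using assms
proof (induction n arbitrary: J K)
  case 0
  then show ?case by (simp add: um_Nil star_one eqv_refl free_one)
next
  case (Suc n)
  obtain j J' k K' where JK: "J = j # J'" "K = k # K'" "J' \<in> words N n" "K' \<in> words N n" "j < N" "k < N"
    using Suc.prems by (cases J; cases K) auto
  have 1: "(\<Sum>I\<in>words N (Suc n). nc_star (um I J) * um I K) = (\<Sum>I\<in>words N n. nc_star (um I J') * ((\<Sum>a<N. gen a j * gen a k) * um I K'))"
    unfolding sum_words_Suc JK um_Cons star_mult star_gen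
    by (subst sum.swap) (simp add: sum_distrib_left sum_distrib_right mult.assoc)
  have 2: "eqv N (\<Sum>I\<in>words N n. nc_star (um I J') * ((\<Sum>a<N. gen a j * gen a k) * um I K'))
     (\<Sum>I\<in>words N n. nc_star (um I J') * ((if j = k then 1 else 0) * um I K'))"
    using JK by (intro eqv_sum eqv_mult_left eqv_mult_right eqv_rel2 um_free star_um_free)
  have 3: "(\<Sum>I\<in>words N n. nc_star (um I J') * ((if j = k then 1 else 0) * um I K')) =
     (if j = k then \<Sum>I\<in>words N n. nc_star (um I J') * um I K' else 0)"
    by simp
  have 4: "eqv N (if j = k then \<Sum>I\<in>words N n. nc_star (um I J') * um I K' else 0) (if j = k then (if J' = K' then 1 else 0) else 0)"
    using Suc.IH[OF JK(3,4)] by (simp add: eqv_refl free_zero)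
  have "eqv N (\<Sum>I\<in>words N (Suc n). nc_star (um I J) * um I K) (if j = k then (if J' = K' then 1 else 0) else 0)"
    unfolding 1 by (rule eqv_trans[OF 2]) (simp only: 3 4)
  then show ?case by (simp add: JK split: if_splits)
qed

lemma um_unitary_right:
  assumes "J \<in> words N n" "K \<in> words N n"
  shows "eqv N (\<Sum>I\<in>words N n. um I J * nc_star (um I K)) (if J = K then 1 else 0)"
  using assms
proof (induction n arbitrary: J K)
  case 0
  then show ?case by (simp add: um_Nil star_one eqv_refl free_one)
next
  case (Suc n)
  obtain j J' where J: "J = J' @ [j]" "J' \<in> words N n" "j < N"
    using Suc.prems(1) by (cases J rule: rev_cases) auto
  obtain k K' where K: "K = K' @ [k]" "K' \<in> words N n" "k < N"
    using Suc.prems(2) by (cases K rule: rev_cases) auto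
  have "(\<Sum>I\<in>words N (Suc n). um I J * nc_star (um I K)) = (\<Sum>I\<in>words N n. \<Sum>a<N. um I J' * ((gen a j * gen a k) * nc_star (um I K')))"
    unfolding sum_words_snoc J K
    by (intro sum.cong refl) (use J K in \<open>simp add: um_snoc star_mult star_gen mult.assoc length_words\<close>)
  also have "\<dots> = (\<Sum>I\<in>words N n. um I J' * ((\<Sum>a<N. gen a j * gen a k) * nc_star (um I K')))"
    by (simp only: sum_distrib_left sum_distrib_right)
  finally have 1: "(\<Sum>I\<in>words N (Suc n). um I J * nc_star (um I K)) = \<dots>" .
  have 2: "eqv N (\<Sum>I\<in>words N n. um I J' * ((\<Sum>a<N. gen a j * gen a k) * nc_star (um I K')))
     (\<Sum>I\<in>words N n. um I J' * ((if j = k then 1 else 0) * nc_star (um I K')))"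
    using J K by (intro eqv_sum eqv_mult_left eqv_mult_right eqv_rel2 um_free star_um_free)
  have 3: "(\<Sum>I\<in>words N n. um I J' * ((if j = k then 1 else 0) * nc_star (um I K'))) =
     (if j = k then \<Sum>I\<in>words N n. um I J' * nc_star (um I K') else 0)"
    by simp
  have 4: "eqv N (if j = k then \<Sum>I\<in>words N n. um I J' * nc_star (um I K') else 0) (if j = k then (if J' = K' then 1 else 0) else 0)"
    using Suc.IH[OF J(2) K(2)] by (simp add: eqv_refl free_zero)
  have "eqv N (\<Sum>I\<in>words N (Suc n). um I J * nc_star (um I K)) (if j = k then (if J' = K' then 1 else 0) else 0)"
    unfolding 1 by (rule eqv_trans[OF 2]) (simp only: 3 4)
  then show ?case by (simp add: J K split: if_splits)
qed

context temperley_lieb begin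

text \<open>
\<open>P\<^sub>n u = u P\<^sub>n\<close>.  By the recursion it suffices that \<open>t t\<^sup>*\<close> intertwines, which is unitarity of \<open>u\<close> together with
self-adjointness of the generators.
\<close>

lemma Q_intertwiner:
  assumes "I \<in> words N n" "L \<in> words N n"
  shows "eqv N (\<Sum>K\<in>words N n. sc (Q n I K) * um K L) (\<Sum>K\<in>words N n. sc (Q n K L) * um I K)"
  using assms
proof (induction n arbitrary: I L)
  case 0
  then show ?case by (simp add: um_Nil sc_simps eqv_refl free_one)
next
  case (Suc n)
  obtain a I' l L' where IL: "I = a # I'" "L = l # L'" "I' \<in> words N n" "L' \<in> words N n" "a < N" "l < N"
    using Suc.prems by (cases I; cases L) auto
  let ?c = "complex_of_real (c n)" and ?M = "words N (n - 1)" and ?W = "words N n"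
  define P1 where "P1 = gen a l * (\<Sum>K\<in>?W. sc (Q n I' K) * um K L')"
  define P2 where "P2 = (\<Sum>b<N. \<Sum>A\<in>?M. sc (Q n I' (a # A)) * (gen b l * (\<Sum>K\<in>?W. sc (Q n (b # A) K) * um K L')))"
  define R1 where "R1 = gen a l * (\<Sum>K\<in>?W. sc (Q n K L') * um I' K)"
  define R2 where "R2 = (\<Sum>b<N. \<Sum>A\<in>?M. sc (Q n (l # A) L') * (gen a b * (\<Sum>K\<in>?W. sc (Q n K (b # A)) * um I' K)))"
  have lhs: "(\<Sum>K\<in>words N (Suc n). sc (Q (Suc n) I K) * um K L) = P1 + sc (- ?c) * P2"
  proof -
    have "(\<Sum>K\<in>words N (Suc n). sc (Q (Suc n) I K) * um K L) = (\<Sum>b<N. \<Sum>K\<in>?W.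
       (if a = b then sc (Q n I' K) * (gen b l * um K L') else 0) +
       sc (- ?c) * (\<Sum>A\<in>?M. sc (Q n I' (a # A)) * (sc (Q n (b # A) K) * (gen b l * um K L'))))"
    proof -
      have sc_sum: "sc (\<Sum>x\<in>A. f x) = (\<Sum>x\<in>A. sc (f x))" for f :: "nat list \<Rightarrow> complex" and A
        by (induction A rule: infinite_finite_induct) (simp_all add: sc_simps)
      show ?thesis
        unfolding sum_words_Suc
        by (intro sum.cong refl) (use IL in \<open>simp add: um_Cons sc_simps sc_sum left_diff_distrib sum_distrib_right sum_distrib_left mult.assoc sum_negf\<close>)
    qed
    also have "\<dots> = (\<Sum>b<N. if a = b then \<Sum>K\<in>?W. sc (Q n I' K) * (gen b l * um K L') else 0) +
       sc (- ?c) * (\<Sum>b<N. \<Sum>K\<in>?W. \<Sum>A\<in>?M. sc (Q n I' (a # A)) * (sc (Q n (b # A) K) * (gen b l * um K L')))"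
    proof -
      have "(\<Sum>K\<in>?W. if a = b then sc (Q n I' K) * (gen b l * um K L') else 0) = (if a = b then \<Sum>K\<in>?W. sc (Q n I' K) * (gen b l * um K L') else 0)" for b
        by simp
      then show ?thesis by (simp only: sum.distrib sum_distrib_left)
    qed
    also have "(\<Sum>b<N. if a = b then \<Sum>K\<in>?W. sc (Q n I' K) * (gen b l * um K L') else 0) = P1"
      using IL by (simp add: P1_def sum_distrib_left sc_pull)
    also have "(\<Sum>b<N. \<Sum>K\<in>?W. \<Sum>A\<in>?M. sc (Q n I' (a # A)) * (sc (Q n (b # A) K) * (gen b l * um K L'))) = P2"
      unfolding P2_def sum_distrib_left by (rule sum.cong[OF refl], subst sum.swap) (simp only: sc_pull)
    finally show ?thesis .
  qed
  have rhs: "(\<Sum>K\<in>words N (Suc n). sc (Q (Suc n) K L) * um I K) = R1 + sc (- ?c) * R2"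
  proof -
    have "(\<Sum>K\<in>words N (Suc n). sc (Q (Suc n) K L) * um I K) = (\<Sum>b<N. \<Sum>K\<in>?W.
       (if b = l then sc (Q n K L') * (gen a b * um I' K) else 0) +
       sc (- ?c) * (\<Sum>A\<in>?M. sc (Q n (l # A) L') * (sc (Q n K (b # A)) * (gen a b * um I' K))))"
    proof -
      have sc_sum: "sc (\<Sum>x\<in>A. f x) = (\<Sum>x\<in>A. sc (f x))" for f :: "nat list \<Rightarrow> complex" and A
        by (induction A rule: infinite_finite_induct) (simp_all add: sc_simps)
      have Qe: "Q (Suc n) (b # K) (l # L') = (if b = l then Q n K L' else 0) + (- ?c) * (\<Sum>A\<in>?M. Q n (l # A) L' * Q n K (b # A))"
        if "b < N" for b K
        using IL that by (simp add: mult.commute[of "Q n K _"])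
      show ?thesis
        unfolding sum_words_Suc
        by (intro sum.cong refl)
          (use IL in \<open>simp add: um_Cons Qe sc_simps sc_sum left_diff_distrib sum_distrib_right sum_distrib_left mult.assoc sum_negf sc_pull del: Q.simps\<close>)
    qed
    also have "\<dots> = (\<Sum>b<N. if b = l then \<Sum>K\<in>?W. sc (Q n K L') * (gen a b * um I' K) else 0) +
       sc (- ?c) * (\<Sum>b<N. \<Sum>K\<in>?W. \<Sum>A\<in>?M. sc (Q n (l # A) L') * (sc (Q n K (b # A)) * (gen a b * um I' K)))"
    proof -
      have "(\<Sum>K\<in>?W. if b = l then sc (Q n K L') * (gen a b * um I' K) else 0) = (if b = l then \<Sum>K\<in>?W. sc (Q n K L') * (gen a b * um I' K) else 0)" for b
        by simp
      then show ?thesis by (simp only: sum.distrib sum_distrib_left)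
    qed
    also have "(\<Sum>b<N. if b = l then \<Sum>K\<in>?W. sc (Q n K L') * (gen a b * um I' K) else 0) = R1"
      using IL by (simp add: R1_def sum_distrib_left sc_pull)
    also have "(\<Sum>b<N. \<Sum>K\<in>?W. \<Sum>A\<in>?M. sc (Q n (l # A) L') * (sc (Q n K (b # A)) * (gen a b * um I' K))) = R2"
      unfolding R2_def sum_distrib_left by (rule sum.cong[OF refl], subst sum.swap) (simp only: sc_pull)
    finally show ?thesis .
  qed
  have free: "P1 \<in> free_alg N" "P2 \<in> free_alg N" "R1 \<in> free_alg N" "R2 \<in> free_alg N"
    unfolding P1_def P2_def R1_def R2_def using IL by (auto intro!: free_sum free_mult free_sc free_gen um_free)
  have first: "eqv N P1 R1"
    unfolding P1_def R1_def using Suc.IH[OF IL(3,4)] IL by (intro eqv_mult_left free_gen)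
  have second: "eqv N (sc (- ?c) * P2) (sc (- ?c) * R2)"
  proof (cases n)
    case 0
    have "P2 \<in> free_alg N" "R2 \<in> free_alg N" by (fact free)+
    then show ?thesis using 0 by (simp add: sc_simps eqv_refl free_zero)
  next
    case (Suc m)
    \<comment> \<open>both sides of the intertwining relation for the Wenzl correction reduce to this element\<close>
    define Z where "Z = (\<Sum>A\<in>?M. \<Sum>B\<in>?M. sc (Q n I' (a # A)) * (sc (Q n (l # B) L') * um A B))"
    have W: "A \<in> ?M \<Longrightarrow> b < N \<Longrightarrow> b # A \<in> ?W" for A b using Suc by simp
    have A: "eqv N P2 (\<Sum>b<N. \<Sum>A\<in>?M. sc (Q n I' (a # A)) * (gen b l * (\<Sum>K\<in>?W. sc (Q n K L') * um (b # A) K)))"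
      unfolding P2_def using IL W
      by (intro eqv_sum eqv_sc eqv_mult_left free_gen Suc.IH) auto
    have B: "(\<Sum>b<N. \<Sum>A\<in>?M. sc (Q n I' (a # A)) * (gen b l * (\<Sum>K\<in>?W. sc (Q n K L') * um (b # A) K)))
       = (\<Sum>A\<in>?M. \<Sum>k<N. \<Sum>B\<in>?M. sc (Q n I' (a # A)) * (sc (Q n (k # B) L') * ((\<Sum>b<N. gen b l * gen b k) * um A B)))"
    proof -
      have "(\<Sum>b<N. \<Sum>A\<in>?M. sc (Q n I' (a # A)) * (gen b l * (\<Sum>K\<in>?W. sc (Q n K L') * um (b # A) K)))
        = (\<Sum>b<N. \<Sum>A\<in>?M. \<Sum>k<N. \<Sum>B\<in>?M. sc (Q n I' (a # A)) * (sc (Q n (k # B) L') * (gen b l * gen b k * um A B)))"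
        unfolding Suc by (simp add: sum_words_Suc um_Cons sum_distrib_left sc_pull mult.assoc del: Q.simps)
      also have "\<dots> = (\<Sum>A\<in>?M. \<Sum>b<N. \<Sum>k<N. \<Sum>B\<in>?M. sc (Q n I' (a # A)) * (sc (Q n (k # B) L') * (gen b l * gen b k * um A B)))"
        by (rule sum.swap)
      also have "\<dots> = (\<Sum>A\<in>?M. \<Sum>k<N. \<Sum>b<N. \<Sum>B\<in>?M. sc (Q n I' (a # A)) * (sc (Q n (k # B) L') * (gen b l * gen b k * um A B)))"
        by (rule sum.cong[OF refl], rule sum.swap)
      also have "\<dots> = (\<Sum>A\<in>?M. \<Sum>k<N. \<Sum>B\<in>?M. \<Sum>b<N. sc (Q n I' (a # A)) * (sc (Q n (k # B) L') * (gen b l * gen b k * um A B)))"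
        by (rule sum.cong[OF refl], rule sum.cong[OF refl], rule sum.swap)
      finally show ?thesis by (simp only: sum_distrib_left sum_distrib_right)
    qed
    have C: "eqv N (\<Sum>A\<in>?M. \<Sum>k<N. \<Sum>B\<in>?M. sc (Q n I' (a # A)) * (sc (Q n (k # B) L') * ((\<Sum>b<N. gen b l * gen b k) * um A B))) (\<Sum>A\<in>?M. \<Sum>k<N. \<Sum>B\<in>?M. sc (Q n I' (a # A)) * (sc (Q n (k # B) L') * ((if l = k then 1 else 0) * um A B)))"
      using IL by (intro eqv_sum eqv_sc eqv_mult_right eqv_rel2 um_free) auto
    have D: "(\<Sum>A\<in>?M. \<Sum>k<N. \<Sum>B\<in>?M. sc (Q n I' (a # A)) * (sc (Q n (k # B) L') * ((if l = k then 1 else 0) * um A B))) = Z"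
    proof -
      have "(\<Sum>B\<in>?M. sc (Q n I' (a # A)) * (sc (Q n (k # B) L') * ((if l = k then 1 else 0) * um A B))) =
         (if l = k then \<Sum>B\<in>?M. sc (Q n I' (a # A)) * (sc (Q n (l # B) L') * um A B) else 0)" for A k
        by simp
      then show ?thesis using IL by (simp add: Z_def)
    qed
    have PZ: "eqv N P2 Z" using eqv_trans[OF A[unfolded B] C[unfolded D]] .
    have A: "eqv N R2 (\<Sum>b<N. \<Sum>A\<in>?M. sc (Q n (l # A) L') * (gen a b * (\<Sum>K\<in>?W. sc (Q n I' K) * um K (b # A))))"
      unfolding R2_def using IL W
      by (intro eqv_sum eqv_sc eqv_mult_left free_gen eqv_sym[OF Suc.IH]) auto
    have B: "(\<Sum>b<N. \<Sum>A\<in>?M. sc (Q n (l # A) L') * (gen a b * (\<Sum>K\<in>?W. sc (Q n I' K) * um K (b # A))))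
       = (\<Sum>A\<in>?M. \<Sum>k<N. \<Sum>B\<in>?M. sc (Q n (l # A) L') * (sc (Q n I' (k # B)) * ((\<Sum>b<N. gen a b * gen k b) * um B A)))"
    proof -
      have "(\<Sum>b<N. \<Sum>A\<in>?M. sc (Q n (l # A) L') * (gen a b * (\<Sum>K\<in>?W. sc (Q n I' K) * um K (b # A))))
        = (\<Sum>b<N. \<Sum>A\<in>?M. \<Sum>k<N. \<Sum>B\<in>?M. sc (Q n (l # A) L') * (sc (Q n I' (k # B)) * (gen a b * gen k b * um B A)))"
        unfolding Suc by (simp add: sum_words_Suc um_Cons sum_distrib_left sc_pull mult.assoc del: Q.simps)
      also have "\<dots> = (\<Sum>A\<in>?M. \<Sum>b<N. \<Sum>k<N. \<Sum>B\<in>?M. sc (Q n (l # A) L') * (sc (Q n I' (k # B)) * (gen a b * gen k b * um B A)))"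
        by (rule sum.swap)
      also have "\<dots> = (\<Sum>A\<in>?M. \<Sum>k<N. \<Sum>b<N. \<Sum>B\<in>?M. sc (Q n (l # A) L') * (sc (Q n I' (k # B)) * (gen a b * gen k b * um B A)))"
        by (rule sum.cong[OF refl], rule sum.swap)
      also have "\<dots> = (\<Sum>A\<in>?M. \<Sum>k<N. \<Sum>B\<in>?M. \<Sum>b<N. sc (Q n (l # A) L') * (sc (Q n I' (k # B)) * (gen a b * gen k b * um B A)))"
        by (rule sum.cong[OF refl], rule sum.cong[OF refl], rule sum.swap)
      finally show ?thesis by (simp only: sum_distrib_left sum_distrib_right)
    qed
    have C: "eqv N (\<Sum>A\<in>?M. \<Sum>k<N. \<Sum>B\<in>?M. sc (Q n (l # A) L') * (sc (Q n I' (k # B)) * ((\<Sum>b<N. gen a b * gen k b) * um B A))) (\<Sum>A\<in>?M. \<Sum>k<N. \<Sum>B\<in>?M. sc (Q n (l # A) L') * (sc (Q n I' (k # B)) * ((if a = k then 1 else 0) * um B A)))"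
      using IL by (intro eqv_sum eqv_sc eqv_mult_right eqv_rel1 um_free) auto
    have D: "(\<Sum>A\<in>?M. \<Sum>k<N. \<Sum>B\<in>?M. sc (Q n (l # A) L') * (sc (Q n I' (k # B)) * ((if a = k then 1 else 0) * um B A))) = Z"
    proof -
      have "(\<Sum>B\<in>?M. sc (Q n (l # A) L') * (sc (Q n I' (k # B)) * ((if a = k then 1 else 0) * um B A))) =
         (if a = k then \<Sum>B\<in>?M. sc (Q n (l # A) L') * (sc (Q n I' (a # B)) * um B A) else 0)" for A k
        by simp
      then have "(\<Sum>A\<in>?M. \<Sum>k<N. \<Sum>B\<in>?M. sc (Q n (l # A) L') * (sc (Q n I' (k # B)) * ((if a = k then 1 else 0) * um B A)))
        = (\<Sum>A\<in>?M. \<Sum>B\<in>?M. sc (Q n I' (a # B)) * (sc (Q n (l # A) L') * um B A))"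
        using IL by (simp add: sc_comm)
      also have "\<dots> = Z" unfolding Z_def by (rule sum.swap)
      finally show ?thesis .
    qed
    have "eqv N R2 Z" using eqv_trans[OF A[unfolded B] C[unfolded D]] .
    then show ?thesis by (intro eqv_sc eqv_trans[OF PZ eqv_sym])
  qed
  show ?case unfolding lhs rhs by (rule eqv_add[OF first second])
qed

context
  fixes h assumes haar: "haar_state N h"
begin

definition \<Phi> :: "nat list \<Rightarrow> nat list \<Rightarrow> nat list \<Rightarrow> nat list \<Rightarrow> complex" where
  "\<Phi> I J K L = haarpoly N h (nc_star (um I J) * um K L)"

text \<open>
Invariance applied to the coefficient \<open>u\<^sub>I\<^sub>J\<^sup>* u\<^sub>K\<^sub>L\<close>, whose coproduct is that of a monomial of degree
\<open>2 n\<close> because the generators are self-adjoint.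
\<close>

lemma \<Phi>_invariance:
  assumes "I \<in> words N n" "J \<in> words N n" "K \<in> words N n" "L \<in> words N n"
  shows "eqv N (\<Sum>A\<in>words N n. \<Sum>B\<in>words N n. sc (\<Phi> A J B L) * (nc_star (um I A) * um K B)) (sc (\<Phi> I J K L))"
proof -
  have um2: "um (rev A @ B) (rev C @ D) = nc_star (um A C) * um B D"
    if "A \<in> words N n" "C \<in> words N n" for A B C D
    using that by (simp add: um_append um_star length_words)
  have IK: "rev I @ K \<in> words N (n + n)" and JL: "rev J @ L \<in> words N (n + n)"
    using assms by (auto simp: words_def)
  have "(\<Sum>M\<in>words N (n + n). sc (haarpoly N h (um M (rev J @ L))) * um (rev I @ K) M)
    = (\<Sum>A\<in>words N n. \<Sum>B\<in>words N n. sc (haarpoly N h (um (rev A @ B) (rev J @ L))) * um (rev I @ K) (rev A @ B))"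
    unfolding sum_words_add by (rule sum_words_rev[symmetric])
  also have "\<dots> = (\<Sum>A\<in>words N n. \<Sum>B\<in>words N n. sc (\<Phi> A J B L) * (nc_star (um I A) * um K B))"
    by (intro sum.cong refl) (simp add: um2 assms \<Phi>_def)
  finally show ?thesis
    using haar_invariance[OF haar IK JL] um2[OF assms(1,2), of K L] by (simp add: \<Phi>_def)
qed

text \<open>
For fixed \<open>J\<close> and \<open>L\<close> the matrix \<open>S\<close> with entries \<open>S\<^sub>K\<^sub>I = \<Phi> I J K L\<close> satisfies \<open>u S = S u\<close>: multiply the
invariance by \<open>u\<close> on the left and use unitarity.
\<close>

lemma \<Phi>_commutes:
  assumes J: "J \<in> words N n" and K: "K \<in> words N n" and L: "L \<in> words N n" and Z: "Z \<in> words N n"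
  shows "eqv N (\<Sum>B\<in>words N n. sc (\<Phi> Z J B L) * um K B) (\<Sum>I\<in>words N n. sc (\<Phi> I J K L) * um I Z)"
proof -
  let ?W = "words N n"
  have A: "eqv N (\<Sum>I\<in>?W. um I Z * (\<Sum>A\<in>?W. \<Sum>B\<in>?W. sc (\<Phi> A J B L) * (nc_star (um I A) * um K B)))
     (\<Sum>I\<in>?W. um I Z * sc (\<Phi> I J K L))"
    using assms by (intro eqv_sum eqv_mult_left \<Phi>_invariance um_free)
  have R: "(\<Sum>I\<in>?W. um I Z * sc (\<Phi> I J K L)) = (\<Sum>I\<in>?W. sc (\<Phi> I J K L) * um I Z)"
    by (simp add: sc_central)
  have B: "(\<Sum>I\<in>?W. um I Z * (\<Sum>A\<in>?W. \<Sum>B\<in>?W. sc (\<Phi> A J B L) * (nc_star (um I A) * um K B)))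
     = (\<Sum>A\<in>?W. \<Sum>B\<in>?W. sc (\<Phi> A J B L) * ((\<Sum>I\<in>?W. um I Z * nc_star (um I A)) * um K B))"
  proof -
    have "(\<Sum>I\<in>?W. um I Z * (\<Sum>A\<in>?W. \<Sum>B\<in>?W. sc (\<Phi> A J B L) * (nc_star (um I A) * um K B)))
      = (\<Sum>I\<in>?W. \<Sum>A\<in>?W. \<Sum>B\<in>?W. sc (\<Phi> A J B L) * (um I Z * nc_star (um I A) * um K B))"
      by (simp only: sum_distrib_left sc_pull mult.assoc)
    also have "\<dots> = (\<Sum>A\<in>?W. \<Sum>I\<in>?W. \<Sum>B\<in>?W. sc (\<Phi> A J B L) * (um I Z * nc_star (um I A) * um K B))"
      by (rule sum.swap)
    also have "\<dots> = (\<Sum>A\<in>?W. \<Sum>B\<in>?W. \<Sum>I\<in>?W. sc (\<Phi> A J B L) * (um I Z * nc_star (um I A) * um K B))"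
      by (rule sum.cong[OF refl], rule sum.swap)
    finally show ?thesis by (simp only: sum_distrib_left sum_distrib_right)
  qed
  have C: "eqv N (\<Sum>A\<in>?W. \<Sum>B\<in>?W. sc (\<Phi> A J B L) * ((\<Sum>I\<in>?W. um I Z * nc_star (um I A)) * um K B)) (\<Sum>A\<in>?W. \<Sum>B\<in>?W. sc (\<Phi> A J B L) * ((if Z = A then 1 else 0) * um K B))"
    using assms by (intro eqv_sum eqv_sc eqv_mult_right um_unitary_right um_free)
  have D: "(\<Sum>A\<in>?W. \<Sum>B\<in>?W. sc (\<Phi> A J B L) * ((if Z = A then 1 else 0) * um K B)) = (\<Sum>B\<in>?W. sc (\<Phi> Z J B L) * um K B)"
  proof -
    have "(\<Sum>B\<in>?W. sc (\<Phi> A J B L) * ((if Z = A then 1 else 0) * um K B)) = (if Z = A then \<Sum>B\<in>?W. sc (\<Phi> Z J B L) * um K B else 0)" for A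
      by simp
    then show ?thesis using Z by simp
  qed
  show ?thesis using eqv_trans[OF eqv_sym[OF C[unfolded D]] A[unfolded R B]] .
qed

text \<open>
The trace of \<open>P S\<close>, computed by moving \<open>P\<close> through \<open>u\<close> and then using unitarity.
\<close>

lemma \<Phi>_trace:
  assumes J: "J \<in> words N n" and L: "L \<in> words N n"
  shows "(\<Sum>K\<in>words N n. \<Sum>A\<in>words N n. Q n K A * \<Phi> A J K L) = Q n J L"
proof -
  let ?W = "words N n"
  have fr: "nc_star (um A J) * um K L \<in> free_alg N" if "A \<in> ?W" "K \<in> ?W" for A K
    using that assms by (intro free_mult um_free star_um_free)
  have "(\<Sum>K\<in>?W. \<Sum>A\<in>?W. Q n K A * \<Phi> A J K L) = (\<Sum>A\<in>?W. \<Sum>K\<in>?W. Q n A K * \<Phi> A J K L)"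
    by (subst sum.swap) (simp add: Q_sym)
  also have "\<dots> = haarpoly N h (\<Sum>A\<in>?W. nc_star (um A J) * (\<Sum>K\<in>?W. sc (Q n A K) * um K L))"
    using fr by (simp add: \<Phi>_def haarpoly_sum[OF haar] haarpoly_sc[OF haar] sum_distrib_left sc_pull free_intros)
  also have "\<dots> = haarpoly N h (\<Sum>A\<in>?W. nc_star (um A J) * (\<Sum>K\<in>?W. sc (Q n K L) * um A K))"
    using assms by (intro haarpoly_eqv[OF haar] eqv_sum eqv_mult_left Q_intertwiner star_um_free)
  also have "(\<Sum>A\<in>?W. nc_star (um A J) * (\<Sum>K\<in>?W. sc (Q n K L) * um A K)) = (\<Sum>K\<in>?W. sc (Q n K L) * (\<Sum>A\<in>?W. nc_star (um A J) * um A K))"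
    unfolding sum_distrib_left by (subst sum.swap) (simp only: sc_pull)
  also have "haarpoly N h \<dots> = haarpoly N h (\<Sum>K\<in>?W. sc (Q n K L) * (if J = K then 1 else 0))"
    using assms by (intro haarpoly_eqv[OF haar] eqv_sum eqv_sc um_unitary_left)
  also have "\<dots> = Q n J L"
  proof -
    have "(\<Sum>K\<in>?W. sc (Q n K L) * (if J = K then 1 else 0)) = sc (Q n J L)"
      using J by (simp add: if_distrib[where f="\<lambda>x. _ * x"] cong: if_cong)
    then show ?thesis by (simp add: haarpoly_const[OF haar])
  qed
  finally show ?thesis .
qed

text \<open>
Schur's lemma.  The relation \<open>u S = S u\<close> is a linear relation between coefficients of \<open>u\<close>; by linear independence
it holds between the compressed coefficient matrices, where it reads \<open>rel\<close>.  So \<open>P S P\<close> is a multiple of \<open>P\<close>, and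
traces determine the factor.
\<close>

lemma \<Phi>_compressed:
  assumes J: "J \<in> words N n" and L: "L \<in> words N n" and Y: "Y \<in> words N n" and Z: "Z \<in> words N n"
  shows "(\<Sum>B\<in>words N n. \<Sum>I\<in>words N n. Q n Y B * (\<Phi> I J B L * Q n I Z)) = Q n J L * Q n Y Z / of_real (d n)"
proof -
  let ?W = "words N n"
  define T where "T X0 K = (\<Sum>A\<in>?W. Q n X0 A * \<Phi> A J K L)" for X0 K
  define S0 where "S0 Z0 = (\<Sum>B\<in>?W. Q n Y B * \<Phi> Z0 J B L)" for Z0
  have rel: "Q n X0 K * S0 Z0 = T X0 K * Q n Y Z0" if K: "K \<in> ?W" and Z0: "Z0 \<in> ?W" and X0: "X0 \<in> ?W" for X0 K Z0
  proof -
    \<comment> \<open>the relation \<open>u S = S u\<close> at the entry \<open>(K, Z0)\<close>, with all terms on one side\<close>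
    define coef where "coef A B = (if A = K then \<Phi> Z0 J B L else 0) - (if B = Z0 then \<Phi> A J K L else 0)" for A B
    have "(\<Sum>A\<in>?W. \<Sum>B\<in>?W. sc (coef A B) * um A B) = (\<Sum>B\<in>?W. sc (\<Phi> Z0 J B L) * um K B) - (\<Sum>A\<in>?W. sc (\<Phi> A J K L) * um A Z0)"
    proof -
      have "(\<Sum>A\<in>?W. \<Sum>B\<in>?W. sc (coef A B) * um A B) = (\<Sum>A\<in>?W. if A = K then \<Sum>B\<in>?W. sc (\<Phi> Z0 J B L) * um K B else 0)
         - (\<Sum>A\<in>?W. \<Sum>B\<in>?W. if B = Z0 then sc (\<Phi> A J K L) * um A Z0 else 0)"
        unfolding sum_subtractf[symmetric]
      proof (intro sum.cong refl)
        fix A assume "A \<in> ?W"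
        have "(if A = K then \<Sum>B\<in>?W. sc (\<Phi> Z0 J B L) * um K B else 0) = (\<Sum>B\<in>?W. if A = K then sc (\<Phi> Z0 J B L) * um K B else 0)" by simp
        then show "(\<Sum>B\<in>?W. sc (coef A B) * um A B) = (if A = K then \<Sum>B\<in>?W. sc (\<Phi> Z0 J B L) * um K B else 0) - (\<Sum>B\<in>?W. if B = Z0 then sc (\<Phi> A J K L) * um A Z0 else 0)"
          by (simp only: sum_subtractf[symmetric]) (intro sum.cong refl, auto simp: coef_def sc_simps left_diff_distrib)
      qed
      then show ?thesis using K Z0 by simp
    qed
    moreover have "eqv N \<dots> 0"
    proof -
      have e: "eqv N (\<Sum>B\<in>?W. sc (\<Phi> Z0 J B L) * um K B) (\<Sum>A\<in>?W. sc (\<Phi> A J K L) * um A Z0)"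
        by (rule \<Phi>_commutes[OF J K L Z0])
      then show ?thesis by (auto simp: eqv_def intro: free_diff free_zero)
    qed
    ultimately have "eqv N (\<Sum>A\<in>?W. \<Sum>B\<in>?W. sc (coef A B) * um A B) 0" by simp
    from coefficients_independent[OF this X0 Y]
    have "(\<Sum>A\<in>?W. \<Sum>B\<in>?W. coef A B * (Q n X0 A * Q n Y B)) = 0" .
    moreover have "(\<Sum>A\<in>?W. \<Sum>B\<in>?W. coef A B * (Q n X0 A * Q n Y B)) = (\<Sum>A\<in>?W. if A = K then Q n X0 K * S0 Z0 else 0)
         - (\<Sum>A\<in>?W. \<Sum>B\<in>?W. if B = Z0 then Q n X0 A * \<Phi> A J K L * Q n Y Z0 else 0)"
      unfolding sum_subtractf[symmetric]
    proof (intro sum.cong refl)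
      fix A assume "A \<in> ?W"
      have "(if A = K then Q n X0 K * S0 Z0 else 0) = (\<Sum>B\<in>?W. if A = K then Q n X0 K * (Q n Y B * \<Phi> Z0 J B L) else 0)"
        by (simp add: S0_def sum_distrib_left)
      then show "(\<Sum>B\<in>?W. coef A B * (Q n X0 A * Q n Y B)) = (if A = K then Q n X0 K * S0 Z0 else 0) - (\<Sum>B\<in>?W. if B = Z0 then Q n X0 A * \<Phi> A J K L * Q n Y Z0 else 0)"
        by (simp only: sum_subtractf[symmetric]) (intro sum.cong refl, auto simp: coef_def algebra_simps)
    qed
    ultimately show ?thesis using K Z0 by (simp add: T_def sum_distrib_right)
  qed
  define G where "G = (\<Sum>I\<in>?W. S0 I * Q n I Z)"
  have "Q n X0 K * G = T X0 K * Q n Y Z" if "K \<in> ?W" "X0 \<in> ?W" for X0 K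
  proof -
    have "Q n X0 K * G = (\<Sum>I\<in>?W. (Q n X0 K * S0 I) * Q n I Z)"
      by (simp add: G_def sum_distrib_left mult.assoc)
    also have "\<dots> = T X0 K * (\<Sum>I\<in>?W. Q n Y I * Q n I Z)"
      using that by (simp add: rel sum_distrib_left mult.assoc)
    finally show ?thesis by (simp only: Q_idem)
  qed
  then have "(\<Sum>K\<in>?W. Q n K K) * G = (\<Sum>K\<in>?W. T K K) * Q n Y Z"
    by (simp add: sum_distrib_right)
  moreover have "(\<Sum>K\<in>?W. T K K) = Q n J L"
    unfolding T_def by (rule \<Phi>_trace[OF J L])
  ultimately have "of_real (d n) * G = Q n J L * Q n Y Z" by (simp only: Q_trace)
  moreover have "G = (\<Sum>B\<in>?W. \<Sum>I\<in>?W. Q n Y B * (\<Phi> I J B L * Q n I Z))"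
    unfolding G_def S0_def sum_distrib_right by (subst sum.swap) (simp only: mult.assoc)
  ultimately show ?thesis by (simp add: field_simps)
qed

lemma ucoef_eq: "ucoef N n X = cu_emb N (\<Sum>I\<in>words N n. \<Sum>J\<in>words N n. sc (X J I) * um I J)"
  by (simp add: ucoef_def sc_def um_def mult_single)

text \<open>
\<open>\<Phi>_compressed\<close> contracted with the entries of \<open>X\<close> and \<open>Y\<close>, which absorb the projections.
\<close>

theorem haar_inner_ucoef:
  assumes X: "X \<in> MH n" and Y: "Y \<in> MH n"
  shows "haar_inner N h (ucoef N n X) (ucoef N n Y) = ip n X Y"
proof -
  let ?W = "words N n"
  let ?p = "\<lambda>X. \<Sum>I\<in>?W. \<Sum>J\<in>?W. sc (X J I) * um I J"
  have fr: "?p X \<in> free_alg N" for X by (intro free_intros um_free)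
  have "haar_inner N h (ucoef N n X) (ucoef N n Y) = haarpoly N h (nc_star (?p X) * ?p Y)"
    unfolding ucoef_eq by (rule haar_inner_emb[OF haar fr fr])
  also have "nc_star (?p X) * ?p Y = (\<Sum>I\<in>?W. \<Sum>J\<in>?W. \<Sum>K\<in>?W. \<Sum>L\<in>?W. sc (cnj (X J I) * Y L K) * (nc_star (um I J) * um K L))"
  proof -
    have "nc_star (?p X) = (\<Sum>I\<in>?W. \<Sum>J\<in>?W. sc (cnj (X J I)) * nc_star (um I J))"
      by (simp add: star_sum star_mult star_sc sc_central)
    then have "nc_star (?p X) * ?p Y = (\<Sum>I\<in>?W. \<Sum>J\<in>?W. \<Sum>K\<in>?W. \<Sum>L\<in>?W. (sc (cnj (X J I)) * nc_star (um I J)) * (sc (Y L K) * um K L))"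
      by (simp only: sum_distrib_right, simp only: sum_distrib_left)
    moreover have "(sc a * p) * (sc b * r) = sc (a * b) * (p * r)" for a b p r
      unfolding sc_simps(4) by (metis mult.assoc sc_left)
    ultimately show ?thesis by simp
  qed
  also have "haarpoly N h \<dots> = (\<Sum>I\<in>?W. \<Sum>J\<in>?W. \<Sum>K\<in>?W. \<Sum>L\<in>?W. cnj (X J I) * Y L K * \<Phi> I J K L)"
  proof -
    have "nc_star (um I J) * um K L \<in> free_alg N" if "I \<in> ?W" "J \<in> ?W" "K \<in> ?W" "L \<in> ?W" for I J K L
      using that by (intro free_mult um_free star_um_free)
    then show ?thesis by (simp add: \<Phi>_def haarpoly_sum[OF haar] haarpoly_sc[OF haar] free_intros)
  qed
  also have "\<dots> = (\<Sum>J\<in>?W. \<Sum>L\<in>?W. \<Sum>I\<in>?W. \<Sum>K\<in>?W. cnj (X J I) * Y L K * \<Phi> I J K L)"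
  proof -
    have "(\<Sum>I\<in>?W. \<Sum>J\<in>?W. \<Sum>K\<in>?W. \<Sum>L\<in>?W. cnj (X J I) * Y L K * \<Phi> I J K L)
       = (\<Sum>J\<in>?W. \<Sum>I\<in>?W. \<Sum>K\<in>?W. \<Sum>L\<in>?W. cnj (X J I) * Y L K * \<Phi> I J K L)" by (rule sum.swap)
    also have "\<dots> = (\<Sum>J\<in>?W. \<Sum>I\<in>?W. \<Sum>L\<in>?W. \<Sum>K\<in>?W. cnj (X J I) * Y L K * \<Phi> I J K L)"
      by (rule sum.cong[OF refl], rule sum.cong[OF refl], rule sum.swap)
    also have "\<dots> = (\<Sum>J\<in>?W. \<Sum>L\<in>?W. \<Sum>I\<in>?W. \<Sum>K\<in>?W. cnj (X J I) * Y L K * \<Phi> I J K L)"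
      by (rule sum.cong[OF refl], rule sum.swap)
    finally show ?thesis .
  qed
  also have "\<dots> = (\<Sum>J\<in>?W. \<Sum>L\<in>?W. \<Sum>Z\<in>?W. \<Sum>M\<in>?W. cnj (X J Z) * Y L M * (Q n J L * Q n M Z / of_real (d n)))"
  proof (rule sum.cong[OF refl], rule sum.cong[OF refl])
    fix J L assume J: "J \<in> ?W" and L: "L \<in> ?W"
    have Xe: "cnj (X J I) = (\<Sum>Z\<in>?W. Q n I Z * cnj (X J Z))" for I
      using Q_fix[OF H_cnj[OF MH_snd[OF X]]] by simp
    have Ye: "Y L K = (\<Sum>M\<in>?W. Q n M K * Y L M)" for K
      using Q_fix[OF MH_snd[OF Y], of K] by (simp add: Q_sym[of n K])
    have "(\<Sum>I\<in>?W. \<Sum>K\<in>?W. cnj (X J I) * Y L K * \<Phi> I J K L) = (\<Sum>I\<in>?W. \<Sum>K\<in>?W. \<Sum>Z\<in>?W. \<Sum>M\<in>?W. (Q n I Z * cnj (X J Z)) * (Q n M K * Y L M) * \<Phi> I J K L)"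
      by (intro sum.cong refl, subst Xe, subst Ye) (simp only: sum_distrib_right, simp only: sum_distrib_left, simp only: sum_distrib_right)
    also have "\<dots> = (\<Sum>Z\<in>?W. \<Sum>M\<in>?W. \<Sum>I\<in>?W. \<Sum>K\<in>?W. (Q n I Z * cnj (X J Z)) * (Q n M K * Y L M) * \<Phi> I J K L)"
      by (rule sum_swap4)
    also have "\<dots> = (\<Sum>Z\<in>?W. \<Sum>M\<in>?W. cnj (X J Z) * Y L M * (\<Sum>K\<in>?W. \<Sum>I\<in>?W. Q n M K * (\<Phi> I J K L * Q n I Z)))"
    proof (intro sum.cong refl)
      fix Z M
      show "(\<Sum>I\<in>?W. \<Sum>K\<in>?W. (Q n I Z * cnj (X J Z)) * (Q n M K * Y L M) * \<Phi> I J K L) = cnj (X J Z) * Y L M * (\<Sum>K\<in>?W. \<Sum>I\<in>?W. Q n M K * (\<Phi> I J K L * Q n I Z))"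
        unfolding sum_distrib_left by (subst sum.swap) (simp only: mult_ac)
    qed
    also have "\<dots> = (\<Sum>Z\<in>?W. \<Sum>M\<in>?W. cnj (X J Z) * Y L M * (Q n J L * Q n M Z / of_real (d n)))"
      by (intro sum.cong refl) (simp only: \<Phi>_compressed[OF J L])
    finally show "(\<Sum>I\<in>?W. \<Sum>K\<in>?W. cnj (X J I) * Y L K * \<Phi> I J K L) = \<dots>" .
  qed
  also have "\<dots> = (\<Sum>J\<in>?W. \<Sum>L\<in>?W. \<Sum>Z\<in>?W. cnj (X J Z) * (Q n J L / of_real (d n)) * (\<Sum>M\<in>?W. Y L M * Q n M Z))"
    by (simp add: sum_distrib_left sum_divide_distrib mult_ac)
  also have "\<dots> = (\<Sum>J\<in>?W. \<Sum>L\<in>?W. \<Sum>Z\<in>?W. cnj (X J Z) * (Q n J L / of_real (d n)) * Y L Z)"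
    by (simp only: Q_fix_right[OF MH_snd[OF Y]])
  also have "\<dots> = (\<Sum>J\<in>?W. \<Sum>Z\<in>?W. cnj (X J Z) / of_real (d n) * (\<Sum>L\<in>?W. Q n J L * Y L Z))"
    unfolding sum_distrib_left by (rule sum.cong[OF refl], subst sum.swap) (simp add: mult_ac)
  also have "\<dots> = ip n X Y"
    by (simp only: Q_fix[OF MH_fst[OF Y]]) (simp add: ip_def sum_divide_distrib)
  finally show ?thesis .
qed

end
end

section \<open>Entries of the Gram matrices\<close>

context temperley_lieb begin

lemma inverse_d_le: "1 / d n \<le> q ^ n"
proof (induction n)
  case (Suc n)
  have "1 / d (Suc n) = c (Suc n) * (1 / d n)" by (simp add: c_Suc_d)
  also have "\<dots> \<le> q * q ^ n" using Suc c_bounds[of "Suc n"] q0 by (intro mult_mono) (auto simp: less_imp_le)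
  finally show ?case by simp
qed simp

lemma cmod_e_eq: "cmod (e n) = 1 / d n"
  by (simp add: e_def norm_divide norm_power abs_of_pos del: of_real_divide of_real_power of_real_minus)

lemma cmod_e: "cmod (e n) \<le> q ^ n"
  using inverse_d_le[of n] by (simp add: cmod_e_eq)

text \<open>
Partial sums of the geometric series in \<open>q\<^sup>2\<close>, in which the errors below accumulate.
\<close>

definition geo :: "nat \<Rightarrow> real" where "geo r = (\<Sum>s<r. (q\<^sup>2) ^ s)"

lemma geo_simps [simp]: "geo 0 = 0" "geo (Suc r) = geo r + (q\<^sup>2) ^ r"
  by (simp_all add: geo_def)

lemma geo_bounds: "0 \<le> geo r" "geo r \<le> 6 / 5"
proof -
  show "0 \<le> geo r" by (simp add: geo_def sum_nonneg)
  have q2: "q\<^sup>2 \<le> 4 / 25" using power_mono[OF q_le, of 2] q0 by (simp add: power2_eq_square)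
  have "geo r = (1 - (q\<^sup>2) ^ r) / (1 - q\<^sup>2)" using q2 unfolding geo_def by (subst sum_gp_strict) auto
  also have "\<dots> \<le> 1 / (1 - q\<^sup>2)" using q2 by (intro divide_right_mono) auto
  also have "\<dots> \<le> 6 / 5" using q2 by (simp add: field_simps)
  finally show "geo r \<le> 6 / 5" .
qed

text \<open>
Both directions of the rotation occur in \<open>tau_kap\<close> with the same coefficient, so only their sum has to be
followed.
\<close>

definition rotsum :: "nat \<Rightarrow> tmat \<Rightarrow> tmat" where
  "rotsum n Y = lc 1 (R0 n Y) 1 (R1 n Y)"

lemma rotsum_kap:
  assumes "Y \<in> MH (Suc m)"
  shows "rotsum (Suc (Suc m)) (kap (Suc m) Y) = lc (- of_real (c (Suc m))) (kap (Suc m) (rotsum (Suc m) Y))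
     (- 2 * e (Suc m)) (lam (Suc m) (lc 1 Y (- 1) (kap m (kapstar m Y))))"
  unfolding rotsum_def R0_kap[OF assms] R1_kap[OF assms] kap_lc lam_lc kapstar_def kap_scale lam_scale
  by (simp add: fun_eq_iff algebra_simps)

lemma lamstar_kap:
  assumes "Y \<in> MH (Suc m)"
  shows "lamstar (Suc m) (kap (Suc m) Y) =
    lc 1 (lc (of_real (c (Suc (Suc m)) / c (Suc m))) (kap m (lamstar m Y)) (- (of_real (c (Suc (Suc m))) * e (Suc m))) (rotsum (Suc m) Y))
     (of_real (c (Suc (Suc m)) / c (Suc m)) * (e (Suc m))\<^sup>2) (lam m (kapstar m Y))"
  unfolding rotsum_def lamstar_def tau_kap[OF assms] kapstar_def kap_scale lam_scale
  using c_pos[of m] by (simp add: fun_eq_iff algebra_simps)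

lemma lam_sum: "lam n (\<lambda>I J. \<Sum>s\<in>A. f s * Z s I J) = (\<lambda>I J. \<Sum>s\<in>A. f s * lam n (Z s) I J)"
proof (induction A rule: infinite_finite_induct)
  case (insert x F)
  then show ?case using lam_lc[of n "f x" "Z x" 1 "\<lambda>I J. \<Sum>s\<in>F. f s * Z s I J"] by simp
qed (use lam_scale[of n 0] in simp_all)

lemma lamstar_lc: "lamstar n (lc s Y t Z) = lc s (lamstar n Y) t (lamstar n Z)"
  unfolding lamstar_def tau_lc by (simp add: algebra_simps)

lemma lamstar_sum: "lamstar n (\<lambda>I J. \<Sum>s\<in>A. f s * Z s I J) = (\<lambda>I J. \<Sum>s\<in>A. f s * lamstar n (Z s) I J)"
proof (induction A rule: infinite_finite_induct)
  case (insert x F)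
  then show ?case using lamstar_lc[of n "f x" "Z x" 1 "\<lambda>I J. \<Sum>s\<in>F. f s * Z s I J"] by simp
qed (simp_all add: lamstar_def ptrace_first_def)

context
  fixes k m0 X \<mu>
  assumes k: "k = Suc m0" and X00: "X \<in> BH00 N (Suc m0)"
    and mu: "cmod \<mu> = 1" and R0X: "R0 (Suc m0) X = (\<lambda>I J. \<mu> * X I J)"
    and R1X: "R1 (Suc m0) X = (\<lambda>I J. cnj \<mu> * X I J)"
    and normX: "sq (Suc m0) X = 1"
begin

abbreviation "xij \<equiv> xshift k X"

lemma XMH: "X \<in> MH k" and XMH': "X \<in> MH (Suc m0)" and lamstar_X: "lamstar m0 X = (\<lambda>_ _. 0)" and kapstar_X: "kapstar m0 X = (\<lambda>_ _. 0)"
  using X00 by (simp_all add: BH00_eq k lamstar_def kapstar_def)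

lemma x_MH: "xij i j \<in> MH (k + i + j)" and x_MH': "xij i j \<in> MH (Suc (m0 + i + j))"
  using xshift_MH[OF XMH, of i j] by (simp_all add: k)

text \<open>
The number with \<open>\<kappa>\<^sup>* \<kappa>\<^sup>r X = (1 - loss r) \<kappa>\<^sup>r\<^sup>-\<^sup>1 X\<close> for \<open>r > 0\<close>.
\<close>

definition loss :: "nat \<Rightarrow> real" where "loss r = (\<Prod>s<r. c (k + s) * c (Suc (k + s)))"

lemma loss_bounds: "0 \<le> loss r" "loss r \<le> (q\<^sup>2) ^ r"
proof -
  show "0 \<le> loss r" unfolding loss_def using c_bounds by (intro prod_nonneg) auto
  have "loss r \<le> (\<Prod>s<r. q\<^sup>2)"
    unfolding loss_def power2_eq_square using c_bounds q0 by (intro prod_mono) (auto intro!: mult_mono)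
  then show "loss r \<le> (q\<^sup>2) ^ r" by simp
qed

lemma loss_le_1: "loss r \<le> 1"
proof -
  have "q\<^sup>2 \<le> 1" using q0 q1 by (intro power_le_one) auto
  then have "(q\<^sup>2) ^ r \<le> 1" using power_le_one[of "q\<^sup>2" r] by simp
  then show ?thesis using loss_bounds(2)[of r] by linarith
qed

lemma kapstar_kapn: "kapstar (k + r) (kapn k X (Suc r)) = (\<lambda>I J. of_real (1 - loss (Suc r)) * kapn k X r I J)"
proof (induction r)
  case 0
  have "kapstar k (kap k X) = lc (of_real (1 - c k * c (Suc k))) X (of_real (c k * c (Suc k))) (kap m0 (\<lambda>I J. 0 * X I J))"
    using kapstar_kap[OF XMH'] by (simp add: k kapstar_X)
  then show ?case unfolding kap_scale by (simp add: loss_def)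
next
  case (Suc r)
  let ?Y = "kapn k X (Suc r)" and ?g = "c (Suc (k + r)) * c (Suc (Suc (k + r)))"
  have Y: "?Y \<in> MH (Suc (k + r))" using kapn_MH[OF XMH, of "Suc r"] by simp
  have "kapstar (Suc (k + r)) (kap (Suc (k + r)) ?Y) = lc (of_real (1 - ?g)) ?Y (of_real ?g) (kap (k + r) (\<lambda>I J. of_real (1 - loss (Suc r)) * kapn k X r I J))"
    unfolding kapstar_kap[OF Y] Suc.IH ..
  also have "\<dots> = (\<lambda>I J. of_real (1 - loss (Suc (Suc r))) * ?Y I J)"
    unfolding kap_scale by (simp add: loss_def fun_eq_iff algebra_simps)
  finally show ?case by simp
qed

lemma kap_kapstar_kapn: "kap (m0 + r) (kapstar (m0 + r) (kapn k X r)) = (\<lambda>I J. of_real (1 - loss r) * kapn k X r I J)"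
proof (cases r)
  case 0
  have "kap m0 (\<lambda>I J. 0 * X I J) = (\<lambda>I J. 0 * X I J)" unfolding kap_scale by simp
  then show ?thesis using 0 by (simp add: kapstar_X loss_def)
next
  case (Suc r')
  have n: "m0 + r = k + r'" using Suc k by simp
  show ?thesis unfolding n unfolding Suc kapstar_kapn kap_scale by simp
qed

lemma kap_shift_pair:
  assumes "r = 0 \<Longrightarrow> b = 0"
  shows "kap (k + r) (lc a (xij 0 r) b (xij 1 (r - 1))) = lc a (xij 0 (Suc r)) b (xij 1 r)"
proof (cases r)
  case 0
  then show ?thesis using assms by (simp add: kap_scale)
next
  case (Suc r')
  then show ?thesis using kap_xshift[OF XMH, of 1 r'] by (simp add: kap_lc)
qed

text \<open>
The span of \<open>\<kappa>\<^sup>r X\<close> and \<open>\<lambda> \<kappa>\<^sup>r\<^sup>-\<^sup>1 X\<close> contains the rotations of \<open>\<kappa>\<^sup>r X\<close>, by induction with \<open>R0_kap\<close> and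
\<open>R1_kap\<close>.  Each step multiplies the coefficients by at most \<open>q\<close> and feeds a term of size \<open>|e|\<close> into the second
one.
\<close>

lemma rotsum_kapn:
  "\<exists>A B. rotsum (k + r) (kapn k X r) = lc A (xij 0 r) B (xij 1 (r - 1)) \<and>
     cmod A \<le> 2 * q ^ r \<and> cmod B \<le> 2 * geo r * q ^ (m0 + r)"
proof (induction r)
  case 0
  have "rotsum k X = lc (\<mu> + cnj \<mu>) (xij 0 0) 0 (xij 1 (0 - 1))"
    by (simp add: rotsum_def k R0X R1X algebra_simps)
  moreover have "cmod (\<mu> + cnj \<mu>) \<le> 2" using norm_triangle_ineq[of \<mu> "cnj \<mu>"] mu by simp
  ultimately show ?case by (intro exI[of _ "\<mu> + cnj \<mu>"] exI[of _ 0]) simp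
next
  case (Suc r)
  then obtain A B where T: "rotsum (k + r) (kapn k X r) = lc A (xij 0 r) B (xij 1 (r - 1))"
    and A: "cmod A \<le> 2 * q ^ r" and B: "cmod B \<le> 2 * geo r * q ^ (m0 + r)" by blast
  let ?Y = "kapn k X r" and ?c = "complex_of_real (c (k + r))" and ?e = "e (k + r)"
  have Y: "?Y \<in> MH (Suc (m0 + r))" and n: "Suc (m0 + r) = k + r"
    using kapn_MH[OF XMH, of r] by (simp_all add: k)
  have B0: "r = 0 \<Longrightarrow> B = 0" using B by simp
  have "rotsum (k + Suc r) (kapn k X (Suc r)) = lc (- ?c) (kap (k + r) (rotsum (k + r) ?Y))
     (- 2 * ?e) (lam (k + r) (lc 1 ?Y (- 1) (kap (m0 + r) (kapstar (m0 + r) ?Y))))"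
    using rotsum_kap[OF Y] unfolding n by simp
  also have "lc 1 ?Y (- 1) (kap (m0 + r) (kapstar (m0 + r) ?Y)) = (\<lambda>I J. of_real (loss r) * ?Y I J)"
    unfolding kap_kapstar_kapn by (simp add: fun_eq_iff algebra_simps)
  also have "lam (k + r) \<dots> = (\<lambda>I J. of_real (loss r) * xij 1 r I J)"
    unfolding lam_scale by simp
  also have "kap (k + r) (rotsum (k + r) ?Y) = lc A (xij 0 (Suc r)) B (xij 1 r)"
    unfolding T by (rule kap_shift_pair[OF B0])
  finally have eq: "rotsum (k + Suc r) (kapn k X (Suc r)) = lc (- ?c * A) (xij 0 (Suc r)) (- ?c * B - 2 * ?e * of_real (loss r)) (xij 1 (Suc r - 1))"
    by (simp add: fun_eq_iff algebra_simps)
  have "cmod (- ?c * A) \<le> q * (2 * q ^ r)"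
    using A c_bounds[of "k + r"] q0 by (simp only: norm_mult norm_minus_cancel norm_of_real) (intro mult_mono, auto)
  then have A': "cmod (- ?c * A) \<le> 2 * q ^ Suc r" by simp
  have "cmod (- ?c * B - 2 * ?e * of_real (loss r)) \<le> cmod (- ?c * B) + cmod (2 * ?e * of_real (loss r))"
    by (rule norm_triangle_ineq4)
  also have "\<dots> \<le> q * (2 * geo r * q ^ (m0 + r)) + 2 * q ^ (k + r) * (q\<^sup>2) ^ r"
    using B c_bounds[of "k + r"] q0 loss_bounds[of r] cmod_e[of "k + r"]
    by (intro add_mono) (simp only: norm_mult norm_minus_cancel norm_of_real norm_numeral; intro mult_mono; auto)+
  also have "\<dots> = 2 * geo (Suc r) * q ^ (m0 + Suc r)"
    by (simp add: k algebra_simps)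
  finally show ?case using eq A' by blast
qed

text \<open>
The induction follows \<open>lamstar_kap\<close>; the factor \<open>c\<close> is split off so that the recursion for \<open>\<alpha>\<close> and \<open>\<beta>\<close> is
purely additive, with increments of order \<open>q\<^sup>2\<^sup>r\<^sup>+\<^sup>1\<close>.  The constant \<open>17 / 5\<close> is \<open>12 / 5 + 1\<close>: the first summand bounds
twice a value of \<open>geo\<close>, the second comes from the term with \<open>e\<^sup>2\<close>.
\<close>

lemma lamstar_kapn:
  "\<exists>\<alpha> \<beta>. lamstar (m0 + r) (kapn k X r) = lc (of_real (c (k + r)) * \<alpha>) (xij 0 (r - 1)) (of_real (c (k + r)) * \<beta>) (xij 1 (r - 2)) \<and>
     cmod \<alpha> \<le> 2 * q * geo r \<and> cmod \<beta> \<le> 17 / 5 * q ^ 3 * geo (r - 1)"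
proof (induction r)
  case 0
  show ?case by (intro exI[of _ 0]) (simp add: lamstar_X)
next
  case (Suc r)
  then obtain \<alpha> \<beta> where IH: "lamstar (m0 + r) (kapn k X r) = lc (of_real (c (k + r)) * \<alpha>) (xij 0 (r - 1)) (of_real (c (k + r)) * \<beta>) (xij 1 (r - 2))"
    and \<alpha>: "cmod \<alpha> \<le> 2 * q * geo r" and \<beta>: "cmod \<beta> \<le> 17 / 5 * q ^ 3 * geo (r - 1)" by blast
  obtain A B where T: "rotsum (k + r) (kapn k X r) = lc A (xij 0 r) B (xij 1 (r - 1))"
    and A: "cmod A \<le> 2 * q ^ r" and B: "cmod B \<le> 2 * geo r * q ^ (m0 + r)" using rotsum_kapn[of r] by blast
  let ?Y = "kapn k X r" and ?c = "complex_of_real (c (k + r))" and ?c' = "complex_of_real (c (Suc (k + r)))" and ?e = "e (k + r)"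
  have Y: "?Y \<in> MH (Suc (m0 + r))" and n: "Suc (m0 + r) = k + r"
    using kapn_MH[OF XMH, of r] by (simp_all add: k)
  have cpos: "0 < c (k + r)" using c_pos[of "m0 + r"] by (simp add: k)
  have 1: "kap (m0 + r) (lamstar (m0 + r) ?Y) = lc (?c * \<alpha>) (xij 0 r) (?c * \<beta>) (xij 1 (r - 1))"
  proof (cases r)
    case 0
    have "kap m0 (\<lambda>I J. 0 * X I J) = (\<lambda>I J. 0 * X I J)" unfolding kap_scale by simp
    then show ?thesis using 0 \<alpha> \<beta> by (simp add: lamstar_X)
  next
    case (Suc r')
    then have "r' = 0 \<Longrightarrow> ?c * \<beta> = 0" using \<beta> by simp
    then show ?thesis unfolding IH using kap_shift_pair[of r' "?c * \<beta>" "?c * \<alpha>"] Suc by (simp add: k)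
  qed
  have 2: "lam (m0 + r) (kapstar (m0 + r) ?Y) = (\<lambda>I J. of_real (1 - loss r) * xij 1 (r - 1) I J)"
  proof (cases r)
    case 0
    have "lam m0 (\<lambda>I J. 0 * X I J) = (\<lambda>I J. 0 * X I J)" unfolding lam_scale by simp
    then show ?thesis using 0 by (simp add: kapstar_X loss_def)
  next
    case (Suc r')
    have n: "m0 + r = k + r'" using Suc k by simp
    show ?thesis unfolding n unfolding Suc kapstar_kapn lam_scale by simp
  qed
  define \<alpha>' where "\<alpha>' = \<alpha> - ?e * A"
  define \<beta>' where "\<beta>' = \<beta> - ?e * B + ?e\<^sup>2 / ?c * of_real (1 - loss r)"
  have "lamstar (k + r) (kapn k X (Suc r)) =
    lc 1 (lc (?c' / ?c) (lc (?c * \<alpha>) (xij 0 r) (?c * \<beta>) (xij 1 (r - 1))) (- (?c' * ?e)) (lc A (xij 0 r) B (xij 1 (r - 1))))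
     (?c' / ?c * ?e\<^sup>2) (\<lambda>I J. of_real (1 - loss r) * xij 1 (r - 1) I J)"
    using lamstar_kap[OF Y] unfolding n 1 2 T by simp
  also have "\<dots> = lc (?c' * \<alpha>') (xij 0 r) (?c' * \<beta>') (xij 1 (r - 1))"
    using cpos by (simp add: fun_eq_iff \<alpha>'_def \<beta>'_def field_simps del: xshift.simps)
  finally have eq: "lamstar (m0 + Suc r) (kapn k X (Suc r)) =
      lc (of_real (c (k + Suc r)) * \<alpha>') (xij 0 (Suc r - 1)) (of_real (c (k + Suc r)) * \<beta>') (xij 1 (Suc r - 2))"
    by (simp add: k numeral_2_eq_2 del: xshift.simps)
  have qk: "q ^ (k + r) \<le> q ^ Suc r" and qm: "q ^ (m0 + r) \<le> q ^ r"
    using q0 q1 by (auto intro!: power_decreasing simp: k)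
  have "cmod \<alpha>' \<le> cmod \<alpha> + cmod ?e * cmod A" unfolding \<alpha>'_def norm_mult[symmetric] by (rule norm_triangle_ineq4)
  also have "\<dots> \<le> 2 * q * geo r + q ^ Suc r * (2 * q ^ r)"
    using \<alpha> A cmod_e[of "k + r"] qk q0 by (intro add_mono mult_mono) auto
  also have "\<dots> = 2 * q * geo (Suc r)" by (simp add: algebra_simps power_mult_distrib power2_eq_square)
  finally have a: "cmod \<alpha>' \<le> 2 * q * geo (Suc r)" .
  have b: "cmod \<beta>' \<le> 17 / 5 * q ^ 3 * geo (Suc r - 1)"
  proof (cases r)
    case 0
    then show ?thesis using B \<beta> by (simp add: \<beta>'_def loss_def)
  next
    case (Suc r')
    have e2: "cmod (?e\<^sup>2 / ?c) \<le> q ^ Suc r * q ^ r"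
    proof -
      have "cmod (?e\<^sup>2 / ?c) = (1 / d (k + r))\<^sup>2 / c (k + r)"
        using cpos by (simp add: cmod_e_eq norm_divide norm_power)
      also have "\<dots> = (1 / d (k + r)) * (1 / d (m0 + r))"
        by (simp add: k c_Suc_d power2_eq_square)
      also have "\<dots> \<le> q ^ Suc r * q ^ r"
        using order.trans[OF inverse_d_le qk] order.trans[OF inverse_d_le qm] q0
        by (intro mult_mono) (auto simp: less_imp_le)
      finally show ?thesis .
    qed
    have "cmod \<beta>' \<le> cmod (\<beta> - ?e * B) + cmod (?e\<^sup>2 / ?c * of_real (1 - loss r))"
      unfolding \<beta>'_def by (rule norm_triangle_ineq)
    also have "\<dots> \<le> (cmod \<beta> + cmod ?e * cmod B) + cmod (?e\<^sup>2 / ?c) * (1 - loss r)"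
    proof (rule add_mono)
      show "cmod (\<beta> - ?e * B) \<le> cmod \<beta> + cmod ?e * cmod B"
        unfolding norm_mult[symmetric] by (rule norm_triangle_ineq4)
      show "cmod (?e\<^sup>2 / ?c * of_real (1 - loss r)) \<le> cmod (?e\<^sup>2 / ?c) * (1 - loss r)"
        unfolding norm_mult norm_of_real using loss_le_1[of r] by simp
    qed
    also have "\<dots> \<le> (17 / 5 * q ^ 3 * geo (r - 1) + q ^ Suc r * (12 / 5 * q ^ r)) + q ^ Suc r * q ^ r * 1"
    proof (intro add_mono)
      show "cmod ?e * cmod B \<le> q ^ Suc r * (12 / 5 * q ^ r)"
      proof (rule mult_mono)
        show "cmod ?e \<le> q ^ Suc r" using cmod_e[of "k + r"] qk by linarith
        have "2 * geo r * q ^ (m0 + r) \<le> 12 / 5 * q ^ r"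
          using geo_bounds[of r] qm q0 by (intro mult_mono) auto
        then show "cmod B \<le> 12 / 5 * q ^ r" using B by linarith
      qed (use q0 in auto)
      show "cmod (?e\<^sup>2 / ?c) * (1 - loss r) \<le> q ^ Suc r * q ^ r * 1"
        using e2 loss_le_1[of r] loss_bounds(1)[of r] q0 by (intro mult_mono) auto
    qed (use \<beta> in auto)
    also have "\<dots> = 17 / 5 * q ^ 3 * geo (Suc r - 1)"
      using Suc by (simp add: algebra_simps power2_eq_square power3_eq_cube power_mult_distrib)
    finally show ?thesis .
  qed
  show ?case using eq a b by blast
qed

definition wt :: real where "wt = 1 / (2 * q)"

lemma wt: "1 \<le> wt" "0 < wt" "2 * q * wt = 1"
  using q0 q_le by (simp_all add: wt_def field_simps)

text \<open>
The ball of radius \<open>B\<close> in the weighted \<open>\<ell>\<^sup>1\<close>-norm on combinations of the \<open>X\<^sub>s\<^sub>,\<^sub>m\<^sub>-\<^sub>s\<close>.  Stating bounds by membership avoids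
the question whether these operators are linearly independent.
\<close>

definition wball :: "nat \<Rightarrow> real \<Rightarrow> tmat set" where
  "wball m B = {v. \<exists>f. v = (\<lambda>I J. \<Sum>s\<le>m. f s * xij s (m - s) I J) \<and> (\<Sum>s\<le>m. cmod (f s) * wt ^ s) \<le> B}"

lemma wball_I: "v = (\<lambda>I J. \<Sum>s\<le>m. f s * xij s (m - s) I J) \<Longrightarrow> (\<Sum>s\<le>m. cmod (f s) * wt ^ s) \<le> B \<Longrightarrow> v \<in> wball m B"
  by (auto simp: wball_def)

lemma wball_mono: "v \<in> wball m B \<Longrightarrow> B \<le> B' \<Longrightarrow> v \<in> wball m B'"
  by (force simp: wball_def)

lemma wball_x:
  assumes "p \<le> m"
  shows "xij p (m - p) \<in> wball m (wt ^ p)"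
proof -
  have "xij p (m - p) = (\<lambda>I J. \<Sum>s\<le>m. (if s = p then 1 else 0) * xij s (m - s) I J)"
    using assms by (simp add: if_distrib[where f="\<lambda>xij. xij * _"] cong: if_cong)
  moreover have "(\<Sum>s\<le>m. cmod (if s = p then 1 else 0) * wt ^ s) \<le> wt ^ p"
    using assms by (simp add: if_distrib[where f=cmod] if_distrib[where f="\<lambda>xij. xij * _"] cong: if_cong)
  ultimately show ?thesis by (rule wball_I)
qed

lemma wball_lc:
  assumes "u \<in> wball m B" "v \<in> wball m B'"
  shows "lc s u t v \<in> wball m (cmod s * B + cmod t * B')"
proof -
  obtain f g where f: "u = (\<lambda>I J. \<Sum>s\<le>m. f s * xij s (m - s) I J)" "(\<Sum>s\<le>m. cmod (f s) * wt ^ s) \<le> B"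
    and g: "v = (\<lambda>I J. \<Sum>s\<le>m. g s * xij s (m - s) I J)" "(\<Sum>s\<le>m. cmod (g s) * wt ^ s) \<le> B'"
    using assms unfolding wball_def by blast
  have "lc s u t v = (\<lambda>I J. \<Sum>r\<le>m. (s * f r + t * g r) * xij r (m - r) I J)"
    by (simp add: f g sum_distrib_left sum.distrib algebra_simps)
  moreover have "(\<Sum>r\<le>m. cmod (s * f r + t * g r) * wt ^ r) \<le> cmod s * B + cmod t * B'"
  proof -
    have "(\<Sum>r\<le>m. cmod (s * f r + t * g r) * wt ^ r) \<le> (\<Sum>r\<le>m. cmod s * (cmod (f r) * wt ^ r) + cmod t * (cmod (g r) * wt ^ r))"
    proof (rule sum_mono)
      fix r
      have "cmod (s * f r + t * g r) * wt ^ r \<le> (cmod s * cmod (f r) + cmod t * cmod (g r)) * wt ^ r"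
        using norm_triangle_ineq[of "s * f r" "t * g r"] wt by (intro mult_right_mono) (auto simp: norm_mult)
      then show "cmod (s * f r + t * g r) * wt ^ r \<le> cmod s * (cmod (f r) * wt ^ r) + cmod t * (cmod (g r) * wt ^ r)"
        by (simp add: algebra_simps)
    qed
    also have "\<dots> = cmod s * (\<Sum>r\<le>m. cmod (f r) * wt ^ r) + cmod t * (\<Sum>r\<le>m. cmod (g r) * wt ^ r)"
      by (simp add: sum.distrib sum_distrib_left)
    also have "\<dots> \<le> cmod s * B + cmod t * B'"
      using f(2) g(2) by (intro add_mono mult_left_mono) auto
    finally show ?thesis .
  qed
  ultimately show ?thesis by (rule wball_I)
qed

lemma wball_sum:
  assumes "finite A" "\<And>s. s \<in> A \<Longrightarrow> v s \<in> wball m (B s)"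
  shows "(\<lambda>I J. \<Sum>s\<in>A. f s * v s I J) \<in> wball m (\<Sum>s\<in>A. cmod (f s) * B s)"
  using assms
proof (induction A rule: finite_induct)
  case empty
  have "(\<Sum>s\<le>m. cmod 0 * wt ^ s) \<le> 0" by simp
  then show ?case by (intro wball_I[where f="\<lambda>_. 0"]) auto
next
  case (insert y F)
  then show ?case using wball_lc[of "v y" m "B y" "\<lambda>I J. \<Sum>s\<in>F. f s * v s I J" "\<Sum>s\<in>F. cmod (f s) * B s" "f y" 1] by simp
qed

lemma wball_MH:
  assumes "v \<in> wball m B" shows "v \<in> MH (k + m)"
proof -
  obtain f where f: "v = (\<lambda>I J. \<Sum>s\<le>m. f s * xij s (m - s) I J)"
    using assms unfolding wball_def by blast
  have xm: "xij s (m - s) \<in> MH (k + m)" if "s \<le> m" for s using x_MH[of s "m - s"] that by simp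
  show ?thesis unfolding f MH_def
    by (auto intro!: H_sum MH_fst[OF xm] MH_snd[OF xm])
qed

lemma wball_lam:
  assumes "v \<in> wball m B"
  shows "lam (k + m) v \<in> wball (Suc m) (wt * B)"
proof -
  obtain f where f: "v = (\<lambda>I J. \<Sum>s\<le>m. f s * xij s (m - s) I J)" "(\<Sum>s\<le>m. cmod (f s) * wt ^ s) \<le> B"
    using assms unfolding wball_def by blast
  have lx: "lam (k + m) (xij s (m - s)) = xij (Suc s) (m - s)" if "s \<le> m" for s using that by simp
  have "lam (k + m) v = (\<lambda>I J. \<Sum>s\<le>m. f s * xij (Suc s) (m - s) I J)"
    unfolding f lam_sum by (intro ext sum.cong refl) (simp add: lx del: xshift.simps)
  also have "\<dots> \<in> wball (Suc m) (\<Sum>s\<le>m. cmod (f s) * wt ^ Suc s)"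
    using wball_x[of "Suc _" "Suc m"] by (intro wball_sum) (auto simp del: xshift.simps)
  finally show ?thesis
  proof (rule wball_mono)
    have "(\<Sum>s\<le>m. cmod (f s) * wt ^ Suc s) = wt * (\<Sum>s\<le>m. cmod (f s) * wt ^ s)"
      by (simp add: sum_distrib_left mult_ac)
    then show "(\<Sum>s\<le>m. cmod (f s) * wt ^ Suc s) \<le> wt * B" using f(2) wt by simp
  qed
qed

text \<open>
Without left legs the bound is the one of \<open>lamstar_kapn\<close>.  With left legs, \<open>\<lambda>\<^sup>* \<lambda> Y = (1 - g) Y + g \<lambda> \<lambda>\<^sup>* Y\<close> is a convex
combination of two members of the same ball, because \<open>\<lambda>\<close> multiplies the norm by \<open>1 / (2 q)\<close> and \<open>\<lambda>\<^sup>*\<close> by \<open>2 q\<close>.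
\<close>

lemma lamstar_x:
  assumes "p + r = Suc m"
  shows "lamstar (k + m) (xij p r) \<in> wball m (2 * q * wt ^ p)"
  using assms
proof (induction p arbitrary: m)
  case 0
  obtain \<alpha> \<beta> where eq: "lamstar (m0 + Suc m) (kapn k X (Suc m)) = lc (of_real (c (k + Suc m)) * \<alpha>) (xij 0 m) (of_real (c (k + Suc m)) * \<beta>) (xij 1 (m - 1))"
    and \<alpha>: "cmod \<alpha> \<le> 2 * q * geo (Suc m)" and \<beta>: "cmod \<beta> \<le> 17 / 5 * q ^ 3 * geo m"
    using lamstar_kapn[of "Suc m"] by (auto simp del: geo_simps xshift.simps simp: numeral_2_eq_2)
  let ?a = "of_real (c (k + Suc m)) * \<alpha>" and ?b = "of_real (c (k + Suc m)) * \<beta>"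
  have "cmod ?a \<le> q * (2 * q * (6 / 5))"
    unfolding norm_mult norm_of_real
    using order.trans[OF \<alpha> mult_left_mono[OF geo_bounds(2)]] c_bounds[of "k + Suc m"] q0
    by (intro mult_mono) auto
  then have a: "cmod ?a \<le> 12 / 5 * q\<^sup>2" by (simp add: power2_eq_square)
  have "cmod ?b \<le> q * (17 / 5 * q ^ 3 * (6 / 5))"
    unfolding norm_mult norm_of_real
    using order.trans[OF \<beta> mult_left_mono[OF geo_bounds(2)]] c_bounds[of "k + Suc m"] q0
    by (intro mult_mono) auto
  then have "cmod ?b * wt \<le> q * (17 / 5 * q ^ 3 * (6 / 5)) * wt"
    using wt by (intro mult_right_mono) auto
  also have "\<dots> = 51 / 25 * q ^ 3" using wt(3) q0 by (simp add: wt_def field_simps power3_eq_cube)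
  finally have b: "cmod ?b * wt \<le> 51 / 25 * q ^ 3" .
  have q2: "q\<^sup>2 \<le> 2 / 5 * q" using q_le q0 by (simp add: power2_eq_square)
  have "q ^ 3 = q * q\<^sup>2" by (simp add: power2_eq_square power3_eq_cube)
  also have "\<dots> \<le> q * (2 / 5 * q)" using q2 q0 by (intro mult_left_mono) auto
  also have "\<dots> = 2 / 5 * q\<^sup>2" by (simp add: power2_eq_square)
  finally have q3: "q ^ 3 \<le> 2 / 5 * q\<^sup>2" .
  have ab: "cmod ?a + cmod ?b * wt \<le> 2 * q"
    using a b q2 q3 q0 by linarith
  have "lamstar (k + m) (xij 0 r) = lc ?a (xij 0 m) ?b (xij 1 (m - 1))"
    using eq 0 by (simp add: k)
  also have "\<dots> \<in> wball m (2 * q)"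
  proof (cases m)
    case 0
    then have "\<beta> = 0" using \<beta> by simp
    then show ?thesis using wball_mono[OF wball_lc[OF wball_x[of 0 m] wball_x[of 0 m], of ?a 0], of "2 * q"] 0 ab by simp
  next
    case (Suc m')
    then show ?thesis using wball_mono[OF wball_lc[OF wball_x[of 0 m] wball_x[of 1 m], of ?a ?b], of "2 * q"] ab by simp
  qed
  finally show ?case by simp
next
  case (Suc p)
  then have m: "p + r = m" by simp
  let ?g = "c (Suc (m0 + m)) * c (Suc (Suc (m0 + m)))" and ?Y = "xij p r"
  have Y: "?Y \<in> MH (Suc (m0 + m))" using x_MH'[of p r] m by (simp add: add.assoc)
  have g: "0 \<le> ?g" "?g \<le> 1" using gg_bounds[OF creation_lam] by (auto simp: less_imp_le)
  have W1: "?Y \<in> wball m (wt ^ p)" using wball_x[of p m] m by auto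
  have W2: "lam (m0 + m) (lamstar (m0 + m) ?Y) \<in> wball m (wt ^ p)"
  proof (cases m)
    case 0
    then have "lam (m0 + m) (lamstar (m0 + m) ?Y) = (\<lambda>I J. 0 * xij 0 0 I J)"
      using lam_scale[of m0 0 X] m by (simp add: lamstar_X)
    also have "\<dots> \<in> wball m (wt ^ p)"
      using wball_mono[OF wball_lc[OF wball_x[of 0 0] wball_x[of 0 0], of 0 0], of "wt ^ p"] 0 wt by simp
    finally show ?thesis .
  next
    case (Suc m')
    have "lamstar (k + m') ?Y \<in> wball m' (2 * q * wt ^ p)" using Suc.IH[of m'] m Suc by simp
    then have "lam (k + m') (lamstar (k + m') ?Y) \<in> wball (Suc m') (wt * (2 * q * wt ^ p))" by (rule wball_lam)
    moreover have "wt * (2 * q * wt ^ p) = wt ^ p" using wt(3) by (metis mult.assoc mult.commute mult.left_neutral)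
    ultimately show ?thesis using Suc by (simp add: k)
  qed
  have "lamstar (k + m) (xij (Suc p) r) = lamstar (Suc (m0 + m)) (lam (Suc (m0 + m)) ?Y)"
    using m by (simp add: k add.assoc)
  also have "\<dots> = lc (of_real (1 - ?g)) ?Y (of_real ?g) (lam (m0 + m) (lamstar (m0 + m) ?Y))"
    by (rule lamstar_lam[OF Y])
  also have "\<dots> \<in> wball m (cmod (of_real (1 - ?g)) * wt ^ p + cmod (of_real ?g) * wt ^ p)"
    by (rule wball_lc[OF W1 W2])
  also have "cmod (of_real (1 - ?g)) * wt ^ p + cmod (of_real ?g) * wt ^ p = (cmod (of_real (1 - ?g)) + cmod (of_real ?g)) * wt ^ p"
    by (simp only: distrib_right)
  also have "cmod (of_real (1 - ?g)) + cmod (of_real ?g) = 1"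
    unfolding norm_of_real using g by simp
  also have "1 * wt ^ p = 2 * q * wt ^ Suc p" using wt(3) by simp
  finally show ?case .
qed

lemma lamstar_wball:
  assumes "v \<in> wball (Suc m) B"
  shows "lamstar (k + m) v \<in> wball m (2 * q * B)"
proof -
  obtain f where f: "v = (\<lambda>I J. \<Sum>s\<le>Suc m. f s * xij s (Suc m - s) I J)" "(\<Sum>s\<le>Suc m. cmod (f s) * wt ^ s) \<le> B"
    using assms unfolding wball_def by blast
  have "lamstar (k + m) v = (\<lambda>I J. \<Sum>s\<le>Suc m. f s * lamstar (k + m) (xij s (Suc m - s)) I J)"
    unfolding f lamstar_sum ..
  also have "\<dots> \<in> wball m (\<Sum>s\<le>Suc m. cmod (f s) * (2 * q * wt ^ s))"
    by (intro wball_sum lamstar_x) auto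
  finally show ?thesis
  proof (rule wball_mono)
    have "(\<Sum>s\<le>Suc m. cmod (f s) * (2 * q * wt ^ s)) = 2 * q * (\<Sum>s\<le>Suc m. cmod (f s) * wt ^ s)"
      unfolding sum_distrib_left by (simp only: mult_ac)
    then show "(\<Sum>s\<le>Suc m. cmod (f s) * (2 * q * wt ^ s)) \<le> 2 * q * B"
      using f(2) q0 by simp
  qed
qed

lemma sq_kapn_le: "sq (k + j) (kapn k X j) \<le> 1"
proof (induction j)
  case (Suc j)
  then show ?case using L_contract[OF creation_kap kapn_MH[OF XMH, of j]] by simp
qed (simp add: k normX)

lemma sq_x_le: "sq (k + i + j) (xij i j) \<le> 1"
proof (induction i)
  case (Suc i)
  then show ?case using L_contract[OF creation_lam x_MH[of i j]] by simp
qed (simp add: sq_kapn_le)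

lemma sq_kapn_ge: "1 - q\<^sup>2 / (1 - q\<^sup>2) \<le> sq (k + j) (kapn k X j)"
  using iterate_lower[OF creation_kap, of "kapn k X" m0 j] by (simp add: XMH' normX k)

lemma sq_x_ge: "1 - 2 * (q\<^sup>2 / (1 - q\<^sup>2)) \<le> sq (k + i + j) (xij i j)"
proof -
  let ?Q = "q\<^sup>2 / (1 - q\<^sup>2)"
  have q2: "q\<^sup>2 \<le> 4 / 25" using power_mono[OF q_le, of 2] q0 by (simp add: power2_eq_square)
  have Q: "0 \<le> ?Q" "?Q \<le> 1" using q2 by (simp_all add: field_simps)
  have "(1 - ?Q) * sq (Suc (m0 + j)) (xij 0 j) \<le> sq (Suc (m0 + j) + i) (xij i j)"
    by (rule iterate_lower[OF creation_lam, of "\<lambda>i. xij i j"]) (use kapn_MH[OF XMH, of j] in \<open>simp_all add: k add_ac\<close>)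
  then have "(1 - ?Q) * sq (k + j) (kapn k X j) \<le> sq (k + i + j) (xij i j)"
    by (simp add: k add_ac)
  moreover have "(1 - ?Q) * (1 - ?Q) \<le> (1 - ?Q) * sq (k + j) (kapn k X j)"
    using sq_kapn_ge Q by (intro mult_left_mono) auto
  moreover have "1 - 2 * y \<le> (1 - y) * (1 - y)" for y :: real by (simp add: algebra_simps)
  ultimately show ?thesis by (meson order.trans)
qed

text \<open>
The operators \<open>X\<^sub>i\<^sub>,\<^sub>j\<close> have norm at most 1 and the weights are at least 1.
\<close>

lemma ip_xij_wball:
  assumes "v \<in> wball j B" and ij: "i' + j' = j"
  shows "cmod (ip (k + j) (xij i' j') v) \<le> B"
proof -
  obtain f where f: "v = (\<lambda>I J. \<Sum>s\<le>j. f s * xij s (j - s) I J)" "(\<Sum>s\<le>j. cmod (f s) * wt ^ s) \<le> B"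
    using assms(1) unfolding wball_def by blast
  have one: "sqrt (sq (k + j) (xij a b)) \<le> 1" if "a + b = j" for a b
    using sq_x_le[of a b] that by (simp add: add.assoc)
  have "cmod (ip (k + j) (xij i' j') v) \<le> (\<Sum>s\<le>j. cmod (f s * ip (k + j) (xij i' j') (xij s (j - s))))"
    unfolding f ip_sum by (rule norm_sum)
  also have "\<dots> \<le> (\<Sum>s\<le>j. cmod (f s) * wt ^ s)"
  proof (rule sum_mono)
    fix s assume "s \<in> {..j}"
    then have "cmod (ip (k + j) (xij i' j') (xij s (j - s))) \<le> 1 * 1"
      using ij by (intro order.trans[OF cauchy_schwarz] mult_mono one) (auto simp: sq_nonneg)
    also have "\<dots> \<le> wt ^ s" using wt by (simp add: one_le_power)
    finally show "cmod (f s * ip (k + j) (xij i' j') (xij s (j - s))) \<le> cmod (f s) * wt ^ s"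
      unfolding norm_mult by (intro mult_left_mono) auto
  qed
  finally show ?thesis using f(2) by simp
qed

text \<open>
Each of the \<open>i\<close> left legs is moved to the other side, where \<open>\<lambda>\<^sup>*\<close> gains a factor \<open>2 q\<close>.
\<close>

lemma ip_creations_wball: "v \<in> wball (i + j) B \<Longrightarrow> cmod (ip (k + i + j) (xij i j) v) \<le> (2 * q) ^ i * B"
proof (induction i arbitrary: v B)
  case 0
  then show ?case using ip_xij_wball[OF 0, of 0 j] by simp
next
  case (Suc i)
  have v: "v \<in> MH (Suc (k + i + j))" using wball_MH[OF Suc.prems] by (simp add: add.assoc)
  have "ip (k + Suc i + j) (xij (Suc i) j) v = ip (k + i + j) (xij i j) (lamstar (k + i + j) v)"
    using lam_adj[OF v, of "xij i j"] by simp
  moreover have "lamstar (k + i + j) v \<in> wball (i + j) (2 * q * B)"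
    using lamstar_wball[of v "i + j" B] Suc.prems by (simp add: add.assoc)
  ultimately show ?case using Suc.IH[of "lamstar (k + i + j) v" "2 * q * B"] by (simp add: mult_ac)
qed

lemma ip_x_x:
  assumes "i \<le> m" "p \<le> m" "p \<le> i"
  shows "cmod (ip (k + m) (xij i (m - i)) (xij p (m - p))) \<le> (2 * q) ^ (i - p)"
proof -
  have "cmod (ip (k + m) (xij i (m - i)) (xij p (m - p))) \<le> (2 * q) ^ i * wt ^ p"
    using ip_creations_wball[of "xij p (m - p)" i "m - i" "wt ^ p"] wball_x[OF assms(2)] assms by simp
  also have "(2 * q) ^ i * wt ^ p = (2 * q) ^ (i - p)"
  proof -
    have "(2 * q) ^ p * wt ^ p = 1" using wt(3) by (metis power_mult_distrib power_one)
    moreover have "(2 * q) ^ i = (2 * q) ^ (i - p) * (2 * q) ^ p"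
      by (metis assms(3) le_add_diff_inverse2 power_add)
    ultimately show ?thesis by (metis mult.assoc mult.right_neutral)
  qed
  finally show ?thesis .
qed

lemma gram_off_diagonal:
  assumes "i \<le> m" "p \<le> m"
  shows "cmod (ip (k + m) (xij i (m - i)) (xij p (m - p))) \<le> (2 * q) ^ (if p \<le> i then i - p else p - i)"
proof (cases "p \<le> i")
  case True
  then show ?thesis using ip_x_x[OF assms True] by simp
next
  case False
  then have "cmod (ip (k + m) (xij p (m - p)) (xij i (m - i))) \<le> (2 * q) ^ (p - i)"
    using ip_x_x[OF assms(2,1)] by simp
  then show ?thesis using False by (metis ip_cnj complex_mod_cnj)
qed

lemma gram_diagonal:
  assumes "i \<le> m"
  shows "cmod (ip (k + m) (xij i (m - i)) (xij i (m - i)) - 1) \<le> 2 * (q\<^sup>2 / (1 - q\<^sup>2))"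
proof -
  have s: "1 - 2 * (q\<^sup>2 / (1 - q\<^sup>2)) \<le> sq (k + m) (xij i (m - i))" "sq (k + m) (xij i (m - i)) \<le> 1"
    using sq_x_ge[of i "m - i"] sq_x_le[of i "m - i"] assms by simp_all
  have "cmod (ip (k + m) (xij i (m - i)) (xij i (m - i)) - 1) = \<bar>sq (k + m) (xij i (m - i)) - 1\<bar>"
    unfolding ip_self by (metis norm_of_real of_real_1 of_real_diff)
  then show ?thesis using s by linarith
qed

end
end

section \<open>Operator norms of nearly diagonal matrices\<close>

lemma vec_norm2_nonneg: "0 \<le> vec_norm2 v"
  by (simp add: vec_norm2_def L2_set_nonneg)

lemma vec_norm2_eq_0: "vec_norm2 v = 0 \<longleftrightarrow> v = 0\<^sub>v (dim_vec v)"
proof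
  assume "vec_norm2 v = 0"
  then have "\<forall>i<dim_vec v. vec_index v i = 0" by (simp add: vec_norm2_def L2_set_eq_0_iff)
  then show "v = 0\<^sub>v (dim_vec v)" by (intro eq_vecI) auto
next
  assume "v = 0\<^sub>v (dim_vec v)"
  then have "vec_index v i = 0" if "i < dim_vec v" for i using that by (metis index_zero_vec(1))
  then show "vec_norm2 v = 0" by (simp add: vec_norm2_def L2_set_eq_0_iff)
qed

lemma vec_norm2_zero [simp]: "vec_norm2 (0\<^sub>v n) = 0"
  by (simp add: vec_norm2_eq_0)

lemma vec_norm2_triangle:
  assumes "v \<in> carrier_vec n" "w \<in> carrier_vec n"
  shows "vec_norm2 v \<le> vec_norm2 (v - w) + vec_norm2 w"
proof -
  have "vec_norm2 v \<le> L2_set (\<lambda>i. cmod (vec_index (v - w) i) + cmod (vec_index w i)) {..<n}"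
    unfolding vec_norm2_def using assms norm_triangle_sub by (auto intro!: L2_set_mono simp: add.commute)
  also have "\<dots> \<le> vec_norm2 (v - w) + vec_norm2 w"
    unfolding vec_norm2_def using assms L2_set_triangle_ineq by (metis carrier_vecD index_minus_vec(2))
  finally show ?thesis .
qed

lemma mat_op_norm_le:
  assumes M: "M \<in> carrier_mat n n" and C: "0 \<le> C"
    and bound: "\<And>v. v \<in> carrier_vec n \<Longrightarrow> vec_norm2 (M *\<^sub>v v) \<le> C * vec_norm2 v"
  shows "mat_op_norm M \<le> C"
  unfolding mat_op_norm_def
proof (rule cSUP_least)
  have "0\<^sub>v n \<in> {v \<in> carrier_vec (dim_col M). vec_norm2 v \<le> 1}" using M by auto
  then show "{v \<in> carrier_vec (dim_col M). vec_norm2 v \<le> 1} \<noteq> {}" by blast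
next
  fix v assume "v \<in> {v \<in> carrier_vec (dim_col M). vec_norm2 v \<le> 1}"
  then have v: "v \<in> carrier_vec n" "vec_norm2 v \<le> 1" using M by auto
  have "vec_norm2 (M *\<^sub>v v) \<le> C * vec_norm2 v" by (rule bound[OF v(1)])
  also have "\<dots> \<le> C * 1" using v(2) C by (rule mult_left_mono)
  finally show "vec_norm2 (M *\<^sub>v v) \<le> C" by simp
qed

text \<open>
Cauchy--Schwarz with each entry split into two square roots, one of which is summed along rows and the other along
columns.
\<close>

lemma schur_test:
  fixes a :: "nat \<Rightarrow> nat \<Rightarrow> complex" and v :: "nat \<Rightarrow> complex"
  assumes row: "\<And>i. i < n \<Longrightarrow> (\<Sum>j<n. cmod (a i j)) \<le> R"
    and col: "\<And>j. j < n \<Longrightarrow> (\<Sum>i<n. cmod (a i j)) \<le> R" and R: "0 \<le> R"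
  shows "L2_set (\<lambda>i. cmod (\<Sum>j<n. a i j * v j)) {..<n} \<le> R * L2_set (\<lambda>i. cmod (v i)) {..<n}"
proof -
  have entry: "(cmod (\<Sum>j<n. a i j * v j))\<^sup>2 \<le> R * (\<Sum>j<n. cmod (a i j) * (cmod (v j))\<^sup>2)"
    if i: "i < n" for i
  proof -
    have "cmod (\<Sum>j<n. a i j * v j) \<le> (\<Sum>j<n. sqrt (cmod (a i j)) * (sqrt (cmod (a i j)) * cmod (v j)))"
      by (rule order.trans[OF norm_sum]) (simp add: norm_mult flip: mult.assoc)
    also have "\<dots> \<le> L2_set (\<lambda>j. sqrt (cmod (a i j))) {..<n} * L2_set (\<lambda>j. sqrt (cmod (a i j)) * cmod (v j)) {..<n}"
      using L2_set_mult_ineq[of "\<lambda>j. sqrt (cmod (a i j))" "\<lambda>j. sqrt (cmod (a i j)) * cmod (v j)"] by simp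
    finally have "(cmod (\<Sum>j<n. a i j * v j))\<^sup>2 \<le> (L2_set (\<lambda>j. sqrt (cmod (a i j))) {..<n} * L2_set (\<lambda>j. sqrt (cmod (a i j)) * cmod (v j)) {..<n})\<^sup>2"
      by (rule power_mono) simp
    also have "\<dots> = (\<Sum>j<n. cmod (a i j)) * (\<Sum>j<n. cmod (a i j) * (cmod (v j))\<^sup>2)"
      by (simp add: L2_set_def power_mult_distrib sum_nonneg)
    also have "\<dots> \<le> R * (\<Sum>j<n. cmod (a i j) * (cmod (v j))\<^sup>2)"
      by (rule mult_right_mono[OF row[OF i]]) (simp add: sum_nonneg)
    finally show ?thesis .
  qed
  have "(\<Sum>i<n. (cmod (\<Sum>j<n. a i j * v j))\<^sup>2) \<le> (\<Sum>i<n. R * (\<Sum>j<n. cmod (a i j) * (cmod (v j))\<^sup>2))"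
    by (rule sum_mono) (use entry in simp)
  also have "\<dots> = R * (\<Sum>i<n. \<Sum>j<n. cmod (a i j) * (cmod (v j))\<^sup>2)"
    by (rule sum_distrib_left[symmetric])
  also have "\<dots> = R * (\<Sum>j<n. (\<Sum>i<n. cmod (a i j)) * (cmod (v j))\<^sup>2)"
    by (subst sum.swap) (simp only: sum_distrib_right)
  also have "\<dots> \<le> R * (\<Sum>j<n. R * (cmod (v j))\<^sup>2)"
    using R by (intro mult_left_mono sum_mono mult_right_mono col) auto
  also have "\<dots> = R\<^sup>2 * (\<Sum>j<n. (cmod (v j))\<^sup>2)"
    by (simp add: sum_distrib_left power2_eq_square mult.assoc)
  finally show ?thesis
    unfolding L2_set_def using R real_sqrt_le_mono by (fastforce simp: real_sqrt_mult)
qed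

lemma mult_mat_vec_norm_le:
  assumes M: "M \<in> carrier_mat n n" and v: "v \<in> carrier_vec n" and R: "0 \<le> R"
    and "\<And>i. i < n \<Longrightarrow> (\<Sum>j<n. cmod (index_mat M (i, j))) \<le> R"
    and "\<And>j. j < n \<Longrightarrow> (\<Sum>i<n. cmod (index_mat M (i, j))) \<le> R"
  shows "vec_norm2 (M *\<^sub>v v) \<le> R * vec_norm2 v"
proof -
  have "vec_norm2 (M *\<^sub>v v) = L2_set (\<lambda>i. cmod (\<Sum>j<n. index_mat M (i, j) * vec_index v j)) {..<n}"
    unfolding vec_norm2_def using M v
    by (intro L2_set_cong) (auto simp: scalar_prod_def atLeast0LessThan)
  also have "\<dots> \<le> R * L2_set (\<lambda>i. cmod (vec_index v i)) {..<n}"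
    by (rule schur_test) (use assms in auto)
  finally show ?thesis using v by (simp add: vec_norm2_def)
qed

text \<open>
By the Schur test \<open>\<parallel>v - M v\<parallel> \<le> R \<parallel>v\<parallel>\<close>, so \<open>M\<close> is bounded below by \<open>1 - R\<close>; a square matrix that is bounded below is
invertible, with the reciprocal bound for the inverse.
\<close>

lemma nearly_identity_invertible:
  assumes M: "M \<in> carrier_mat n n" and R: "0 \<le> R" "R < 1"
    and row: "\<And>i. i < n \<Longrightarrow> (\<Sum>j<n. cmod (index_mat M (i, j) - (if i = j then 1 else 0))) \<le> R"
    and col: "\<And>j. j < n \<Longrightarrow> (\<Sum>i<n. cmod (index_mat M (i, j) - (if i = j then 1 else 0))) \<le> R"
  shows "\<exists>M'\<in>carrier_mat n n. inverts_mat M M' \<and> inverts_mat M' M \<and> mat_op_norm M' \<le> 1 / (1 - R)"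
proof -
  have lower: "(1 - R) * vec_norm2 v \<le> vec_norm2 (M *\<^sub>v v)" if v: "v \<in> carrier_vec n" for v
  proof -
    have Mv: "M *\<^sub>v v \<in> carrier_vec n" using M v by simp
    have "(1\<^sub>m n - M) *\<^sub>v v = v - M *\<^sub>v v"
      using minus_mult_distrib_mat_vec[OF one_carrier_mat M v] v by simp
    moreover have "vec_norm2 ((1\<^sub>m n - M) *\<^sub>v v) \<le> R * vec_norm2 v"
    proof (rule mult_mat_vec_norm_le[OF _ v R(1)])
      show "1\<^sub>m n - M \<in> carrier_mat n n" by (rule minus_carrier_mat[OF M])
      fix i assume i: "i < n"
      have eq: "cmod (index_mat (1\<^sub>m n - M) (a, b)) = cmod (index_mat M (a, b) - (if a = b then 1 else 0))"
        if "a < n" "b < n" for a b using M that by (simp add: norm_minus_commute)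
      show "(\<Sum>j<n. cmod (index_mat (1\<^sub>m n - M) (i, j))) \<le> R"
        using row[OF i] eq i by simp
      show "(\<Sum>j<n. cmod (index_mat (1\<^sub>m n - M) (j, i))) \<le> R"
        using col[OF i] eq i by simp
    qed
    ultimately show ?thesis using vec_norm2_triangle[OF v Mv] by (simp add: algebra_simps)
  qed
  have "det M \<noteq> 0"
  proof
    assume "det M = 0"
    then obtain v where v: "v \<in> carrier_vec n" "v \<noteq> 0\<^sub>v n" "M *\<^sub>v v = 0\<^sub>v n"
      using det_0_iff_vec_prod_zero_field[OF M] by blast
    have "(1 - R) * vec_norm2 v \<le> 0" using lower[OF v(1)] v(3) by simp
    then have "vec_norm2 v = 0" using R vec_norm2_nonneg[of v]
      by (metis antisym diff_gt_0_iff_gt mult_le_0_iff not_less)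
    then show False using v by (simp add: vec_norm2_eq_0)
  qed
  then obtain M' where M': "M' \<in> carrier_mat n n" "M' * M = 1\<^sub>m n" "M * M' = 1\<^sub>m n"
    using det_non_zero_imp_unit[OF M, of n] unfolding Units_def ring_mat_def by auto
  have "vec_norm2 (M' *\<^sub>v v) \<le> 1 / (1 - R) * vec_norm2 v" if v: "v \<in> carrier_vec n" for v
  proof -
    have "M *\<^sub>v (M' *\<^sub>v v) = v"
      using M'(3) v assoc_mult_mat_vec[OF M M'(1) v] by simp
    then have "(1 - R) * vec_norm2 (M' *\<^sub>v v) \<le> vec_norm2 v"
      using lower[of "M' *\<^sub>v v"] M'(1) v by simp
    then show ?thesis using R by (simp add: field_simps)
  qed
  then have "mat_op_norm M' \<le> 1 / (1 - R)"
    using R by (intro mat_op_norm_le[OF M'(1)]) auto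
  then show ?thesis using M M' by (auto simp: inverts_mat_def)
qed

lemma geometric_row_sum:
  fixes \<theta> :: real
  assumes \<theta>: "0 \<le> \<theta>" "\<theta> < 1" and i: "i \<le> m"
  shows "(\<Sum>p<Suc m. if p = i then 0 else \<theta> ^ (if p \<le> i then i - p else p - i)) \<le> 2 * (\<theta> / (1 - \<theta>))"
proof -
  have geo: "(\<Sum>s<r. \<theta> ^ Suc s) \<le> \<theta> / (1 - \<theta>)" for r
  proof -
    have "(\<Sum>s<r. \<theta> ^ Suc s) = \<theta> * ((1 - \<theta> ^ r) / (1 - \<theta>))"
      using \<theta> sum_gp_strict[of \<theta> r] by (simp flip: sum_distrib_left)
    also have "\<dots> \<le> \<theta> * (1 / (1 - \<theta>))"
      using \<theta> by (intro mult_left_mono divide_right_mono) auto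
    finally show ?thesis by simp
  qed
  let ?f = "\<lambda>p. if p = i then 0 else \<theta> ^ (if p \<le> i then i - p else p - i)"
  have "sum ?f {..<Suc m} = sum ?f (({..<i} \<union> {i}) \<union> {Suc i..<Suc m})"
    by (rule arg_cong[where f="sum ?f"]) (use i in auto)
  also have "\<dots> = sum ?f ({..<i} \<union> {i}) + sum ?f {Suc i..<Suc m}"
    by (rule sum.union_disjoint) auto
  also have "sum ?f ({..<i} \<union> {i}) = sum ?f {..<i}"
    by (subst sum.union_disjoint) auto
  also have "sum ?f {..<i} = (\<Sum>s<i. \<theta> ^ Suc s)"
    by (subst sum.nat_diff_reindex[symmetric]) (auto intro!: sum.cong)
  also have "sum ?f {Suc i..<Suc m} = (\<Sum>s<m - i. \<theta> ^ Suc s)"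
    by (rule sum.reindex_bij_witness[of _ "\<lambda>s. Suc i + s" "\<lambda>p. p - Suc i"]) (auto simp: Suc_diff_Suc Suc_le_eq simp flip: power_Suc)
  finally show ?thesis using geo[of i] geo[of "m - i"] by linarith
qed

section \<open>Gram matrices as operators\<close>

context temperley_lieb begin

lemma gram_matrix_entries:
  fixes h
  assumes haar: "haar_state N h" and basis: "W_basis N h k B" and k: "1 \<le> k" and X: "X \<in> B" and n: "k \<le> n"
    and i: "i < n - k + 1" and p: "p < n - k + 1"
  shows "cmod (index_mat (gram_matrix N h k X n) (i, p)) \<le> (2 * q) ^ (if p \<le> i then i - p else p - i)"
    and "p = i \<Longrightarrow> cmod (index_mat (gram_matrix N h k X n) (i, p) - 1) \<le> 2 * (q\<^sup>2 / (1 - q\<^sup>2))"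
proof -
  obtain m0 where m0: "k = Suc m0" using k by (cases k) auto
  define m where "m = n - k"
  have X00: "X \<in> BH00 N (Suc m0)" and nz: "X \<noteq> (\<lambda>_ _. 0)" and norm: "haar_norm2 N h (ucoef N k X) = 1"
    using basis X unfolding W_basis_def m0 by auto
  obtain \<mu> where \<mu>: "rotation N (Suc m0) X = (\<lambda>I J. \<mu> * X I J)"
    using basis X unfolding W_basis_def m0 by blast
  have MH: "X \<in> MH k" using X00 by (simp add: BH00_eq m0)
  have sq: "sq (Suc m0) X = 1"
    using norm haar_inner_ucoef[OF haar MH MH] by (simp add: haar_norm2_def ip_self m0)
  have entry: "index_mat (gram_matrix N h k X n) (i, p) = ip (k + m) (xshift k X i (m - i)) (xshift k X p (m - p))"
  proof -
    have eq: "a + k + (m - a) = k + m" if "a < n - k + 1" for a using that n by (simp add: m_def)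
    have "xshift k X a (m - a) \<in> MH (k + m)" if "a < n - k + 1" for a
      using xshift_MH[OF MH, of a "m - a"] that n by (simp add: m_def)
    then show ?thesis using i p haar_inner_ucoef[OF haar, of _ "k + m"]
      by (simp add: gram_matrix_def x_shift_def shifted_eq[OF MH] eq flip: m_def)
  qed
  note gram = m0 X00 eigenvector_rotations[OF X00 nz \<mu>] sq
  have im: "i \<le> m" "p \<le> m" using i p by (auto simp: m_def)
  show "cmod (index_mat (gram_matrix N h k X n) (i, p)) \<le> (2 * q) ^ (if p \<le> i then i - p else p - i)"
    unfolding entry by (rule gram_off_diagonal[OF gram im])
  show "cmod (index_mat (gram_matrix N h k X n) (i, p) - 1) \<le> 2 * (q\<^sup>2 / (1 - q\<^sup>2))" if "p = i"
    using gram_diagonal[OF gram im(1)] entry that by simp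
qed

text \<open>
The same number bounds the sums along rows and along columns, as both hypotheses of the Schur test require.
\<close>

lemma gram_matrix_sum:
  fixes h
  assumes haar: "haar_state N h" and basis: "W_basis N h k B" and k: "1 \<le> k" and X: "X \<in> B" and n: "k \<le> n"
    and i: "i < n - k + 1"
  defines "G \<equiv> gram_matrix N h k X n"
  defines "E \<equiv> \<lambda>i j. cmod (index_mat G (i, j) - (if i = j then 1 else 0))"
  defines "R \<equiv> 2 * (q\<^sup>2 / (1 - q\<^sup>2)) + 2 * (2 * q / (1 - 2 * q))"
  shows "(\<Sum>j<n - k + 1. E i j) \<le> R" and "(\<Sum>j<n - k + 1. E j i) \<le> R"
proof -
  note ge = gram_matrix_entries[OF haar basis k X n, folded G_def]
  have q: "0 \<le> 2 * q" "2 * q < 1" using q0 q_le by auto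
  let ?D = "2 * (q\<^sup>2 / (1 - q\<^sup>2))" and ?f = "\<lambda>p. if p = i then 0 else (2 * q) ^ (if p \<le> i then i - p else p - i)"
  have "(\<Sum>j<n - k + 1. if j = i then ?D else 0) = ?D" using i by (subst sum.delta) auto
  then have D0: "(\<Sum>j<n - k + 1. (if j = i then ?D else 0) + ?f j) \<le> R"
    using geometric_row_sum[OF q, of i "n - k"] i
    unfolding sum.distrib R_def Suc_eq_plus1 by linarith
  have sym: "(2 * q) ^ (if i \<le> j then j - i else i - j) = (2 * q) ^ (if j \<le> i then i - j else j - i)" for j
    by auto
  have "E i j \<le> (if j = i then ?D else 0) + ?f j" "E j i \<le> (if j = i then ?D else 0) + ?f j" if j: "j < n - k + 1" for j
    using ge(1)[OF i j] ge(2)[OF i j] ge(1)[OF j i] unfolding E_def sym by auto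
  then have "(\<Sum>j<n - k + 1. E i j) \<le> (\<Sum>j<n - k + 1. (if j = i then ?D else 0) + ?f j)"
    "(\<Sum>j<n - k + 1. E j i) \<le> (\<Sum>j<n - k + 1. (if j = i then ?D else 0) + ?f j)"
    by (intro sum_mono; simp only: lessThan_iff)+
  then show "(\<Sum>j<n - k + 1. E i j) \<le> R" "(\<Sum>j<n - k + 1. E j i) \<le> R" using D0 by linarith+
qed

end

text \<open>
As \<open>q \<le> 2 / 5\<close>, a single constant serves all \<open>q\<^sub>0\<close> in the first part: the off-diagonal row sums are at most 8, the diagonal
entries are within 2 of 1.  In the second part \<open>q \<le> 1 / 12\<close> gives \<open>2 \<cdot> 1 / 5 + 2 \<cdot> 1 / 143 \<le> 1 / 2\<close> for the distance to the
identity.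
\<close>

theorem theorem3p10:
  shows "(\<forall>q0::real. 0 < q0 \<and> q0 < 1 \<longrightarrow>
           (\<exists>C::real. C > 0 \<and>
             (\<forall>(N::nat) (q::real) h basis.
                3 \<le> N \<and> 0 < q \<and> q < 1 \<and> q + inverse q = real N \<and> q \<le> q0 \<and>
                haar_state N h \<and> (\<forall>k\<ge>1. W_basis N h k (basis k)) \<longrightarrow>
                (\<forall>k\<ge>1. \<forall>X\<in>basis k. \<forall>n\<ge>k. mat_op_norm (gram_matrix N h k X n) \<le> C))))
       \<and> (\<exists>(q1::real) (D::real). 0 < q1 \<and> q1 < 1 \<and> D > 0 \<and>
             (\<forall>(N::nat) (q::real) h basis.
                3 \<le> N \<and> 0 < q \<and> q < 1 \<and> q + inverse q = real N \<and> q \<le> q1 \<and>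
                haar_state N h \<and> (\<forall>k\<ge>1. W_basis N h k (basis k)) \<longrightarrow>
                (\<forall>k\<ge>1. \<forall>X\<in>basis k. \<forall>n\<ge>k.
                   \<exists>G'\<in>carrier_mat (n - k + 1) (n - k + 1).
                     inverts_mat (gram_matrix N h k X n) G' \<and>
                     inverts_mat G' (gram_matrix N h k X n) \<and>
                     mat_op_norm G' \<le> D)))"
proof (rule conjI)
  show "\<forall>q0::real. 0 < q0 \<and> q0 < 1 \<longrightarrow>
           (\<exists>C::real. C > 0 \<and>
             (\<forall>(N::nat) (q::real) h basis.
                3 \<le> N \<and> 0 < q \<and> q < 1 \<and> q + inverse q = real N \<and> q \<le> q0 \<and>
                haar_state N h \<and> (\<forall>k\<ge>1. W_basis N h k (basis k)) \<longrightarrow>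
                (\<forall>k\<ge>1. \<forall>X\<in>basis k. \<forall>n\<ge>k. mat_op_norm (gram_matrix N h k X n) \<le> C)))"
  proof (intro allI impI exI[of _ 11] conjI ballI)
    fix q0 q :: real and N h basis k X n
    assume A: "3 \<le> N \<and> 0 < q \<and> q < 1 \<and> q + inverse q = real N \<and> q \<le> q0 \<and>
      haar_state N h \<and> (\<forall>k\<ge>1. W_basis N h k (basis k))"
      and k: "1 \<le> k" and X: "X \<in> basis k" and n: "k \<le> n"
    interpret temperley_lieb N q by unfold_locales (use A in auto)
    let ?G = "gram_matrix N h k X n"
    have haar: "haar_state N h" and basis: "W_basis N h k (basis k)" using A k by auto
    have G: "?G \<in> carrier_mat (n - k + 1) (n - k + 1)" by (simp add: gram_matrix_def)
    let ?E = "\<lambda>i j. cmod (index_mat ?G (i, j) - (if i = j then 1 else 0))"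
    let ?R = "2 * (q\<^sup>2 / (1 - q\<^sup>2)) + 2 * (2 * q / (1 - 2 * q))"
    have R: "?R \<le> 10"
    proof -
      have q2: "q\<^sup>2 \<le> 4 / 25" using power_mono[OF q_le, of 2] A by (simp add: power2_eq_square)
      then have "q\<^sup>2 / (1 - q\<^sup>2) \<le> 1" by (simp add: field_simps)
      moreover have "2 * q / (1 - 2 * q) \<le> 4" using q_le by (simp add: field_simps)
      ultimately show ?thesis by linarith
    qed
    have row: "(\<Sum>j<n - k + 1. cmod (index_mat ?G (i, j))) \<le> 11"
      and col: "(\<Sum>j<n - k + 1. cmod (index_mat ?G (j, i))) \<le> 11" if i: "i < n - k + 1" for i
    proof -
      have le: "cmod (index_mat ?G (a, b)) \<le> ?E a b + (if b = a then 1 else 0)" for a b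
        using norm_triangle_ineq[of "index_mat ?G (a, b) - 1" 1] by auto
      have one: "(\<Sum>j<n - k + 1. if j = i then 1 else 0 :: real) = 1" "(\<Sum>j<n - k + 1. if i = j then 1 else 0 :: real) = 1"
        using i by (simp_all only: sum.delta sum.delta' finite_lessThan lessThan_iff if_True)
      have "(\<Sum>j<n - k + 1. cmod (index_mat ?G (i, j))) \<le> (\<Sum>j<n - k + 1. ?E i j + (if j = i then 1 else 0))"
        by (intro sum_mono le)
      also have "\<dots> \<le> 11" using gram_matrix_sum(1)[OF haar basis k X n i] R unfolding sum.distrib one by linarith
      finally show "(\<Sum>j<n - k + 1. cmod (index_mat ?G (i, j))) \<le> 11" .
      have "(\<Sum>j<n - k + 1. cmod (index_mat ?G (j, i))) \<le> (\<Sum>j<n - k + 1. ?E j i + (if i = j then 1 else 0))"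
        by (intro sum_mono le)
      also have "\<dots> \<le> 11" using gram_matrix_sum(2)[OF haar basis k X n i] R unfolding sum.distrib one by linarith
      finally show "(\<Sum>j<n - k + 1. cmod (index_mat ?G (j, i))) \<le> 11" .
    qed
    show "mat_op_norm ?G \<le> 11"
    proof (rule mat_op_norm_le[OF G])
      show "vec_norm2 (?G *\<^sub>v v) \<le> 11 * vec_norm2 v" if "v \<in> carrier_vec (n - k + 1)" for v
        by (rule mult_mat_vec_norm_le[OF G that _ row col]) simp_all
    qed simp
  qed simp
next
  show "\<exists>(q1::real) (D::real). 0 < q1 \<and> q1 < 1 \<and> D > 0 \<and>
             (\<forall>(N::nat) (q::real) h basis.
                3 \<le> N \<and> 0 < q \<and> q < 1 \<and> q + inverse q = real N \<and> q \<le> q1 \<and>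
                haar_state N h \<and> (\<forall>k\<ge>1. W_basis N h k (basis k)) \<longrightarrow>
                (\<forall>k\<ge>1. \<forall>X\<in>basis k. \<forall>n\<ge>k.
                   \<exists>G'\<in>carrier_mat (n - k + 1) (n - k + 1).
                     inverts_mat (gram_matrix N h k X n) G' \<and>
                     inverts_mat G' (gram_matrix N h k X n) \<and>
                     mat_op_norm G' \<le> D))"
  proof (rule exI[of _ "1 / 12"], rule exI[of _ 2], intro conjI allI impI ballI)
    fix q :: real and N h basis k X n
    assume A: "3 \<le> N \<and> 0 < q \<and> q < 1 \<and> q + inverse q = real N \<and> q \<le> 1 / 12 \<and>
      haar_state N h \<and> (\<forall>k\<ge>1. W_basis N h k (basis k))"
      and k: "1 \<le> k" and X: "X \<in> basis k" and n: "k \<le> n"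
    interpret temperley_lieb N q by unfold_locales (use A in auto)
    let ?G = "gram_matrix N h k X n"
    have haar: "haar_state N h" and basis: "W_basis N h k (basis k)" using A k by auto
    have G: "?G \<in> carrier_mat (n - k + 1) (n - k + 1)" by (simp add: gram_matrix_def)
    have R: "2 * (q\<^sup>2 / (1 - q\<^sup>2)) + 2 * (2 * q / (1 - 2 * q)) \<le> 1 / 2"
    proof -
      have q2: "q\<^sup>2 \<le> 1 / 144" using power_mono[of q "1 / 12" 2] A by (simp add: power2_eq_square)
      then have "q\<^sup>2 / (1 - q\<^sup>2) \<le> 1 / 143" by (simp add: field_simps)
      moreover have "2 * q / (1 - 2 * q) \<le> 1 / 5" using A by (simp add: field_simps)
      ultimately show ?thesis by linarith
    qed
    have "\<exists>G'\<in>carrier_mat (n - k + 1) (n - k + 1).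
       inverts_mat ?G G' \<and> inverts_mat G' ?G \<and> mat_op_norm G' \<le> 1 / (1 - 1 / 2)"
    proof (rule nearly_identity_invertible[OF G])
      fix i assume i: "i < n - k + 1"
      note sums = gram_matrix_sum[OF haar basis k X n i]
      show "(\<Sum>j<n - k + 1. cmod (index_mat ?G (i, j) - (if i = j then 1 else 0))) \<le> 1 / 2"
        using order.trans[OF sums(1) R] .
      show "(\<Sum>j<n - k + 1. cmod (index_mat ?G (j, i) - (if j = i then 1 else 0))) \<le> 1 / 2"
        using order.trans[OF sums(2) R] .
    qed simp_all
    then show "\<exists>G'\<in>carrier_mat (n - k + 1) (n - k + 1).
       inverts_mat ?G G' \<and> inverts_mat G' ?G \<and> mat_op_norm G' \<le> 2" by simp
  qed simp_all
qed

end
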